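(* Let $n\ge 1$, let $A:\mathbb{R}^n\to\mathbb{M}_n$ be a bounded and elliptic (measurable) matrix-valued function with constants $0<\lambda\le 1\le\Lambda<\infty$, let $p\in[\frac n2,\infty]$ with $p>1$, let $V\in RH_p$ with uniform $RH_p$ constant $C_V$, and let $d_V:\mathbb{R}^n\times\mathbb{R}^n\to\mathbb{R}_{\ge 0}$ denote the Agmon distance function associated to $V$. There exists a constant $\gamma_0=\gamma_0(n,\lambda,\Lambda,p,C_V)>0$, depending only on the indicated quantities, such that the following holds. If $u:\mathbb{R}^n\to\mathbb{R}$ is a non-trivial weak solution to $-\operatorname{div}(A\nabla u)+Vu=0$ in $\mathbb{R}^n$, then for every $\gamma_1<\gamma_0$ there exists a sequence of points $\{x_j\}_{j=1}^\infty\subset\mathbb{R}^n$, with $|x_j|$ increasing and unbounded, such that $$\|u\|_{L^2(B_1(x_j))}\ge j\,e^{2\gamma_1 d_V(x_j,0)}$$ for every $j\in\mathbb{N}$.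
   Context: Bounded and elliptic: $\mathbb{M}_n$ is the set of real $n\times n$ matrices, and for a.e. $x\in\mathbb{R}^n$ and all $\xi,\zeta\in\mathbb{R}^n$, $|A(x)\xi\cdot\zeta|\le\Lambda|\xi||\zeta|$ and $A(x)\xi\cdot\xi\ge\lambda|\xi|^2$ ($A$ need not be symmetric). $B_r(x)$ is the ball of radius $r$ centered at $x$. Reverse Hölder class: for $1<p\le\infty$, $V\in RH_p$ means $V\in L^p_{\mathrm{loc}}(\mathbb{R}^n)$, $V>0$ a.e., and there is a constant $C_V$ such that for every ball $B\subset\mathbb{R}^n$, $\left(\frac1{|B|}\int_B V^p\right)^{1/p}\le C_V\frac1{|B|}\int_B V$ (for $p=\infty$ the left side is $\|V\|_{L^\infty(B)}$); $C_V$ is called the uniform $RH_p$ constant. Weak solution: $u\in H^1_{\mathrm{loc}}(\mathbb{R}^n)$ such that $\int_{\mathbb{R}^n}A\nabla u\cdot\nabla\varphi+Vu\varphi=0$ for every $\varphi\in H^1_0(\mathbb{R}^n)$ with compact support. Agmon distance: set $\psi_V(x,r)=r^2\frac1{|B_r(x)|}\int_{B_r(x)}V(y)\,dy$ and define $m_V:\mathbb{R}^n\to(0,\infty)$ by $\frac1{m_V(x)}=\sup\{r>0:\psi_V(x,r)\le1\}$. (If $p=\frac n2$, Gehring's lemma gives $V\in RH_q$ for some $q>\frac n2$, so $m_V$ is well defined.) Then $d_V(x,y)=\inf_{\sigma}\int_0^1 m_V(\sigma(t))|\sigma'(t)|\,dt$, the infimum being over all absolutely continuous $\sigma:[0,1]\to\mathbb{R}^n$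 with $\sigma(0)=x$, $\sigma(1)=y$. *)

theory Defs
  imports "HOL-Analysis.Analysis" "HOL-Probability.Essential_Supremum"
begin

section \<open>Lebesgue and Sobolev spaces\<close>

definition average :: "(real^'n) set \<Rightarrow> (real^'n \<Rightarrow> real) \<Rightarrow> real"
  where "average S f = (LINT y:S|lebesgue. f y) / measure lebesgue S"

definition Lp_loc :: "ereal \<Rightarrow> (real^'n \<Rightarrow> 'b::euclidean_space) \<Rightarrow> bool"
  where "Lp_loc p f \<longleftrightarrow> f \<in> borel_measurable lebesgue \<and>
    (\<forall>K. compact K \<longrightarrow>
      (if p = \<infinity> then esssup (lebesgue_on K) (\<lambda>x. ereal (norm (f x))) < \<infinity>
       else set_integrable lebesgue K (\<lambda>x. norm (f x) powr real_of_ereal p)))"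

definition L2 :: "(real^'n \<Rightarrow> 'b::euclidean_space) \<Rightarrow> bool"
  where "L2 f \<longleftrightarrow> f \<in> borel_measurable lebesgue \<and> integrable lebesgue (\<lambda>x. (norm (f x))\<^sup>2)"

definition L2_norm_on :: "(real^'n) set \<Rightarrow> (real^'n \<Rightarrow> 'b::euclidean_space) \<Rightarrow> real"
  where "L2_norm_on S f = sqrt (LINT x:S|lebesgue. (norm (f x))\<^sup>2)"

definition partial :: "'n \<Rightarrow> (real^'n \<Rightarrow> real) \<Rightarrow> real^'n \<Rightarrow> real"
  where "partial i f x = frechet_derivative f (at x) (axis i 1)"

fun C_k :: "nat \<Rightarrow> (real^'n \<Rightarrow> real) \<Rightarrow> bool" where
  "C_k 0 f \<longleftrightarrow> continuous_on UNIV f"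
| "C_k (Suc k) f \<longleftrightarrow> (\<forall>x. f differentiable at x) \<and> (\<forall>i. C_k k (partial i f))"

text \<open>\<open>test_fun\<close> describes the space \<open>C\<^sub>c\<^sup>\<infinity>\<close> on the whole space.\<close>

definition test_fun :: "(real^'n \<Rightarrow> real) \<Rightarrow> bool"
  where "test_fun \<phi> \<longleftrightarrow> (\<forall>k. C_k k \<phi>) \<and> (\<exists>K. compact K \<and> (\<forall>x. x \<notin> K \<longrightarrow> \<phi> x = 0))"

definition is_weak_grad :: "(real^'n \<Rightarrow> real) \<Rightarrow> (real^'n \<Rightarrow> real^'n) \<Rightarrow> bool"
  where "is_weak_grad u g \<longleftrightarrow> Lp_loc 1 u \<and> Lp_loc 1 g \<and>
    (\<forall>\<phi> i. test_fun \<phi> \<longrightarrow>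
      (LINT x|lebesgue. u x * partial i \<phi> x) = - (LINT x|lebesgue. g x $ i * \<phi> x))"

text \<open>Weak gradients are unique almost everywhere; \<open>weak_grad\<close> picks a representative.
  It is only meaningful for functions that have a weak gradient.\<close>

definition weak_grad :: "(real^'n \<Rightarrow> real) \<Rightarrow> real^'n \<Rightarrow> real^'n"
  where "weak_grad u = (SOME g. is_weak_grad u g)"

definition H1 :: "(real^'n \<Rightarrow> real) \<Rightarrow> bool"
  where "H1 u \<longleftrightarrow> L2 u \<and> (\<exists>g. is_weak_grad u g \<and> L2 g)"

definition H1_loc :: "(real^'n \<Rightarrow> real) \<Rightarrow> bool"
  where "H1_loc u \<longleftrightarrow> Lp_loc 2 u \<and> (\<exists>g. is_weak_grad u g \<and> Lp_loc 2 g)"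

definition H1_norm :: "(real^'n \<Rightarrow> real) \<Rightarrow> real"
  where "H1_norm u = sqrt (LINT x|lebesgue. (u x)\<^sup>2 + (norm (weak_grad u x))\<^sup>2)"

text \<open>The closure of the test functions in \<open>H1\<close>.\<close>

definition H1_0 :: "(real^'n \<Rightarrow> real) \<Rightarrow> bool"
  where "H1_0 u \<longleftrightarrow> H1 u \<and>
    (\<forall>\<epsilon>>0. \<exists>\<phi>. test_fun \<phi> \<and> H1_norm (\<lambda>x. u x - \<phi> x) < \<epsilon>)"

definition ae_compact_support :: "(real^'n \<Rightarrow> real) \<Rightarrow> bool"
  where "ae_compact_support u \<longleftrightarrow>
    (\<exists>K. compact K \<and> (AE x in lebesgue. x \<notin> K \<longrightarrow> u x = 0))"


section \<open>The equation\<close>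

definition bounded_elliptic :: "real \<Rightarrow> real \<Rightarrow> (real^'n \<Rightarrow> real^'n^'n) \<Rightarrow> bool"
  where "bounded_elliptic lam Lam A \<longleftrightarrow> A \<in> borel_measurable lebesgue \<and>
    (AE x in lebesgue. \<forall>\<xi> \<zeta>.
      \<bar>(A x *v \<xi>) \<bullet> \<zeta>\<bar> \<le> Lam * norm \<xi> * norm \<zeta> \<and>
      (A x *v \<xi>) \<bullet> \<xi> \<ge> lam * (norm \<xi>)\<^sup>2)"

text \<open>For a potential in \<open>RH p\<close> with \<open>p > 1\<close> and \<open>p \<ge> n/2\<close> the integrand below is always
  integrable by Sobolev embedding; \<open>has_bochner_integral\<close> avoids relying on the value \<open>0\<close>
  that the library assigns to the integral of a non-integrable function.\<close>

definition weak_solution ::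
    "(real^'n \<Rightarrow> real^'n^'n) \<Rightarrow> (real^'n \<Rightarrow> real) \<Rightarrow> (real^'n \<Rightarrow> real) \<Rightarrow> bool"
  where "weak_solution A V u \<longleftrightarrow> H1_loc u \<and>
    (\<forall>\<phi>. H1_0 \<phi> \<and> ae_compact_support \<phi> \<longrightarrow>
      has_bochner_integral lebesgue
        (\<lambda>x. (A x *v weak_grad u x) \<bullet> weak_grad \<phi> x + V x * u x * \<phi> x) 0)"


section \<open>Reverse Hoelder classes and the Agmon distance\<close>

definition Lp_mean :: "ereal \<Rightarrow> (real^'n) set \<Rightarrow> (real^'n \<Rightarrow> real) \<Rightarrow> ereal"
  where "Lp_mean p S f =
    (if p = \<infinity> then esssup (lebesgue_on S) (\<lambda>x. ereal \<bar>f x\<bar>)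
     else ereal (average S (\<lambda>x. \<bar>f x\<bar> powr real_of_ereal p) powr (1 / real_of_ereal p)))"

definition RH :: "ereal \<Rightarrow> real \<Rightarrow> (real^'n \<Rightarrow> real) \<Rightarrow> bool"
  where "RH p C V \<longleftrightarrow> Lp_loc p V \<and> (AE x in lebesgue. V x > 0) \<and>
    (\<forall>x r. r > 0 \<longrightarrow> Lp_mean p (ball x r) V \<le> ereal (C * average (ball x r) V))"

definition psi :: "(real^'n \<Rightarrow> real) \<Rightarrow> real^'n \<Rightarrow> real \<Rightarrow> real"
  where "psi V x r = r\<^sup>2 * average (ball x r) V"

definition agmon_m :: "(real^'n \<Rightarrow> real) \<Rightarrow> real^'n \<Rightarrow> real"
  where "agmon_m V x = 1 / Sup {r. r > 0 \<and> psi V x r \<le> 1}"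

definition absolutely_continuous_on :: "real \<Rightarrow> real \<Rightarrow> (real \<Rightarrow> 'a::real_normed_vector) \<Rightarrow> bool"
  where "absolutely_continuous_on a b \<sigma> \<longleftrightarrow>
    (\<forall>\<epsilon>>0. \<exists>\<delta>>0. \<forall>I. finite I \<and> (\<forall>(s, t)\<in>I. a \<le> s \<and> s < t \<and> t \<le> b) \<and>
      disjoint_family_on (\<lambda>(s, t). {s<..<t}) I \<and> (\<Sum>(s, t)\<in>I. t - s) < \<delta> \<longrightarrow>
      (\<Sum>(s, t)\<in>I. norm (\<sigma> t - \<sigma> s)) < \<epsilon>)"

definition agmon_length :: "(real^'n \<Rightarrow> real) \<Rightarrow> (real \<Rightarrow> real^'n) \<Rightarrow> ennreal"
  where "agmon_length V \<sigma> =
    (\<integral>\<^sup>+ t\<in>{0..1}. ennreal (agmon_m V (\<sigma> t) * norm (vector_derivative \<sigma> (at t))) \<partial>lebesgue)"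

definition agmon_dist :: "(real^'n \<Rightarrow> real) \<Rightarrow> real^'n \<Rightarrow> real^'n \<Rightarrow> real"
  where "agmon_dist V x y =
    enn2real (INF \<sigma>\<in>{\<sigma>. absolutely_continuous_on 0 1 \<sigma> \<and> \<sigma> 0 = x \<and> \<sigma> 1 = y}. agmon_length V \<sigma>)"

end

theory Submission
  imports Defs
begin

text \<open>
  Let \<open>\<rho> = 1/m\<close> be the critical radius, regularised to be 1-Lipschitz, and let \<open>D\<close> be the infimum of the Agmon
  lengths of piecewise smooth Lipschitz paths to the origin, so that \<open>d(x,0) \<le> D(x)\<close> and \<open>D\<close> is locally
  Lipschitz with constant \<open>2/\<rho>\<close>. Caccioppoli's inequality for \<open>u \<psi>\<close> and the Fefferman-Phong inequality
  \<open>\<integral> f\<^sup>2/\<rho>\<^sup>2 \<le> C \<integral> (|\<nabla>f|\<^sup>2 + V f\<^sup>2)\<close>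
  yield \<open>\<integral> u\<^sup>2 \<psi>\<^sup>2/\<rho>\<^sup>2 \<le> C \<integral> u\<^sup>2 |\<nabla>\<psi>|\<^sup>2\<close>. For \<open>\<psi>\<close> a mollified cutoff times \<open>exp (- \<gamma> D)\<close>
  with \<open>\<gamma>\<close> small, the part of the right-hand side coming from the exponential is absorbed, leaving
  \<open>\<integral>\<^bsub>|x| \<le> R\<^esub> u\<^sup>2 exp (- 2 \<gamma> D)/\<rho>\<^sup>2 \<le> (K/R\<^sup>2) \<integral>\<^bsub>|x| \<le> 3R\<^esub> u\<^sup>2 exp (- 2 \<gamma> D)\<close>.
  Denote the left-hand side by \<open>J(R)\<close>. Since \<open>\<rho> = o(|x|)\<close>, for every \<open>\<kappa> > 0\<close> and all large \<open>R\<close> one gets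
  \<open>J(R) \<le> \<kappa> J(3R)\<close>, so a nonzero \<open>J\<close> outgrows every power of \<open>R\<close>. If the conclusion failed, \<open>J\<close>
  would be bounded by a multiple of \<open>R\<^sup>n\<close>; hence \<open>J = 0\<close> and \<open>u = 0\<close>.
\<close>

section \<open>Reverse Hoelder weights\<close>

text \<open>Since the admissible rate may depend on \<open>V\<close> only through the exponent and
  the reverse Hoelder constant, the estimates behind it fix their constants before \<open>V\<close>
  is quantified. They rest on one fact: small subsets of a ball carry at most half of its mass. It
  yields doubling, a large set where \<open>V\<close> is at least a quarter of its mean, and the
  growth of \<open>psi\<close> in the radius, which is why \<rho> = o(|x|). If the conclusion fails
  at rate \<gamma>, the L2 norms of u on far unit balls are bounded by a multiple of exp (2 \<gamma>
  d), hence of exp (2 \<gamma> D). The distance enters only through d \<le> D, so D may be built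
  from conveniently regular paths. In the weighted comparison both sides carry the same exponential,
  and the gain is 1/\<rho>^2 against 1/R^2 alone. Absorption needs a finite left-hand side, which
  the compact support of \<psi> gives before any decay of u is known.\<close>

lemma set_integral_mono_subset:
  fixes f :: "'a \<Rightarrow> real"
  assumes "set_integrable M B f" "A \<in> sets M" "A \<subseteq> B" "\<And>x. 0 \<le> f x"
  shows "(LINT x:A|M. f x) \<le> (LINT x:B|M. f x)"
  unfolding set_lebesgue_integral_def
proof (rule integral_mono)
  show "integrable M (\<lambda>x. indicator B x *\<^sub>R f x)" using assms(1) by (simp add: set_integrable_def)
  show "integrable M (\<lambda>x. indicator A x *\<^sub>R f x)"
    using set_integrable_subset[OF assms(1,2,3)] by (simp add: set_integrable_def)
  show "indicator A x *\<^sub>R f x \<le> indicator B x *\<^sub>R f x" for x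
    using assms(3,4) by (auto simp: indicator_def)
qed

text \<open>Working version of the class: a finite exponent and nonnegativity everywhere, so that
  pointwise estimates meet no null sets. Integrability over balls is included because the integral
  of a non-integrable function is 0 by convention, which would make the last inequality
  hollow.\<close>

definition RH_real :: "real \<Rightarrow> real \<Rightarrow> (real^'n \<Rightarrow> real) \<Rightarrow> bool" where
  "RH_real p C V \<longleftrightarrow> V \<in> borel_measurable lebesgue \<and> (\<forall>x. 0 \<le> V x) \<and>
    (\<forall>x r. r > 0 \<longrightarrow> set_integrable lebesgue (ball x r) (\<lambda>y. V y powr p) \<and>
       0 < average (ball x r) V \<and>
       average (ball x r) (\<lambda>y. V y powr p) \<le> (C * average (ball x r) V) powr p)"

lemma content_ball_eq:
  fixes x :: "'a::euclidean_space"
  assumes "0 \<le> r"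
  shows "measure lebesgue (ball x r) = r ^ DIM('a) * measure lebesgue (ball (0::'a) 1)"
  using content_ball_conv_unit_ball[OF assms, of x] by simp

lemma emeasure_lborel_ball_eq:
  fixes x :: "real^'n"
  assumes "0 < r"
  shows "emeasure lborel (ball x r) = ennreal (measure lebesgue (ball (0::real^'n) 1) * r ^ CARD('n))"
proof -
  have "emeasure lborel (ball x r) = ennreal (measure lborel (ball x r))"
    using emeasure_lborel_ball_finite[of x r] by (intro emeasure_eq_ennreal_measure) (simp add: less_top)
  also have "measure lborel (ball x r) = measure lebesgue (ball (0::real^'n) 1) * r ^ CARD('n)"
    using content_ball_conv_unit_ball[of r x] assms by simp
  finally show ?thesis .
qed

text \<open>Integrating this inequality with a suitable \<open>t\<close> replaces every use of Hoelder's inequality.\<close>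

lemma le_add_powr:
  fixes v t p :: real
  assumes "0 \<le> v" "0 < t" "1 < p"
  shows "v \<le> t + t powr (1 - p) * v powr p"
proof (cases "v \<le> t")
  case True then show ?thesis using assms by (simp add: add_increasing2)
next
  case False
  have "v = v powr (1 - p) * v powr p" using False assms by (simp flip: powr_add)
  also have "\<dots> \<le> t powr (1 - p) * v powr p"
    using False assms by (intro mult_right_mono powr_mono2') auto
  finally show ?thesis using assms by simp
qed

context
  fixes p C :: real and V :: "real^'n \<Rightarrow> real"
  assumes RH: "RH_real p C V" and p1: "1 < p" and C1: "1 \<le> C"
begin

lemma RH_meas: "V \<in> borel_measurable lebesgue"
  and RH_nonneg: "0 \<le> V x"
  and RH_powr: "0 < r \<Longrightarrow> set_integrable lebesgue (ball x r) (\<lambda>y. V y powr p)"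
  and RH_avg_pos: "0 < r \<Longrightarrow> 0 < average (ball x r) V"
  and RH_le: "0 < r \<Longrightarrow> average (ball x r) (\<lambda>y. V y powr p) \<le> (C * average (ball x r) V) powr p"
  using RH unfolding RH_real_def by auto

lemma RH_integrable: 
  assumes "0 < r" shows "set_integrable lebesgue (ball x r) V"
proof (rule set_integrable_bound)
  have "set_integrable lebesgue (ball x r) (\<lambda>y. 1::real)"
    using lmeasurable_ball[of x r] unfolding set_integrable_def fmeasurable_def by (auto simp: less_top)
  then show "set_integrable lebesgue (ball x r) (\<lambda>y. 1 + V y powr p)"
    using RH_powr[OF assms] by (rule set_integral_add)
  show "set_borel_measurable lebesgue (ball x r) V"
    unfolding set_borel_measurable_def using RH_meas by (intro borel_measurable_scaleR borel_measurable_indicator) auto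
  show "AE y in lebesgue. y \<in> ball x r \<longrightarrow> norm (V y) \<le> norm (1 + V y powr p)"
    using le_add_powr[OF RH_nonneg zero_less_one p1] RH_nonneg by (auto simp: add_increasing)
qed

lemma RH_integral_eq: "0 < r \<Longrightarrow> (LINT y:ball x r|lebesgue. V y) = average (ball x r) V * measure lebesgue (ball x r)"
  by (simp add: average_def)

lemma RH_integral_pos: "0 < r \<Longrightarrow> 0 < (LINT y:ball x r|lebesgue. V y)"
  using RH_integral_eq RH_avg_pos by (simp add: )

lemma RH_powr_integral_le: "0 < r \<Longrightarrow> (LINT y:ball x r|lebesgue. V y powr p) \<le> (C * average (ball x r) V) powr p * measure lebesgue (ball x r)"
  using RH_le[of r x] by (simp add: average_def field_simps)

text \<open>The level \<open>t\<close> stays free: one value gives a substitute for Jensen's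
  inequality, another the smallness of the mass of small sets.\<close>

lemma RH_integral_subset_le:
  assumes "0 < r" "E \<in> sets lebesgue" "E \<subseteq> ball x r" "0 < t"
  shows "(LINT y:E|lebesgue. V y) \<le> t * measure lebesgue E + t powr (1 - p) * (LINT y:ball x r|lebesgue. V y powr p)"
proof -
  have fin: "E \<in> lmeasurable" using assms(2,3) by (meson bounded_ball bounded_subset bounded_set_imp_lmeasurable)
  have i1: "set_integrable lebesgue E (\<lambda>y. t)" using fin by (auto simp: set_integrable_def fmeasurable_def)
  have i2: "set_integrable lebesgue E (\<lambda>y. t powr (1 - p) * V y powr p)"
    using set_integrable_subset[OF RH_powr[OF assms(1)] assms(2,3)] by auto
  have "(LINT y:E|lebesgue. V y) \<le> (LINT y:E|lebesgue. t + t powr (1 - p) * V y powr p)"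
    using set_integrable_subset[OF RH_integrable[OF assms(1)] assms(2,3)] i1 i2 le_add_powr[OF RH_nonneg assms(4) p1]
    by (intro set_integral_mono) auto
  also have "\<dots> = t * measure lebesgue E + t powr (1 - p) * (LINT y:E|lebesgue. V y powr p)"
    using i1 i2 fin by (subst set_integral_add) (auto simp: set_lebesgue_integral_def)
  also have "\<dots> \<le> t * measure lebesgue E + t powr (1 - p) * (LINT y:ball x r|lebesgue. V y powr p)"
    using set_integral_mono_subset[OF RH_powr[OF assms(1)] assms(2,3)] by (intro add_left_mono mult_left_mono) auto
  finally show ?thesis .
qed

lemma RH_powr_integral_ge: 
  assumes "0 < r"
  shows "(average (ball x r) V / 2) powr p * measure lebesgue (ball x r) \<le> (LINT y:ball x r|lebesgue. V y powr p)"
proof -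
  define a where "a = average (ball x r) V"
  have a: "a > 0" using RH_avg_pos assms a_def by auto
  define W where "W = (LINT y:ball x r|lebesgue. V y powr p)"
  \<comment> \<open>At level \<open>a/2\<close> the first term is half of the left-hand side and is
    absorbed; the price is the factor 1/2 in the result.\<close>
  have "a * measure lebesgue (ball x r) \<le> (a/2) * measure lebesgue (ball x r) + (a/2) powr (1-p) * W"
    using RH_integral_subset_le[of r "ball x r" x "a/2"] a assms RH_integral_eq[of r x] by (auto simp: a_def W_def)
  then have "(a/2) * measure lebesgue (ball x r) \<le> (a/2) powr (1-p) * W" by (simp add: field_simps)
  then have "(a/2) powr (p-1) * ((a/2) * measure lebesgue (ball x r)) \<le> (a/2) powr (p-1) * ((a/2) powr (1-p) * W)"
    by (intro mult_left_mono) auto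
  also have "(a/2) powr (p-1) * ((a/2) powr (1-p) * W) = W" using a by (simp flip: powr_add mult.assoc)
  also have "(a/2) powr (p-1) * ((a/2) * measure lebesgue (ball x r)) = (a/2) powr p * measure lebesgue (ball x r)"
    using a by (simp add: powr_diff)
  finally show ?thesis by (simp add: a_def W_def)
qed

text \<open>At level \<open>M * a\<close> each of the two terms is at most a quarter of the mass:
  the first by the bound on the measure of \<open>E\<close>, the second by the reverse Hoelder
  inequality and the choice of \<open>M\<close>.\<close>

lemma RH_integral_small_subset:
  assumes "0 < r" "E \<in> sets lebesgue" "E \<subseteq> ball x r"
    and "0 < M" "M powr (1 - p) * C powr p \<le> 1/4" "measure lebesgue E \<le> measure lebesgue (ball x r) / (4 * M)"
  shows "(LINT y:E|lebesgue. V y) \<le> (LINT y:ball x r|lebesgue. V y) / 2"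
proof -
  define a where "a = average (ball x r) V"
  have a: "a > 0" using RH_avg_pos assms a_def by auto
  let ?B = "measure lebesgue (ball x r)"
  have "(LINT y:E|lebesgue. V y) \<le> (M * a) * measure lebesgue E + (M*a) powr (1 - p) * (LINT y:ball x r|lebesgue. V y powr p)"
    using RH_integral_subset_le[OF assms(1-3), of "M*a"] assms a by auto
  also have "\<dots> \<le> (M * a) * (?B / (4*M)) + (M*a) powr (1 - p) * ((C * a) powr p * ?B)"
    using RH_powr_integral_le[of r x] assms a by (intro add_mono mult_left_mono) (auto simp: a_def)
  also have "(M*a) powr (1 - p) * ((C * a) powr p * ?B) = (M powr (1 - p) * C powr p) * (a * ?B)"
    using assms a C1 by (simp add: powr_mult powr_diff field_simps)
  also have "\<dots> \<le> 1/4 * (a * ?B)" using assms a by (intro mult_right_mono) auto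
  also have "(M * a) * (?B / (4*M)) = 1/4 * (a * ?B)" using assms by simp
  finally show ?thesis using RH_integral_eq[OF assms(1), of x] by (simp add: a_def)
qed

end

section \<open>Absolute continuity and doubling with constants uniform in the weight\<close>

lemma ex_small_powr:
  fixes p C :: real assumes "1 < p"
  shows "\<exists>M>0. M powr (1 - p) * C powr p \<le> 1/4"
proof -
  have "((\<lambda>M. M powr (1 - p) * C powr p) \<longlongrightarrow> 0 * C powr p) at_top"
    using assms by (intro tendsto_mult tendsto_neg_powr filterlim_ident tendsto_const) auto
  then have "eventually (\<lambda>M. M powr (1 - p) * C powr p < 1/4) at_top"
    by (intro order_tendstoD(2)[where y=0]) auto
  then have "eventually (\<lambda>M. M powr (1 - p) * C powr p < 1/4 \<and> M > 0) at_top"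
    using eventually_gt_at_top by eventually_elim auto
  then show ?thesis by (metis (no_types, lifting) eventually_at_top_linorder less_imp_le order_refl)
qed

text \<open>The A-infinity property of Muckenhoupt weights. The bound \<open>e < 1\<close> is
  recorded because the doubling argument takes a root of \<open>1 - e\<close>.\<close>

lemma RH_Ainfty:
  fixes p C :: real assumes "1 < p" "1 \<le> C"
  shows "\<exists>e>0. e < 1 \<and> (\<forall>(V :: real^'n \<Rightarrow> real) x r E. RH_real p C V \<longrightarrow> 0 < r \<longrightarrow> E \<in> sets lebesgue \<longrightarrow> E \<subseteq> ball x r
    \<longrightarrow> measure lebesgue E \<le> e * measure lebesgue (ball x r) \<longrightarrow>
   (LINT y:E|lebesgue. V y) \<le> (LINT y:ball x r|lebesgue. V y) / 2)"
proof -
  obtain M where M: "M > 0" "M powr (1 - p) * C powr p \<le> 1/4" using ex_small_powr[OF assms(1)] by blast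
  have e: "min (1/(4*M)) (1/2) * c \<le> c / (4*M)" if "c \<ge> 0" for c :: real
    using mult_right_mono[OF min.cobounded1[of "1/(4*M)" "1/2"] that] by simp
  show ?thesis
  proof (intro exI[of _ "min (1/(4*M)) (1/2)"] conjI allI impI)
    show "(LINT y:E|lebesgue. V y) \<le> (LINT y:ball x r|lebesgue. V y) / 2"
      if "RH_real p C V" "0 < r" "E \<in> sets lebesgue" "E \<subseteq> ball x r"
         "measure lebesgue E \<le> min (1/(4*M)) (1/2) * measure lebesgue (ball x r)"
      for V :: "real^'n \<Rightarrow> real" and x r E
      using RH_integral_small_subset[OF that(1) assms that(2-4) M] that(5) e[of "measure lebesgue (ball x r)"] by auto
  qed (use M in auto)
qed

text \<open>A thin shell has a small share of the volume, hence at most half of the mass, so a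
  slight shrinking of the radius loses at most a factor 2. Finitely many shrinkings, their number
  depending only on \<open>e\<close> and the dimension, halve the radius.\<close>

lemma RH_doubling:
  fixes p C :: real assumes "1 < p" "1 \<le> C"
  shows "\<exists>K\<ge>1. \<forall>(V :: real^'n \<Rightarrow> real) x r. RH_real p C V \<longrightarrow> 0 < r \<longrightarrow> 
   (LINT y:ball x (2*r)|lebesgue. V y) \<le> K * (LINT y:ball x r|lebesgue. V y)"
proof -
  obtain e where e: "e > 0" "e < 1" 
   "\<And>(V :: real^'n \<Rightarrow> real) x r E. RH_real p C V \<Longrightarrow> 0 < r \<Longrightarrow> E \<in> sets lebesgue \<Longrightarrow> E \<subseteq> ball x r
    \<Longrightarrow> measure lebesgue E \<le> e * measure lebesgue (ball x r) \<Longrightarrow>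
   (LINT y:E|lebesgue. V y) \<le> (LINT y:ball x r|lebesgue. V y) / 2"
    using RH_Ainfty[OF assms, where 'n='n] by blast
  \<comment> \<open>With this ratio the shell between the radii \<open>q * s\<close> and
    \<open>s\<close> has exactly the fraction \<open>e\<close> of the volume.\<close>
  define q where "q = root CARD('n) (1 - e)"
  have q: "0 < q" "q < 1" "q ^ CARD('n) = 1 - e" using e by (auto simp: q_def real_root_gt_zero)
  obtain N where N: "q ^ N < 1/2" using real_arch_pow_inv[of "1/2" q] q by auto
  have step: "(LINT y:ball x s|lebesgue. V y) \<le> 2 * (LINT y:ball x (q * s)|lebesgue. V y)"
    if V: "RH_real p C V" and s: "0 < s" for V :: "real^'n \<Rightarrow> real" and x s
  proof -
    note int = RH_integrable[OF V assms]
    have sub: "ball x (q * s) \<subseteq> ball x s" using q s by (intro subset_ball) (auto simp: mult_le_cancel_right1)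
    let ?E = "ball x s - ball x (q * s)"
    have "measure lebesgue ?E = measure lebesgue (ball x s) - measure lebesgue (ball x (q * s))"
      using sub by (intro measurable_measure_Diff) auto
    also have "\<dots> = e * measure lebesgue (ball x s)"
      using content_ball_eq[of s x] content_ball_eq[of "q * s" x] q s e
      by (simp add: power_mult_distrib algebra_simps)
    finally have "(LINT y:?E|lebesgue. V y) \<le> (LINT y:ball x s|lebesgue. V y) / 2"
      by (intro e(3)[OF V s]) auto
    moreover have "(LINT y:ball x s|lebesgue. V y) = (LINT y:(?E \<union> ball x (q * s))|lebesgue. V y)"
      using sub by (intro arg_cong[where f="\<lambda>S. (LINT y:S|lebesgue. V y)"]) auto
    moreover have "(LINT y:(?E \<union> ball x (q * s))|lebesgue. V y) = (LINT y:?E|lebesgue. V y) + (LINT y:ball x (q * s)|lebesgue. V y)"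
      using sub s q by (intro set_integral_Un set_integrable_subset[OF int[OF s, of x]]) auto
    ultimately show ?thesis by linarith
  qed
  have iter: "(LINT y:ball x s|lebesgue. V y) \<le> 2^k * (LINT y:ball x (q^k * s)|lebesgue. V y)"
    if V: "RH_real p C V" and s: "0 < s" for V :: "real^'n \<Rightarrow> real" and x s k
  proof (induction k)
    case (Suc k)
    have "(LINT y:ball x (q^k * s)|lebesgue. V y) \<le> 2 * (LINT y:ball x (q*(q^k * s))|lebesgue. V y)"
      using q s by (intro step[OF V]) auto
    then have "2^k * (LINT y:ball x (q^k * s)|lebesgue. V y) \<le> 2^k * (2 * (LINT y:ball x (q*(q^k * s))|lebesgue. V y))"
      by (intro mult_left_mono) auto
    with Suc have "(LINT y:ball x s|lebesgue. V y) \<le> 2^k * (2 * (LINT y:ball x (q*(q^k * s))|lebesgue. V y))"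
      by (rule order_trans)
    then show ?case by (simp only: power_Suc mult.assoc mult.left_commute)
  qed simp
  show ?thesis
  proof (intro exI[of _ "2^N"] conjI allI impI)
    fix V :: "real^'n \<Rightarrow> real" and x and r :: real assume V: "RH_real p C V" and r: "0 < r"
    have "(LINT y:ball x (2*r)|lebesgue. V y) \<le> 2^N * (LINT y:ball x (q^N*(2*r))|lebesgue. V y)"
      using iter[OF V, of "2*r"] r by auto
    also have "\<dots> \<le> 2^N * (LINT y:ball x r|lebesgue. V y)"
    proof (intro mult_left_mono set_integral_mono_subset[OF RH_integrable[OF V assms r]] subset_ball)
      have "q^N*(2*r) \<le> 1/2 * (2*r)" using N r by (intro mult_right_mono) auto
      then show "q^N*(2*r) \<le> r" by simp
    qed (auto simp: RH_nonneg[OF V assms])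
    finally show "(LINT y:ball x (2*r)|lebesgue. V y) \<le> 2^N * (LINT y:ball x r|lebesgue. V y)" .
  qed auto
qed

lemma RH_doubling_power:
  fixes p C :: real assumes "1 < p" "1 \<le> C"
  shows "\<exists>K\<ge>1. \<forall>(V :: real^'n \<Rightarrow> real) x r k. RH_real p C V \<longrightarrow> 0 < r \<longrightarrow> 
   (LINT y:ball x (2^k*r)|lebesgue. V y) \<le> K^k * (LINT y:ball x r|lebesgue. V y)"
proof -
  obtain K where K: "K \<ge> 1" "\<And>(V :: real^'n \<Rightarrow> real) x r. RH_real p C V \<Longrightarrow> 0 < r \<Longrightarrow> 
   (LINT y:ball x (2*r)|lebesgue. V y) \<le> K * (LINT y:ball x r|lebesgue. V y)"
    using RH_doubling[OF assms, where 'n='n] by blast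
  have "(LINT y:ball x (2^k*r)|lebesgue. V y) \<le> K^k * (LINT y:ball x r|lebesgue. V y)"
    if V: "RH_real p C V" and r: "0 < r" for V :: "real^'n \<Rightarrow> real" and x r k
  proof (induction k)
    case (Suc k)
    have "(LINT y:ball x (2*(2^k*r))|lebesgue. V y) \<le> K * (LINT y:ball x (2^k*r)|lebesgue. V y)"
      using r by (intro K(2)[OF V]) auto
    also have "\<dots> \<le> K * (K^k * (LINT y:ball x r|lebesgue. V y))"
      using K(1) Suc by (intro mult_left_mono) auto
    finally show ?case by (simp add: mult.assoc)
  qed simp
  with K(1) show ?thesis by blast
qed

lemma RH_integral_compare:
  fixes p C K0 :: real assumes "1 < p" "1 \<le> C" "1 \<le> K0"
  shows "\<exists>K\<ge>1. \<forall>(V :: real^'n \<Rightarrow> real) x y r s. RH_real p C V \<longrightarrow> 0 < r \<longrightarrow> 0 < s \<longrightarrow> s \<le> K0 * r \<longrightarrow> dist x y \<le> K0 * r \<longrightarrow>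
   (LINT y:ball y s|lebesgue. V y) \<le> K * (LINT y:ball x r|lebesgue. V y)"
proof -
  obtain K where K: "K \<ge> 1" "\<And>(V :: real^'n \<Rightarrow> real) x r k. RH_real p C V \<Longrightarrow> 0 < r \<Longrightarrow> 
   (LINT y:ball x (2^k*r)|lebesgue. V y) \<le> K^k * (LINT y:ball x r|lebesgue. V y)"
    using RH_doubling_power[OF assms(1,2), where 'n='n] by blast
  obtain k where k: "2 * K0 < 2^k" using real_arch_pow[of 2 "2*K0"] by auto
  show ?thesis
  proof (intro exI[of _ "K^k"] conjI allI impI)
    fix V :: "real^'n \<Rightarrow> real" and x y :: "real^'n" and r s :: real
    assume V: "RH_real p C V" and r: "0 < r" "0 < s" "s \<le> K0 * r" "dist x y \<le> K0 * r"
    have "ball y s \<subseteq> ball x (2^k*r)"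
    proof
      fix z assume "z \<in> ball y s"
      then have "dist x z < 2 * K0 * r" using r dist_triangle[of x z y] by auto
      also have "\<dots> \<le> 2^k*r" using k r by (intro mult_right_mono) auto
      finally show "z \<in> ball x (2^k*r)" by simp
    qed
    then have "(LINT y:ball y s|lebesgue. V y) \<le> (LINT y:ball x (2^k*r)|lebesgue. V y)"
      using r RH_nonneg[OF V assms(1,2)]
      by (intro set_integral_mono_subset[OF RH_integrable[OF V assms(1,2)]]) auto
    also have "\<dots> \<le> K^k * (LINT y:ball x r|lebesgue. V y)" by (rule K(2)[OF V r(1)])
    finally show "(LINT y:ball y s|lebesgue. V y) \<le> K^k * (LINT y:ball x r|lebesgue. V y)" .
  qed (use K(1) in simp)
qed

section \<open>Comparison and growth of the scale-invariant mean \<open>psi\<close>\<close>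

lemma psi_eq:
  fixes V :: "real^'n \<Rightarrow> real"
  assumes "0 < r"
  shows "psi V x r = r powr (2 - real CARD('n)) * ((LINT y:ball x r|lebesgue. V y) / measure lebesgue (ball (0::real^'n) 1))"
proof -
  have "r^2 / r^CARD('n) = r powr (2 - real CARD('n))"
    using assms by (simp add: powr_diff powr_realpow)
  moreover have "psi V x r = r^2 / r^CARD('n) * ((LINT y:ball x r|lebesgue. V y) / measure lebesgue (ball (0::real^'n) 1))"
    using assms by (simp add: psi_def average_def content_ball_conv_unit_ball[of r x])
  ultimately show ?thesis by simp
qed

lemma psi_pos:
  fixes V :: "real^'n \<Rightarrow> real"
  assumes "RH_real p C V" "0 < r" shows "0 < psi V x r"
proof -
  have "0 < average (ball x r) V" using assms unfolding RH_real_def by auto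
  then show ?thesis using assms(2) by (simp add: psi_def)
qed

text \<open>Doubling handles the masses. The prefactor \<open>r powr (2 - n)\<close> increases or
  decreases according to the dimension, hence the two-sided comparison of the radii and the absolute
  value in the constant.\<close>

lemma psi_compare:
  fixes p C K0 :: real assumes "1 < p" "1 \<le> C" "1 \<le> K0"
  shows "\<exists>K\<ge>1. \<forall>(V :: real^'n \<Rightarrow> real) x y r s. RH_real p C V \<longrightarrow> 0 < r \<longrightarrow> r / K0 \<le> s \<longrightarrow> s \<le> K0 * r \<longrightarrow> dist x y \<le> K0 * r \<longrightarrow>
     psi V y s \<le> K * psi V x r"
proof -
  obtain K where K: "K \<ge> 1" "\<And>(V :: real^'n \<Rightarrow> real) x y r s. RH_real p C V \<Longrightarrow> 0 < r \<Longrightarrow> 0 < s \<Longrightarrow> s \<le> K0 * r \<Longrightarrow> dist x y \<le> K0 * r \<Longrightarrow>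
   (LINT y:ball y s|lebesgue. V y) \<le> K * (LINT y:ball x r|lebesgue. V y)"
    using RH_integral_compare[OF assms, where 'n='n] by blast
  let ?d = "\<bar>2 - real CARD('n)\<bar>"
  have pw: "s powr (2 - real CARD('n)) \<le> K0 powr ?d * r powr (2 - real CARD('n))"
    if "0 < r" "r / K0 \<le> s" "s \<le> K0 * r" for r s :: real
  proof (cases "2 - real CARD('n) \<ge> 0")
    case True
    have s: "s > 0" using that assms by (meson divide_pos_pos less_le_trans zero_less_one)
    have "s powr (2 - real CARD('n)) \<le> (K0 * r) powr (2 - real CARD('n))"
      using True s that by (intro powr_mono2) auto
    then show ?thesis using True assms that by (simp add: powr_mult)
  next
    case False
    have s: "s > 0" using that assms by (meson divide_pos_pos less_le_trans zero_less_one)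
    have "s powr (2 - real CARD('n)) \<le> (r / K0) powr (2 - real CARD('n))"
      using False s that assms by (intro powr_mono2') auto
    also have "\<dots> = K0 powr (-(2 - real CARD('n))) * r powr (2 - real CARD('n))"
      using assms that by (subst powr_minus, subst powr_divide) (simp_all add: divide_inverse)
    also have "-(2 - real CARD('n)) = ?d" using False by simp
    finally show ?thesis .
  qed
  show ?thesis
  proof (intro exI[of _ "K0 powr ?d * K"] conjI allI impI)
    have "1 \<le> K0 powr ?d" using assms by (intro ge_one_powr_ge_zero) auto
    with K(1) show "1 \<le> K0 powr ?d * K" using mult_mono[of 1 "K0 powr ?d" 1 K] by simp
  next
    fix V :: "real^'n \<Rightarrow> real" and x y :: "real^'n" and r s :: real
    assume V: "RH_real p C V" and r: "0 < r" "r / K0 \<le> s" "s \<le> K0 * r" "dist x y \<le> K0 * r"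
    have s: "s > 0" using r assms by (meson divide_pos_pos less_le_trans zero_less_one)
    let ?c = "measure lebesgue (ball (0::real^'n) 1)"
    have c: "?c > 0" by simp
    have "psi V y s = s powr (2 - real CARD('n)) * ((LINT y:ball y s|lebesgue. V y) / ?c)"
      by (rule psi_eq[OF s])
    also have "\<dots> \<le> (K0 powr ?d * r powr (2 - real CARD('n))) * ((K * (LINT y:ball x r|lebesgue. V y)) / ?c)"
      using RH_integral_pos[OF V assms(1,2) s, of y] c
      by (intro mult_mono pw[OF r(1-3)] divide_right_mono K(2)[OF V r(1) s r(3,4)]) auto
    also have "\<dots> = (K0 powr ?d * K) * psi V x r" by (simp add: psi_eq[OF r(1)])
    finally show "psi V y s \<le> (K0 powr ?d * K) * psi V x r" .
  qed
qed

text \<open>Reverse doubling of the measure \<open>V powr p\<close>. It gives power growth of \<open>psi\<close> also in the borderline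
  case \<open>2 * p = n\<close>, where one would otherwise appeal to Gehring's lemma.\<close>

lemma RH_powr_integral_triple:
  fixes p C :: real assumes "1 < p" "1 \<le> C"
  shows "\<exists>q>1. \<forall>(V :: real^'n \<Rightarrow> real) x r. RH_real p C V \<longrightarrow> 0 < r \<longrightarrow> 
   q * (LINT y:ball x r|lebesgue. V y powr p) \<le> (LINT y:ball x (3*r)|lebesgue. V y powr p)"
proof -
  obtain K where K: "K \<ge> 1" "\<And>(V :: real^'n \<Rightarrow> real) x y r s. RH_real p C V \<Longrightarrow> 0 < r \<Longrightarrow> 0 < s \<Longrightarrow> s \<le> 3 * r \<Longrightarrow> dist x y \<le> 3 * r \<Longrightarrow>
   (LINT y:ball y s|lebesgue. V y) \<le> K * (LINT y:ball x r|lebesgue. V y)"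
    using RH_integral_compare[OF assms, where 'n='n and ?K0.0=3] by auto
  define L where "L = (2 * C * K) powr p * 3 ^ CARD('n)"
  have L: "L > 0" using K assms by (auto simp: L_def)
  have "(1 + 1 / L) * (LINT y:ball x r|lebesgue. V y powr p) \<le> (LINT y:ball x (3*r)|lebesgue. V y powr p)"
    if V: "RH_real p C V" and r: "0 < r" for V :: "real^'n \<Rightarrow> real" and x r
  proof -
    \<comment> \<open>A second ball of radius \<open>r\<close>, centred at distance
      \<open>2 * r\<close>, is disjoint from the first and lies in the tripled ball. By doubling it
      has at least the share \<open>1 / L\<close> of the mass of the tripled ball, so the first ball
      cannot have nearly all of it.\<close>
    obtain e :: "real^'n" where e: "norm e = 1" using vector_choose_size[of 1] by auto
    define y where "y = x + (2*r) *\<^sub>R e"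
    have xy: "dist x y = 2 * r" using e r by (simp add: y_def dist_norm)
    let ?w = "\<lambda>S. (LINT y:S|lebesgue. V y powr p)"
    note int = RH_powr[OF V assms]
    have disj: "ball x r \<inter> ball y r = {}"
    proof -
      have False if "dist x z < r" "dist y z < r" for z
        using that xy dist_triangle[of x y z] by (simp add: dist_commute)
      then show ?thesis by auto
    qed
    have sub: "ball x r \<union> ball y r \<subseteq> ball x (3*r)"
    proof -
      have "dist x z < 3*r" if "dist y z < r" for z
        using that xy dist_triangle[of x z y] by (simp add: dist_commute)
      then show ?thesis using r by auto
    qed
    have "?w (ball x r) + ?w (ball y r) = ?w (ball x r \<union> ball y r)"
      using disj int[OF r] by (intro set_integral_Un[symmetric]) auto
    also have "\<dots> \<le> ?w (ball x (3*r))"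
      using sub r int by (intro set_integral_mono_subset) auto
    finally have 1: "?w (ball x r) + ?w (ball y r) \<le> ?w (ball x (3*r))" .
    let ?B = "measure lebesgue (ball y r)"
    have B: "?B > 0" using r by simp
    have B3: "measure lebesgue (ball x (3*r)) = 3 ^ CARD('n) * ?B"
      using content_ball_eq[of "3*r" x] content_ball_eq[of r y] r by (simp add: power_mult_distrib)
    have "average (ball x (3*r)) V \<le> K * average (ball y r) V"
    proof -
      have "(LINT y:ball x (3*r)|lebesgue. V y) \<le> K * (LINT y:ball y r|lebesgue. V y)"
        using xy r by (intro K(2)[OF V]) (auto simp: dist_commute)
      also have "\<dots> = K * average (ball y r) V * ?B" by (simp add: RH_integral_eq[OF V assms r])
      finally have "average (ball x (3*r)) V * (3 ^ CARD('n) * ?B) \<le> K * average (ball y r) V * ?B"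
        using r by (simp add: RH_integral_eq[OF V assms] B3)
      then have "average (ball x (3*r)) V * 3 ^ CARD('n) \<le> K * average (ball y r) V"
        using B by (simp add: mult.assoc[symmetric])
      moreover have "average (ball x (3*r)) V * 1 \<le> average (ball x (3*r)) V * 3 ^ CARD('n)"
        using RH_avg_pos[OF V assms, of "3*r" x] r by (intro mult_left_mono) auto
      ultimately show ?thesis by simp
    qed
    then have "(C * average (ball x (3*r)) V) powr p \<le> (C * (K * average (ball y r) V)) powr p"
      using RH_avg_pos[OF V assms, of "3*r" x] r assms by (intro powr_mono2 mult_left_mono) auto
    also have "\<dots> = (2*C*K) powr p * (average (ball y r) V / 2) powr p"
      using RH_avg_pos[OF V assms r, of y] assms K(1) by (simp flip: powr_mult)
    finally have *: "(C * average (ball x (3*r)) V) powr p \<le> (2*C*K) powr p * (average (ball y r) V / 2) powr p" .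
    have "?w (ball x (3*r)) \<le> (C * average (ball x (3*r)) V) powr p * (3 ^ CARD('n) * ?B)"
      using RH_powr_integral_le[OF V assms, of "3*r" x] r B3 by simp
    also have "\<dots> \<le> ((2*C*K) powr p * (average (ball y r) V / 2) powr p) * (3 ^ CARD('n) * ?B)"
      using * by (intro mult_right_mono) auto
    also have "\<dots> = L * ((average (ball y r) V / 2) powr p * ?B)" by (simp add: L_def)
    also have "\<dots> \<le> L * ?w (ball y r)"
      using RH_powr_integral_ge[OF V assms r, of y] L by (intro mult_left_mono) auto
    finally have "?w (ball x (3*r)) \<le> L * ?w (ball y r)" .
    moreover have "?w (ball x r) \<le> ?w (ball x (3*r))"
      using r by (intro set_integral_mono_subset int subset_ball) auto
    ultimately have "?w (ball x r) / L \<le> ?w (ball y r)" using L by (simp add: field_simps)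
    with 1 show ?thesis by (simp add: field_simps)
  qed
  then show ?thesis using L by (intro exI[of _ "1+1/L"]) auto
qed

text \<open>Up to a constant, \<open>psi V x r powr p\<close> is \<open>r powr (2 * p - n)\<close>
  times the p-th power of the mean of \<open>V\<close> times the volume. The last two factors are
  comparable to the mass of \<open>V powr p\<close>, which grows geometrically under tripling, and
  the power of \<open>r\<close> is nondecreasing because \<open>2 * p\<close> is at least the
  dimension.\<close>

lemma psi_growth:
  fixes p C M :: real assumes p: "1 < p" "real CARD('n) \<le> 2 * p" and C: "1 \<le> C"
  shows "\<exists>T\<ge>1. \<forall>(V :: real^'n \<Rightarrow> real) x r R. RH_real p C V \<longrightarrow> 0 < r \<longrightarrow> T * r \<le> R \<longrightarrow> M * psi V x r \<le> psi V x R"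
proof -
  obtain q where q: "q > 1" "\<And>(V :: real^'n \<Rightarrow> real) x r. RH_real p C V \<Longrightarrow> 0 < r \<Longrightarrow> 
   q * (LINT y:ball x r|lebesgue. V y powr p) \<le> (LINT y:ball x (3*r)|lebesgue. V y powr p)"
    using RH_powr_integral_triple[OF p(1) C, where 'n='n] by blast
  let ?w = "\<lambda>V S. (LINT y:S|lebesgue. V y powr p)"
  have iter: "q^k * ?w V (ball x r) \<le> ?w V (ball x (3^k * r))"
    if V: "RH_real p C V" and r: "0 < r" for V :: "real^'n \<Rightarrow> real" and x r k
  proof (induction k)
    case (Suc k)
    have "q * (q^k * ?w V (ball x r)) \<le> q * ?w V (ball x (3^k * r))"
      using q(1) Suc by (intro mult_left_mono) auto
    also have "\<dots> \<le> ?w V (ball x (3 * (3^k * r)))" using r by (intro q(2)[OF V]) auto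
    finally show ?case by (simp add: mult.assoc)
  qed simp
  \<comment> \<open>Passing from \<open>psi\<close> to the mass of \<open>V powr p\<close> and back
    costs the factors 2 and \<open>C\<close>, which the k-fold growth has to beat together with
    \<open>M\<close>. A negative \<open>M\<close> is replaced by 0 to keep the base of
    \<open>powr\<close> nonnegative.\<close>
  obtain k where k: "(2 * C * max M 0) powr p < q^k" using real_arch_pow[OF q(1)] by blast
  let ?c = "measure lebesgue (ball (0::real^'n) 1)"
  have "M * psi V x r \<le> psi V x R" if V: "RH_real p C V" and r: "0 < r" and R: "3^k * r \<le> R"
    for V :: "real^'n \<Rightarrow> real" and x r R
  proof -
    have R0: "R > 0" using r R by (smt (verit) mult_pos_pos zero_less_power)
    have "1 * r \<le> 3^k * r" using r by (intro mult_right_mono one_le_power) auto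
    then have rR: "r \<le> R" using R by simp
    have "max M 0 * psi V x r / 2 \<le> C * psi V x R / (2 * C)"
    proof -
      have psip: "(c * psi V x s) powr p = s powr (2*p - real CARD('n)) / ?c * ((c * average (ball x s) V) powr p * measure lebesgue (ball x s))"
        if "s > 0" "c \<ge> 0" for s c
      proof -
        have "(c * psi V x s) powr p = (s^2) powr p * (c * average (ball x s) V) powr p"
          using that RH_avg_pos[OF V p(1) C, of s x] by (simp add: psi_def powr_mult)
        also have "(s^2) powr p = s powr (2 * p)" using that by (simp add: powr_powr flip: powr_numeral)
        also have "s powr (2*p) = s powr (2*p - real CARD('n)) * s ^ CARD('n)"
          using that by (simp add: powr_diff powr_realpow)
        finally show ?thesis using that content_ball_eq[of s x] by simp
      qed
      have "((2 * C * max M 0) * (1/2 * psi V x r)) powr p = (2 * C * max M 0) powr p * (1/2 * psi V x r) powr p"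
        using C psi_pos[OF V r, of x] by (subst powr_mult) auto
      also have "\<dots> \<le> q^k * (1/2 * psi V x r) powr p"
        using k by (intro mult_right_mono) auto
      also have "\<dots> = r powr (2*p - real CARD('n)) / ?c * (q^k * ((1/2 * average (ball x r) V) powr p * measure lebesgue (ball x r)))"
        using psip[OF r, of "1/2"] by simp
      also have "\<dots> \<le> r powr (2*p - real CARD('n)) / ?c * (q^k * ?w V (ball x r))"
        using RH_powr_integral_ge[OF V p(1) C r, of x] q(1) by (intro mult_left_mono) auto
      also have "\<dots> \<le> r powr (2*p - real CARD('n)) / ?c * ?w V (ball x (3^k * r))"
        using iter[OF V r, of k x] by (intro mult_left_mono) auto
      also have "\<dots> \<le> r powr (2*p - real CARD('n)) / ?c * ?w V (ball x R)"
        using R R0 RH_powr[OF V p(1) C R0] by (intro mult_left_mono set_integral_mono_subset subset_ball) auto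
      also have "\<dots> \<le> R powr (2*p - real CARD('n)) / ?c * ?w V (ball x R)"
        using p rR r by (intro mult_right_mono divide_right_mono powr_mono2) (auto simp: set_lebesgue_integral_def)
      also have "\<dots> \<le> R powr (2*p - real CARD('n)) / ?c * ((C * average (ball x R) V) powr p * measure lebesgue (ball x R))"
        using RH_powr_integral_le[OF V p(1) C R0, of x] by (intro mult_left_mono) auto
      also have "\<dots> = (C * psi V x R) powr p" using psip[OF R0, of C] C by simp
      finally have "(2 * C * max M 0) * (1/2 * psi V x r) \<le> C * psi V x R"
        using p C psi_pos[OF V r, of x] psi_pos[OF V R0, of x] powr_less_mono2[of p "C * psi V x R" "(2 * C * max M 0) * (1/2 * psi V x r)"]
        by (force simp: not_le)
      then show ?thesis using C by (simp add: field_simps)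
    qed
    then have "max M 0 * psi V x r \<le> psi V x R" using C by simp
    moreover have "M * psi V x r \<le> max M 0 * psi V x r" using psi_pos[OF V r, of x] by (intro mult_right_mono) auto
    ultimately show ?thesis by simp
  qed
  then show ?thesis by (intro exI[of _ "3^k"]) auto
qed

text \<open>Otherwise the set where \<open>V\<close> is at least a quarter of its mean would carry
  at most half of the mass and its complement at most a quarter, which do not add up to the
  whole.\<close>

lemma RH_large_set:
  fixes p C :: real assumes "1 < p" "1 \<le> C"
  shows "\<exists>e>0. \<forall>(V :: real^'n \<Rightarrow> real) x r. RH_real p C V \<longrightarrow> 0 < r \<longrightarrow> 
   e * measure lebesgue (ball x r) \<le> measure lebesgue {y\<in>ball x r. average (ball x r) V / 4 \<le> V y}"
proof -
  obtain e where e: "e > 0" "e < 1" 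
   "\<And>(V :: real^'n \<Rightarrow> real) x r E. RH_real p C V \<Longrightarrow> 0 < r \<Longrightarrow> E \<in> sets lebesgue \<Longrightarrow> E \<subseteq> ball x r
    \<Longrightarrow> measure lebesgue E \<le> e * measure lebesgue (ball x r) \<Longrightarrow>
   (LINT y:E|lebesgue. V y) \<le> (LINT y:ball x r|lebesgue. V y) / 2"
    using RH_Ainfty[OF assms, where 'n='n] by blast
  have "e * measure lebesgue (ball x r) \<le> measure lebesgue {y\<in>ball x r. average (ball x r) V / 4 \<le> V y}"
    if V: "RH_real p C V" and r: "0 < r" for V :: "real^'n \<Rightarrow> real" and x r
  proof (rule ccontr)
    define a where "a = average (ball x r) V"
    have a: "a > 0" using RH_avg_pos[OF V assms r] by (simp add: a_def)
    define E where "E = {y\<in>ball x r. a / 4 \<le> V y}"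
    define F where "F = ball x r - E"
    note int = RH_integrable[OF V assms r, of x]
    note [measurable] = RH_meas[OF V assms]
    have "E = ball x r \<inter> {y \<in> space lebesgue. a / 4 \<le> V y}" by (auto simp: E_def)
    also have "\<dots> \<in> sets lebesgue" by (intro sets.Int borel_measurable_le) auto
    finally have Es: "E \<in> sets lebesgue" .
    have Fs: "F \<in> sets lebesgue" using Es by (auto simp: F_def)
    have Esub: "E \<subseteq> ball x r" and Fsub: "F \<subseteq> ball x r" by (auto simp: E_def F_def)
    have EF: "ball x r = E \<union> F" by (auto simp: E_def F_def)
    assume "\<not> e * measure lebesgue (ball x r) \<le> measure lebesgue {y\<in>ball x r. average (ball x r) V / 4 \<le> V y}"
    then have "measure lebesgue E \<le> e * measure lebesgue (ball x r)"
      unfolding E_def a_def by linarith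
    then have "(LINT y:E|lebesgue. V y) \<le> (LINT y:ball x r|lebesgue. V y) / 2"
      by (intro e(3)[OF V r] Es Esub)
    moreover have "(LINT y:ball x r|lebesgue. V y) = (LINT y:(E \<union> F)|lebesgue. V y)"
      using EF by simp
    moreover have "(LINT y:(E \<union> F)|lebesgue. V y) = (LINT y:E|lebesgue. V y) + (LINT y:F|lebesgue. V y)"
      using Es Fs Esub Fsub by (intro set_integral_Un set_integrable_subset[OF int]) (auto simp: F_def)
    moreover have "(LINT y:F|lebesgue. V y) \<le> (LINT y:F|lebesgue. a/4)"
    proof (rule set_integral_mono)
      show "set_integrable lebesgue F V" using Fs by (intro set_integrable_subset[OF int]) (auto simp: F_def)
      have "F \<in> lmeasurable" using Fs bounded_subset[OF bounded_ball Fsub] by (intro bounded_set_imp_lmeasurable)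
      then show "set_integrable lebesgue F (\<lambda>x. a/4)" by (auto simp: set_integrable_def fmeasurable_def)
    qed (auto simp: F_def E_def)
    moreover have "(LINT y:F|lebesgue. a/4) \<le> a/4 * measure lebesgue (ball x r)"
    proof -
      have "(LINT y:F|lebesgue. a/4) = a/4 * measure lebesgue F" using Fs by (simp add: set_lebesgue_integral_def)
      also have "\<dots> \<le> a/4 * measure lebesgue (ball x r)"
        using a Fs by (intro mult_left_mono measure_mono_fmeasurable) (auto simp: F_def)
      finally show ?thesis .
    qed
    moreover have "(LINT y:ball x r|lebesgue. V y) = a * measure lebesgue (ball x r)"
      using RH_integral_eq[OF V assms r] by (simp add: a_def)
    moreover have "a * measure lebesgue (ball x r) > 0" using a r by simp
    ultimately show False by linarith
  qed
  with e(1) show ?thesis by blast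
qed

section \<open>The critical radius\<close>

text \<open>\<open>agmon_rho\<close> is the critical radius, the reciprocal of \<open>agmon_m\<close>; \<open>lip_rho\<close> is a comparable
  1-Lipschitz minorant of it, which makes measurability trivial and local comparisons elementary.\<close>

definition agmon_rho :: "(real^'n \<Rightarrow> real) \<Rightarrow> real^'n \<Rightarrow> real" where
  "agmon_rho V x = Sup {r. r > 0 \<and> psi V x r \<le> 1}"

definition lip_rho :: "(real^'n \<Rightarrow> real) \<Rightarrow> real^'n \<Rightarrow> real" where
  "lip_rho V x = (INF y. agmon_rho V y + dist x y)"

lemma agmon_m_eq: "agmon_m V x = 1 / agmon_rho V x"
  by (simp add: agmon_m_def agmon_rho_def)

context
  fixes p C :: real and V :: "real^'n \<Rightarrow> real"
  assumes p: "1 < p" "real CARD('n) \<le> 2 * p" and C: "1 \<le> C" and V: "RH_real p C V"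
begin

text \<open>Growth from radius \<open>1/T\<close> to radius 1 by the factor \<open>psi V x 1\<close>
  forces \<open>psi\<close> to be at most 1 at \<open>1/T\<close>. The upper bound of the set comes
  in the same way from growth beyond radius 1.\<close>

lemma agmon_set_nonempty: "{r. r > 0 \<and> psi V x r \<le> 1} \<noteq> {}"
proof -
  have a: "0 < psi V x 1" by (rule psi_pos[OF V]) simp
  obtain T where T: "T \<ge> 1" "\<And>y r R. 0 < r \<Longrightarrow> T * r \<le> R \<Longrightarrow> psi V x 1 * psi V y r \<le> psi V y R"
    using psi_growth[OF p C, of "psi V x 1"] V by meson
  have "psi V x 1 * psi V x (1/T) \<le> psi V x 1"
    using T(1) by (intro T(2)) auto
  then have "psi V x (1/T) \<le> 1" using a by (simp add: mult_le_cancel_left1)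
  then have "1/T \<in> {r. r > 0 \<and> psi V x r \<le> 1}" using T(1) by simp
  then show ?thesis by blast
qed

lemma agmon_set_bdd: "bdd_above {r. r > 0 \<and> psi V x r \<le> 1}"
proof -
  have a: "0 < psi V x 1" by (rule psi_pos[OF V]) simp
  obtain T where T: "T \<ge> 1" "\<And>y r R. 0 < r \<Longrightarrow> T * r \<le> R \<Longrightarrow> (2/psi V x 1) * psi V y r \<le> psi V y R"
    using psi_growth[OF p C, of "2/psi V x 1"] V by meson
  have "r \<le> T" if "psi V x r \<le> 1" for r
  proof (rule ccontr)
    assume "\<not> r \<le> T"
    then have "2 / psi V x 1 * psi V x 1 \<le> psi V x r" by (intro T(2)) auto
    with that a show False by simp
  qed
  then show ?thesis by (intro bdd_aboveI) auto
qed

lemma agmon_rho_upper: "0 < r \<Longrightarrow> psi V x r \<le> 1 \<Longrightarrow> r \<le> agmon_rho V x"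
  unfolding agmon_rho_def by (rule cSup_upper[OF _ agmon_set_bdd]) auto

lemma agmon_rho_pos: "0 < agmon_rho V x"
  using agmon_set_nonempty[of x] agmon_rho_upper[of _ x] by force

lemma psi_gt_agmon_rho: "agmon_rho V x < r \<Longrightarrow> 1 < psi V x r"
  using agmon_rho_upper[of r x] agmon_rho_pos[of x] by (force simp: not_le[symmetric])

text \<open>An almost extremal radius serves where continuity of \<open>psi\<close> in the radius
  would show that the supremum is attained.\<close>

lemma psi_le_ex: "\<exists>r. agmon_rho V x / 2 < r \<and> r \<le> agmon_rho V x \<and> psi V x r \<le> 1"
proof -
  have "\<exists>r\<in>{r. r > 0 \<and> psi V x r \<le> 1}. agmon_rho V x / 2 < r"
    using agmon_rho_pos[of x] less_cSup_iff[OF agmon_set_nonempty agmon_set_bdd, of "agmon_rho V x / 2" x]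
    by (simp add: agmon_rho_def)
  then show ?thesis using agmon_rho_upper[of _ x] by auto
qed

lemma lip_rho_bdd: "bdd_below (range (\<lambda>y. agmon_rho V y + dist x y))"
  using agmon_rho_pos by (intro bdd_belowI[of _ 0]) (force intro: add_nonneg_nonneg less_imp_le)

lemma lip_rho_le: "lip_rho V x \<le> agmon_rho V x"
  unfolding lip_rho_def by (rule cINF_lower2[OF lip_rho_bdd, of x]) auto

lemma lip_rho_lipschitz: "lip_rho V x \<le> lip_rho V y + dist x y"
proof -
  have "lip_rho V x - dist x y \<le> lip_rho V y"
    unfolding lip_rho_def[of V y]
  proof (rule cINF_greatest)
    fix z
    have "lip_rho V x \<le> agmon_rho V z + dist x z" unfolding lip_rho_def by (rule cINF_lower[OF lip_rho_bdd]) auto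
    also have "\<dots> \<le> agmon_rho V z + (dist y z + dist x y)" using dist_triangle[of x z y] by auto
    finally show "lip_rho V x - dist x y \<le> agmon_rho V z + dist y z" by simp
  qed auto
  then show ?thesis by simp
qed

end

text \<open>For \<open>y\<close> within \<open>agmon_rho V x\<close> of \<open>x\<close>, comparison
  bounds \<open>psi\<close> at \<open>y\<close> and that radius by a constant \<open>K\<close>.
  Shrinking the radius by the factor over which \<open>psi\<close> grows \<open>K\<close>-fold
  brings it down to 1, so the critical radius at \<open>y\<close> cannot be much smaller. Farther
  points are penalised by the distance term of the infimum.\<close>

lemma lip_rho_ge:
  fixes p C :: real assumes p: "1 < p" "real CARD('n) \<le> 2 * p" and C: "1 \<le> C"
  shows "\<exists>T\<ge>1. \<forall>(V :: real^'n \<Rightarrow> real) x. RH_real p C V \<longrightarrow> agmon_rho V x \<le> T * lip_rho V x"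
proof -
  obtain K where K: "K \<ge> 1" "\<And>(V :: real^'n \<Rightarrow> real) x y r s. RH_real p C V \<Longrightarrow> 0 < r \<Longrightarrow> r / 2 \<le> s \<Longrightarrow> s \<le> 2 * r \<Longrightarrow> dist x y \<le> 2 * r \<Longrightarrow>
     psi V y s \<le> K * psi V x r"
    using psi_compare[OF p(1) C, of 2, where 'n='n] by auto
  obtain T where T: "T \<ge> 1" "\<And>(V :: real^'n \<Rightarrow> real) x r R. RH_real p C V \<Longrightarrow> 0 < r \<Longrightarrow> T * r \<le> R \<Longrightarrow> K * psi V x r \<le> psi V x R"
    using psi_growth[OF p C, of K] by meson
  have "agmon_rho V x \<le> T * lip_rho V x" if V: "RH_real p C V" for V :: "real^'n \<Rightarrow> real" and x
  proof -
    note pos = agmon_rho_pos[OF p C V]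
    have "agmon_rho V x / T \<le> lip_rho V x"
      unfolding lip_rho_def
    proof (rule cINF_greatest)
      fix y
      show "agmon_rho V x / T \<le> agmon_rho V y + dist x y"
      proof (cases "dist x y \<le> agmon_rho V x")
        case False
        have "agmon_rho V x / T \<le> agmon_rho V x" using T(1) pos[of x] by (simp add: field_simps)
        then show ?thesis using False pos[of y] by simp
      next
        case True
        obtain r where r: "agmon_rho V x / 2 < r" "r \<le> agmon_rho V x" "psi V x r \<le> 1"
          using psi_le_ex[OF p C V] by blast
        have r0: "r > 0" using r pos[of x] by simp
        have "psi V y (agmon_rho V x) \<le> K * psi V x r"
          using r True r0 by (intro K(2)[OF V]) auto
        also have "\<dots> \<le> K" using r K(1) by (simp add: mult_le_cancel_left1)
        finally have "psi V y (agmon_rho V x) \<le> K" .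
        moreover have "K * psi V y (agmon_rho V x / T) \<le> psi V y (agmon_rho V x)"
          using T(1) pos[of x] by (intro T(2)[OF V]) auto
        ultimately have "K * psi V y (agmon_rho V x / T) \<le> K" by simp
        then have "psi V y (agmon_rho V x / T) \<le> 1" using K(1) by (simp add: mult_le_cancel_left1)
        then have "agmon_rho V x / T \<le> agmon_rho V y"
          using T(1) pos[of x] by (intro agmon_rho_upper[OF p C V]) auto
        then show ?thesis by (smt (verit) zero_le_dist)
      qed
    qed auto
    then show ?thesis using T(1) by (simp add: field_simps)
  qed
  with T(1) show ?thesis by blast
qed

lemma lip_rho_pos:
  fixes V :: "real^'n \<Rightarrow> real"
  assumes p: "1 < p" "real CARD('n) \<le> 2 * p" and C: "1 \<le> C" and V: "RH_real p C V"
  shows "0 < lip_rho V x"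
proof -
  obtain T where "T \<ge> 1" "agmon_rho V x \<le> T * lip_rho V x" using lip_rho_ge[OF p C] V by blast
  with agmon_rho_pos[OF p C V, of x] show ?thesis by (smt (verit) mult_nonneg_nonpos)
qed

lemma agmon_m_le:
  fixes V :: "real^'n \<Rightarrow> real"
  assumes p: "1 < p" "real CARD('n) \<le> 2 * p" and C: "1 \<le> C" and V: "RH_real p C V"
  shows "agmon_m V x \<le> 1 / lip_rho V x"
  using lip_rho_pos[OF assms, of x] lip_rho_le[OF assms, of x] by (simp add: agmon_m_eq frac_le)

text \<open>This bounds the mean of \<open>V\<close> from below on the balls used for the
  Fefferman-Phong inequality. It holds because \<open>psi\<close> exceeds 1 at the radius
  \<open>2 * agmon_rho V x\<close>, which is comparable to \<open>lip_rho V x / 2\<close>.\<close>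

lemma psi_lip_rho:
  fixes p C :: real assumes p: "1 < p" "real CARD('n) \<le> 2 * p" and C: "1 \<le> C"
  shows "\<exists>c>0. \<forall>(V :: real^'n \<Rightarrow> real) x. RH_real p C V \<longrightarrow> c \<le> psi V x (lip_rho V x / 2)"
proof -
  obtain T where T: "T \<ge> 1" "\<And>(V :: real^'n \<Rightarrow> real) x. RH_real p C V \<Longrightarrow> agmon_rho V x \<le> T * lip_rho V x"
    using lip_rho_ge[OF assms] by meson
  have T4: "1 \<le> 4 * T" using T by simp
  obtain K where K: "K \<ge> 1" "\<And>(V :: real^'n \<Rightarrow> real) x y r s. RH_real p C V \<Longrightarrow> 0 < r \<Longrightarrow> r / (4*T) \<le> s \<Longrightarrow> s \<le> 4*T * r \<Longrightarrow> dist x y \<le> 4*T * r \<Longrightarrow>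
     psi V y s \<le> K * psi V x r"
    using psi_compare[OF p(1) C T4, where 'n='n] by auto
  have "1 / K \<le> psi V x (lip_rho V x / 2)" if V: "RH_real p C V" for V :: "real^'n \<Rightarrow> real" and x
  proof -
    note pos = lip_rho_pos[OF assms V, of x] 
    note le = lip_rho_le[OF assms V, of x] T(2)[OF V, of x]
    have "1 < psi V x (2 * agmon_rho V x)"
      using agmon_rho_pos[OF p C V, of x] by (intro psi_gt_agmon_rho[OF p C V]) auto
    also have "\<dots> \<le> K * psi V x (lip_rho V x / 2)"
    proof (rule K(2)[OF V])
      have "lip_rho V x / 2 \<le> 2 * agmon_rho V x * 1" using pos le by simp
      also have "\<dots> \<le> 2 * agmon_rho V x * (4*T)"
        using pos le T4 by (intro mult_left_mono) auto
      finally show "lip_rho V x / 2 / (4*T) \<le> 2 * agmon_rho V x" using T(1) by (simp add: field_simps)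
    qed (use pos le T(1) in auto)
    finally show ?thesis using K(1) by (simp add: field_simps)
  qed
  moreover have "1/K > 0" using K(1) by simp
  ultimately show ?thesis by blast
qed

text \<open>For large \<open>R\<close> the value \<open>psi V 0 R\<close> is as large as desired,
  and comparison moves this to every ball of radius \<open>e * R\<close> centred within
  \<open>3 * R\<close> of the origin. The factor 3 is the ratio of the two balls in the weighted
  estimate.\<close>

lemma lip_rho_sublinear:
  fixes V :: "real^'n \<Rightarrow> real"
  assumes p: "1 < p" "real CARD('n) \<le> 2 * p" and C: "1 \<le> C" and V: "RH_real p C V" and e: "0 < e"
  shows "\<exists>R0>0. \<forall>R\<ge>R0. \<forall>x. norm x \<le> 3 * R \<longrightarrow> lip_rho V x \<le> e * R"
proof -
  \<comment> \<open>The bounds \<open>e\<close> and \<open>3/e\<close> make \<open>e * R\<close> and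
    \<open>R\<close> comparable radii and keep the origin within \<open>K0 * (e * R)\<close> of
    \<open>x\<close>.\<close>
  define K0 where "K0 = max 1 (max e (3/e))"
  have K0: "1 \<le> K0" "e \<le> K0" "3/e \<le> K0" by (auto simp: K0_def)
  then have K3: "3 \<le> K0 * e" using e by (simp add: field_simps)
  obtain K where K: "K \<ge> 1" "\<And>(V :: real^'n \<Rightarrow> real) x y r s. RH_real p C V \<Longrightarrow> 0 < r \<Longrightarrow> r / K0 \<le> s \<Longrightarrow> s \<le> K0 * r \<Longrightarrow> dist x y \<le> K0 * r \<Longrightarrow>
     psi V y s \<le> K * psi V x r"
    using psi_compare[OF p(1) C K0(1), where 'n='n] by auto
  obtain T where T: "T \<ge> 1" "\<And>(V' :: real^'n \<Rightarrow> real) x r R. RH_real p C V' \<Longrightarrow> 0 < r \<Longrightarrow> T * r \<le> R \<Longrightarrow> (2*K/psi V 0 1) * psi V' x r \<le> psi V' x R"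
    using psi_growth[OF p C, of "2*K/psi V 0 1"] by meson
  have a: "0 < psi V 0 1" by (rule psi_pos[OF V]) simp
  have big: "1 < psi V x (e * R)" if "R \<ge> T" "norm x \<le> 3 * R" for R and x :: "real^'n"
  proof -
    have R: "R > 0" using that T(1) by simp
    have "2*K/psi V 0 1 * psi V 0 1 \<le> psi V 0 R" using that by (intro T(2)[OF V]) auto
    then have "2 * K \<le> psi V 0 R" using a by simp
    also have "\<dots> \<le> K * psi V x (e * R)"
    proof (rule K(2)[OF V])
      show "e * R / K0 \<le> R" using mult_right_mono[OF K0(2), of R] R K0(1) by (simp add: field_simps)
      have "3 * R \<le> K0 * (e * R)" using mult_right_mono[OF K3, of R] R by (simp only: mult.assoc)
      then show "R \<le> K0 * (e * R)" "dist x 0 \<le> K0 * (e*R)" using that R unfolding dist_norm diff_zero by linarith+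
    qed (use e R in auto)
    finally show ?thesis using K(1) by simp
  qed
  show ?thesis
  proof (intro exI[of _ T] conjI allI impI)
    fix R and x :: "real^'n" assume R: "R \<ge> T" "norm x \<le> 3 * R"
    have "agmon_rho V x \<le> e * R" unfolding agmon_rho_def
    proof (rule cSup_least[OF agmon_set_nonempty[OF p C V]])
      fix r assume r: "r \<in> {r. 0 < r \<and> psi V x r \<le> 1}"
      show "r \<le> e * R"
      proof (rule ccontr)
        assume "\<not> r \<le> e * R"
        \<comment> \<open>\<open>psi\<close> need not be monotone in the radius, so each radius
          \<open>r\<close> above \<open>e * R\<close> is excluded separately, with
          \<open>r / e\<close> in the place of \<open>R\<close>.\<close>
        then have "R \<le> r / e" using e by (simp add: field_simps)
        then have "1 < psi V x (e * (r/e))" using R by (intro big) auto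
        then show False using r e by auto
      qed
    qed
    then show "lip_rho V x \<le> e * R" using lip_rho_le[OF p C V, of x] by simp
  qed (use T(1) in auto)
qed

section \<open>Polygonal paths and the Agmon distance\<close>

text \<open>Weights \<open>h\<close> dominating the integrand keep the concatenation of paths free of measurability
  questions about \<open>agmon_m\<close>.\<close>

definition agmon_path :: "(real^'n \<Rightarrow> real) \<Rightarrow> real^'n \<Rightarrow> real \<Rightarrow> bool" where
  "agmon_path V x L \<longleftrightarrow> (\<exists>\<sigma> h B S. B-lipschitz_on {0..1} \<sigma> \<and> \<sigma> 0 = x \<and> \<sigma> 1 = 0 \<and>
     h \<in> borel_measurable borel \<and> finite S \<and>
     (\<forall>t\<in>{0..1}-S. \<exists>v. (\<sigma> has_vector_derivative v) (at t) \<and> ennreal (agmon_m V (\<sigma> t) * norm v) \<le> h t) \<and>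
     (\<integral>\<^sup>+t. h t * indicator {0..1} t \<partial>lborel) \<le> ennreal L)"

lemma agmon_path_zero: "agmon_path V 0 0"
  unfolding agmon_path_def
  by (rule exI[of _ "\<lambda>_. 0"], rule exI[of _ "\<lambda>_. 0"], rule exI[of _ 0], rule exI[of _ "{}"])
     (auto intro!: lipschitz_intros exI[of _ 0] has_vector_derivative_const)

text \<open>A segment is put in front of a given path, and each is run at double speed on half of
  the unit interval.\<close>

lemma agmon_path_step:
  fixes V :: "real^'n \<Rightarrow> real"
  assumes "agmon_path V x L" "0 \<le> L" "0 \<le> M" "\<And>z. z \<in> closed_segment y x \<Longrightarrow> agmon_m V z \<le> M"
  shows "agmon_path V y (L + M * dist x y)"
proof -
  obtain \<sigma> h B S where \<sigma>: "B-lipschitz_on {0..1} \<sigma>" "\<sigma> 0 = x" "\<sigma> 1 = 0" and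
     h[measurable]: "h \<in> borel_measurable borel" and S: "finite S" and
     deriv: "\<And>t. t\<in>{0..1}-S \<Longrightarrow> \<exists>v. (\<sigma> has_vector_derivative v) (at t) \<and> ennreal (agmon_m V (\<sigma> t) * norm v) \<le> h t" and
     int: "(\<integral>\<^sup>+t. h t * indicator {0..1} t \<partial>lborel) \<le> ennreal L"
    using assms(1) unfolding agmon_path_def by blast
  define l where "l t = y + (2*t) *\<^sub>R (x - y)" for t :: real
  define \<tau> where "\<tau> t = (if t \<le> 1/2 then l t else \<sigma> (2*t-1))" for t :: real
  define k where "k t = (if t \<le> 1/2 then ennreal (2 * M * dist x y) else 2 * h (2*t-1))" for t :: real
  \<comment> \<open>\<open>1/2\<close> is the corner of the new path; the images of \<open>S\<close>
    are the old exceptional times in the new parameter.\<close>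
  define S' where "S' = {0,1/2,1} \<union> (\<lambda>s. (s+1)/2) ` S"
  have B: "B \<ge> 0" using \<sigma>(1) by (rule lipschitz_on_nonneg)
  have "(max (2 * dist x y) (2 * B))-lipschitz_on {0..1} \<tau>"
    unfolding \<tau>_def
  proof (rule lipschitz_on_concat)
    have "(2 * dist x y)-lipschitz_on {0..1/2} l"
    proof (rule lipschitz_onI)
      fix s t :: real
      have "l s - l t = (2 * (s - t)) *\<^sub>R (x - y)" by (simp add: l_def algebra_simps)
      then have "norm (l s - l t) = 2 * \<bar>s - t\<bar> * norm (x - y)" by (simp only: norm_scaleR abs_mult)
      then show "dist (l s) (l t) \<le> 2 * dist x y * dist s t" by (simp add: dist_norm)
    qed simp
    then show "(max (2 * dist x y) (2 * B))-lipschitz_on {0..1/2} l" by (rule lipschitz_on_le) simp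
    have "(2 * B)-lipschitz_on {1/2..1} (\<lambda>t. \<sigma> (2*t-1))"
    proof (rule lipschitz_onI)
      fix s t :: real assume st: "s \<in> {1/2..1}" "t \<in> {1/2..1}"
      then have "dist (\<sigma> (2 * s - 1)) (\<sigma> (2*t-1)) \<le> B * dist (2 * s - 1) (2*t-1)"
        by (intro lipschitz_onD[OF \<sigma>(1)]) auto
      also have "dist (2 * s - 1) (2 * t - 1) = 2 * dist s t" by (auto simp: dist_real_def abs_if)
      also have "B * (2 * dist s t) = 2 * B * dist s t" by simp
      finally show "dist (\<sigma> (2 * s - 1)) (\<sigma> (2*t-1)) \<le> 2 * B * dist s t" .
    qed (use B in simp)
    then show "(max (2 * dist x y) (2 * B))-lipschitz_on {1/2..1} (\<lambda>t. \<sigma> (2*t-1))" by (rule lipschitz_on_le) simp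
    show "l (1/2) = \<sigma> (2*(1/2)-1)" using \<sigma> by (simp add: l_def)
  qed
  moreover have "\<tau> 0 = y" "\<tau> 1 = 0" using \<sigma> by (auto simp: \<tau>_def l_def)
  moreover have km[measurable]: "k \<in> borel_measurable borel" unfolding k_def by measurable
  moreover have "finite S'" using S by (simp add: S'_def)
  moreover have "\<exists>v. (\<tau> has_vector_derivative v) (at t) \<and> ennreal (agmon_m V (\<tau> t) * norm v) \<le> k t"
    if t: "t \<in> {0..1} - S'" for t
  proof (cases "t < 1/2")
    case True
    have "(l has_vector_derivative (2 *\<^sub>R (x - y))) (at t)"
      unfolding l_def by (auto intro!: derivative_eq_intros)
    then have "(\<tau> has_vector_derivative (2 *\<^sub>R (x - y))) (at t)"
      by (rule has_vector_derivative_transform_within_open[of _ _ _ "{..<1/2}"]) (use True in \<open>auto simp: \<tau>_def\<close>)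
    moreover have "ennreal (agmon_m V (\<tau> t) * norm (2 *\<^sub>R (x - y))) \<le> k t"
    proof -
      have "l t = (1 - 2*t) *\<^sub>R y + (2*t) *\<^sub>R x" by (simp add: l_def algebra_simps)
      then have "l t \<in> closed_segment y x" using True t by (auto simp: in_segment intro!: exI[of _ "2*t"])
      then have "agmon_m V (l t) \<le> M" by (rule assms(4))
      then have "agmon_m V (l t) * norm (2 *\<^sub>R (x - y)) \<le> M * norm (2 *\<^sub>R (x - y))" by (intro mult_right_mono) auto
      then show ?thesis using True by (auto simp: \<tau>_def k_def dist_norm intro!: ennreal_leI)
    qed
    ultimately show ?thesis by blast
  next
    case False
    then have t2: "1/2 < t" "t < 1" using t by (auto simp: S'_def)
    have "2*t-1 \<notin> S"
    proof
      assume "2*t-1 \<in> S"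
      then have "((2*t-1)+1)/2 \<in> S'" unfolding S'_def by blast
      then show False using t by simp
    qed
    then have "2*t-1 \<in> {0..1} - S" using t2 by auto
    from deriv[OF this] obtain v where v: "(\<sigma> has_vector_derivative v) (at (2*t-1))" "ennreal (agmon_m V (\<sigma> (2*t-1)) * norm v) \<le> h (2*t-1)"
      by blast
    have "((\<sigma> \<circ> (\<lambda>t. 2*t-1)) has_vector_derivative (2 *\<^sub>R v)) (at t)"
      by (rule vector_diff_chain_at[of "\<lambda>t. 2*t-1" 2 t \<sigma> v]) (use v(1) in \<open>auto intro!: derivative_eq_intros\<close>)
    then have "(\<tau> has_vector_derivative (2 *\<^sub>R v)) (at t)"
      by (rule has_vector_derivative_transform_within_open[of _ _ _ "{1/2<..}"]) (use t2 in \<open>auto simp: \<tau>_def\<close>)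
    moreover have "ennreal (agmon_m V (\<tau> t) * norm (2 *\<^sub>R v)) \<le> k t"
    proof -
      have "ennreal (agmon_m V (\<tau> t) * norm (2 *\<^sub>R v)) = 2 * ennreal (agmon_m V (\<sigma> (2*t-1)) * norm v)"
        using t2 ennreal_mult'[of 2 "agmon_m V (\<sigma> (2*t-1)) * norm v"] by (simp add: \<tau>_def mult_ac)
      also have "\<dots> \<le> 2 * h (2*t-1)" using v(2) by (intro mult_left_mono) auto
      finally show ?thesis using t2 by (simp add: k_def)
    qed
    ultimately show ?thesis by blast
  qed
  moreover have "(\<integral>\<^sup>+t. k t * indicator {0..1} t \<partial>lborel) \<le> ennreal (L + M * dist x y)"
  proof -
    have "(\<integral>\<^sup>+t. k t * indicator {0..1} t \<partial>lborel) \<le>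
      (\<integral>\<^sup>+t. ennreal (2 * M * dist x y) * indicator {0..1/2} t + 2 * (h (-1 + 2*t) * indicator {0..1} (-1 + 2*t)) \<partial>lborel)"
      by (intro nn_integral_mono) (auto simp: k_def indicator_def add.commute)
    also have "\<dots> = ennreal (2 * M * dist x y) * emeasure lborel {0..1/2::real} + 2 * (\<integral>\<^sup>+t. h (-1 + 2*t) * indicator {0..1} (-1 + 2*t) \<partial>lborel)"
      by (subst nn_integral_add) (auto simp: nn_integral_cmult)
    also have "2 * (\<integral>\<^sup>+t. h (-1 + 2*t) * indicator {0..1} (-1 + 2*t) \<partial>lborel) = (\<integral>\<^sup>+t. h t * indicator {0..1} t \<partial>lborel)"
      by (subst nn_integral_real_affine[where c=2 and t="-1"]) auto
    also have "ennreal (2 * M * dist x y) * emeasure lborel {0..1/2::real} = ennreal (M * dist x y)"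
    proof -
      have e: "emeasure lborel {0..1/2::real} = ennreal (1/2)" using emeasure_lborel_Icc[of 0 "1/2::real"] by (simp only:) simp
      show ?thesis unfolding e by (subst ennreal_mult[symmetric]) (use assms(3) in auto)
    qed
    also have "ennreal (M * dist x y) + (\<integral>\<^sup>+t. h t * indicator {0..1} t \<partial>lborel) \<le> ennreal (M * dist x y) + ennreal L"
      using int by (intro add_left_mono)
    also have "\<dots> = ennreal (L + M * dist x y)" using assms(2,3) by (simp add: ennreal_plus[symmetric] add.commute del: ennreal_plus)
    finally show ?thesis .
  qed
  ultimately show ?thesis unfolding agmon_path_def by blast
qed

lemma lipschitz_imp_absolutely_continuous:
  assumes "B-lipschitz_on {a..b} \<sigma>"
  shows "absolutely_continuous_on a b \<sigma>"
  unfolding absolutely_continuous_on_def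
proof (intro allI impI)
  fix \<epsilon> :: real assume e: "\<epsilon> > 0"
  have B: "B \<ge> 0" using assms by (rule lipschitz_on_nonneg)
  show "\<exists>\<delta>>0. \<forall>I. finite I \<and> (\<forall>(s, t)\<in>I. a \<le> s \<and> s < t \<and> t \<le> b) \<and>
      disjoint_family_on (\<lambda>(s, t). {s<..<t}) I \<and> (\<Sum>(s, t)\<in>I. t - s) < \<delta> \<longrightarrow>
      (\<Sum>(s, t)\<in>I. norm (\<sigma> t - \<sigma> s)) < \<epsilon>"
  \<comment> \<open>\<open>B + 1\<close> keeps the denominator positive when \<open>B\<close> is
    0.\<close>
  proof (intro exI[of _ "\<epsilon>/(B+1)"] conjI allI impI)
    fix I :: "(real \<times> real) set"
    assume I: "finite I \<and> (\<forall>(s, t)\<in>I. a \<le> s \<and> s < t \<and> t \<le> b) \<and>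
      disjoint_family_on (\<lambda>(s, t). {s<..<t}) I \<and> (\<Sum>(s, t)\<in>I. t - s) < \<epsilon>/(B+1)"
    have "(\<Sum>(s, t)\<in>I. norm (\<sigma> t - \<sigma> s)) \<le> (\<Sum>(s, t)\<in>I. (B+1) * (t - s))"
    proof (rule sum_mono, clarsimp)
      fix s t assume "(s,t) \<in> I"
      then have st: "a \<le> s" "s < t" "t \<le> b" using I by auto
      then have "norm (\<sigma> t - \<sigma> s) \<le> B * (t - s)"
        using lipschitz_onD[OF assms, of t s] by (simp add: dist_norm)
      also have "\<dots> \<le> (B+1) * (t - s)" using st by (intro mult_right_mono) auto
      finally show "norm (\<sigma> t - \<sigma> s) \<le> (B+1) * (t - s)" .
    qed
    also have "\<dots> = (B+1) * (\<Sum>(s, t)\<in>I. t - s)" by (simp add: sum_distrib_left case_prod_beta)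
    also have "\<dots> < (B+1) * (\<epsilon>/(B+1))" using I B by (intro mult_strict_left_mono) auto
    finally show "(\<Sum>(s, t)\<in>I. norm (\<sigma> t - \<sigma> s)) < \<epsilon>" using B by simp
  qed (use e B in auto)
qed

lemma agmon_dist_le_path:
  fixes V :: "real^'n \<Rightarrow> real"
  assumes "agmon_path V x L" "0 \<le> L"
  shows "agmon_dist V x 0 \<le> L"
proof -
  obtain \<sigma> h B S where \<sigma>: "B-lipschitz_on {0..1} \<sigma>" "\<sigma> 0 = x" "\<sigma> 1 = 0" and
     h[measurable]: "h \<in> borel_measurable borel" and S: "finite S" and
     deriv: "\<And>t. t\<in>{0..1}-S \<Longrightarrow> \<exists>v. (\<sigma> has_vector_derivative v) (at t) \<and> ennreal (agmon_m V (\<sigma> t) * norm v) \<le> h t" and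
     int: "(\<integral>\<^sup>+t. h t * indicator {0..1} t \<partial>lborel) \<le> ennreal L"
    using assms(1) unfolding agmon_path_def by blast
  have "(INF \<sigma>\<in>{\<sigma>. absolutely_continuous_on 0 1 \<sigma> \<and> \<sigma> 0 = x \<and> \<sigma> 1 = 0}. agmon_length V \<sigma>) \<le> agmon_length V \<sigma>"
    using lipschitz_imp_absolutely_continuous[OF \<sigma>(1)] \<sigma> by (intro INF_lower) auto
  also have "agmon_length V \<sigma> \<le> (\<integral>\<^sup>+t. h t * indicator {0..1} t \<partial>lborel)"
    unfolding agmon_length_def nn_integral_completion
  proof (rule nn_integral_mono_AE)
    have "AE t in lborel. t \<notin> S" using S by (intro AE_not_in finite_imp_null_set_lborel)
    then show "AE t in lborel. ennreal (agmon_m V (\<sigma> t) * norm (vector_derivative \<sigma> (at t))) * indicator {0..1} t \<le> h t * indicator {0..1} t"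
    proof eventually_elim
      case (elim t)
      show ?case
      proof (cases "t \<in> {0..1}")
        case True
        then obtain v where "(\<sigma> has_vector_derivative v) (at t)" "ennreal (agmon_m V (\<sigma> t) * norm v) \<le> h t"
          using deriv[of t] elim by auto
        then show ?thesis using True by (simp add: vector_derivative_at)
      qed simp
    qed
  qed
  also note int
  finally show ?thesis unfolding agmon_dist_def using assms(2) by (intro enn2real_leI)
qed

definition agmon_path_inf :: "(real^'n \<Rightarrow> real) \<Rightarrow> real^'n \<Rightarrow> real" where
  "agmon_path_inf V x = Inf {L. 0 \<le> L \<and> agmon_path V x L}"

context
  fixes p C :: real and V :: "real^'n \<Rightarrow> real"
  assumes p: "1 < p" "real CARD('n) \<le> 2 * p" and C: "1 \<le> C" and V: "RH_real p C V"
begin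

lemmas rho_pos = lip_rho_pos[OF p C V]
lemmas rho_lip = lip_rho_lipschitz[OF p C V]

lemma continuous_lip_rho: "continuous_on UNIV (lip_rho V)"
proof -
  have "1-lipschitz_on UNIV (lip_rho V)"
  proof (rule lipschitz_onI)
    show "dist (lip_rho V x) (lip_rho V y) \<le> 1 * dist x y" for x y
      using rho_lip[of x y] rho_lip[of y x] by (simp add: dist_real_def abs_le_iff dist_commute)
  qed simp
  then show ?thesis by (rule lipschitz_on_continuous_on)
qed

lemma agmon_path_ex: "\<exists>L\<ge>0. agmon_path V x L"
proof -
  have "continuous_on (closed_segment x 0) (\<lambda>z. 1 / lip_rho V z)"
    using rho_pos continuous_on_subset[OF continuous_lip_rho] by (intro continuous_intros) (auto simp: less_imp_neq[THEN not_sym])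
  then have "bounded ((\<lambda>z. 1 / lip_rho V z) ` closed_segment x 0)"
    by (intro compact_imp_bounded compact_continuous_image) auto
  then obtain M where M: "M > 0" "\<And>z. z \<in> closed_segment x 0 \<Longrightarrow> \<bar>1 / lip_rho V z\<bar> \<le> M"
    by (auto simp: bounded_pos)
  have "agmon_path V x (0 + M * dist 0 x)"
  proof (rule agmon_path_step[OF agmon_path_zero])
    show "agmon_m V z \<le> M" if "z \<in> closed_segment x 0" for z
      using agmon_m_le[OF p C V, of z] M(2)[OF that] by linarith
  qed (use M in auto)
  then show ?thesis using M by (intro exI[of _ "M * dist 0 x"]) auto
qed

lemma agmon_path_lengths: "{L. 0 \<le> L \<and> agmon_path V x L} \<noteq> {}" "bdd_below {L. 0 \<le> L \<and> agmon_path V x L}"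
  using agmon_path_ex[of x] by (auto intro: bdd_belowI[of _ 0])

lemma agmon_path_inf_nonneg: "0 \<le> agmon_path_inf V x"
  unfolding agmon_path_inf_def using agmon_path_lengths by (intro cInf_greatest) auto

lemma agmon_dist_le_D: "agmon_dist V x 0 \<le> agmon_path_inf V x"
  unfolding agmon_path_inf_def using agmon_path_lengths agmon_dist_le_path by (intro cInf_greatest) auto

lemma agmon_path_inf_step:
  assumes "0 \<le> M" "\<And>z. z \<in> closed_segment y x \<Longrightarrow> agmon_m V z \<le> M"
  shows "agmon_path_inf V y \<le> agmon_path_inf V x + M * dist x y"
proof -
  have "agmon_path_inf V y - M * dist x y \<le> agmon_path_inf V x"
    unfolding agmon_path_inf_def[of V x]
  proof (rule cInf_greatest[OF agmon_path_lengths(1)])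
    fix L assume "L \<in> {L. 0 \<le> L \<and> agmon_path V x L}"
    then have "L + M * dist x y \<in> {L. 0 \<le> L \<and> agmon_path V y L}"
      using assms agmon_path_step[of V x L M y] by auto
    then have "agmon_path_inf V y \<le> L + M * dist x y"
      unfolding agmon_path_inf_def by (rule cInf_lower[OF _ agmon_path_lengths(2)])
    then show "agmon_path_inf V y - M * dist x y \<le> L" by simp
  qed
  then show ?thesis by simp
qed

text \<open>Along the segment the 1-Lipschitz function \<open>lip_rho\<close> stays above half of
  its value at \<open>x\<close>, which bounds the weight there by
  \<open>2 / lip_rho V x\<close>.\<close>

lemma agmon_path_inf_lipschitz:
  assumes "dist x y \<le> lip_rho V x / 2"
  shows "\<bar>agmon_path_inf V x - agmon_path_inf V y\<bar> \<le> 2 / lip_rho V x * dist x y"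
proof -
  have m: "agmon_m V z \<le> 2 / lip_rho V x" if "z \<in> closed_segment x y" for z
  proof -
    have "dist x z \<le> dist x y" using segment_bound(1)[OF that] by (simp add: dist_norm norm_minus_commute)
    then have "lip_rho V x / 2 \<le> lip_rho V z" using rho_lip[of x z] assms by simp
    then have "1 / lip_rho V z \<le> 1 / (lip_rho V x / 2)" using rho_pos[of x] by (intro divide_left_mono) auto
    then show ?thesis using agmon_m_le[OF p C V, of z] by simp
  qed
  have "agmon_path_inf V y \<le> agmon_path_inf V x + 2 / lip_rho V x * dist x y"
    using m rho_pos[of x] by (intro agmon_path_inf_step) (auto simp: closed_segment_commute)
  moreover have "agmon_path_inf V x \<le> agmon_path_inf V y + 2 / lip_rho V x * dist y x"
    using m rho_pos[of x] by (intro agmon_path_inf_step) (auto simp: closed_segment_commute)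
  ultimately show ?thesis by (simp add: dist_commute abs_le_iff)
qed

lemma continuous_agmon_D: "continuous_on UNIV (agmon_path_inf V)"
proof -
  have "isCont (agmon_path_inf V) x" for x
  proof -
    have "((\<lambda>y. agmon_path_inf V y - agmon_path_inf V x) \<longlongrightarrow> 0) (at x)"
    proof (rule Lim_null_comparison)
      have "eventually (\<lambda>y. dist x y \<le> lip_rho V x / 2) (at x)"
        using rho_pos[of x] unfolding eventually_at by (intro exI[of _ "lip_rho V x / 2"]) (auto simp: dist_commute)
      then show "eventually (\<lambda>y. norm (agmon_path_inf V y - agmon_path_inf V x) \<le> 2 / lip_rho V x * dist x y) (at x)"
        by eventually_elim (use agmon_path_inf_lipschitz[of x] in \<open>auto simp: abs_minus_commute\<close>)
      have "((\<lambda>y. 2 / lip_rho V x * dist x y) \<longlongrightarrow> 2 / lip_rho V x * dist x x) (at x)"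
        by (intro tendsto_intros)
      then show "((\<lambda>y. 2 / lip_rho V x * dist x y) \<longlongrightarrow> 0) (at x)" by simp
    qed
    then show ?thesis by (simp add: isCont_def LIM_zero_iff)
  qed
  then show ?thesis by (simp add: continuous_on_eq_continuous_at)
qed

end

section \<open>Smooth functions and mollification\<close>

lemma partial_eqI: "(f has_derivative f') (at x) \<Longrightarrow> partial i f x = f' (axis i 1)"
  unfolding partial_def by (metis frechet_derivative_at)

lemma C_k_SucD: "C_k (Suc k) f \<Longrightarrow> C_k k f"
proof (induction k arbitrary: f)
  case 0
  then show ?case by (auto simp: continuous_on_eq_continuous_at intro: differentiable_imp_continuous_within)
next
  case (Suc k)
  then show ?case by (metis C_k.simps(2))
qed

lemma C_k_const: "C_k k (\<lambda>x :: real^'n. c)"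
proof (induction k arbitrary: c)
  case (Suc k)
  have p: "partial i (\<lambda>x :: real^'n. c) = (\<lambda>x. 0)" for i by (rule ext) (rule partial_eqI[OF has_derivative_const])
  have "C_k k (partial i (\<lambda>x :: real^'n. c))" for i unfolding p by (rule Suc)
  then show ?case by simp
qed auto

lemma C_k_add: "C_k k f \<Longrightarrow> C_k k g \<Longrightarrow> C_k k (\<lambda>x. f x + g x)"
proof (induction k arbitrary: f g)
  case 0 then show ?case by (auto intro: continuous_intros)
next
  case (Suc k)
  have "partial i (\<lambda>x. f x + g x) = (\<lambda>x. partial i f x + partial i g x)" for i
  proof
    fix x
    have "(f has_derivative frechet_derivative f (at x)) (at x)" "(g has_derivative frechet_derivative g (at x)) (at x)"
      using Suc.prems by (auto simp: frechet_derivative_works)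
    from partial_eqI[OF has_derivative_add[OF this]]
    show "partial i (\<lambda>x. f x + g x) x = partial i f x + partial i g x" by (simp add: partial_def)
  qed
  with Suc show ?case by (auto intro: differentiable_add)
qed

lemma partial_mult:
  assumes "f differentiable at x" "g differentiable at x"
  shows "partial i (\<lambda>x. f x * g x) x = f x * partial i g x + partial i f x * g x"
proof -
  have "(f has_derivative frechet_derivative f (at x)) (at x)" "(g has_derivative frechet_derivative g (at x)) (at x)"
    using assms by (auto simp: frechet_derivative_works)
  from partial_eqI[OF has_derivative_mult[OF this]]
  show ?thesis by (simp add: partial_def)
qed

lemma C_k_mult: "C_k k f \<Longrightarrow> C_k k g \<Longrightarrow> C_k k (\<lambda>x. f x * g x)"
proof (induction k arbitrary: f g)
  case 0 then show ?case by (auto intro: continuous_intros)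
next
  case (Suc k)
  have "partial i (\<lambda>x. f x * g x) = (\<lambda>x. f x * partial i g x + partial i f x * g x)" for i
    using Suc.prems by (intro ext partial_mult) auto
  moreover have "C_k k f" "C_k k g" using Suc.prems C_k_SucD by blast+
  ultimately show ?case using Suc by (auto intro!: C_k_add Suc.IH)
qed

lemma C_k_vec_nth: "C_k k (\<lambda>x :: real^'n. x $ j)"
proof (cases k)
  case (Suc l)
  have d: "((\<lambda>x :: real^'n. x $ j) has_derivative (\<lambda>x. x $ j)) (at x)" for x
    by (rule bounded_linear_imp_has_derivative[OF bounded_linear_vec_nth])
  have "partial i (\<lambda>x :: real^'n. x $ j) = (\<lambda>x. axis i 1 $ j)" for i
    by (rule ext) (rule partial_eqI[OF d])
  then show ?thesis using d Suc C_k_const by (auto simp: differentiable_def)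
qed (auto intro: continuous_intros)

text \<open>The powers of \<open>1/t\<close> in front of the classical flat function make the family
  closed under differentiation up to linear combinations, so smoothness follows by one induction
  that treats all \<open>j\<close> together.\<close>

definition exp_inv :: "nat \<Rightarrow> real \<Rightarrow> real" where
  "exp_inv j t = (if t > 0 then (1/t)^j * exp (- (1/t)) else 0)"

text \<open>One term of the exponential series gives quadratic decay at 0, just enough to make the
  derivative there vanish.\<close>

lemma exp_inv_bound: "\<bar>exp_inv j t\<bar> \<le> fact (j+2) * t^2"
proof (cases "t > 0")
  case True
  define x where "x = 1/t"
  have x: "x > 0" using True by (simp add: x_def)
  have "x^(j+2) / fact (j+2) \<le> (\<Sum>i\<le>j+2. x^i / fact i)"
    using x by (intro member_le_sum[of "j+2" "{..j+2}" "\<lambda>i. x^i / fact i"]) auto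
  also have "\<dots> \<le> exp x"
  proof -
    have "(\<Sum>i\<in>{..j+2}. x^i / fact i) \<le> (\<Sum>i. x^i / fact i)"
      using x summable_exp[of x] by (intro sum_le_suminf) (auto simp: divide_inverse mult.commute)
    then show ?thesis by (simp add: exp_def divide_inverse mult.commute)
  qed
  finally have "x^(j+2) \<le> fact (j+2) * exp x" by (subst (asm) pos_divide_le_eq) (auto simp: mult.commute)
  then have "x^j * exp (-x) \<le> fact (j+2) / x^2"
    using x by (simp add: exp_minus field_simps power_add power2_eq_square del: fact_Suc)
  then show ?thesis using True by (simp add: exp_inv_def x_def power_divide del: fact_Suc)
qed (simp add: exp_inv_def)

lemma exp_inv_deriv: "(exp_inv j has_real_derivative (exp_inv (j+2) t - j * exp_inv (j+1) t)) (at t)"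
proof (cases t "0::real" rule: linorder_cases)
  case greater
  have "((\<lambda>t. (1/t)^j * exp (- (1/t))) has_real_derivative (exp_inv (j+2) t - j * exp_inv (j+1) t)) (at t)"
    using greater
    by (auto intro!: derivative_eq_intros simp: exp_inv_def field_simps power2_eq_square power_add)
       (cases j; auto simp: field_simps)
  then show ?thesis
    by (rule has_field_derivative_transform_within_open[of _ _ _ "{0<..}"]) (use greater in \<open>auto simp: exp_inv_def\<close>)
next
  case less
  have "((\<lambda>t. 0) has_real_derivative (exp_inv (j+2) t - j * exp_inv (j+1) t)) (at t)"
    using less by (simp add: exp_inv_def)
  then show ?thesis
    by (rule has_field_derivative_transform_within_open[of _ _ _ "{..<0}"]) (use less in \<open>auto simp: exp_inv_def\<close>)
next
  case equal
  have "((\<lambda>h. (exp_inv j (0 + h) - exp_inv j 0) / h) \<longlongrightarrow> 0) (at 0)"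
  proof (rule Lim_null_comparison)
    show "eventually (\<lambda>h. norm ((exp_inv j (0 + h) - exp_inv j 0) / h) \<le> fact (j+2) * \<bar>h\<bar>) (at 0)"
    proof (rule always_eventually, rule allI)
      fix h :: real
      show "norm ((exp_inv j (0 + h) - exp_inv j 0) / h) \<le> fact (j+2) * \<bar>h\<bar>"
        using exp_inv_bound[of j h] by (cases "h = 0") (simp_all add: exp_inv_def[of j 0] pos_divide_le_eq power2_eq_square mult.assoc del: fact_Suc)
    qed
    have "((\<lambda>h. fact (j+2) * \<bar>h\<bar>) \<longlongrightarrow> fact (j+2) * \<bar>0\<bar>) (at (0::real))" by (intro tendsto_intros)
    then show "((\<lambda>h. fact (j+2) * \<bar>h\<bar>) \<longlongrightarrow> 0) (at (0::real))" by simp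
  qed
  then show ?thesis using equal by (simp add: DERIV_def exp_inv_def[of _ 0])
qed

lemma C_k_exp_inv: "C_k k (\<lambda>x :: real^'n. exp_inv j (a - x \<bullet> x))"
proof (induction k arbitrary: j)
  case 0
  have "continuous_on UNIV (exp_inv j)" 
    using exp_inv_deriv by (intro DERIV_continuous_on) (auto intro: has_field_derivative_at_within)
  then show ?case by (auto intro!: continuous_on_compose2[of UNIV "exp_inv j"] continuous_intros)
next
  case (Suc k)
  let ?D = "\<lambda>x :: real^'n. exp_inv (j+2) (a - x \<bullet> x) - j * exp_inv (j+1) (a - x \<bullet> x)"
  have d: "((\<lambda>x :: real^'n. exp_inv j (a - x \<bullet> x)) has_derivative (\<lambda>h. ?D x * (- 2 * (x \<bullet> h)))) (at x)" for x
  proof -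
    have "((\<lambda>x :: real^'n. a - x \<bullet> x) has_derivative (\<lambda>h. - 2 * (x \<bullet> h))) (at x)"
      by (auto intro!: derivative_eq_intros simp: inner_commute)
    from has_derivative_compose[OF this exp_inv_deriv[unfolded has_field_derivative_def]]
    show ?thesis by simp
  qed
  have p: "partial i (\<lambda>x :: real^'n. exp_inv j (a - x \<bullet> x)) =
     (\<lambda>x. (exp_inv (j+2) (a - x \<bullet> x) + (- j) * exp_inv (j+1) (a - x \<bullet> x)) * ((- 2) * (x $ i)))" for i
    by (rule ext, subst partial_eqI[OF d]) (simp add: inner_axis)
  have "C_k k (partial i (\<lambda>x :: real^'n. exp_inv j (a - x \<bullet> x)))" for i
    unfolding p by (intro C_k_mult C_k_add Suc.IH C_k_const C_k_vec_nth)
  then show ?case using d by (auto simp: differentiable_def)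
qed

section \<open>Gradients and test functions\<close>

definition grad :: "(real^'n \<Rightarrow> real) \<Rightarrow> real^'n \<Rightarrow> real^'n" where
  "grad f x = (\<chi> i. partial i f x)"

lemma has_derivative_grad:
  fixes f :: "real^'n \<Rightarrow> real"
  assumes "f differentiable at x"
  shows "(f has_derivative (\<lambda>h. grad f x \<bullet> h)) (at x)"
proof -
  let ?f = "frechet_derivative f (at x)"
  have d: "(f has_derivative ?f) (at x)" using assms by (simp add: frechet_derivative_works)
  then have lin: "linear ?f" by (rule has_derivative_linear)
  have "?f h = grad f x \<bullet> h" for h
  proof -
    have "?f h = ?f (\<Sum>i\<in>UNIV. (h $ i) *\<^sub>R axis i 1)"
      using basis_expansion[of h] by (simp add: scalar_mult_eq_scaleR)
    also have "\<dots> = (\<Sum>i\<in>UNIV. (h $ i) * ?f (axis i 1))" 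
      by (simp add: linear_sum[OF lin] linear_scale[OF lin])
    also have "\<dots> = grad f x \<bullet> h" by (simp add: grad_def inner_vec_def partial_def mult.commute)
    finally show ?thesis .
  qed
  then have "?f = (\<lambda>h. grad f x \<bullet> h)" by auto
  with d show ?thesis by simp
qed

lemma test_fun_C_k: "test_fun f \<Longrightarrow> C_k k f"
  by (simp add: test_fun_def)

lemma test_fun_differentiable: "test_fun f \<Longrightarrow> f differentiable at x"
  using test_fun_C_k[of f 1] by simp

lemma test_fun_continuous: "test_fun f \<Longrightarrow> continuous_on S f"
  using test_fun_C_k[of f 0] by (auto intro: continuous_on_subset)

lemma test_fun_support:
  assumes "test_fun f" obtains R where "R > 0" "\<And>x. norm x > R \<Longrightarrow> f x = 0"
proof -
  obtain K where K: "compact K" "\<And>x. x \<notin> K \<Longrightarrow> f x = 0" using assms by (auto simp: test_fun_def)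
  obtain R where "R > 0" "\<And>x. x \<in> K \<Longrightarrow> norm x \<le> R" using K(1) by (meson bounded_pos compact_imp_bounded)
  with K(2) that[of R] show ?thesis by (meson not_le)
qed

lemma test_funI:
  assumes "\<And>k. C_k k f" "\<And>x. norm x > R \<Longrightarrow> f x = 0"
  shows "test_fun f"
  unfolding test_fun_def using assms by (auto intro!: exI[of _ "cball 0 R"])

lemma partial_zero_outside:
  fixes f :: "real^'n \<Rightarrow> real"
  assumes "\<And>x. norm x > R \<Longrightarrow> f x = 0" "norm x > R"
  shows "partial i f x = 0"
proof -
  have "((\<lambda>x. 0) has_derivative (\<lambda>x. 0)) (at x)" by simp
  then have "(f has_derivative (\<lambda>x. 0)) (at x)"
    by (rule has_derivative_transform_within_open[of _ _ _ _ "- cball 0 R"]) (use assms in auto)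
  from partial_eqI[OF this] show ?thesis .
qed

lemma test_fun_partial: "test_fun f \<Longrightarrow> test_fun (partial i f)"
proof -
  assume f: "test_fun f"
  obtain R where R: "R > 0" "\<And>x. norm x > R \<Longrightarrow> f x = 0" using test_fun_support[OF f] by blast
  show ?thesis
  proof (rule test_funI)
    show "C_k k (partial i f)" for k using test_fun_C_k[OF f, of "Suc k"] by simp
    show "partial i f x = 0" if "norm x > R" for x using partial_zero_outside[where f=f, OF R(2) that] by blast
  qed
qed

lemma test_fun_mult: "test_fun f \<Longrightarrow> test_fun g \<Longrightarrow> test_fun (\<lambda>x. f x * g x)"
  unfolding test_fun_def by (auto intro: C_k_mult)

lemma test_fun_cmult: "test_fun f \<Longrightarrow> test_fun (\<lambda>x. c * f x)"
  unfolding test_fun_def by (auto intro: C_k_mult C_k_const)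

lemma continuous_grad: "test_fun f \<Longrightarrow> continuous_on S (grad f)"
  unfolding grad_def by (intro continuous_on_vec_lambda test_fun_continuous test_fun_partial)

lemma C_k_reflect:
  fixes f :: "real^'n \<Rightarrow> real"
  shows "C_k k f \<Longrightarrow> C_k k (\<lambda>y. f (x - y))"
proof (induction k arbitrary: f)
  case 0 then show ?case by (auto intro!: continuous_on_compose2[of UNIV f] continuous_intros)
next
  case (Suc k)
  have d: "((\<lambda>y. f (x - y)) has_derivative (\<lambda>h. grad f (x - y) \<bullet> (- h))) (at y)" for y
    by (rule has_derivative_compose[of "\<lambda>y. x - y" "\<lambda>h. - h", OF _ has_derivative_grad])
       (use Suc.prems in \<open>auto intro!: derivative_eq_intros\<close>)
  have p: "partial i (\<lambda>y. f (x - y)) = (\<lambda>y. (-1) * partial i f (x - y))" for i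
    by (rule ext, subst partial_eqI[OF d]) (simp add: inner_axis grad_def)
  have "C_k k (partial i (\<lambda>y. f (x - y)))" for i
    unfolding p by (intro C_k_mult C_k_const Suc.IH) (use Suc.prems in auto)
  then show ?case using d by (auto simp: differentiable_def)
qed

lemma partial_reflect:
  fixes f :: "real^'n \<Rightarrow> real"
  assumes "test_fun f"
  shows "partial i (\<lambda>y. f (x - y)) y = - partial i f (x - y)"
proof -
  have d: "((\<lambda>y. f (x - y)) has_derivative (\<lambda>h. grad f (x - y) \<bullet> (- h))) (at y)" for y
    by (rule has_derivative_compose[of "\<lambda>y. x - y" "\<lambda>h. - h", OF _ has_derivative_grad])
       (use test_fun_differentiable[OF assms] in \<open>auto intro!: derivative_eq_intros\<close>)
  show ?thesis by (subst partial_eqI[OF d]) (simp add: inner_axis grad_def)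
qed

lemma test_fun_reflect:
  fixes f :: "real^'n \<Rightarrow> real"
  assumes "test_fun f" shows "test_fun (\<lambda>y. f (x - y))"
proof -
  obtain R where R: "R > 0" "\<And>x. norm x > R \<Longrightarrow> f x = 0" using test_fun_support[OF assms] by blast
  show ?thesis
  proof (rule test_funI)
    show "f (x - y) = 0" if "norm x + R < norm y" for y
      using that norm_triangle_ineq2[of y x] by (intro R(2)) (simp add: norm_minus_commute)
  qed (intro C_k_reflect test_fun_C_k assms)
qed

section \<open>Compactly supported continuous functions and mollifying kernels\<close>

lemma continuous_zero_outside_integrable:
  fixes f :: "real^'n \<Rightarrow> 'b::euclidean_space"
  assumes "continuous_on UNIV f" "\<And>x. norm x > R \<Longrightarrow> f x = 0"
  shows "integrable lebesgue f"
proof -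
  have "integrable lborel (\<lambda>x. indicator (cball 0 R) x *\<^sub>R f x)"
    by (intro borel_integrable_compact continuous_on_subset[OF assms(1)]) auto
  note I = this
  have "integrable lebesgue (\<lambda>x. indicator (cball 0 R) x *\<^sub>R f x)"
    using I integrable_completion[OF borel_measurable_integrable[OF I]] by simp
  moreover have "(\<lambda>x. indicator (cball 0 R) x *\<^sub>R f x) = f"
    using assms(2) by (auto simp: indicator_def fun_eq_iff not_le)
  ultimately show ?thesis by simp
qed

text \<open>A predicate instead of one rescaled kernel: convergence is stated uniformly over all
  kernels supported in a small ball, so a single kernel can serve several functions at once.\<close>

definition mollifier :: "real \<Rightarrow> (real^'n \<Rightarrow> real) \<Rightarrow> bool" where
  "mollifier \<epsilon> \<eta> \<longleftrightarrow> test_fun \<eta> \<and> (\<forall>x. 0 \<le> \<eta> x) \<and> (\<forall>x. \<epsilon> \<le> norm x \<longrightarrow> \<eta> x = 0) \<and> integral\<^sup>L lebesgue \<eta> = 1"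

lemma test_fun_integrable: "test_fun f \<Longrightarrow> integrable lebesgue f"
  by (rule test_fun_support, assumption) (rule continuous_zero_outside_integrable[OF test_fun_continuous])

lemma mollifier_ex:
  assumes "0 < \<epsilon>" shows "\<exists>\<eta> :: real^'n \<Rightarrow> real. mollifier \<epsilon> \<eta>"
proof -
  define b where "b x = exp_inv 0 (\<epsilon>\<^sup>2 - x \<bullet> x)" for x :: "real^'n"
  have z: "b x = 0" if "\<epsilon> \<le> norm x" for x
  proof -
    have "\<epsilon>\<^sup>2 \<le> x \<bullet> x" using power_mono[OF that, of 2] assms by (simp add: dot_square_norm)
    then show ?thesis by (simp add: b_def exp_inv_def)
  qed
  have pos: "b x > 0" if "norm x < \<epsilon>" for x
    using power_strict_mono[OF that, of 2] assms by (simp add: b_def exp_inv_def dot_square_norm)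
  have nn: "b x \<ge> 0" for x by (simp add: b_def exp_inv_def)
  have tb: "test_fun b"
  proof (rule test_funI[where R=\<epsilon>])
    show "C_k k b" for k unfolding b_def[abs_def] by (rule C_k_exp_inv)
  qed (use z in auto)
  note int = test_fun_integrable[OF tb]
  have "integral\<^sup>L lebesgue b \<noteq> 0"
  proof
    assume "integral\<^sup>L lebesgue b = 0"
    then have "AE x in lebesgue. b x = 0" using integral_nonneg_eq_0_iff_AE[OF int] nn by auto
    then have "AE x in lebesgue. x \<notin> ball (0::real^'n) \<epsilon>"
    proof eventually_elim
      case (elim x)
      then show ?case using pos[of x] by auto
    qed
    then have "ball 0 \<epsilon> \<in> null_sets (lebesgue :: (real^'n) measure)" by (subst AE_iff_null_sets) auto
    then have "measure lebesgue (ball (0::real^'n) \<epsilon>) = 0" by (simp add: null_sets_def measure_def)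
    then show False using assms by simp
  qed
  moreover have "integral\<^sup>L lebesgue b \<ge> 0" using nn by simp
  ultimately have I: "integral\<^sup>L lebesgue b > 0" by simp
  have "mollifier \<epsilon> (\<lambda>x. (1 / integral\<^sup>L lebesgue b) * b x)"
    unfolding mollifier_def using z nn I test_fun_cmult[OF tb, of "1 / integral\<^sup>L lebesgue b"] by auto
  then show ?thesis by blast
qed

lemma lborel_distr_reflect: "distr lborel borel (\<lambda>y. x - y) = (lborel :: (real^'n) measure)"
proof -
  have "lborel = density (distr lborel borel (\<lambda>y. x + (-1) *\<^sub>R y)) (\<lambda>_. \<bar>-1::real\<bar>^DIM(real^'n))"
    by (rule lborel_affine) simp
  then show ?thesis by (simp add: density_1)
qed

lemma nn_integral_translate:
  fixes x :: "real^'n"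
  assumes [measurable]: "g \<in> borel_measurable borel"
  shows "(\<integral>\<^sup>+y. g (y - x) \<partial>lborel) = (\<integral>\<^sup>+y. g y \<partial>lborel)"
proof -
  have "(\<integral>\<^sup>+y. g y \<partial>lborel) = (\<integral>\<^sup>+y. g (- x + y) \<partial>lborel)"
    by (subst lborel_distr_plus[of "-x", symmetric], subst nn_integral_distr) auto
  then show ?thesis by (simp add: add.commute[of "-x"])
qed

lemma integral_reflect:
  fixes x :: "real^'n" and g :: "real^'n \<Rightarrow> real"
  assumes [measurable]: "g \<in> borel_measurable borel"
  shows "(LINT y|lebesgue. g (x - y)) = (LINT y|lebesgue. g y)"
proof -
  have "(LINT y|lborel. g y) = (LINT y|lborel. g (x - y))"
    by (subst lborel_distr_reflect[of x, symmetric], subst integral_distr) auto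
  then show ?thesis by (simp add: integral_completion)
qed

lemma mollifierD:
  assumes "mollifier \<epsilon> \<eta>"
  shows "test_fun \<eta>" "0 \<le> \<eta> x" "\<epsilon> \<le> norm x \<Longrightarrow> \<eta> x = 0" "integral\<^sup>L lebesgue \<eta> = 1" "continuous_on UNIV \<eta>"
    "\<eta> \<in> borel_measurable borel"
  using assms test_fun_continuous[of \<eta> UNIV] by (auto simp: mollifier_def intro: borel_measurable_continuous_onI)

lemma mollifier_integral:
  fixes \<eta> :: "real^'n \<Rightarrow> real"
  assumes "mollifier \<epsilon> \<eta>" 
  shows "(LINT y|lebesgue. \<eta> (x - y)) = 1" "integrable lebesgue (\<lambda>y. \<eta> (x - y))"
  using integral_reflect[OF mollifierD(6)[OF assms], of x] mollifierD(4)[OF assms]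
    test_fun_integrable[OF test_fun_reflect[OF mollifierD(1)[OF assms]]] by auto

lemma mollifier_nn_integral:
  fixes \<eta> :: "real^'n \<Rightarrow> real"
  assumes "mollifier \<epsilon> \<eta>" 
  shows "(\<integral>\<^sup>+x. ennreal (\<eta> (x - y)) \<partial>lborel) = 1"
proof -
  note m = mollifierD[OF assms]
  have i: "integrable lborel \<eta>" using test_fun_integrable[OF m(1)] m(6) by (simp add: integrable_completion)
  have "(\<integral>\<^sup>+x. ennreal (\<eta> (x - y)) \<partial>lborel) = (\<integral>\<^sup>+x. ennreal (\<eta> x) \<partial>lborel)"
    using m(6) by (intro nn_integral_translate) simp
  also have "\<dots> = ennreal (integral\<^sup>L lborel \<eta>)" using i m(2) by (intro nn_integral_eq_integral) auto
  also have "integral\<^sup>L lborel \<eta> = 1" using m(4,6) by (simp add: integral_completion)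
  finally show ?thesis by simp
qed

section \<open>Convolution with a test function and integration by parts\<close>

definition conv :: "(real^'n \<Rightarrow> real) \<Rightarrow> (real^'n \<Rightarrow> real) \<Rightarrow> real^'n \<Rightarrow> real" where
  "conv f \<phi> x = (LINT y|lebesgue. f y * \<phi> (x - y))"

lemma test_fun_bounded:
  assumes "test_fun f" obtains B where "B > 0" "\<And>x. \<bar>f x\<bar> \<le> B"
proof -
  obtain R where R: "R > 0" "\<And>x. norm x > R \<Longrightarrow> f x = 0" using test_fun_support[OF assms] by blast
  have "bounded (f ` cball 0 R)"
    by (intro compact_imp_bounded compact_continuous_image test_fun_continuous assms) auto
  then obtain B where B: "B > 0" "\<And>x. x \<in> cball 0 R \<Longrightarrow> \<bar>f x\<bar> \<le> B" by (auto simp: bounded_pos)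
  have "\<bar>f x\<bar> \<le> B" for x using B R(2)[of x] by (cases "x \<in> cball 0 R") auto
  with B(1) that show ?thesis by blast
qed

lemma borel_measurable_lebesgueI: "continuous_on UNIV f \<Longrightarrow> f \<in> borel_measurable lebesgue"
  by (simp add: borel_measurable_continuous_onI measurable_completion)

lemma norm_integral_le:
  fixes f :: "'a \<Rightarrow> real"
  assumes "integrable M f" "integrable M g" "\<And>x. norm (f x) \<le> g x"
  shows "norm (integral\<^sup>L M f) \<le> integral\<^sup>L M g"
proof -
  have "norm (integral\<^sup>L M f) \<le> (LINT x|M. norm (f x))" by (rule Bochner_Integration.integral_norm_bound)
  also have "\<dots> \<le> integral\<^sup>L M g" using assms by (intro integral_mono) auto
  finally show ?thesis .
qed

lemma integrable_mult_bounded: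
  fixes f \<phi> :: "'a \<Rightarrow> real"
  assumes "integrable M f" "\<phi> \<in> borel_measurable M" "\<And>x. \<bar>\<phi> x\<bar> \<le> B"
  shows "integrable M (\<lambda>x. f x * \<phi> x)"
proof (rule Bochner_Integration.integrable_bound[where f="\<lambda>x. B * f x"])
  show "AE x in M. norm (f x * \<phi> x) \<le> norm (B * f x)"
  proof (rule AE_I2)
    fix x
    have "\<bar>f x\<bar> * \<bar>\<phi> x\<bar> \<le> \<bar>f x\<bar> * \<bar>B\<bar>" using assms(3)[of x] by (intro mult_left_mono) auto
    then show "norm (f x * \<phi> x) \<le> norm (B * f x)" by (simp add: abs_mult mult.commute)
  qed
qed (use assms in auto)

lemma integrable_mult_test:
  assumes "integrable lebesgue f" "test_fun \<phi>"
  shows "integrable lebesgue (\<lambda>y. f y * \<phi> y)"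
proof -
  obtain B where "\<And>x. \<bar>\<phi> x\<bar> \<le> B" using test_fun_bounded[OF assms(2)] by blast
  then show ?thesis using assms
    by (intro integrable_mult_bounded borel_measurable_lebesgueI test_fun_continuous)
qed

text \<open>The remainder is uniform in the base point because the gradient is uniformly continuous
  on a ball, and beyond that ball all terms vanish. This uniformity permits differentiation under
  the convolution integral.\<close>

lemma test_fun_taylor:
  fixes \<phi> :: "real^'n \<Rightarrow> real"
  assumes "test_fun \<phi>" "0 < e"
  shows "\<exists>d>0. \<forall>z h. norm h < d \<longrightarrow> \<bar>\<phi> (z + h) - \<phi> z - grad \<phi> z \<bullet> h\<bar> \<le> e * norm h"
proof -
  obtain R where R: "R > 0" "\<And>x. norm x > R \<Longrightarrow> \<phi> x = 0" using test_fun_support[OF assms(1)] by blast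
  have "uniformly_continuous_on (cball 0 (R+2)) (grad \<phi>)"
    by (intro compact_uniformly_continuous continuous_grad assms) auto
  then have "\<exists>d>0. \<forall>x\<in>cball 0 (R+2). \<forall>y\<in>cball 0 (R+2). dist y x < d \<longrightarrow> dist (grad \<phi> y) (grad \<phi> x) < e"
    using assms(2) by (simp only: uniformly_continuous_on_def)
  then obtain d where d0: "d > 0" and d: "\<forall>x\<in>cball 0 (R+2). \<forall>y\<in>cball 0 (R+2). dist y x < d \<longrightarrow> dist (grad \<phi> y) (grad \<phi> x) < e"
    by blast
  have "\<bar>\<phi> (z + h) - \<phi> z - grad \<phi> z \<bullet> h\<bar> \<le> e * norm h" if h: "norm h < min d 1" for z h
  proof (cases "norm z \<le> R + 1")
    case False
    have "norm (z + h) > R" using False h norm_diff_ineq[of z h] by simp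
    moreover have "grad \<phi> z = 0" using False partial_zero_outside[of R \<phi> z] R(2) by (simp add: grad_def vec_eq_iff)
    ultimately show ?thesis using False R(2)[of "z+h"] R(2)[of z] assms(2) by simp
  next
    case True
    have "norm (\<phi> (z+h) - \<phi> z - grad \<phi> z \<bullet> (z + h - z)) \<le> norm (z + h - z) * e"
    proof (rule differentiable_bound_linearization[where f=\<phi> and a=z and b="z+h" and ?x0.0=z and B=e and S="ball z (min d 1)" and f'="\<lambda>x h. grad \<phi> x \<bullet> h"])
      fix t :: real assume "t \<in> {0..1}"
      then have "t * norm h \<le> 1 * norm h" by (intro mult_right_mono) auto
      then show "z + t *\<^sub>R (z + h - z) \<in> ball z (min d 1)" using h \<open>t \<in> _\<close> by (simp add: dist_norm)
    next
      fix x assume "x \<in> ball z (min d 1)"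
      show "(\<phi> has_derivative (\<bullet>) (grad \<phi> x)) (at x within ball z (min d 1))"
        by (rule has_derivative_at_withinI[OF has_derivative_grad[OF test_fun_differentiable[OF assms(1)]]])
    next
      fix x assume x: "x \<in> ball z (min d 1)"
      have "norm x \<le> R + 2" using x True norm_triangle_ineq2[of x z] by (simp add: dist_norm norm_minus_commute)
      then have *: "norm (grad \<phi> x - grad \<phi> z) \<le> e" using d[THEN bspec, of z, THEN bspec, of x] x True by (simp add: dist_norm norm_minus_commute)
      have "(\<bullet>) (grad \<phi> x) - (\<bullet>) (grad \<phi> z) = (\<lambda>h. (grad \<phi> x - grad \<phi> z) \<bullet> h)"
        by (simp add: fun_eq_iff inner_diff_left)
      moreover have "onorm (\<lambda>h. (grad \<phi> x - grad \<phi> z) \<bullet> h) \<le> norm (grad \<phi> x - grad \<phi> z)"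
        by (rule onorm_le) (simp add: Cauchy_Schwarz_ineq2)
      ultimately show "onorm ((\<bullet>) (grad \<phi> x) - (\<bullet>) (grad \<phi> z)) \<le> e" using * by simp
    qed (use d0 in auto)
    then show ?thesis by (simp add: mult.commute)
  qed
  then show ?thesis using d0 by (intro exI[of _ "min d 1"]) auto
qed

text \<open>All regularity comes from the kernel: its uniform Taylor remainder is integrated against
  \<open>\<bar>f y\<bar>\<close>. Dividing by \<open>N + 1\<close> is safe even if \<open>f\<close>
  vanishes almost everywhere.\<close>

lemma conv_has_derivative:
  fixes f \<phi> :: "real^'n \<Rightarrow> real"
  assumes f: "integrable lebesgue f" and \<phi>: "test_fun \<phi>"
  shows "(conv f \<phi> has_derivative (\<lambda>h. (\<chi> i. conv f (partial i \<phi>) x) \<bullet> h)) (at x)"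
  unfolding has_derivative_at_alt
proof (intro conjI allI impI)
  show "bounded_linear ((\<bullet>) (\<chi> i. conv f (partial i \<phi>) x))" by (rule bounded_linear_inner_right)
  fix e :: real assume e: "0 < e"
  define N where "N = (LINT y|lebesgue. \<bar>f y\<bar>)"
  have N: "N \<ge> 0" by (simp add: N_def)
  obtain d where d: "d > 0" "\<And>z h. norm h < d \<Longrightarrow> \<bar>\<phi> (z + h) - \<phi> z - grad \<phi> z \<bullet> h\<bar> \<le> e / (N+1) * norm h"
    using test_fun_taylor[OF \<phi>, of "e / (N+1)"] e N by auto
  have i: "integrable lebesgue (\<lambda>y. f y * \<psi> (u - y))" if "test_fun \<psi>" for \<psi> :: "real^'n \<Rightarrow> real" and u
    using integrable_mult_test[OF f test_fun_reflect[OF that]] .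
  show "\<exists>d>0. \<forall>y. norm (y - x) < d \<longrightarrow>
          norm (conv f \<phi> y - conv f \<phi> x - (\<chi> i. conv f (partial i \<phi>) x) \<bullet> (y - x)) \<le> e * norm (y - x)"
  proof (intro exI[of _ d] conjI allI impI d(1))
    fix w assume w: "norm (w - x) < d"
    define h where "h = w - x"
    have "(\<chi> i. conv f (partial i \<phi>) x) \<bullet> h = (\<Sum>i\<in>UNIV. conv f (partial i \<phi>) x * h $ i)"
      by (simp add: inner_vec_def)
    also have "\<dots> = (LINT y|lebesgue. (\<Sum>i\<in>UNIV. (f y * partial i \<phi> (x - y)) * h $ i))"
      unfolding conv_def by (subst Bochner_Integration.integral_sum) (auto intro!: integrable_mult_left i test_fun_partial \<phi>)
    also have "\<dots> = (LINT y|lebesgue. f y * (grad \<phi> (x - y) \<bullet> h))"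
      by (simp add: inner_vec_def grad_def sum_distrib_left mult.assoc)
    finally have 1: "(\<chi> i. conv f (partial i \<phi>) x) \<bullet> h = (LINT y|lebesgue. f y * (grad \<phi> (x - y) \<bullet> h))" .
    have i2: "integrable lebesgue (\<lambda>y. f y * (grad \<phi> (x - y) \<bullet> h))"
    proof -
      have "integrable lebesgue (\<lambda>y. \<Sum>i\<in>UNIV. (f y * partial i \<phi> (x - y)) * h $ i)"
        by (intro Bochner_Integration.integrable_sum integrable_mult_left i test_fun_partial \<phi>)
      then show ?thesis by (simp add: inner_vec_def grad_def sum_distrib_left mult.assoc)
    qed
    have "conv f \<phi> w - conv f \<phi> x - (\<chi> i. conv f (partial i \<phi>) x) \<bullet> h =
      (LINT y|lebesgue. f y * \<phi> (w - y) - f y * \<phi> (x - y) - f y * (grad \<phi> (x - y) \<bullet> h))"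
      unfolding 1 by (simp add: conv_def i[OF \<phi>] i2)
    also have "norm \<dots> \<le> (LINT y|lebesgue. \<bar>f y\<bar> * (e / (N+1) * norm h))"
    proof (rule norm_integral_le)
      show "integrable lebesgue (\<lambda>y. f y * \<phi> (w - y) - f y * \<phi> (x - y) - f y * (grad \<phi> (x - y) \<bullet> h))"
        using i[OF \<phi>] i2 by auto
      show "integrable lebesgue (\<lambda>y. \<bar>f y\<bar> * (e / (N+1) * norm h))" using f by auto
      fix y
      have "f y * \<phi> (w - y) - f y * \<phi> (x - y) - f y * (grad \<phi> (x - y) \<bullet> h) =
        f y * (\<phi> ((x - y) + h) - \<phi> (x - y) - grad \<phi> (x - y) \<bullet> h)"
        by (simp add: h_def algebra_simps)
      then have "norm (f y * \<phi> (w - y) - f y * \<phi> (x - y) - f y * (grad \<phi> (x - y) \<bullet> h)) =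
          \<bar>f y\<bar> * \<bar>\<phi> ((x - y) + h) - \<phi> (x - y) - grad \<phi> (x - y) \<bullet> h\<bar>" by (simp only: real_norm_def abs_mult)
      also have "\<dots> \<le> \<bar>f y\<bar> * (e / (N+1) * norm h)" using w by (intro mult_left_mono d(2)) (auto simp: h_def)
      finally show "norm (f y * \<phi> (w - y) - f y * \<phi> (x - y) - f y * (grad \<phi> (x - y) \<bullet> h)) \<le> \<bar>f y\<bar> * (e / (N+1) * norm h)" .
    qed
    also have "\<dots> = N * (e / (N+1)) * norm h" by (simp add: N_def)
    also have "\<dots> \<le> e * norm h"
      using e N by (intro mult_right_mono) (auto simp: field_simps)
    finally show "norm (conv f \<phi> w - conv f \<phi> x - (\<chi> i. conv f (partial i \<phi>) x) \<bullet> (w - x)) \<le> e * norm (w - x)"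
      by (simp add: h_def)
  qed
qed

lemma partial_conv:
  assumes "integrable lebesgue f" "test_fun \<phi>"
  shows "partial i (conv f \<phi>) = conv f (partial i \<phi>)"
  by (rule ext, subst partial_eqI[OF conv_has_derivative[OF assms]]) (simp add: inner_axis)

lemma C_k_conv:
  assumes "integrable lebesgue f" "test_fun \<phi>" shows "C_k k (conv f \<phi>)"
  using assms(2)
proof (induction k arbitrary: \<phi>)
  case 0
  have "conv f \<phi> differentiable (at x)" for x using conv_has_derivative[OF assms(1) 0] unfolding differentiable_def by blast
  then show ?case by (auto simp: continuous_on_eq_continuous_at intro: differentiable_imp_continuous_within)
next
  case (Suc k)
  have "conv f \<phi> differentiable (at x)" for x using conv_has_derivative[OF assms(1) Suc.prems] unfolding differentiable_def by blast
  then show ?case using Suc by (simp add: partial_conv[OF assms(1)] test_fun_partial)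
qed

lemma conv_zero_outside:
  assumes "\<And>y. norm y > R \<Longrightarrow> f y = 0" "\<And>y. norm y > S \<Longrightarrow> \<phi> y = 0" "norm x > R + S"
  shows "conv f \<phi> x = 0"
proof -
  have "f y * \<phi> (x - y) = 0" for y
  proof (cases "norm y > R")
    case False
    then have "norm (x - y) > S" using assms(3) norm_triangle_ineq2[of x y] by simp
    then show ?thesis using assms(2) by simp
  qed (use assms in auto)
  then have "(\<lambda>y. f y * \<phi> (x - y)) = (\<lambda>y. 0)" by blast
  then show ?thesis by (simp add: conv_def)
qed

lemma test_fun_conv:
  assumes "integrable lebesgue f" "\<And>y. norm y > R \<Longrightarrow> f y = 0" "test_fun \<phi>"
  shows "test_fun (conv f \<phi>)"
proof -
  obtain S where S: "\<And>x. norm x > S \<Longrightarrow> \<phi> x = 0" using test_fun_support[OF assms(3)] by blast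
  show ?thesis
    by (rule test_funI[where R="R+S"]) (use C_k_conv[OF assms(1,3)] conv_zero_outside[OF assms(2) S] in auto)
qed

text \<open>Convolving the indicator of a large ball with \<open>\<phi>\<close> gives a function
  that near the origin is constantly the integral of \<open>\<phi>\<close>. Its partial derivative
  there is 0, and it is also the integral of \<open>partial i \<phi>\<close>. This takes the place
  of iterated one-dimensional integration.\<close>

lemma integral_partial_zero:
  fixes \<phi> :: "real^'n \<Rightarrow> real"
  assumes "test_fun \<phi>" shows "(LINT x|lebesgue. partial i \<phi> x) = 0"
proof -
  obtain R where R: "R > 0" "\<And>x. norm x > R \<Longrightarrow> \<phi> x = 0" using test_fun_support[OF assms] by blast
  \<comment> \<open>With radius \<open>R + 1\<close> the ball contains the support of
    \<open>\<lambda>y. \<phi> (x - y)\<close> for every \<open>x\<close> of norm below 1.\<close>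
  let ?f = "indicator (ball (0::real^'n) (R+1)) :: _ \<Rightarrow> real"
  have f: "integrable lebesgue ?f"
    using lmeasurable_ball[of "0::real^'n" "R+1"] by (auto simp: fmeasurable_def)
  have c: "conv ?f \<psi> x = (LINT y|lebesgue. \<psi> y)" if "norm x < 1" "test_fun \<psi>" "\<And>x. norm x > R \<Longrightarrow> \<psi> x = 0" for x \<psi>
  proof -
    have "?f y * \<psi> (x - y) = \<psi> (x - y)" for y
    proof (cases "norm y < R + 1")
      case False
      then have "norm (x - y) > R" using that(1) norm_triangle_ineq2[of y x] by (simp add: norm_minus_commute)
      then show ?thesis using that(3) by simp
    qed simp
    then have "(\<lambda>y. ?f y * \<psi> (x - y)) = (\<lambda>y. \<psi> (x - y))" by blast
    then show ?thesis using integral_reflect[of \<psi> x] test_fun_continuous[OF that(2), of UNIV]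
      by (simp add: conv_def borel_measurable_continuous_onI)
  qed
  have "((\<lambda>x. LINT y|lebesgue. \<phi> y) has_derivative (\<lambda>h. 0)) (at 0)" by simp
  then have "(conv ?f \<phi> has_derivative (\<lambda>h. 0)) (at 0)"
    by (rule has_derivative_transform_within_open[of _ _ _ _ "ball 0 1"]) (use c[OF _ assms R(2)] in auto)
  then have "0 = partial i (conv ?f \<phi>) 0" using partial_eqI by force
  also have "\<dots> = conv ?f (partial i \<phi>) 0" by (simp add: partial_conv[OF f assms])
  also have "\<dots> = (LINT x|lebesgue. partial i \<phi> x)"
    by (rule c) (use test_fun_partial[OF assms] partial_zero_outside[where f=\<phi>, OF R(2)] in auto)
  finally show ?thesis by simp
qed

lemma integration_by_parts:
  fixes \<phi> \<theta> :: "real^'n \<Rightarrow> real"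
  assumes "test_fun \<phi>" "test_fun \<theta>"
  shows "(LINT x|lebesgue. \<phi> x * partial i \<theta> x) = - (LINT x|lebesgue. partial i \<phi> x * \<theta> x)"
proof -
  have "0 = (LINT x|lebesgue. partial i (\<lambda>x. \<phi> x * \<theta> x) x)"
    using integral_partial_zero[OF test_fun_mult[OF assms]] by simp
  also have "\<dots> = (LINT x|lebesgue. \<phi> x * partial i \<theta> x + partial i \<phi> x * \<theta> x)"
    by (simp add: partial_mult test_fun_differentiable assms)
  also have "\<dots> = (LINT x|lebesgue. \<phi> x * partial i \<theta> x) + (LINT x|lebesgue. partial i \<phi> x * \<theta> x)"
    by (intro Bochner_Integration.integral_add test_fun_integrable test_fun_mult test_fun_partial assms)
  finally show ?thesis by simp
qed

section \<open>Mollification estimates, uniform and in L2\<close>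

lemma mollify_le:
  fixes f \<eta> :: "real^'n \<Rightarrow> real"
  assumes m: "mollifier \<epsilon> \<eta>" and i: "integrable lebesgue (\<lambda>y. f y * \<eta> (x - y))"
    and b: "\<And>y. dist x y < \<epsilon> \<Longrightarrow> \<bar>f y - c\<bar> \<le> B"
  shows "\<bar>conv f \<eta> x - c\<bar> \<le> B"
proof -
  note I = mollifier_integral[OF m, of x]
  have "conv f \<eta> x - c = (LINT y|lebesgue. f y * \<eta> (x - y)) - (LINT y|lebesgue. c * \<eta> (x - y))"
    using I by (simp add: conv_def)
  also have "\<dots> = (LINT y|lebesgue. f y * \<eta> (x - y) - c * \<eta> (x - y))"
    using i I by (intro Bochner_Integration.integral_diff[symmetric]) auto
  also have "norm \<dots> \<le> (LINT y|lebesgue. B * \<eta> (x - y))"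
  proof (rule norm_integral_le)
    show "integrable lebesgue (\<lambda>y. f y * \<eta> (x - y) - c * \<eta> (x - y))" using i I by auto
    show "integrable lebesgue (\<lambda>y. B * \<eta> (x - y))" using I by auto
    fix y
    show "norm (f y * \<eta> (x - y) - c * \<eta> (x - y)) \<le> B * \<eta> (x - y)"
    proof (cases "dist x y < \<epsilon>")
      case True
      then show ?thesis using b[OF True] mollifierD(2)[OF m, of "x - y"]
        by (simp add: left_diff_distrib[symmetric] abs_mult mult_right_mono)
    next
      case False
      then show ?thesis using mollifierD(3)[OF m, of "x - y"] by (simp add: dist_norm)
    qed
  qed
  also have "\<dots> = B" using I by simp
  finally show ?thesis by simp
qed

text \<open>Tonelli's theorem needs joint measurability for the product of the Borel measures, which
  a merely Lebesgue measurable \<open>f\<close> does not give. A Borel function equal to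
  \<open>f\<close> almost everywhere is inserted for the exchange and removed afterwards.\<close>

lemma nn_integral_kernel_swap:
  fixes f :: "real^'n \<Rightarrow> ennreal" and k :: "real^'n \<Rightarrow> real^'n \<Rightarrow> ennreal"
  assumes f: "f \<in> borel_measurable lebesgue" and k: "case_prod k \<in> borel_measurable borel"
  shows "(\<integral>\<^sup>+x. \<integral>\<^sup>+y. f y * k x y \<partial>lborel \<partial>lborel) = (\<integral>\<^sup>+y. f y * (\<integral>\<^sup>+x. k x y \<partial>lborel) \<partial>lborel)"
proof -
  obtain f' where f'[measurable]: "f' \<in> borel_measurable lborel" and eq: "AE y in lborel. f y = f' y"
    using completion_ex_borel_measurable[OF f] by blast
  have [measurable]: "case_prod k \<in> borel_measurable (lborel \<Otimes>\<^sub>M lborel)"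
    using k by (simp add: borel_prod[symmetric] cong: measurable_cong_sets)
  have "(\<integral>\<^sup>+x. \<integral>\<^sup>+y. f y * k x y \<partial>lborel \<partial>lborel) = (\<integral>\<^sup>+x. \<integral>\<^sup>+y. f' y * k x y \<partial>lborel \<partial>lborel)"
  proof (rule nn_integral_cong)
    show "(\<integral>\<^sup>+y. f y * k x y \<partial>lborel) = (\<integral>\<^sup>+y. f' y * k x y \<partial>lborel)" for x
      using eq by (intro nn_integral_cong_AE) auto
  qed
  also have "\<dots> = (\<integral>\<^sup>+y. \<integral>\<^sup>+x. f' y * k x y \<partial>lborel \<partial>lborel)"
    by (rule lborel_pair.Fubini'[symmetric]) measurable
  also have "\<dots> = (\<integral>\<^sup>+y. f' y * (\<integral>\<^sup>+x. k x y \<partial>lborel) \<partial>lborel)"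
    by (intro nn_integral_cong nn_integral_cmult) measurable
  also have "\<dots> = (\<integral>\<^sup>+y. f y * (\<integral>\<^sup>+x. k x y \<partial>lborel) \<partial>lborel)"
    using eq by (intro nn_integral_cong_AE) auto
  finally show ?thesis .
qed

text \<open>\<open>measurable_on\<close> already provides continuous functions converging almost everywhere; they only have
  to be truncated.\<close>

lemma ae_limit_continuous:
  fixes s :: "real^'n \<Rightarrow> real"
  assumes s: "s \<in> borel_measurable lebesgue" and M: "0 \<le> M" "\<And>x. \<bar>s x\<bar> \<le> M" and R: "\<And>x. norm x > R \<Longrightarrow> s x = 0"
  obtains g :: "nat \<Rightarrow> real^'n \<Rightarrow> real" where "\<And>n. continuous_on UNIV (g n)" "\<And>n x. \<bar>g n x\<bar> \<le> M"
    "\<And>n x. norm x > R + 1 \<Longrightarrow> g n x = 0" "AE x in lebesgue. (\<lambda>n. g n x) \<longlonglongrightarrow> s x"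
proof -
  have "s measurable_on UNIV" using s by (subst measurable_on_iff_borel_measurable) auto
  then obtain N g where N: "negligible N" and g: "\<And>n. continuous_on UNIV (g n)" "\<And>x. x \<notin> N \<Longrightarrow> (\<lambda>n. g n x) \<longlonglongrightarrow> s x"
    by (auto simp: measurable_on_def)
  define cut where "cut x = max 0 (min 1 (R + 1 - norm x))" for x :: "real^'n"
  define h where "h n x = cut x * max (-M) (min M (g n x))" for n x
  have "continuous_on UNIV (h n)" for n
    unfolding h_def cut_def by (intro continuous_intros g)
  moreover have "\<bar>h n x\<bar> \<le> M" for n x
  proof -
    have "\<bar>h n x\<bar> = \<bar>cut x\<bar> * \<bar>max (-M) (min M (g n x))\<bar>" by (simp add: h_def abs_mult)
    also have "\<dots> \<le> 1 * M" using M(1) by (intro mult_mono) (auto simp: cut_def)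
    finally show ?thesis by simp
  qed
  moreover have "h n x = 0" if "norm x > R + 1" for n x using that by (simp add: h_def cut_def)
  moreover have "AE x in lebesgue. (\<lambda>n. h n x) \<longlonglongrightarrow> s x"
  proof -
    have "AE x in lebesgue. x \<notin> N" using N by (intro AE_not_in) (simp add: negligible_iff_null_sets)
    then show ?thesis
    proof eventually_elim
      case (elim x)
      have "(\<lambda>n. h n x) \<longlonglongrightarrow> cut x * max (-M) (min M (s x))"
        unfolding h_def by (intro tendsto_intros tendsto_max tendsto_min g(2) elim)
      moreover have "cut x * max (-M) (min M (s x)) = s x"
      proof (cases "norm x > R")
        case True then show ?thesis using R[OF True] M(1) by simp
      next
        case False then show ?thesis using M(2)[of x] by (auto simp: cut_def abs_le_iff min_def max_def)
      qed
      ultimately show ?case by simp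
    qed
  qed
  ultimately show ?thesis using that by blast
qed

lemma uniformly_continuous_zero_outside:
  fixes g :: "real^'n \<Rightarrow> real"
  assumes g: "continuous_on UNIV g" and R: "\<And>x. norm x > R \<Longrightarrow> g x = 0" and e: "0 < e"
  shows "\<exists>d>0. \<forall>x y. dist x y < d \<longrightarrow> \<bar>g y - g x\<bar> < e"
proof -
  have "uniformly_continuous_on (cball 0 (R+2)) g"
    by (intro compact_uniformly_continuous continuous_on_subset[OF g]) auto
  then have "\<exists>d>0. \<forall>x\<in>cball 0 (R+2). \<forall>y\<in>cball 0 (R+2). dist y x < d \<longrightarrow> dist (g y) (g x) < e"
    using e by (simp only: uniformly_continuous_on_def)
  then obtain d where d: "d > 0" "\<forall>x\<in>cball 0 (R+2). \<forall>y\<in>cball 0 (R+2). dist y x < d \<longrightarrow> dist (g y) (g x) < e"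
    by blast
  have "\<bar>g y - g x\<bar> < e" if xy: "dist x y < min d 1" for x y
  proof (cases "norm x \<le> R + 1")
    case True
    have "norm y \<le> R + 2" using True xy norm_triangle_ineq2[of y x] by (simp add: dist_norm norm_minus_commute)
    then show ?thesis using d(2)[THEN bspec, of x, THEN bspec, of y] True xy by (simp add: dist_real_def dist_commute)
  next
    case False
    then have "norm y > R" using xy norm_triangle_ineq2[of x y] by (simp add: dist_norm)
    then show ?thesis using False R[of x] R[of y] e by simp
  qed
  then show ?thesis using d(1) by (intro exI[of _ "min d 1"]) auto
qed

lemma mollify_continuous_product:
  fixes g :: "real^'n \<Rightarrow> real"
  assumes "mollifier \<epsilon> \<eta>" "continuous_on UNIV g"
  shows "integrable lebesgue (\<lambda>y. g y * \<eta> (x - y))"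
proof -
  have t: "test_fun (\<lambda>y. \<eta> (x - y))" by (rule test_fun_reflect[OF mollifierD(1)[OF assms(1)]])
  obtain R where R: "\<And>y. norm y > R \<Longrightarrow> \<eta> (x - y) = 0" using test_fun_support[OF t] by blast
  show ?thesis
    by (rule continuous_zero_outside_integrable[where R=R])
       (use R in \<open>auto intro!: continuous_on_mult assms(2) test_fun_continuous[OF t]\<close>)
qed

lemma mollify_uniform:
  fixes g :: "real^'n \<Rightarrow> real"
  assumes g: "continuous_on UNIV g" and R: "\<And>x. norm x > R \<Longrightarrow> g x = 0" and e: "0 < e"
  shows "\<exists>d>0. \<forall>\<epsilon> \<eta> x. \<epsilon> \<le> d \<longrightarrow> mollifier \<epsilon> \<eta> \<longrightarrow> \<bar>conv g \<eta> x - g x\<bar> \<le> e"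
proof -
  obtain d where d: "d > 0" "\<And>x y. dist x y < d \<Longrightarrow> \<bar>g y - g x\<bar> < e"
    using uniformly_continuous_zero_outside[OF assms] by blast
  have "\<bar>conv g \<eta> x - g x\<bar> \<le> e" if "\<epsilon> \<le> d" "mollifier \<epsilon> \<eta>" for \<epsilon> \<eta> x
    using mollify_continuous_product[OF that(2) g] 
    by (rule mollify_le[OF that(2)]) (use that(1) in \<open>auto intro!: less_imp_le[OF d(2)]\<close>)
  with d(1) show ?thesis by blast
qed

lemma integrable_L2_zero_outside:
  fixes f :: "real^'n \<Rightarrow> real"
  assumes "f \<in> borel_measurable lebesgue" "integrable lebesgue (\<lambda>x. (f x)\<^sup>2)" "\<And>x. norm x > R \<Longrightarrow> f x = 0"
  shows "integrable lebesgue f"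
proof (rule Bochner_Integration.integrable_bound)
  have "integrable lebesgue (indicator (cball (0::real^'n) R) :: _ \<Rightarrow> real)"
    using lmeasurable_cball[of "0::real^'n" R] by (auto simp: fmeasurable_def)
  then show "integrable lebesgue (\<lambda>x. indicator (cball 0 R) x + (f x)\<^sup>2)"
    using assms(2) by (rule Bochner_Integration.integrable_add)
  have "\<bar>f x\<bar> \<le> indicator (cball 0 R) x + (f x)\<^sup>2" for x
  proof (cases "norm x > R")
    case False
    have "\<bar>f x\<bar> \<le> 1 + (f x)\<^sup>2" using zero_le_power2[of "\<bar>f x\<bar> - 1/2"] by (simp add: power2_diff power_divide) 
    then show ?thesis using False by simp
  qed (use assms in auto)
  then show "AE x in lebesgue. norm (f x) \<le> norm (indicator (cball 0 R) x + (f x)\<^sup>2)"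
    by (intro AE_I2) (auto simp: abs_of_nonneg)
qed (use assms in auto)

text \<open>Jensen's inequality for the probability kernel, read off from the nonnegative variance
  of \<open>f\<close> around \<open>conv f \<eta> x\<close>, followed by an exchange of the
  integrations.\<close>

lemma mollify_L2_le:
  fixes f :: "real^'n \<Rightarrow> real"
  assumes m: "mollifier \<epsilon> \<eta>" and f: "integrable lebesgue f" "integrable lebesgue (\<lambda>x. (f x)\<^sup>2)"
  shows "(\<integral>\<^sup>+x. ennreal ((conv f \<eta> x)\<^sup>2) \<partial>lborel) \<le> (\<integral>\<^sup>+x. ennreal ((f x)\<^sup>2) \<partial>lborel)"
proof -
  note t = test_fun_reflect[OF mollifierD(1)[OF m]]
  have fm[measurable]: "f \<in> borel_measurable lebesgue" using f(1) by auto
  have le: "ennreal ((conv f \<eta> x)\<^sup>2) \<le> (\<integral>\<^sup>+y. ennreal ((f y)\<^sup>2) * ennreal (\<eta> (x - y)) \<partial>lborel)" for x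
  proof -
    define c where "c = conv f \<eta> x"
    have i: "integrable lebesgue (\<lambda>y. f y * \<eta> (x - y))" "integrable lebesgue (\<lambda>y. (f y)\<^sup>2 * \<eta> (x - y))" "integrable lebesgue (\<lambda>y. \<eta> (x - y))"
      using f integrable_mult_test[OF _ t] mollifier_integral(2)[OF m] by auto
    have "0 \<le> (LINT y|lebesgue. (f y - c)\<^sup>2 * \<eta> (x - y))"
      using mollifierD(2)[OF m] by (intro integral_nonneg_AE AE_I2) auto
    also have "\<dots> = (LINT y|lebesgue. (f y)\<^sup>2 * \<eta> (x - y) - 2 * c * (f y * \<eta> (x - y)) + c\<^sup>2 * \<eta> (x - y))"
      by (intro Bochner_Integration.integral_cong) (auto simp: power2_diff algebra_simps)
    also have "\<dots> = (LINT y|lebesgue. (f y)\<^sup>2 * \<eta> (x - y)) - 2 * c * conv f \<eta> x + c\<^sup>2 * 1"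
      using i mollifier_integral(1)[OF m, of x] by (simp add: conv_def)
    also have "\<dots> = (LINT y|lebesgue. (f y)\<^sup>2 * \<eta> (x - y)) - c\<^sup>2" by (simp add: c_def power2_eq_square)
    finally have "ennreal (c\<^sup>2) \<le> ennreal (LINT y|lebesgue. (f y)\<^sup>2 * \<eta> (x - y))" by (intro ennreal_leI) simp
    also have "\<dots> = (\<integral>\<^sup>+y. ennreal ((f y)\<^sup>2 * \<eta> (x - y)) \<partial>lebesgue)"
      using i(2) mollifierD(2)[OF m] by (intro nn_integral_eq_integral[symmetric]) auto
    also have "\<dots> = (\<integral>\<^sup>+y. ennreal ((f y)\<^sup>2) * ennreal (\<eta> (x - y)) \<partial>lborel)"
      using mollifierD(2)[OF m] by (simp add: nn_integral_completion ennreal_mult)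
    finally show ?thesis by (simp add: c_def)
  qed
  have "(\<integral>\<^sup>+x. ennreal ((conv f \<eta> x)\<^sup>2) \<partial>lborel) \<le> (\<integral>\<^sup>+x. \<integral>\<^sup>+y. ennreal ((f y)\<^sup>2) * ennreal (\<eta> (x - y)) \<partial>lborel \<partial>lborel)"
    by (intro nn_integral_mono le)
  also have "\<dots> = (\<integral>\<^sup>+y. ennreal ((f y)\<^sup>2) * (\<integral>\<^sup>+x. ennreal (\<eta> (x - y)) \<partial>lborel) \<partial>lborel)"
  proof (rule nn_integral_kernel_swap)
    have "continuous_on UNIV (\<lambda>z :: (real^'n) \<times> (real^'n). \<eta> (fst z - snd z))"
      by (intro continuous_on_compose2[OF mollifierD(5)[OF m]] continuous_intros) auto
    from borel_measurable_continuous_onI[OF this]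
    show "(\<lambda>(x, y). ennreal (\<eta> (x - y))) \<in> borel_measurable borel" by (simp add: case_prod_beta')
  qed measurable
  also have "\<dots> = (\<integral>\<^sup>+x. ennreal ((f x)\<^sup>2) \<partial>lborel)" by (simp add: mollifier_nn_integral[OF m])
  finally show ?thesis .
qed

text \<open>Truncation comes first because it supplies the bound that dominates the almost
  everywhere convergence of continuous functions. Each of the two errors is below \<open>e/4\<close>
  and enters with a factor 2.\<close>

lemma L2_continuous_approx:
  fixes f :: "real^'n \<Rightarrow> real"
  assumes f: "f \<in> borel_measurable lebesgue" "integrable lebesgue (\<lambda>x. (f x)\<^sup>2)" "\<And>x. norm x > R \<Longrightarrow> f x = 0"
    and e: "0 < e"
  shows "\<exists>g. continuous_on UNIV g \<and> (\<forall>x. norm x > R + 1 \<longrightarrow> g x = 0) \<and> (LINT x|lebesgue. (f x - g x)\<^sup>2) < e"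
proof -
  define t where "t m x = max (- real m) (min (real m) (f x))" for m :: nat and x
  have tm[measurable]: "t m \<in> borel_measurable lebesgue" for m unfolding t_def using f(1) by measurable
  have "(\<lambda>m. LINT x|lebesgue. (f x - t m x)\<^sup>2) \<longlonglongrightarrow> (LINT x|(lebesgue :: (real^'n) measure). 0)"
  proof (rule integral_dominated_convergence[where w="\<lambda>x. (f x)\<^sup>2"])
    show "AE x in lebesgue. (\<lambda>m. (f x - t m x)\<^sup>2) \<longlonglongrightarrow> 0"
    proof (rule AE_I2)
      fix x
      obtain m0 :: nat where "\<bar>f x\<bar> \<le> m0" using real_arch_simple by blast
      then have "t m x = f x" if "m \<ge> m0" for m using that by (auto simp: t_def abs_le_iff min_def max_def)
      then have "eventually (\<lambda>m. (f x - t m x)\<^sup>2 = 0) sequentially"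
        by (intro eventually_sequentiallyI[of m0]) auto
      then show "(\<lambda>m. (f x - t m x)\<^sup>2) \<longlonglongrightarrow> 0" by (rule tendsto_eventually)
    qed
    show "AE x in lebesgue. norm ((f x - t m x)\<^sup>2) \<le> (f x)\<^sup>2" for m
    proof (rule AE_I2)
      fix x
      have "\<bar>f x - t m x\<bar> \<le> \<bar>f x\<bar>" by (auto simp: t_def min_def max_def)
      then show "norm ((f x - t m x)\<^sup>2) \<le> (f x)\<^sup>2" by (simp add: abs_le_square_iff)
    qed
  qed (use f in measurable)
  then have "eventually (\<lambda>m. (LINT x|lebesgue. (f x - t m x)\<^sup>2) < e/4) sequentially"
    using e by (intro order_tendstoD(2)) auto
  then obtain m where m: "(LINT x|lebesgue. (f x - t m x)\<^sup>2) < e/4" by (meson eventually_sequentially order_refl)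
  have tz: "t m x = 0" if "norm x > R" for x using f(3)[OF that] by (simp add: t_def)
  have tb: "\<bar>t m x\<bar> \<le> real m" for x by (auto simp: t_def)
  obtain g :: "nat \<Rightarrow> real^'n \<Rightarrow> real" where g: "\<And>n. continuous_on UNIV (g n)" "\<And>n x. \<bar>g n x\<bar> \<le> real m"
    "\<And>n x. norm x > R + 1 \<Longrightarrow> g n x = 0" "AE x in lebesgue. (\<lambda>n. g n x) \<longlonglongrightarrow> t m x"
    using ae_limit_continuous[OF tm of_nat_0_le_iff tb tz] by blast
  have gm[measurable]: "g n \<in> borel_measurable lebesgue" for n using borel_measurable_lebesgueI[OF g(1)] .
  have ind: "integrable lebesgue (\<lambda>x. (2 * real m)\<^sup>2 * indicator (cball (0::real^'n) (R+1)) x :: real)"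
    using lmeasurable_cball[of "0::real^'n" "R+1"] by (auto simp: fmeasurable_def)
  have dom: "(t m x - g n x)\<^sup>2 \<le> (2 * real m)\<^sup>2 * indicator (cball 0 (R+1)) x" for n x
  proof (cases "norm x > R + 1")
    case False
    have "\<bar>t m x - g n x\<bar> \<le> 2 * real m" using tb[of x] g(2)[of n x] by simp
    from power_mono[OF this abs_ge_zero, of 2] have "(t m x - g n x)\<^sup>2 \<le> (2 * real m)\<^sup>2" by simp
    then show ?thesis using False by simp
  qed (use g(3) tz in simp)
  have "(\<lambda>n. LINT x|lebesgue. (t m x - g n x)\<^sup>2) \<longlonglongrightarrow> (LINT x|(lebesgue :: (real^'n) measure). 0)"
  proof (rule integral_dominated_convergence[OF _ _ ind])
    show "AE x in lebesgue. (\<lambda>n. (t m x - g n x)\<^sup>2) \<longlonglongrightarrow> 0"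
      using g(4)
    proof eventually_elim
      case (elim x)
      then have "(\<lambda>n. (t m x - g n x)\<^sup>2) \<longlonglongrightarrow> (t m x - t m x)\<^sup>2" by (intro tendsto_intros)
      then show ?case by simp
    qed
  qed (use dom in \<open>auto intro!: AE_I2\<close>)
  then have "eventually (\<lambda>n. (LINT x|lebesgue. (t m x - g n x)\<^sup>2) < e/4) sequentially"
    using e by (intro order_tendstoD(2)) auto
  then obtain n where n: "(LINT x|lebesgue. (t m x - g n x)\<^sup>2) < e/4" by (meson eventually_sequentially order_refl)
  have i1: "integrable lebesgue (\<lambda>x. (f x - t m x)\<^sup>2)"
  proof (rule Bochner_Integration.integrable_bound[OF f(2)])
    show "AE x in lebesgue. norm ((f x - t m x)\<^sup>2) \<le> norm ((f x)\<^sup>2)"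
    proof (rule AE_I2)
      fix x
      have "\<bar>f x - t m x\<bar> \<le> \<bar>f x\<bar>" by (auto simp: t_def min_def max_def)
      then show "norm ((f x - t m x)\<^sup>2) \<le> norm ((f x)\<^sup>2)" by (simp add: abs_le_square_iff)
    qed
  qed (use f in measurable)
  have i2: "integrable lebesgue (\<lambda>x. (t m x - g n x)\<^sup>2)"
  proof (rule Bochner_Integration.integrable_bound[OF ind])
    have "norm (a\<^sup>2) \<le> norm b" if "a\<^sup>2 \<le> b" for a b :: real using that by simp
    from this[OF dom] show "AE x in lebesgue. norm ((t m x - g n x)\<^sup>2) \<le> norm ((2 * real m)\<^sup>2 * indicator (cball (0::real^'n) (R+1)) x :: real)"
      by (intro AE_I2)
  qed measurable
  have sq: "(f x - g n x)\<^sup>2 \<le> 2 * (f x - t m x)\<^sup>2 + 2 * (t m x - g n x)\<^sup>2" for x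
    using zero_le_power2[of "(f x - t m x) - (t m x - g n x)"] by (simp add: power2_eq_square algebra_simps)
  have "(LINT x|lebesgue. (f x - g n x)\<^sup>2) \<le> (LINT x|lebesgue. 2 * (f x - t m x)\<^sup>2 + 2 * (t m x - g n x)\<^sup>2)"
    using i1 i2 by (intro integral_mono' sq) auto
  also have "\<dots> = 2 * (LINT x|lebesgue. (f x - t m x)\<^sup>2) + 2 * (LINT x|lebesgue. (t m x - g n x)\<^sup>2)" using i1 i2 by simp
  also have "\<dots> < e" using m n by simp
  finally show ?thesis using g by blast
qed

lemma nn_integral_sum_indicator:
  assumes [measurable]: "A \<in> borel_measurable M" "B \<in> borel_measurable M" "S \<in> sets M"
  shows "(\<integral>\<^sup>+x. 3 * A x + 3 * B x + k * indicator S x \<partial>M) = 3 * (\<integral>\<^sup>+x. A x \<partial>M) + 3 * (\<integral>\<^sup>+x. B x \<partial>M) + k * emeasure M S"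
  by (simp add: nn_integral_add nn_integral_cmult nn_integral_cmult_indicator)

text \<open>With a continuous approximation \<open>g\<close>, the error splits into
  \<open>f - g\<close>, the mollification of \<open>f - g\<close>, which is no larger in L2, and the
  error of \<open>g\<close>, which is uniformly small on a fixed ball. Splitting the square costs a
  factor 3, so each squared error is kept below \<open>e/9\<close>.\<close>

lemma mollify_L2:
  fixes f :: "real^'n \<Rightarrow> real"
  assumes f: "f \<in> borel_measurable lebesgue" "integrable lebesgue (\<lambda>x. (f x)\<^sup>2)" "\<And>x. norm x > R \<Longrightarrow> f x = 0"
    and e: "0 < e"
  shows "\<exists>d>0. \<forall>\<epsilon> \<eta>. \<epsilon> \<le> d \<longrightarrow> mollifier \<epsilon> \<eta> \<longrightarrow> (\<integral>\<^sup>+x. ennreal ((f x - conv f \<eta> x)\<^sup>2) \<partial>lborel) \<le> ennreal e"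
proof -
  obtain g where g: "continuous_on UNIV g" "\<And>x. norm x > R + 1 \<Longrightarrow> g x = 0" "(LINT x|lebesgue. (f x - g x)\<^sup>2) < e/9"
    using L2_continuous_approx[OF f, where e="e/9"] e by auto
  define c where "c = measure lebesgue (cball (0::real^'n) (R+2))"
  have c: "c \<ge> 0" by (simp add: c_def)
  \<comment> \<open>A uniform error \<open>\<tau>\<close> on the ball of volume \<open>c\<close>
    contributes \<open>\<tau>\<^sup>2 * c\<close>, here at most \<open>e/9\<close>.\<close>
  define \<tau> where "\<tau> = sqrt (e / (9 * (c+1)))"
  have \<tau>: "\<tau> > 0" "\<tau>\<^sup>2 * c \<le> e / 9" using e c by (auto simp: \<tau>_def field_simps)
  obtain d where d: "d > 0" "\<And>\<epsilon> \<eta> x. \<epsilon> \<le> d \<Longrightarrow> mollifier \<epsilon> \<eta> \<Longrightarrow> \<bar>conv g \<eta> x - g x\<bar> \<le> \<tau>"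
    using mollify_uniform[OF g(1,2) \<tau>(1)] by blast
  have gm[measurable]: "g \<in> borel_measurable lebesgue" using borel_measurable_lebesgueI[OF g(1)] .
  note [measurable] = f(1)
  have ig2: "integrable lebesgue (\<lambda>x. (g x)\<^sup>2)"
    using g by (intro continuous_zero_outside_integrable[where R="R+1"] continuous_intros) auto
  have ig: "integrable lebesgue g" using g by (intro continuous_zero_outside_integrable[where R="R+1"]) auto
  have iff: "integrable lebesgue f" by (rule integrable_L2_zero_outside[OF f])
  have ifg: "integrable lebesgue (\<lambda>x. (f x - g x)\<^sup>2)"
  proof (rule Bochner_Integration.integrable_bound)
    show "integrable lebesgue (\<lambda>x. 2 * (f x)\<^sup>2 + 2 * (g x)\<^sup>2)" using f(2) ig2 by auto
    have "(f x - g x)\<^sup>2 \<le> 2 * (f x)\<^sup>2 + 2 * (g x)\<^sup>2" for x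
      using zero_le_power2[of "f x + g x"] by (simp add: power2_eq_square algebra_simps)
    then show "AE x in lebesgue. norm ((f x - g x)\<^sup>2) \<le> norm (2 * (f x)\<^sup>2 + 2 * (g x)\<^sup>2)" by (intro AE_I2) auto
  qed measurable
  have I1: "(\<integral>\<^sup>+x. ennreal ((f x - g x)\<^sup>2) \<partial>lborel) \<le> ennreal (e/9)"
    using nn_integral_eq_integral[OF ifg] g(3) by (auto simp: nn_integral_completion ennreal_leI)
  have "(\<integral>\<^sup>+x. ennreal ((f x - conv f \<eta> x)\<^sup>2) \<partial>lborel) \<le> ennreal e" if \<epsilon>: "\<epsilon> \<le> min d 1" and m: "mollifier \<epsilon> \<eta>" for \<epsilon> \<eta>
  proof -
    let ?h = "\<lambda>x. f x - g x"
    have ih: "integrable lebesgue ?h" using iff ig by auto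
    note i = integrable_mult_test[OF _ test_fun_reflect[OF mollifierD(1)[OF m]]]
    have "conv ?h \<eta> x = conv f \<eta> x - conv g \<eta> x" for x
      using i[OF iff, of x] i[OF ig, of x] by (simp add: conv_def left_diff_distrib)
    then have eq: "f x - conv f \<eta> x = ?h x - conv ?h \<eta> x + (g x - conv g \<eta> x)" for x by simp
    have sq: "(a + b + c)\<^sup>2 \<le> 3 * a\<^sup>2 + 3 * b\<^sup>2 + 3 * c\<^sup>2" for a b c :: real
      using zero_le_power2[of "a-b"] zero_le_power2[of "b-c"] zero_le_power2[of "a-c"]
      by (simp add: power2_eq_square algebra_simps)
    have gc: "(g x - conv g \<eta> x)\<^sup>2 \<le> \<tau>\<^sup>2 * indicator (cball 0 (R+2)) x" for x
    proof (cases "norm x > R + 2")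
      case True
      have "conv g \<eta> x = 0"
        by (rule conv_zero_outside[where R="R+1" and S=1, OF g(2)]) (use True \<epsilon> mollifierD(3)[OF m] in auto)
      then show ?thesis using True g(2)[of x] by simp
    next
      case False
      have "\<bar>g x - conv g \<eta> x\<bar> \<le> \<tau>" using d(2)[OF _ m, of x] \<epsilon> by (simp add: abs_minus_commute)
      from power_mono[OF this abs_ge_zero, of 2] have "(g x - conv g \<eta> x)\<^sup>2 \<le> \<tau>\<^sup>2" by simp
      then show ?thesis using False by simp
    qed
    have cm[measurable]: "conv ?h \<eta> \<in> borel_measurable borel"
      using C_k_conv[OF ih mollifierD(1)[OF m], of 0] by (simp add: borel_measurable_continuous_onI)
    have hm[measurable]: "?h \<in> borel_measurable lebesgue" by measurable
    have "(\<integral>\<^sup>+x. ennreal ((f x - conv f \<eta> x)\<^sup>2) \<partial>lborel) \<le>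
      (\<integral>\<^sup>+x. ennreal (3 * (?h x)\<^sup>2) + ennreal (3 * (conv ?h \<eta> x)\<^sup>2) + ennreal (3 * \<tau>\<^sup>2) * indicator (cball 0 (R+2)) x \<partial>lebesgue)"
      unfolding nn_integral_completion
    proof (rule nn_integral_mono)
      fix x
      have "(f x - conv f \<eta> x)\<^sup>2 \<le> 3 * (?h x)\<^sup>2 + 3 * (conv ?h \<eta> x)\<^sup>2 + (3 * \<tau>\<^sup>2) * indicator (cball 0 (R+2)) x"
        using sq[of "?h x" "- conv ?h \<eta> x" "g x - conv g \<eta> x"] gc[of x] unfolding eq by simp
      then have "ennreal ((f x - conv f \<eta> x)\<^sup>2) \<le> ennreal (3 * (?h x)\<^sup>2 + 3 * (conv ?h \<eta> x)\<^sup>2 + (3 * \<tau>\<^sup>2) * indicator (cball 0 (R+2)) x)"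
        by (rule ennreal_leI)
      also have "\<dots> = ennreal (3 * (?h x)\<^sup>2) + ennreal (3 * (conv ?h \<eta> x)\<^sup>2) + ennreal (3 * \<tau>\<^sup>2) * indicator (cball 0 (R+2)) x"
        by (auto simp: indicator_def)
      finally show "ennreal ((f x - conv f \<eta> x)\<^sup>2) \<le> ennreal (3 * (?h x)\<^sup>2) + ennreal (3 * (conv ?h \<eta> x)\<^sup>2) + ennreal (3 * \<tau>\<^sup>2) * indicator (cball 0 (R+2)) x" .
    qed
    also have "\<dots> = 3 * (\<integral>\<^sup>+x. ennreal ((?h x)\<^sup>2) \<partial>lborel) + 3 * (\<integral>\<^sup>+x. ennreal ((conv ?h \<eta> x)\<^sup>2) \<partial>lborel) + ennreal (3 * \<tau>\<^sup>2) * ennreal c"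
    proof -
      have "emeasure lebesgue (cball (0::real^'n) (R+2)) = ennreal c"
        unfolding c_def by (rule emeasure_eq_measure2) (use lmeasurable_cball in \<open>auto simp: fmeasurable_def\<close>)
      moreover have "conv ?h \<eta> \<in> borel_measurable lebesgue" by (simp add: measurable_completion cm)
      ultimately have "(\<integral>\<^sup>+x. ennreal (3 * (?h x)\<^sup>2) + ennreal (3 * (conv ?h \<eta> x)\<^sup>2) + ennreal (3 * \<tau>\<^sup>2) * indicator (cball 0 (R+2)) x \<partial>lebesgue)
        = 3 * (\<integral>\<^sup>+x. ennreal ((?h x)\<^sup>2) \<partial>lebesgue) + 3 * (\<integral>\<^sup>+x. ennreal ((conv ?h \<eta> x)\<^sup>2) \<partial>lebesgue) + ennreal (3 * \<tau>\<^sup>2) * ennreal c"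
        using nn_integral_sum_indicator[of "\<lambda>x. ennreal ((?h x)\<^sup>2)" lebesgue "\<lambda>x. ennreal ((conv ?h \<eta> x)\<^sup>2)" "cball 0 (R+2)" "ennreal (3 * \<tau>\<^sup>2)"]
        by (simp add: ennreal_mult)
      then show ?thesis by (simp only: nn_integral_completion)
    qed
    also have "\<dots> \<le> 3 * ennreal (e/9) + 3 * ennreal (e/9) + ennreal (e/3)"
    proof (intro add_mono mult_left_mono)
      show "(\<integral>\<^sup>+x. ennreal ((conv ?h \<eta> x)\<^sup>2) \<partial>lborel) \<le> ennreal (e/9)"
        using mollify_L2_le[OF m ih ifg] I1 by (rule order_trans)
      have "ennreal (3 * \<tau>\<^sup>2) * ennreal c = ennreal (3 * (\<tau>\<^sup>2 * c))" using c by (simp add: ennreal_mult[symmetric] mult.assoc)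
      also have "\<dots> \<le> ennreal (e/3)" using \<tau> by (intro ennreal_leI) simp
      finally show "ennreal (3 * \<tau>\<^sup>2) * ennreal c \<le> ennreal (e/3)" .
    qed (use I1 in auto)
    also have "\<dots> = ennreal e"
    proof -
      have "3 * ennreal (e/9) = ennreal (e/3)" using e ennreal_mult[of 3 "e/9"] by simp
      then show ?thesis using e by (simp add: ennreal_plus[symmetric] del: ennreal_plus)
    qed
    finally show ?thesis .
  qed
  then show ?thesis using d(1) by (intro exI[of _ "min d 1"]) auto
qed

section \<open>Weak gradients\<close>

lemma Lp_loc_1_iff: "Lp_loc 1 f \<longleftrightarrow> f \<in> borel_measurable lebesgue \<and> (\<forall>K. compact K \<longrightarrow> set_integrable lebesgue K (\<lambda>x. norm (f x)))"
  by (simp add: Lp_loc_def)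

text \<open>The simplifier rewrites the exponent \<open>2 :: ereal\<close> to \<open>ereal 2\<close>.\<close>

lemma Lp_loc_2_iff:
  "Lp_loc 2 f \<longleftrightarrow> f \<in> borel_measurable lebesgue \<and> (\<forall>K. compact K \<longrightarrow> set_integrable lebesgue K (\<lambda>x. (norm (f x))\<^sup>2))"
  "Lp_loc (ereal 2) f \<longleftrightarrow> f \<in> borel_measurable lebesgue \<and> (\<forall>K. compact K \<longrightarrow> set_integrable lebesgue K (\<lambda>x. (norm (f x))\<^sup>2))"
  by (simp_all add: Lp_loc_def powr_numeral)

lemma Lp_loc_1_component:
  fixes g :: "real^'n \<Rightarrow> real^'n"
  assumes "Lp_loc 1 g" shows "Lp_loc 1 (\<lambda>x. g x $ i)"
  unfolding Lp_loc_1_iff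
proof (intro conjI allI impI)
  have g: "g \<in> borel_measurable lebesgue" using assms by (simp add: Lp_loc_1_iff)
  have "(\<lambda>x. g x \<bullet> axis i 1) \<in> borel_measurable lebesgue" using g by measurable
  then show m: "(\<lambda>x. g x $ i) \<in> borel_measurable lebesgue" by (simp add: inner_axis)
  fix K :: "(real^'n) set" assume "compact K"
  then have "set_integrable lebesgue K (\<lambda>x. norm (g x))" "K \<in> sets lebesgue"
    using assms by (auto simp: Lp_loc_1_iff compact_imp_closed)
  then show "set_integrable lebesgue K (\<lambda>x. norm (g x $ i))"
    by (elim set_integrable_bound)
       (use m component_le_norm_cart in \<open>auto simp: set_borel_measurable_def intro!: borel_measurable_scaleR\<close>)
qed

lemma Lp_loc_1_mult_continuous:
  fixes f \<psi> :: "real^'n \<Rightarrow> real"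
  assumes f: "Lp_loc 1 f" and \<psi>: "continuous_on UNIV \<psi>" "\<And>x. norm x > R \<Longrightarrow> \<psi> x = 0"
  shows "integrable lebesgue (\<lambda>x. f x * \<psi> x)"
proof -
  have i: "set_integrable lebesgue (cball 0 R) (\<lambda>x. norm (f x))" using f by (simp add: Lp_loc_1_iff)
  have m[measurable]: "f \<in> borel_measurable lebesgue" "\<psi> \<in> borel_measurable lebesgue"
    using f borel_measurable_lebesgueI[OF \<psi>(1)] by (auto simp: Lp_loc_1_iff)
  have "bounded (\<psi> ` cball 0 R)"
    by (intro compact_imp_bounded compact_continuous_image continuous_on_subset[OF \<psi>(1)]) auto
  then obtain B where B: "B > 0" "\<And>x. x \<in> cball 0 R \<Longrightarrow> \<bar>\<psi> x\<bar> \<le> B" by (auto simp: bounded_pos)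
  show ?thesis
  proof (rule Bochner_Integration.integrable_bound)
    show "integrable lebesgue (\<lambda>x. B * (indicator (cball 0 R) x *\<^sub>R norm (f x)))"
      using i unfolding set_integrable_def by (rule integrable_mult_right)
    show "AE x in lebesgue. norm (f x * \<psi> x) \<le> norm (B * (indicator (cball 0 R) x *\<^sub>R norm (f x)))"
    proof (rule AE_I2)
      fix x
      show "norm (f x * \<psi> x) \<le> norm (B * (indicator (cball 0 R) x *\<^sub>R norm (f x)))"
      proof (cases "norm x > R")
        case False
        then have "\<bar>f x\<bar> * \<bar>\<psi> x\<bar> \<le> \<bar>f x\<bar> * B" using B(2)[of x] by (intro mult_left_mono) auto
        then show ?thesis using False B(1) by (simp add: abs_mult mult.commute)
      qed (use \<psi> in auto)
    qed
  qed measurable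
qed

lemma Lp_loc_1_mult_test:
  fixes f \<psi> :: "real^'n \<Rightarrow> real"
  assumes "Lp_loc 1 f" "test_fun \<psi>"
  shows "integrable lebesgue (\<lambda>x. f x * \<psi> x)"
  using test_fun_support[OF assms(2)] Lp_loc_1_mult_continuous[OF assms(1) test_fun_continuous[OF assms(2)]] by metis

text \<open>Mollifications of \<open>g\<close> are test functions with supports in one fixed ball
  that converge uniformly to \<open>g\<close>, and \<open>h\<close> is integrable on that
  ball.\<close>

lemma fundamental_lemma_continuous:
  fixes h g :: "real^'n \<Rightarrow> real"
  assumes h: "Lp_loc 1 h" and z: "\<And>\<phi>. test_fun \<phi> \<Longrightarrow> (LINT x|lebesgue. h x * \<phi> x) = 0"
    and g: "continuous_on UNIV g" "\<And>x. norm x > R \<Longrightarrow> g x = 0"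
  shows "(LINT x|lebesgue. h x * g x) = 0"
proof -
  let ?I = "LINT x|lebesgue. indicator (cball 0 (R+1)) x *\<^sub>R norm (h x)"
  have i: "integrable lebesgue (\<lambda>x. indicator (cball 0 (R+1)) x *\<^sub>R norm (h x))"
    using h by (simp add: Lp_loc_1_iff set_integrable_def)
  have ig: "integrable lebesgue g" by (rule continuous_zero_outside_integrable[OF g])
  have "\<bar>LINT x|lebesgue. h x * g x\<bar> \<le> e * ?I" if e: "e > 0" for e
  proof -
    obtain d where d: "d > 0" "\<And>\<epsilon> \<eta> x. \<epsilon> \<le> d \<Longrightarrow> mollifier \<epsilon> \<eta> \<Longrightarrow> \<bar>conv g \<eta> x - g x\<bar> \<le> e"
      using mollify_uniform[OF g e] by blast
    obtain \<eta> :: "real^'n \<Rightarrow> real" where m: "mollifier (min d 1) \<eta>" using mollifier_ex[of "min d 1"] d(1) by auto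
    have t: "test_fun (conv g \<eta>)" by (rule test_fun_conv[OF ig g(2) mollifierD(1)[OF m]])
    have z2: "conv g \<eta> x = 0" if "norm x > R + 1" for x
      by (rule conv_zero_outside[where R=R and S=1, OF g(2)]) (use that mollifierD(3)[OF m] in auto)
    note ii = Lp_loc_1_mult_continuous[OF h g] Lp_loc_1_mult_test[OF h t]
    have "(LINT x|lebesgue. h x * g x) = (LINT x|lebesgue. h x * g x) - (LINT x|lebesgue. h x * conv g \<eta> x)"
      using z[OF t] by simp
    also have "\<dots> = (LINT x|lebesgue. h x * g x - h x * conv g \<eta> x)"
      by (rule Bochner_Integration.integral_diff[OF ii, symmetric])
    also have "norm \<dots> \<le> (LINT x|lebesgue. e * (indicator (cball 0 (R+1)) x *\<^sub>R norm (h x)))"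
    proof (rule norm_integral_le)
      fix x
      show "norm (h x * g x - h x * conv g \<eta> x) \<le> e * (indicator (cball 0 (R+1)) x *\<^sub>R norm (h x))"
      proof (cases "norm x > R + 1")
        case True then show ?thesis using z2 g(2)[of x] by simp
      next
        case False
        have "\<bar>h x\<bar> * \<bar>g x - conv g \<eta> x\<bar> \<le> \<bar>h x\<bar> * e"
          using d(2)[OF _ m, of x] by (intro mult_left_mono) (auto simp: abs_minus_commute)
        moreover have "h x * g x - h x * conv g \<eta> x = h x * (g x - conv g \<eta> x)" by (simp add: right_diff_distrib)
        ultimately show ?thesis using False by (simp add: abs_mult mult.commute)
      qed
    qed (use ii i in auto)
    finally show ?thesis by simp
  qed
  note le = this
  have I: "?I \<ge> 0" by (intro integral_nonneg_AE AE_I2) auto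
  show ?thesis
  proof (rule ccontr)
    assume n: "(LINT x|lebesgue. h x * g x) \<noteq> 0"
    let ?a = "\<bar>LINT x|lebesgue. h x * g x\<bar>"
    define J where "J = ?I"
    have J: "J \<ge> 0" using I by (simp only: J_def)
    have "?a > 0" using n by simp
    with J have "?a / (2 * (J + 1)) > 0" by simp
    then have "?a \<le> ?a / (2 * (J + 1)) * J" unfolding J_def by (rule le)
    also have "\<dots> \<le> ?a / (2 * (J + 1)) * (J + 1)" using J by (intro mult_left_mono) auto
    also have "\<dots> = ?a / 2" using J by (simp add: field_simps)
    finally show False using n by simp
  qed
qed

text \<open>The ideal test function is the sign of \<open>h\<close> on a ball. It is a bounded
  almost everywhere limit of continuous functions with common bounded support, so dominated
  convergence makes the integral of \<open>\<bar>h x\<bar>\<close> over the ball vanish.\<close>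

lemma fundamental_lemma:
  fixes h :: "real^'n \<Rightarrow> real"
  assumes h: "Lp_loc 1 h" and z: "\<And>\<phi>. test_fun \<phi> \<Longrightarrow> (LINT x|lebesgue. h x * \<phi> x) = 0"
  shows "AE x in lebesgue. h x = 0"
proof -
  have hm[measurable]: "h \<in> borel_measurable lebesgue" using h by (simp add: Lp_loc_1_iff)
  have R: "AE x in lebesgue. norm x \<le> real N \<longrightarrow> h x = 0" for N :: nat
  proof -
    define s where "s x = sgn (h x) * indicator (cball 0 (real N)) x" for x
    have sm: "s \<in> borel_measurable lebesgue" unfolding s_def using measurable_compose[OF hm borel_measurable_sgn] by (intro borel_measurable_times borel_measurable_indicator) auto
    have sb: "\<bar>s x\<bar> \<le> 1" and sz: "norm x > real N \<Longrightarrow> s x = 0" for x by (auto simp: s_def sgn_if)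
    obtain g :: "nat \<Rightarrow> real^'n \<Rightarrow> real" where g: "\<And>n. continuous_on UNIV (g n)" "\<And>n x. \<bar>g n x\<bar> \<le> 1"
      "\<And>n x. norm x > real N + 1 \<Longrightarrow> g n x = 0" "AE x in lebesgue. (\<lambda>n. g n x) \<longlonglongrightarrow> s x"
      using ae_limit_continuous[OF sm zero_le_one sb sz] by blast
    have gm[measurable]: "g n \<in> borel_measurable lebesgue" for n using borel_measurable_lebesgueI[OF g(1)] .
    let ?w = "\<lambda>x. indicator (cball 0 (real N+1)) x *\<^sub>R norm (h x)"
    have w: "integrable lebesgue ?w" using h by (simp add: Lp_loc_1_iff set_integrable_def)
    have lim: "(\<lambda>n. LINT x|lebesgue. h x * g n x) \<longlonglongrightarrow> (LINT x|lebesgue. h x * s x)"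
    proof (rule integral_dominated_convergence[OF _ _ w])
      show "(\<lambda>x. h x * s x) \<in> borel_measurable lebesgue" using sm by measurable
      show "AE x in lebesgue. (\<lambda>n. h x * g n x) \<longlonglongrightarrow> h x * s x"
        using g(4) by eventually_elim (intro tendsto_intros)
      show "AE x in lebesgue. norm (h x * g n x) \<le> ?w x" for n
      proof (rule AE_I2)
        fix x show "norm (h x * g n x) \<le> ?w x"
          using g(2)[of n x] g(3)[of x n] by (cases "norm x > real N + 1") (auto simp: abs_mult mult_left_le)
      qed
    qed measurable
    moreover have "(LINT x|lebesgue. h x * g n x) = 0" for n
      by (rule fundamental_lemma_continuous[OF h z g(1) g(3)])
    ultimately have I0: "(LINT x|lebesgue. h x * s x) = 0" using LIMSEQ_unique[OF tendsto_const] by fastforce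
    have hs: "h x * s x = indicator (cball 0 (real N)) x *\<^sub>R norm (h x)" for x
      by (auto simp: s_def indicator_def sgn_if)
    have "integrable lebesgue (\<lambda>x. h x * s x)"
      unfolding hs using h by (simp add: Lp_loc_1_iff set_integrable_def)
    then have "AE x in lebesgue. h x * s x = 0"
      using integral_nonneg_eq_0_iff_AE[of lebesgue "\<lambda>x. h x * s x"] I0 by (simp add: hs)
    then show ?thesis by eventually_elim (auto simp: s_def sgn_if split: if_splits)
  qed
  have "AE x in lebesgue. \<forall>N::nat. norm x \<le> real N \<longrightarrow> h x = 0" using R by (subst AE_all_countable) auto
  then show ?thesis by eventually_elim (use real_arch_simple in blast)
qed

section \<open>Uniqueness and product rule for weak gradients\<close>

lemma is_weak_grad_integrable:
  assumes "is_weak_grad u g" "test_fun \<phi>"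
  shows "integrable lebesgue (\<lambda>x. u x * partial i \<phi> x)" "integrable lebesgue (\<lambda>x. g x $ i * \<phi> x)" "integrable lebesgue (\<lambda>x. u x * \<phi> x)"
  using assms unfolding is_weak_grad_def
  by (auto intro!: Lp_loc_1_mult_test test_fun_partial Lp_loc_1_component)

lemma Lp_loc_1_diff:
  fixes f g :: "real^'n \<Rightarrow> 'b::euclidean_space"
  assumes "Lp_loc 1 f" "Lp_loc 1 g" shows "Lp_loc 1 (\<lambda>x. f x - g x)"
  unfolding Lp_loc_1_iff
proof (intro conjI allI impI)
  show m: "(\<lambda>x. f x - g x) \<in> borel_measurable lebesgue"
    using assms by (auto simp: Lp_loc_1_iff)
  fix K :: "(real^'n) set" assume K: "compact K"
  have Ks: "K \<in> sets lebesgue" using K by (simp add: compact_imp_closed)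
  have "set_integrable lebesgue K (\<lambda>x. norm (f x) + norm (g x))"
    using assms K by (intro set_integral_add) (auto simp: Lp_loc_1_iff)
  then show "set_integrable lebesgue K (\<lambda>x. norm (f x - g x))"
    by (rule set_integrable_bound)
       (use m Ks in \<open>auto simp: set_borel_measurable_def intro!: norm_triangle_ineq4 borel_measurable_scaleR\<close>)
qed

lemma is_weak_grad_diff:
  assumes "is_weak_grad u g" "is_weak_grad v k"
  shows "is_weak_grad (\<lambda>x. u x - v x) (\<lambda>x. g x - k x)"
  unfolding is_weak_grad_def
proof (intro conjI allI impI)
  show "Lp_loc 1 (\<lambda>x. u x - v x)" "Lp_loc 1 (\<lambda>x. g x - k x)"
    using assms by (auto simp: is_weak_grad_def intro!: Lp_loc_1_diff)
  fix \<phi> :: "real^'a \<Rightarrow> real" and i assume \<phi>: "test_fun \<phi>"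
  show "(LINT x|lebesgue. (u x - v x) * partial i \<phi> x) = - (LINT x|lebesgue. (g x - k x) $ i * \<phi> x)"
    using assms \<phi> is_weak_grad_integrable(1,2)[OF assms(1) \<phi>, of i] is_weak_grad_integrable(1,2)[OF assms(2) \<phi>, of i]
    by (simp add: left_diff_distrib is_weak_grad_def)
qed

lemma is_weak_grad_unique:
  fixes g g' :: "real^'n \<Rightarrow> real^'n"
  assumes "is_weak_grad u g" "is_weak_grad u g'"
  shows "AE x in lebesgue. g x = g' x"
proof -
  have "AE x in lebesgue. g x $ i - g' x $ i = 0" for i
  proof (rule fundamental_lemma)
    show "Lp_loc 1 (\<lambda>x. g x $ i - g' x $ i)"
      using assms by (auto simp: is_weak_grad_def intro!: Lp_loc_1_diff Lp_loc_1_component)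
    fix \<phi> :: "real^'n \<Rightarrow> real" assume \<phi>: "test_fun \<phi>"
    show "(LINT x|lebesgue. (g x $ i - g' x $ i) * \<phi> x) = 0"
      using assms \<phi> is_weak_grad_integrable(1,2)[OF assms(1) \<phi>, of i] is_weak_grad_integrable(1,2)[OF assms(2) \<phi>, of i]
      by (simp add: left_diff_distrib is_weak_grad_def)
  qed
  then have "AE x in lebesgue. \<forall>i. g x $ i - g' x $ i = 0" by (subst AE_all_countable) auto
  then show ?thesis by eventually_elim (simp add: vec_eq_iff)
qed

lemma Lp_loc_1_continuous:
  fixes f :: "real^'n \<Rightarrow> 'b::euclidean_space"
  assumes "continuous_on UNIV f" shows "Lp_loc 1 f"
  unfolding Lp_loc_1_iff
proof (intro conjI allI impI)
  show "f \<in> borel_measurable lebesgue" by (rule borel_measurable_lebesgueI[OF assms])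
  fix K :: "(real^'n) set" assume K: "compact K"
  have I: "integrable lborel (\<lambda>x. indicator K x *\<^sub>R norm (f x))"
    by (intro borel_integrable_compact K continuous_intros continuous_on_subset[OF assms]) auto
  show "set_integrable lebesgue K (\<lambda>x. norm (f x))"
    unfolding set_integrable_def using I integrable_completion[OF borel_measurable_integrable[OF I]] by simp
qed

lemma is_weak_grad_test:
  assumes "test_fun \<phi>" shows "is_weak_grad \<phi> (grad \<phi>)"
  unfolding is_weak_grad_def using assms
  by (auto intro!: Lp_loc_1_continuous test_fun_continuous continuous_grad simp: integration_by_parts grad_def)

lemma Lp_loc_1_bounded_scaleR:
  fixes f :: "real^'n \<Rightarrow> 'b::euclidean_space" and \<psi> :: "real^'n \<Rightarrow> real"
  assumes f: "Lp_loc 1 f" and \<psi>: "continuous_on UNIV \<psi>"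
  shows "Lp_loc 1 (\<lambda>x. \<psi> x *\<^sub>R f x)"
  unfolding Lp_loc_1_iff
proof (intro conjI allI impI)
  have fm: "f \<in> borel_measurable lebesgue" using f by (simp add: Lp_loc_1_iff)
  show m: "(\<lambda>x. \<psi> x *\<^sub>R f x) \<in> borel_measurable lebesgue"
    by (intro borel_measurable_scaleR borel_measurable_lebesgueI[OF \<psi>] fm)
  fix K :: "(real^'n) set" assume K: "compact K"
  have Ks: "K \<in> sets lebesgue" using K by (simp add: compact_imp_closed)
  have "bounded (\<psi> ` K)"
    by (intro compact_imp_bounded compact_continuous_image continuous_on_subset[OF \<psi>] K) auto
  then obtain B where B: "B > 0" "\<And>x. x \<in> K \<Longrightarrow> \<bar>\<psi> x\<bar> \<le> B" by (auto simp: bounded_pos)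
  have "set_integrable lebesgue K (\<lambda>x. B * norm (f x))"
    using f K by (intro set_integrable_mult_right) (auto simp: Lp_loc_1_iff)
  then show "set_integrable lebesgue K (\<lambda>x. norm (\<psi> x *\<^sub>R f x))"
    by (rule set_integrable_bound)
       (use measurable_compose[OF m borel_measurable_norm] Ks B in \<open>auto simp: set_borel_measurable_def abs_mult intro!: mult_right_mono borel_measurable_times\<close>)
qed

lemma Lp_loc_1_add:
  fixes f g :: "real^'n \<Rightarrow> 'b::euclidean_space"
  assumes "Lp_loc 1 f" "Lp_loc 1 g" shows "Lp_loc 1 (\<lambda>x. f x + g x)"
proof -
  have "Lp_loc 1 (\<lambda>x. (-1::real) *\<^sub>R g x)" by (rule Lp_loc_1_bounded_scaleR[OF assms(2)]) auto
  from Lp_loc_1_diff[OF assms(1) this] show ?thesis by simp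
qed

lemma Lp_loc_1_scaleR_continuous:
  fixes u :: "real^'n \<Rightarrow> real" and v :: "real^'n \<Rightarrow> real^'n"
  assumes u: "Lp_loc 1 u" and v: "continuous_on UNIV v"
  shows "Lp_loc 1 (\<lambda>x. u x *\<^sub>R v x)"
proof -
  have "Lp_loc 1 (\<lambda>x. norm (v x) *\<^sub>R u x)" by (intro Lp_loc_1_bounded_scaleR u continuous_intros v)
  moreover have "(\<lambda>x. u x *\<^sub>R v x) \<in> borel_measurable lebesgue"
    using u by (intro borel_measurable_scaleR borel_measurable_lebesgueI[OF v]) (simp add: Lp_loc_1_iff)
  ultimately show ?thesis by (simp add: Lp_loc_1_iff abs_mult mult.commute)
qed

lemma is_weak_grad_mult_test:
  fixes u :: "real^'n \<Rightarrow> real"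
  assumes u: "is_weak_grad u g" and \<psi>: "test_fun \<psi>"
  shows "is_weak_grad (\<lambda>x. u x * \<psi> x) (\<lambda>x. \<psi> x *\<^sub>R g x + u x *\<^sub>R grad \<psi> x)"
  unfolding is_weak_grad_def
proof (intro conjI allI impI)
  have l: "Lp_loc 1 u" "Lp_loc 1 g" using u by (auto simp: is_weak_grad_def)
  show "Lp_loc 1 (\<lambda>x. u x * \<psi> x)"
    using Lp_loc_1_bounded_scaleR[OF l(1) test_fun_continuous[OF \<psi>]] by (simp add: mult.commute)
  show "Lp_loc 1 (\<lambda>x. \<psi> x *\<^sub>R g x + u x *\<^sub>R grad \<psi> x)"
    by (intro Lp_loc_1_add Lp_loc_1_bounded_scaleR Lp_loc_1_scaleR_continuous l test_fun_continuous continuous_grad \<psi>)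
  fix \<theta> :: "real^'n \<Rightarrow> real" and i assume \<theta>: "test_fun \<theta>"
  note t = test_fun_mult[OF \<psi> \<theta>]
  have p: "partial i (\<lambda>x. \<psi> x * \<theta> x) = (\<lambda>x. \<psi> x * partial i \<theta> x + partial i \<psi> x * \<theta> x)"
    using \<psi> \<theta> by (simp add: fun_eq_iff partial_mult test_fun_differentiable)
  have t2: "test_fun (\<lambda>x. partial i \<psi> x * \<theta> x)" "test_fun (\<lambda>x. \<psi> x * partial i \<theta> x)"
    by (intro test_fun_mult test_fun_partial \<psi> \<theta>)+
  have i1: "integrable lebesgue (\<lambda>x. u x * (\<psi> x * partial i \<theta> x))" "integrable lebesgue (\<lambda>x. u x * (partial i \<psi> x * \<theta> x))"
     "integrable lebesgue (\<lambda>x. g x $ i * (\<psi> x * \<theta> x))"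
    using l t2 t by (auto intro!: Lp_loc_1_mult_test Lp_loc_1_component)
  have "(LINT x|lebesgue. u x * (\<psi> x * partial i \<theta> x)) + (LINT x|lebesgue. u x * (partial i \<psi> x * \<theta> x)) =
    (LINT x|lebesgue. u x * partial i (\<lambda>x. \<psi> x * \<theta> x) x)"
    using i1 by (simp add: p distrib_left)
  also have "\<dots> = - (LINT x|lebesgue. g x $ i * (\<psi> x * \<theta> x))" using u t by (simp add: is_weak_grad_def)
  finally have "(LINT x|lebesgue. u x * (\<psi> x * partial i \<theta> x)) =
     - ((LINT x|lebesgue. g x $ i * (\<psi> x * \<theta> x)) + (LINT x|lebesgue. u x * (partial i \<psi> x * \<theta> x)))" by simp
  also have "(LINT x|lebesgue. g x $ i * (\<psi> x * \<theta> x)) + (LINT x|lebesgue. u x * (partial i \<psi> x * \<theta> x)) =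
    (LINT x|lebesgue. g x $ i * (\<psi> x * \<theta> x) + u x * (partial i \<psi> x * \<theta> x))"
    by (rule Bochner_Integration.integral_add[symmetric]) (use i1 in auto)
  finally show "(LINT x|lebesgue. u x * \<psi> x * partial i \<theta> x) = - (LINT x|lebesgue. (\<psi> x *\<^sub>R g x + u x *\<^sub>R grad \<psi> x) $ i * \<theta> x)"
    by (simp add: grad_def algebra_simps)
qed

text \<open>It lets any explicitly computed weak gradient stand in for the chosen representative
  under an integral.\<close>

lemma weak_grad_AE:
  assumes "is_weak_grad u g" shows "is_weak_grad u (weak_grad u)" "AE x in lebesgue. weak_grad u x = g x"
proof -
  show "is_weak_grad u (weak_grad u)" unfolding weak_grad_def by (rule someI[of _ g]) (rule assms)
  then show "AE x in lebesgue. weak_grad u x = g x" using assms by (rule is_weak_grad_unique)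
qed

section \<open>Approximation of compactly supported Sobolev functions by test functions\<close>

lemma integral_le_of_nn_integral:
  fixes h :: "'a \<Rightarrow> real"
  assumes "h \<in> borel_measurable M" "\<And>x. 0 \<le> h x" "(\<integral>\<^sup>+x. ennreal (h x) \<partial>M) \<le> ennreal c" "0 \<le> c"
  shows "integral\<^sup>L M h \<le> c"
  using assms by (simp add: integral_eq_nn_integral enn2real_leI)

lemma norm_power2_eq_sum: "(norm (v :: real^'n))\<^sup>2 = (\<Sum>i\<in>UNIV. (v $ i)\<^sup>2)"
  unfolding power2_norm_eq_inner inner_vec_def by (simp add: power2_eq_square)

lemma L2_component:
  fixes G :: "real^'n \<Rightarrow> real^'n"
  assumes "L2 G" shows "L2 (\<lambda>x. G x $ i)"
  unfolding L2_def
proof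
  have G: "G \<in> borel_measurable lebesgue" "integrable lebesgue (\<lambda>x. (norm (G x))\<^sup>2)" using assms by (auto simp: L2_def)
  have "(\<lambda>x. G x \<bullet> axis i 1) \<in> borel_measurable lebesgue" using G by measurable
  then show m: "(\<lambda>x. G x $ i) \<in> borel_measurable lebesgue" by (simp add: inner_axis)
  show "integrable lebesgue (\<lambda>x. (norm (G x $ i))\<^sup>2)"
  proof (rule Bochner_Integration.integrable_bound[OF G(2)])
    show "(\<lambda>x. (norm (G x $ i))\<^sup>2) \<in> borel_measurable lebesgue" using m by measurable
    show "AE x in lebesgue. norm ((norm (G x $ i))\<^sup>2) \<le> norm ((norm (G x))\<^sup>2)"
    proof (rule AE_I2)
      fix x
      from power_mono[OF component_le_norm_cart[of "G x" i] abs_ge_zero, of 2]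
      show "norm ((norm (G x $ i))\<^sup>2) \<le> norm ((norm (G x))\<^sup>2)" by simp
    qed
  qed
qed

text \<open>Mollification commutes with the weak gradient. One kernel has to serve the function and
  all components of its gradient, so the smallest of finitely many radii is taken.\<close>

lemma compact_weak_grad_approx:
  fixes f :: "real^'n \<Rightarrow> real"
  assumes w: "is_weak_grad f G" and f: "L2 f" and G: "L2 G" 
    and fz: "\<And>x. norm x > R \<Longrightarrow> f x = 0" and Gz: "\<And>x. norm x > R \<Longrightarrow> G x = 0" and e: "0 < e"
  shows "\<exists>\<phi>. test_fun \<phi> \<and> (\<integral>\<^sup>+x. ennreal ((f x - \<phi> x)\<^sup>2) \<partial>lebesgue) \<le> ennreal e \<and>
     (\<integral>\<^sup>+x. ennreal ((norm (G x - grad \<phi> x))\<^sup>2) \<partial>lebesgue) \<le> ennreal e"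
proof -
  have fm: "f \<in> borel_measurable lebesgue" "integrable lebesgue (\<lambda>x. (f x)\<^sup>2)" using f by (auto simp: L2_def)
  have Gm: "(\<lambda>x. G x $ i) \<in> borel_measurable lebesgue" "integrable lebesgue (\<lambda>x. (G x $ i)\<^sup>2)" for i
    using L2_component[OF G, of i] by (auto simp: L2_def)
  define n where "n = real CARD('n)"
  have n: "n > 0" by (simp add: n_def)
  obtain d0 where d0: "d0 > 0" "\<And>\<epsilon> \<eta>. \<epsilon> \<le> d0 \<Longrightarrow> mollifier \<epsilon> \<eta> \<Longrightarrow> (\<integral>\<^sup>+x. ennreal ((f x - conv f \<eta> x)\<^sup>2) \<partial>lborel) \<le> ennreal e"
    using mollify_L2[OF fm fz e] by blast
  have "\<forall>i. \<exists>d>0. \<forall>\<epsilon> \<eta>. \<epsilon> \<le> d \<longrightarrow> mollifier \<epsilon> \<eta> \<longrightarrow> (\<integral>\<^sup>+x. ennreal ((G x $ i - conv (\<lambda>x. G x $ i) \<eta> x)\<^sup>2) \<partial>lborel) \<le> ennreal (e/n)"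
  proof
    fix i
    have "0 < e / n" using e n by simp
    moreover have "G x $ i = 0" if "norm x > R" for x using Gz[OF that] by simp
    ultimately show "\<exists>d>0. \<forall>\<epsilon> \<eta>. \<epsilon> \<le> d \<longrightarrow> mollifier \<epsilon> \<eta> \<longrightarrow> (\<integral>\<^sup>+x. ennreal ((G x $ i - conv (\<lambda>x. G x $ i) \<eta> x)\<^sup>2) \<partial>lborel) \<le> ennreal (e/n)"
      by (intro mollify_L2[OF Gm, of R])
  qed
  from choice[OF this] obtain d where d': "\<forall>i. d i > 0 \<and> (\<forall>\<epsilon> \<eta>. \<epsilon> \<le> d i \<longrightarrow> mollifier \<epsilon> \<eta> \<longrightarrow> (\<integral>\<^sup>+x. ennreal ((G x $ i - conv (\<lambda>x. G x $ i) \<eta> x)\<^sup>2) \<partial>lborel) \<le> ennreal (e/n))"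
    by blast
  then have d: "\<And>i. d i > 0" "\<And>i \<epsilon> \<eta>. \<epsilon> \<le> d i \<Longrightarrow> mollifier \<epsilon> \<eta> \<Longrightarrow> (\<integral>\<^sup>+x. ennreal ((G x $ i - conv (\<lambda>x. G x $ i) \<eta> x)\<^sup>2) \<partial>lborel) \<le> ennreal (e/n)"
    by blast+
  define \<epsilon> where "\<epsilon> = min d0 (Min (range d))"
  have \<epsilon>: "0 < \<epsilon>" "\<epsilon> \<le> d0" "\<epsilon> \<le> d i" for i
    using d0(1) d(1) by (auto simp: \<epsilon>_def intro: min.coboundedI2 Min_le)
  obtain \<eta> :: "real^'n \<Rightarrow> real" where m: "mollifier \<epsilon> \<eta>" using mollifier_ex[OF \<epsilon>(1)] by blast
  note t = mollifierD(1)[OF m]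
  have fi: "integrable lebesgue f" by (rule integrable_L2_zero_outside[OF fm fz])
  have tc: "test_fun (conv f \<eta>)" by (rule test_fun_conv[OF fi fz t])
  \<comment> \<open>The weak gradient is tested with the reflected kernel; the sign from reflecting
    cancels the one in the definition.\<close>
  have gr: "grad (conv f \<eta>) x $ i = conv (\<lambda>x. G x $ i) \<eta> x" for x i
  proof -
    have "grad (conv f \<eta>) x $ i = (LINT y|lebesgue. f y * partial i \<eta> (x - y))"
      by (simp add: grad_def partial_conv[OF fi t] conv_def)
    also have "\<dots> = - (LINT y|lebesgue. f y * partial i (\<lambda>y. \<eta> (x - y)) y)"
      by (simp add: partial_reflect[OF t])
    also have "\<dots> = (LINT y|lebesgue. G y $ i * \<eta> (x - y))"
      using w test_fun_reflect[OF t, of x] by (simp add: is_weak_grad_def)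
    finally show ?thesis by (simp add: conv_def)
  qed
  have "(\<integral>\<^sup>+x. ennreal ((norm (G x - grad (conv f \<eta>) x))\<^sup>2) \<partial>lebesgue) =
     (\<integral>\<^sup>+x. (\<Sum>i\<in>UNIV. ennreal ((G x $ i - conv (\<lambda>x. G x $ i) \<eta> x)\<^sup>2)) \<partial>lebesgue)"
    by (simp add: norm_power2_eq_sum gr)
  also have "\<dots> = (\<Sum>i\<in>UNIV. (\<integral>\<^sup>+x. ennreal ((G x $ i - conv (\<lambda>x. G x $ i) \<eta> x)\<^sup>2) \<partial>lebesgue))"
  proof (rule nn_integral_sum)
    fix i
    have "conv (\<lambda>x. G x $ i) \<eta> \<in> borel_measurable lebesgue"
      unfolding gr[symmetric, abs_def] using test_fun_continuous[OF test_fun_partial[OF tc]]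
      by (intro borel_measurable_lebesgueI) (simp add: grad_def)
    with Gm(1)[of i] show "(\<lambda>x. ennreal ((G x $ i - conv (\<lambda>x. G x $ i) \<eta> x)\<^sup>2)) \<in> borel_measurable lebesgue" by measurable
  qed
  also have "\<dots> \<le> (\<Sum>i\<in>(UNIV::'n set). ennreal (e/n))"
    unfolding nn_integral_completion by (intro sum_mono d(2)[OF \<epsilon>(3) m])
  also have "\<dots> = ennreal (\<Sum>i\<in>(UNIV::'n set). e/n)" using e n by (intro sum_ennreal) auto
  also have "(\<Sum>i\<in>(UNIV::'n set). e/n) = e" using n by (simp add: n_def)
  finally have "(\<integral>\<^sup>+x. ennreal ((norm (G x - grad (conv f \<eta>) x))\<^sup>2) \<partial>lebesgue) \<le> ennreal e" .
  moreover have "(\<integral>\<^sup>+x. ennreal ((f x - conv f \<eta> x)\<^sup>2) \<partial>lebesgue) \<le> ennreal e"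
    unfolding nn_integral_completion by (rule d0(2)[OF \<epsilon>(2) m])
  ultimately show ?thesis using tc by blast
qed

text \<open>This makes cutoffs of the solution admissible in the weak formulation.\<close>

lemma H1_0_compact:
  fixes f :: "real^'n \<Rightarrow> real"
  assumes w: "is_weak_grad f G" and f: "L2 f" and G: "L2 G" 
    and fz: "\<And>x. norm x > R \<Longrightarrow> f x = 0" and Gz: "\<And>x. norm x > R \<Longrightarrow> G x = 0"
  shows "H1_0 f"
  unfolding H1_0_def
proof (intro conjI allI impI)
  show "H1 f" using w f G by (auto simp: H1_def)
  fix \<epsilon> :: real assume \<epsilon>: "\<epsilon> > 0"
  \<comment> \<open>The two squared errors add up to half of \<open>\<epsilon>\<^sup>2\<close>, so
    the norm is strictly below \<open>\<epsilon>\<close>.\<close>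
  define e where "e = \<epsilon>\<^sup>2 / 4"
  have e: "e > 0" using \<epsilon> by (simp add: e_def)
  obtain \<phi> where \<phi>: "test_fun \<phi>" "(\<integral>\<^sup>+x. ennreal ((f x - \<phi> x)\<^sup>2) \<partial>lebesgue) \<le> ennreal e"
     "(\<integral>\<^sup>+x. ennreal ((norm (G x - grad \<phi> x))\<^sup>2) \<partial>lebesgue) \<le> ennreal e"
    using compact_weak_grad_approx[OF assms e] by blast
  let ?v = "\<lambda>x. f x - \<phi> x"
  have wd: "is_weak_grad ?v (\<lambda>x. G x - grad \<phi> x)" by (rule is_weak_grad_diff[OF w is_weak_grad_test[OF \<phi>(1)]])
  note wg = weak_grad_AE[OF wd]
  have m1: "?v \<in> borel_measurable lebesgue" and m2: "weak_grad ?v \<in> borel_measurable lebesgue"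
    and m3: "(\<lambda>x. G x - grad \<phi> x) \<in> borel_measurable lebesgue"
    using wg(1) wd by (auto simp: is_weak_grad_def Lp_loc_1_iff)
  have "(LINT x|lebesgue. (?v x)\<^sup>2 + (norm (weak_grad ?v x))\<^sup>2) \<le> 2 * e"
  proof (rule integral_le_of_nn_integral)
    show "(\<lambda>x. (?v x)\<^sup>2 + (norm (weak_grad ?v x))\<^sup>2) \<in> borel_measurable lebesgue" using m1 m2 by measurable
    have "(\<integral>\<^sup>+x. ennreal ((?v x)\<^sup>2 + (norm (weak_grad ?v x))\<^sup>2) \<partial>lebesgue) =
      (\<integral>\<^sup>+x. ennreal ((?v x)\<^sup>2) + ennreal ((norm (G x - grad \<phi> x))\<^sup>2) \<partial>lebesgue)"
      using wg(2) by (intro nn_integral_cong_AE) auto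
    also have "\<dots> = (\<integral>\<^sup>+x. ennreal ((?v x)\<^sup>2) \<partial>lebesgue) + (\<integral>\<^sup>+x. ennreal ((norm (G x - grad \<phi> x))\<^sup>2) \<partial>lebesgue)"
      using borel_measurable_power[OF m1] borel_measurable_power[OF measurable_compose[OF m3 borel_measurable_norm]]
      by (intro nn_integral_add) auto
    also have "\<dots> \<le> ennreal e + ennreal e" by (intro add_mono \<phi>)
    also have "\<dots> = ennreal (2 * e)" using e by (simp add: ennreal_plus[symmetric] del: ennreal_plus)
    finally show "(\<integral>\<^sup>+x. ennreal ((?v x)\<^sup>2 + (norm (weak_grad ?v x))\<^sup>2) \<partial>lebesgue) \<le> ennreal (2 * e)" .
  qed (use e in auto)
  then have "H1_norm ?v \<le> sqrt (2 * e)" by (simp add: H1_norm_def)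
  also have "\<dots> < sqrt (\<epsilon>\<^sup>2)" using \<epsilon> by (intro real_sqrt_less_mono) (simp add: e_def)
  also have "\<dots> = \<epsilon>" using \<epsilon> by simp
  finally show "\<exists>\<phi>. test_fun \<phi> \<and> H1_norm (\<lambda>x. f x - \<phi> x) < \<epsilon>" using \<phi>(1) by blast
qed

lemma Lp_loc_2_norm_mult_bounded:
  fixes f :: "real^'n \<Rightarrow> 'b::euclidean_space" and h :: "real^'n \<Rightarrow> 'c::euclidean_space"
  assumes f: "Lp_loc 2 f" and h: "h \<in> borel_measurable lebesgue" and \<psi>: "continuous_on UNIV \<psi>" "\<And>x. norm x > R \<Longrightarrow> \<psi> x = 0"
    and le: "\<And>x. norm (h x) \<le> \<bar>\<psi> x\<bar> * norm (f x)"
  shows "L2 h"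
  unfolding L2_def
proof (intro conjI h)
  have i: "set_integrable lebesgue (cball 0 R) (\<lambda>x. (norm (f x))\<^sup>2)" using f by (simp add: Lp_loc_2_iff)
  have "bounded (\<psi> ` cball 0 R)"
    by (intro compact_imp_bounded compact_continuous_image continuous_on_subset[OF \<psi>(1)]) auto
  then obtain B where B: "B > 0" "\<And>x. x \<in> cball 0 R \<Longrightarrow> \<bar>\<psi> x\<bar> \<le> B" by (auto simp: bounded_pos)
  show "integrable lebesgue (\<lambda>x. (norm (h x))\<^sup>2)"
  proof (rule Bochner_Integration.integrable_bound)
    show "integrable lebesgue (\<lambda>x. B\<^sup>2 * (indicator (cball 0 R) x *\<^sub>R (norm (f x))\<^sup>2))"
      using i unfolding set_integrable_def by (rule integrable_mult_right)
    show "(\<lambda>x. (norm (h x))\<^sup>2) \<in> borel_measurable lebesgue" using h by measurable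
    show "AE x in lebesgue. norm ((norm (h x))\<^sup>2) \<le> norm (B\<^sup>2 * (indicator (cball 0 R) x *\<^sub>R (norm (f x))\<^sup>2))"
    proof (rule AE_I2)
      fix x
      show "norm ((norm (h x))\<^sup>2) \<le> norm (B\<^sup>2 * (indicator (cball 0 R) x *\<^sub>R (norm (f x))\<^sup>2))"
      proof (cases "norm x > R")
        case True then show ?thesis using le[of x] \<psi>(2)[of x] by simp
      next
        case False
        then have "norm (h x) \<le> B * norm (f x)"
          using le[of x] B(2)[of x] mult_right_mono[of "\<bar>\<psi> x\<bar>" B "norm (f x)"] by auto
        then have "(norm (h x))\<^sup>2 \<le> (B * norm (f x))\<^sup>2" by (intro power_mono) auto
        then show ?thesis using False by (simp add: power_mult_distrib)
      qed
    qed
  qed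
qed

lemma L2_add:
  fixes f g :: "real^'n \<Rightarrow> 'b::euclidean_space"
  assumes "L2 f" "L2 g" shows "L2 (\<lambda>x. f x + g x)"
  unfolding L2_def
proof
  have m: "f \<in> borel_measurable lebesgue" "g \<in> borel_measurable lebesgue"
   and i: "integrable lebesgue (\<lambda>x. (norm (f x))\<^sup>2)" "integrable lebesgue (\<lambda>x. (norm (g x))\<^sup>2)"
    using assms by (auto simp: L2_def)
  show m2: "(\<lambda>x. f x + g x) \<in> borel_measurable lebesgue" using m by (rule borel_measurable_add)
  show "integrable lebesgue (\<lambda>x. (norm (f x + g x))\<^sup>2)"
  proof (rule Bochner_Integration.integrable_bound)
    show "integrable lebesgue (\<lambda>x. 2 * (norm (f x))\<^sup>2 + 2 * (norm (g x))\<^sup>2)" using i by auto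
    show "(\<lambda>x. (norm (f x + g x))\<^sup>2) \<in> borel_measurable lebesgue" using m2 by measurable
    have "(norm (f x + g x))\<^sup>2 \<le> 2 * (norm (f x))\<^sup>2 + 2 * (norm (g x))\<^sup>2" for x
    proof -
      have "(norm (f x + g x))\<^sup>2 \<le> (norm (f x) + norm (g x))\<^sup>2" by (intro power_mono norm_triangle_ineq) auto
      also have "\<dots> \<le> 2 * (norm (f x))\<^sup>2 + 2 * (norm (g x))\<^sup>2"
        using zero_le_power2[of "norm (f x) - norm (g x)"] by (simp add: power2_eq_square algebra_simps)
      finally show ?thesis .
    qed
    then show "AE x in lebesgue. norm ((norm (f x + g x))\<^sup>2) \<le> norm (2 * (norm (f x))\<^sup>2 + 2 * (norm (g x))\<^sup>2)"
      by (intro AE_I2) auto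
  qed
qed

lemma grad_zero_outside:
  fixes f :: "real^'n \<Rightarrow> real"
  assumes "\<And>x. norm x > R \<Longrightarrow> f x = 0" "norm x > R"
  shows "grad f x = 0"
  using partial_zero_outside[where f=f, OF assms] by (simp add: grad_def vec_eq_iff)

lemma H1_loc_weak_grad:
  assumes "H1_loc u"
  shows "Lp_loc 2 u" "is_weak_grad u (weak_grad u)" "Lp_loc 2 (weak_grad u)"
proof -
  obtain g where g: "is_weak_grad u g" "Lp_loc 2 g" and u: "Lp_loc 2 u" using assms by (auto simp: H1_loc_def)
  note w = weak_grad_AE[OF g(1)]
  show "Lp_loc 2 u" "is_weak_grad u (weak_grad u)" by (rule u w)+
  have m: "weak_grad u \<in> borel_measurable lebesgue" using w(1) by (simp add: is_weak_grad_def Lp_loc_1_iff)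
  show "Lp_loc 2 (weak_grad u)" unfolding Lp_loc_2_iff
  proof (intro conjI allI impI m)
    fix K :: "(real^'a) set" assume K: "compact K"
    have i: "integrable lebesgue (\<lambda>x. indicator K x *\<^sub>R (norm (g x))\<^sup>2)"
      using g(2) K by (simp add: Lp_loc_2_iff set_integrable_def)
    have Ks: "K \<in> sets lebesgue" using K by (simp add: compact_imp_closed)
    show "set_integrable lebesgue K (\<lambda>x. (norm (weak_grad u x))\<^sup>2)" unfolding set_integrable_def
    proof (rule Bochner_Integration.integrable_bound[OF i])
      have "(\<lambda>x. (norm (weak_grad u x))\<^sup>2) \<in> borel_measurable lebesgue" using m by measurable
      then show "(\<lambda>x. indicator K x *\<^sub>R (norm (weak_grad u x))\<^sup>2) \<in> borel_measurable lebesgue"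
        using Ks by (intro borel_measurable_scaleR borel_measurable_indicator)
      show "AE x in lebesgue. norm (indicator K x *\<^sub>R (norm (weak_grad u x))\<^sup>2) \<le> norm (indicator K x *\<^sub>R (norm (g x))\<^sup>2)"
        using w(2) by eventually_elim simp
    qed
  qed
qed

lemma H1_loc_mult_test:
  fixes u :: "real^'n \<Rightarrow> real"
  assumes u: "H1_loc u" and \<psi>: "test_fun \<psi>" "\<And>x. norm x > R \<Longrightarrow> \<psi> x = 0"
  defines "G \<equiv> (\<lambda>x. \<psi> x *\<^sub>R weak_grad u x + u x *\<^sub>R grad \<psi> x)"
  shows "is_weak_grad (\<lambda>x. u x * \<psi> x) G" "L2 (\<lambda>x. u x * \<psi> x)" "L2 G" "norm x > R \<Longrightarrow> G x = 0"
    "H1_0 (\<lambda>x. u x * \<psi> x)"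
proof -
  note w = H1_loc_weak_grad[OF u]
  show W: "is_weak_grad (\<lambda>x. u x * \<psi> x) G" unfolding G_def by (rule is_weak_grad_mult_test[OF w(2) \<psi>(1)])
  note c = test_fun_continuous[OF \<psi>(1), of UNIV]
  have um: "u \<in> borel_measurable lebesgue" "weak_grad u \<in> borel_measurable lebesgue"
    using w by (auto simp: Lp_loc_2_iff)
  have \<psi>m: "\<psi> \<in> borel_measurable lebesgue" "grad \<psi> \<in> borel_measurable lebesgue"
    by (auto intro!: borel_measurable_lebesgueI c continuous_grad \<psi>)
  show l: "L2 (\<lambda>x. u x * \<psi> x)"
    by (rule Lp_loc_2_norm_mult_bounded[OF w(1) _ c \<psi>(2)])
       (use um \<psi>m in \<open>auto intro!: borel_measurable_times simp: abs_mult\<close>)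
  have gz: "grad \<psi> x = 0" if "norm x > R" for x by (rule grad_zero_outside[OF \<psi>(2) that])
  have l1: "L2 (\<lambda>x. \<psi> x *\<^sub>R weak_grad u x)"
    by (rule Lp_loc_2_norm_mult_bounded[OF w(3) _ c \<psi>(2)]) (use um \<psi>m in \<open>auto intro!: borel_measurable_scaleR\<close>)
  have l2: "L2 (\<lambda>x. u x *\<^sub>R grad \<psi> x)"
    by (rule Lp_loc_2_norm_mult_bounded[OF w(1), of _ "\<lambda>x. norm (grad \<psi> x)" R])
       (use um \<psi>m gz in \<open>auto intro!: borel_measurable_scaleR continuous_on_norm continuous_grad \<psi>\<close>)
  show L: "L2 G" unfolding G_def by (rule L2_add[OF l1 l2])
  show z: "G x = 0" if "norm x > R" for x using that \<psi>(2) gz by (simp add: G_def)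
  show "H1_0 (\<lambda>x. u x * \<psi> x)"
    by (rule H1_0_compact[OF W l L, of R]) (use z \<psi>(2) in auto)
qed

section \<open>Caccioppoli inequality\<close>

lemma grad_square:
  assumes "test_fun \<psi>" shows "grad (\<lambda>x. \<psi> x * \<psi> x) x = (2 * \<psi> x) *\<^sub>R grad \<psi> x"
  by (simp add: vec_eq_iff grad_def partial_mult test_fun_differentiable[OF assms])

text \<open>The equation is tested with \<open>u\<close> times the square of \<open>\<psi>\<close>,
  and the cross term is absorbed into half of the ellipticity. Only the whole integrand of the
  equation is known to be integrable, so the estimate is made pointwise and integrated as a
  nonnegative function; finiteness of the potential term is then part of the result.\<close>

lemma caccioppoli:
  fixes A :: "real^'n \<Rightarrow> real^'n^'n" and u V :: "real^'n \<Rightarrow> real"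
  assumes A: "bounded_elliptic lam Lam A" "0 < lam" "0 < Lam" and u: "weak_solution A V u"
    and V: "V \<in> borel_measurable lebesgue" "AE x in lebesgue. V x > 0" and \<psi>: "test_fun \<psi>"
  shows "(\<integral>\<^sup>+x. ennreal (lam / 2 * ((\<psi> x)\<^sup>2 * (norm (weak_grad u x))\<^sup>2) + V x * (u x)\<^sup>2 * (\<psi> x)\<^sup>2) \<partial>lebesgue)
    \<le> ennreal (2 * Lam\<^sup>2 / lam) * (\<integral>\<^sup>+x. ennreal ((u x)\<^sup>2 * (norm (grad \<psi> x))\<^sup>2) \<partial>lebesgue)"
proof -
  let ?\<phi> = "\<lambda>x. u x * (\<psi> x * \<psi> x)"
  let ?c = "2 * Lam\<^sup>2 / lam"
  have H: "H1_loc u" using u by (simp add: weak_solution_def)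
  obtain R where R: "\<And>x. norm x > R \<Longrightarrow> \<psi> x = 0" using test_fun_support[OF \<psi>] by blast
  have \<psi>2: "test_fun (\<lambda>x. \<psi> x * \<psi> x)" by (intro test_fun_mult \<psi>)
  note p = H1_loc_mult_test[OF H \<psi>2, of R] 
  have "ae_compact_support ?\<phi>"
    unfolding ae_compact_support_def by (intro exI[of _ "cball 0 R"] conjI AE_I2) (use R in auto)
  moreover have "H1_0 ?\<phi>" using p(5) R by auto
  ultimately have I: "has_bochner_integral lebesgue (\<lambda>x. (A x *v weak_grad u x) \<bullet> weak_grad ?\<phi> x + V x * u x * ?\<phi> x) 0"
    using u by (simp add: weak_solution_def)
  have wg: "AE x in lebesgue. weak_grad ?\<phi> x = (\<psi> x * \<psi> x) *\<^sub>R weak_grad u x + u x *\<^sub>R grad (\<lambda>x. \<psi> x * \<psi> x) x"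
    by (rule weak_grad_AE(2)[OF p(1)]) (use R in auto)
  let ?W = "\<lambda>x. (u x)\<^sup>2 * (norm (grad \<psi> x))\<^sup>2"
  let ?I = "\<lambda>x. (A x *v weak_grad u x) \<bullet> weak_grad ?\<phi> x + V x * u x * ?\<phi> x"
  let ?H = "\<lambda>x. lam / 2 * ((\<psi> x)\<^sup>2 * (norm (weak_grad u x))\<^sup>2) + V x * (u x)\<^sup>2 * (\<psi> x)\<^sup>2"
  have W: "integrable lebesgue ?W"
  proof -
    note w = H1_loc_weak_grad[OF H]
    have "L2 (\<lambda>x. u x *\<^sub>R grad \<psi> x)"
    proof (rule Lp_loc_2_norm_mult_bounded[OF w(1), of _ "\<lambda>x. norm (grad \<psi> x)" R])
      show "(\<lambda>x. u x *\<^sub>R grad \<psi> x) \<in> borel_measurable lebesgue"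
        using w(1) borel_measurable_lebesgueI[OF continuous_grad[OF \<psi>]] by (intro borel_measurable_scaleR) (simp_all add: Lp_loc_2_iff)
      show "norm (grad \<psi> x) = 0" if "norm x > R" for x using grad_zero_outside[OF R that] by simp
    qed (auto intro!: continuous_on_norm continuous_grad \<psi>)
    then show ?thesis by (simp add: L2_def power_mult_distrib)
  qed
  have "AE x in lebesgue. 0 \<le> ?H x \<and> ?H x \<le> ?I x + ?c * ?W x"
    using A(1)[unfolded bounded_elliptic_def, THEN conjunct2] V(2) wg
  proof eventually_elim
    case (elim x)
    let ?g = "weak_grad u x" and ?d = "grad \<psi> x"
    define a where "a = \<bar>\<psi> x\<bar> * norm ?g"
    define b where "b = \<bar>u x\<bar> * norm ?d"
    have e1: "(A x *v ?g) \<bullet> ?g \<ge> lam * (norm ?g)\<^sup>2" using elim(1) by blast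
    have e2: "\<bar>(A x *v ?g) \<bullet> ?d\<bar> \<le> Lam * norm ?g * norm ?d" using elim(1) by blast
    have f1: "(A x *v ?g) \<bullet> weak_grad ?\<phi> x = (\<psi> x)\<^sup>2 * ((A x *v ?g) \<bullet> ?g) + 2 * (u x * \<psi> x * ((A x *v ?g) \<bullet> ?d))"
      unfolding elim(3) grad_square[OF \<psi>] by (simp add: inner_add_right power2_eq_square)
    have f2: "(\<psi> x)\<^sup>2 * ((A x *v ?g) \<bullet> ?g) \<ge> lam * a\<^sup>2"
      using mult_left_mono[OF e1, of "(\<psi> x)\<^sup>2"] by (simp add: a_def power_mult_distrib mult.left_commute)
    have "\<bar>u x * \<psi> x\<bar> * \<bar>(A x *v ?g) \<bullet> ?d\<bar> \<le> Lam * (a * b)"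
      using mult_left_mono[OF e2, of "\<bar>u x * \<psi> x\<bar>"] by (simp add: a_def b_def abs_mult mult_ac)
    then have f3: "u x * \<psi> x * ((A x *v ?g) \<bullet> ?d) \<ge> - (Lam * (a * b))"
      unfolding abs_mult[symmetric] by linarith
    \<comment> \<open>Completing the square is what fixes the constant
      \<open>2 * Lam\<^sup>2 / lam\<close>.\<close>
    have "lam / 2 * a\<^sup>2 - 2 * (Lam * (a * b)) + ?c * b\<^sup>2 = lam / 2 * (a - 2 * Lam / lam * b)\<^sup>2"
      using A(2) by (simp add: power2_eq_square field_simps)
    moreover have "lam / 2 * (a - 2 * Lam / lam * b)\<^sup>2 \<ge> 0" using A(2) by simp
    ultimately have "lam / 2 * a\<^sup>2 \<le> lam * a\<^sup>2 - 2 * (Lam * (a * b)) + ?c * b\<^sup>2" by linarith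
    moreover have "?H x = lam / 2 * a\<^sup>2 + V x * u x * ?\<phi> x"
      by (simp add: a_def power_mult_distrib power2_eq_square)
    ultimately have "?H x \<le> ?I x + ?c * b\<^sup>2" using f1 f2 f3 by linarith
    moreover have "?W x = b\<^sup>2" by (simp add: b_def power_mult_distrib)
    moreover have "0 \<le> ?H x" using A(2) elim(2) by simp
    ultimately show ?case by simp
  qed
  then have AE: "AE x in lebesgue. ?H x \<le> ?I x + ?c * ?W x" "AE x in lebesgue. 0 \<le> ?I x + ?c * ?W x"
    by (eventually_elim; linarith)+
  have i: "integrable lebesgue (\<lambda>x. ?I x + ?c * ?W x)" "(LINT x|lebesgue. ?I x + ?c * ?W x) = ?c * (LINT x|lebesgue. ?W x)"
    using I W by (auto simp: has_bochner_integral_iff)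
  have "(\<integral>\<^sup>+x. ennreal (?H x) \<partial>lebesgue) \<le> (\<integral>\<^sup>+x. ennreal (?I x + ?c * ?W x) \<partial>lebesgue)"
    using AE(1) by (intro nn_integral_mono_AE) (auto intro: ennreal_leI)
  also have "\<dots> = ennreal (?c * (LINT x|lebesgue. ?W x))"
    using nn_integral_eq_integral[OF i(1) AE(2)] i(2) by simp
  also have "\<dots> = ennreal ?c * ennreal (LINT x|lebesgue. ?W x)"
    using A(2) by (intro ennreal_mult integral_nonneg_AE AE_I2) auto
  also have "ennreal (LINT x|lebesgue. ?W x) = (\<integral>\<^sup>+x. ennreal (?W x) \<partial>lebesgue)"
    by (rule nn_integral_eq_integral[OF W, symmetric]) auto
  finally show ?thesis .
qed

section \<open>Poincare inequality on balls\<close>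

text \<open>Jensen's inequality, again from the nonnegative variance around the mean
  \<open>c\<close>.\<close>

lemma square_integral_unit_interval_le:
  fixes h :: "real \<Rightarrow> real"
  assumes h: "continuous_on {0..1} h"
  shows "ennreal ((LINT t|lborel. indicator {0..1} t *\<^sub>R h t)\<^sup>2) \<le> (\<integral>\<^sup>+t. ennreal ((h t)\<^sup>2) * indicator {0..1} t \<partial>lborel)"
proof -
  define c where "c = (LINT t|lborel. indicator {0..1} t *\<^sub>R h t)"
  have i: "integrable lborel (\<lambda>t. indicator {0..1} t *\<^sub>R h t)" "integrable lborel (\<lambda>t. indicator {0..1} t *\<^sub>R (h t)\<^sup>2)"
    by (intro borel_integrable_compact h continuous_intros; simp)+
  have i1: "integrable lborel (\<lambda>t. indicator {0..1::real} t *\<^sub>R (1::real))"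
    by (rule borel_integrable_compact) auto
  have "0 \<le> (LINT t|lborel. indicator {0..1} t *\<^sub>R (h t - c)\<^sup>2)"
    by (intro integral_nonneg_AE AE_I2) auto
  also have "\<dots> = (LINT t|lborel. indicator {0..1} t *\<^sub>R (h t)\<^sup>2 - (2 * c) * (indicator {0..1} t *\<^sub>R h t) + c\<^sup>2 * (indicator {0..1} t *\<^sub>R 1))"
    by (intro Bochner_Integration.integral_cong) (auto simp: power2_diff algebra_simps)
  also have "\<dots> = (LINT t|lborel. indicator {0..1} t *\<^sub>R (h t)\<^sup>2) - 2 * c * c + c\<^sup>2 * (LINT t|lborel. indicator {0..1::real} t *\<^sub>R 1)"
    using i i1 by (simp add: c_def)
  also have "(LINT t|lborel. indicator {0..1::real} t *\<^sub>R (1::real)) = 1" by simp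
  finally have "c\<^sup>2 \<le> (LINT t|lborel. indicator {0..1} t *\<^sub>R (h t)\<^sup>2)" by (simp add: power2_eq_square)
  then have "ennreal (c\<^sup>2) \<le> ennreal (LINT t|lborel. indicator {0..1} t *\<^sub>R (h t)\<^sup>2)" by (rule ennreal_leI)
  also have "\<dots> = (\<integral>\<^sup>+t. ennreal (indicator {0..1} t *\<^sub>R (h t)\<^sup>2) \<partial>lborel)"
    by (rule nn_integral_eq_integral[symmetric, OF i(2)]) auto
  also have "\<dots> = (\<integral>\<^sup>+t. ennreal ((h t)\<^sup>2) * indicator {0..1} t \<partial>lborel)"
    by (intro nn_integral_cong) (auto simp: indicator_def)
  finally show ?thesis by (simp add: c_def)
qed

lemma segment_increment_le:
  fixes f :: "real^'n \<Rightarrow> real"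
  assumes f: "test_fun f"
  shows "ennreal ((f b - f a)\<^sup>2) \<le> ennreal ((norm (b - a))\<^sup>2) * (\<integral>\<^sup>+t. ennreal ((norm (grad f (a + t *\<^sub>R (b - a))))\<^sup>2) * indicator {0..1} t \<partial>lborel)"
proof -
  let ?h = "\<lambda>t. grad f (a + t *\<^sub>R (b - a)) \<bullet> (b - a)"
  have gc: "continuous_on UNIV (\<lambda>t. grad f (a + t *\<^sub>R (b - a)))"
    by (intro continuous_on_compose2[OF continuous_grad[OF f, of UNIV]] continuous_intros) auto
  have c: "continuous_on {0..1} ?h" by (intro continuous_intros continuous_on_subset[OF gc]) auto
  have d: "((\<lambda>t. f (a + t *\<^sub>R (b - a))) has_vector_derivative ?h t) (at t within {0..1})" for t
  proof -
    have "((\<lambda>t. a + t *\<^sub>R (b - a)) has_derivative (\<lambda>s. s *\<^sub>R (b - a))) (at t)"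
      by (auto intro!: derivative_eq_intros)
    from has_derivative_compose[OF this has_derivative_grad[OF test_fun_differentiable[OF f]]]
    have "((\<lambda>t. f (a + t *\<^sub>R (b - a))) has_derivative (\<lambda>s. s *\<^sub>R ?h t)) (at t)" by simp
    then show ?thesis unfolding has_vector_derivative_def by (rule has_derivative_at_withinI)
  qed
  have "(LINT t|lborel. indicator {0..1} t *\<^sub>R ?h t) = f (a + 1 *\<^sub>R (b - a)) - f (a + 0 *\<^sub>R (b - a))"
    by (rule integral_FTC_atLeastAtMost) (use c d in auto)
  then have "ennreal ((f b - f a)\<^sup>2) \<le> (\<integral>\<^sup>+t. ennreal ((?h t)\<^sup>2) * indicator {0..1} t \<partial>lborel)"
    using square_integral_unit_interval_le[OF c] by simp
  also have "\<dots> \<le> (\<integral>\<^sup>+t. ennreal ((norm (b - a))\<^sup>2) * (ennreal ((norm (grad f (a + t *\<^sub>R (b - a))))\<^sup>2) * indicator {0..1} t) \<partial>lborel)"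
  proof (rule nn_integral_mono)
    fix t
    have "\<bar>?h t\<bar> \<le> norm (b - a) * norm (grad f (a + t *\<^sub>R (b - a)))"
      using Cauchy_Schwarz_ineq2[of "grad f (a + t *\<^sub>R (b - a))" "b - a"] by (simp add: mult.commute)
    from power_mono[OF this abs_ge_zero, of 2]
    have "ennreal ((?h t)\<^sup>2) \<le> ennreal ((norm (b - a))\<^sup>2 * (norm (grad f (a + t *\<^sub>R (b - a))))\<^sup>2)"
      by (intro ennreal_leI) (simp add: power_mult_distrib)
    then show "ennreal ((?h t)\<^sup>2) * indicator {0..1} t \<le> ennreal ((norm (b - a))\<^sup>2) * (ennreal ((norm (grad f (a + t *\<^sub>R (b - a))))\<^sup>2) * indicator {0..1} t)"
      by (simp add: ennreal_mult indicator_def)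
  qed
  also have "\<dots> = ennreal ((norm (b - a))\<^sup>2) * (\<integral>\<^sup>+t. ennreal ((norm (grad f (a + t *\<^sub>R (b - a))))\<^sup>2) * indicator {0..1} t \<partial>lborel)"
  proof (rule nn_integral_cmult)
    have "(indicator {0..1} :: real \<Rightarrow> ennreal) \<in> borel_measurable lborel" by (rule borel_measurable_indicator) simp
    with borel_measurable_continuous_onI[OF gc]
    show "(\<lambda>t. ennreal ((norm (grad f (a + t *\<^sub>R (b - a))))\<^sup>2) * indicator {0..1} t) \<in> borel_measurable lborel"
      by measurable
  qed
  finally show ?thesis .
qed

lemma nn_integral_affine:
  fixes a :: "real^'n" and c :: real
  assumes [measurable]: "g \<in> borel_measurable borel" and c: "0 < c"
  shows "(\<integral>\<^sup>+y. g y \<partial>lborel) = ennreal (c ^ CARD('n)) * (\<integral>\<^sup>+y. g (a + c *\<^sub>R y) \<partial>lborel)"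
proof -
  have c0: "c \<noteq> 0" using c by simp
  show ?thesis
    by (subst lborel_affine[OF c0, of a])
       (use c in \<open>simp add: nn_integral_density nn_integral_distr nn_integral_cmult\<close>)
qed

text \<open>Integrating the gradient along the whole segment from \<open>x\<close> to
  \<open>y\<close> would contract the ball to a point at one end, with an unbounded Jacobian. Both
  values are therefore compared with the value at the midpoint: on the half segment towards
  \<open>y\<close> the map in the variable \<open>y\<close> contracts by at most 1/2, so its
  Jacobian costs at most \<open>2 ^ CARD('n)\<close>.\<close>

lemma double_difference_le:
  fixes f :: "real^'n \<Rightarrow> real" and z :: "real^'n"
  assumes f: "test_fun f" and r: "0 < r"
  defines "B \<equiv> ball z r"
  shows "(\<integral>\<^sup>+x. (\<integral>\<^sup>+y. ennreal ((f x - f y)\<^sup>2) * indicator B y \<partial>lborel) * indicator B x \<partial>lborel)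
    \<le> ennreal (4 * 2 ^ CARD('n) * r\<^sup>2 * measure lebesgue B) * (\<integral>\<^sup>+x. ennreal ((norm (grad f x))\<^sup>2) * indicator B x \<partial>lborel)"
proof -
  have Bm[measurable]: "B \<in> sets borel" by (simp add: B_def)
  have fm[measurable]: "f \<in> borel_measurable borel" by (intro borel_measurable_continuous_onI test_fun_continuous f)
  have gm[measurable]: "grad f \<in> borel_measurable borel" by (intro borel_measurable_continuous_onI continuous_grad f)
  let ?g = "\<lambda>x. ennreal ((norm (grad f x))\<^sup>2) * indicator B x"
  let ?m = "\<lambda>x y. (1/2) *\<^sub>R (x + y) :: real^'n"
  let ?D = "\<lambda>x y. ennreal ((f y - f (?m x y))\<^sup>2) * indicator B y * indicator B x"
  let ?I = "\<integral>\<^sup>+x. (\<integral>\<^sup>+y. ?D x y \<partial>lborel) \<partial>lborel"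
  have mm[measurable]: "(\<lambda>(x,y). f (?m x y)) \<in> borel_measurable (lborel \<Otimes>\<^sub>M lborel)" 
    by measurable
  have "(\<integral>\<^sup>+x. (\<integral>\<^sup>+y. ennreal ((f x - f y)\<^sup>2) * indicator B y \<partial>lborel) * indicator B x \<partial>lborel) =
    (\<integral>\<^sup>+x. (\<integral>\<^sup>+y. ennreal ((f x - f y)\<^sup>2) * indicator B y * indicator B x \<partial>lborel) \<partial>lborel)"
    by (intro nn_integral_cong nn_integral_multc[symmetric]) measurable
  also have "\<dots> \<le> (\<integral>\<^sup>+x. (\<integral>\<^sup>+y. 2 * ?D y x + 2 * ?D x y \<partial>lborel) \<partial>lborel)"
  proof (intro nn_integral_mono)
    fix x y
    have "(f x - f y)\<^sup>2 \<le> 2 * (f x - f (?m y x))\<^sup>2 + 2 * (f y - f (?m x y))\<^sup>2"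
      using zero_le_power2[of "(f x - f (?m x y)) + (f y - f (?m x y))"]
      by (simp add: power2_eq_square algebra_simps add.commute[of y x])
    then have "ennreal ((f x - f y)\<^sup>2) \<le> ennreal (2 * (f x - f (?m y x))\<^sup>2 + 2 * (f y - f (?m x y))\<^sup>2)" by (rule ennreal_leI)
    also have "\<dots> = 2 * ennreal ((f x - f (?m y x))\<^sup>2) + 2 * ennreal ((f y - f (?m x y))\<^sup>2)"
      by (simp add: ennreal_mult)
    finally show "ennreal ((f x - f y)\<^sup>2) * indicator B y * indicator B x \<le> 2 * ?D y x + 2 * ?D x y"
      by (simp add: indicator_def)
  qed
  also have "\<dots> = (\<integral>\<^sup>+x. 2 * (\<integral>\<^sup>+y. ?D y x \<partial>lborel) + 2 * (\<integral>\<^sup>+y. ?D x y \<partial>lborel) \<partial>lborel)"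
    by (intro nn_integral_cong) (simp add: nn_integral_add nn_integral_cmult)
  also have "\<dots> = 2 * (\<integral>\<^sup>+x. (\<integral>\<^sup>+y. ?D y x \<partial>lborel) \<partial>lborel) + 2 * ?I"
    by (subst nn_integral_add) (simp_all add: nn_integral_cmult)
  \<comment> \<open>Exchanging the roles of \<open>x\<close> and \<open>y\<close> turns the half
    segment towards \<open>x\<close> into the one towards \<open>y\<close>.\<close>
  also have "(\<integral>\<^sup>+x. (\<integral>\<^sup>+y. ?D y x \<partial>lborel) \<partial>lborel) = ?I"
    by (rule lborel_pair.Fubini') measurable
  also have "2 * ?I + 2 * ?I = 4 * ?I" by (simp add: distrib_right[symmetric])
  finally have A1: "(\<integral>\<^sup>+x. (\<integral>\<^sup>+y. ennreal ((f x - f y)\<^sup>2) * indicator B y \<partial>lborel) * indicator B x \<partial>lborel) \<le> 4 * ?I" .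
  have "?I \<le> (\<integral>\<^sup>+x. ennreal (r\<^sup>2 * 2 ^ CARD('n)) * (\<integral>\<^sup>+y. ?g y \<partial>lborel) * indicator B x \<partial>lborel)"
  proof (rule nn_integral_mono)
    fix x
    show "(\<integral>\<^sup>+y. ?D x y \<partial>lborel) \<le> ennreal (r\<^sup>2 * 2 ^ CARD('n)) * (\<integral>\<^sup>+y. ?g y \<partial>lborel) * indicator B x"
    proof (cases "x \<in> B")
      case True
      \<comment> \<open>The coefficient of \<open>y\<close> on the half segment from the midpoint to
        \<open>y\<close>; it runs from 1/2 to 1.\<close>
      define c where "c t = (1 + t) / 2" for t :: real
      have "(\<integral>\<^sup>+y. ?D x y \<partial>lborel) \<le> (\<integral>\<^sup>+y. (\<integral>\<^sup>+t. ennreal (r\<^sup>2) * (?g ((1 - c t) *\<^sub>R x + c t *\<^sub>R y) * indicator {0..1} t) \<partial>lborel) \<partial>lborel)"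
      proof (rule nn_integral_mono)
        fix y
        show "?D x y \<le> (\<integral>\<^sup>+t. ennreal (r\<^sup>2) * (?g ((1 - c t) *\<^sub>R x + c t *\<^sub>R y) * indicator {0..1} t) \<partial>lborel)"
        proof (cases "y \<in> B")
          case y: True
          have e: "y - ?m x y = (1/2) *\<^sub>R (y - x)" by (simp add: algebra_simps flip: scaleR_left.add)
          have "dist x y < 2 * r" using True y dist_triangle[of x y z] by (simp add: B_def dist_commute)
          then have n: "norm (y - ?m x y) \<le> r" unfolding e by (simp add: dist_norm norm_minus_commute)
          have p: "?m x y + t *\<^sub>R (y - ?m x y) = (1 - c t) *\<^sub>R x + c t *\<^sub>R y" for t
            unfolding e by (simp add: c_def algebra_simps add_divide_distrib)
          have inB: "(1 - c t) *\<^sub>R x + c t *\<^sub>R y \<in> B" if "t \<in> {0..1}" for t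
            using convexD_alt[of B x y "c t"] True y that by (auto simp: B_def c_def)
          have gle: "ennreal ((norm (grad f ((1 - c t) *\<^sub>R x + c t *\<^sub>R y)))\<^sup>2) * indicator {0..1} t \<le> ?g ((1 - c t) *\<^sub>R x + c t *\<^sub>R y) * indicator {0..1} t" for t
            using inB[of t] by (cases "t \<in> {0..1}") simp_all
          have "ennreal ((f y - f (?m x y))\<^sup>2) \<le> ennreal ((norm (y - ?m x y))\<^sup>2) *
             (\<integral>\<^sup>+t. ennreal ((norm (grad f ((1 - c t) *\<^sub>R x + c t *\<^sub>R y)))\<^sup>2) * indicator {0..1} t \<partial>lborel)"
            using segment_increment_le[OF f, of y "?m x y"] unfolding p .
          also have "\<dots> \<le> ennreal (r\<^sup>2) * (\<integral>\<^sup>+t. ?g ((1 - c t) *\<^sub>R x + c t *\<^sub>R y) * indicator {0..1} t \<partial>lborel)"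
            by (rule mult_mono[OF ennreal_leI[OF power_mono[OF n norm_ge_zero]] nn_integral_mono[OF gle]]) auto
          also have "\<dots> = (\<integral>\<^sup>+t. ennreal (r\<^sup>2) * (?g ((1 - c t) *\<^sub>R x + c t *\<^sub>R y) * indicator {0..1} t) \<partial>lborel)"
            unfolding c_def by (intro nn_integral_cmult[symmetric]) measurable
          finally show ?thesis using True y by simp
        qed simp
      qed
      also have "\<dots> = (\<integral>\<^sup>+t. (\<integral>\<^sup>+y. ennreal (r\<^sup>2) * (?g ((1 - c t) *\<^sub>R x + c t *\<^sub>R y) * indicator {0..1} t) \<partial>lborel) \<partial>lborel)"
        unfolding c_def by (rule lborel_pair.Fubini') measurable
      also have "\<dots> \<le> (\<integral>\<^sup>+t. (ennreal (r\<^sup>2 * 2 ^ CARD('n)) * (\<integral>\<^sup>+y. ?g y \<partial>lborel)) * indicator {0..1::real} t \<partial>lborel)"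
      proof (rule nn_integral_mono)
        fix t :: real
        show "(\<integral>\<^sup>+y. ennreal (r\<^sup>2) * (?g ((1 - c t) *\<^sub>R x + c t *\<^sub>R y) * indicator {0..1} t) \<partial>lborel)
          \<le> (ennreal (r\<^sup>2 * 2 ^ CARD('n)) * (\<integral>\<^sup>+y. ?g y \<partial>lborel)) * indicator {0..1::real} t"
        proof (cases "t \<in> {0..1}")
          case t: True
          have c: "1/2 \<le> c t" "0 < c t" using t by (auto simp: c_def)
          have "(\<integral>\<^sup>+y. ennreal (r\<^sup>2) * (?g ((1 - c t) *\<^sub>R x + c t *\<^sub>R y) * indicator {0..1} t) \<partial>lborel) =
             ennreal (r\<^sup>2) * (\<integral>\<^sup>+y. ?g ((1 - c t) *\<^sub>R x + c t *\<^sub>R y) \<partial>lborel)"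
            using t by (simp add: nn_integral_cmult)
          also have "(\<integral>\<^sup>+y. ?g ((1 - c t) *\<^sub>R x + c t *\<^sub>R y) \<partial>lborel) \<le> ennreal (2 ^ CARD('n)) * (\<integral>\<^sup>+y. ?g y \<partial>lborel)"
          proof -
            have "1 \<le> (2 * c t) ^ CARD('n)" using c by (intro one_le_power) simp
            then have "1 \<le> ennreal (2 ^ CARD('n) * (c t) ^ CARD('n))"
              by (metis ennreal_1 ennreal_leI power_mult_distrib)
            then have "1 * (\<integral>\<^sup>+y. ?g ((1 - c t) *\<^sub>R x + c t *\<^sub>R y) \<partial>lborel) \<le>
               ennreal (2 ^ CARD('n) * (c t) ^ CARD('n)) * (\<integral>\<^sup>+y. ?g ((1 - c t) *\<^sub>R x + c t *\<^sub>R y) \<partial>lborel)"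
              by (intro mult_right_mono) auto
            also have "\<dots> = ennreal (2 ^ CARD('n)) * (\<integral>\<^sup>+y. ?g y \<partial>lborel)"
              using c by (subst nn_integral_affine[of ?g "c t" "(1 - c t) *\<^sub>R x"]) (auto simp: ennreal_mult mult.assoc)
            finally show ?thesis by simp
          qed
          finally show ?thesis using t by (simp add: ennreal_mult mult.assoc mult_left_mono)
        qed simp
      qed
      also have "\<dots> = ennreal (r\<^sup>2 * 2 ^ CARD('n)) * (\<integral>\<^sup>+y. ?g y \<partial>lborel)"
        by (subst nn_integral_cmult_indicator) auto
      finally show ?thesis using True by simp
    qed simp
  qed
  also have "\<dots> = ennreal (r\<^sup>2 * 2 ^ CARD('n)) * (\<integral>\<^sup>+y. ?g y \<partial>lborel) * emeasure lborel B"
    by (rule nn_integral_cmult_indicator) simp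
  also have "emeasure lborel B = ennreal (measure lebesgue B)"
    using emeasure_lborel_ball_finite[of z r] by (simp add: B_def emeasure_eq_ennreal_measure less_top)
  finally have A2: "?I \<le> ennreal (r\<^sup>2 * 2 ^ CARD('n)) * (\<integral>\<^sup>+y. ?g y \<partial>lborel) * ennreal (measure lebesgue B)" .
  have "4 * ?I \<le> 4 * (ennreal (r\<^sup>2 * 2 ^ CARD('n)) * (\<integral>\<^sup>+y. ?g y \<partial>lborel) * ennreal (measure lebesgue B))"
    by (intro mult_left_mono A2) simp
  also have "\<dots> = ennreal (4 * 2 ^ CARD('n) * r\<^sup>2 * measure lebesgue B) * (\<integral>\<^sup>+y. ?g y \<partial>lborel)"
    by (simp add: ennreal_mult mult_ac)
  finally show ?thesis using A1 by (rule order_trans[rotated])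
qed


text \<open>Instead of subtracting a mean, \<open>f x\<close> is compared with \<open>f y\<close>
  for all \<open>y\<close> in \<open>E\<close>; the difference is paid by the gradient and the rest
  by the norm of \<open>f\<close> on \<open>E\<close>. Later \<open>E\<close> is the set where the
  potential is large.\<close>

lemma poincare_subset_test:
  fixes f :: "real^'n \<Rightarrow> real" and z :: "real^'n"
  assumes f: "test_fun f" and r: "0 < r" and E: "E \<in> sets lebesgue" "E \<subseteq> ball z r"
  defines "B \<equiv> ball z r"
  shows "ennreal (measure lebesgue E) * (\<integral>\<^sup>+x. ennreal ((f x)\<^sup>2) * indicator B x \<partial>lebesgue)
    \<le> ennreal (8 * 2 ^ CARD('n) * r\<^sup>2 * measure lebesgue B) * (\<integral>\<^sup>+x. ennreal ((norm (grad f x))\<^sup>2) * indicator B x \<partial>lebesgue)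
     + ennreal (2 * measure lebesgue B) * (\<integral>\<^sup>+x. ennreal ((f x)\<^sup>2) * indicator E x \<partial>lebesgue)"
proof -
  have Bm[measurable]: "B \<in> sets borel" by (simp add: B_def)
  have fm[measurable]: "f \<in> borel_measurable borel" by (intro borel_measurable_continuous_onI test_fun_continuous f)
  have fl[measurable]: "f \<in> borel_measurable lebesgue" by (intro borel_measurable_lebesgueI test_fun_continuous f)
  note [measurable] = E(1)
  have Bf: "emeasure lebesgue B = ennreal (measure lebesgue B)"
    using emeasure_lborel_ball_finite[of z r] by (simp add: B_def emeasure_eq_ennreal_measure less_top)
  have "E \<in> lmeasurable" using E by (meson bounded_ball bounded_subset bounded_set_imp_lmeasurable)
  then have Ef: "emeasure lebesgue E = ennreal (measure lebesgue E)"
    by (intro emeasure_eq_ennreal_measure) (auto simp: fmeasurable_def)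
  let ?J = "\<integral>\<^sup>+y. ennreal ((f y)\<^sup>2) * indicator E y \<partial>lebesgue"
  let ?D = "\<lambda>x. \<integral>\<^sup>+y. ennreal ((f x - f y)\<^sup>2) * indicator B y \<partial>lborel"
  have pt: "ennreal (measure lebesgue E) * ennreal ((f x)\<^sup>2) \<le> 2 * ?D x + 2 * ?J" for x
  proof -
    have "ennreal (measure lebesgue E) * ennreal ((f x)\<^sup>2) = (\<integral>\<^sup>+y. ennreal ((f x)\<^sup>2) * indicator E y \<partial>lebesgue)"
      using E(1) Ef by (subst nn_integral_cmult_indicator) (simp_all add: mult.commute)
    also have "\<dots> \<le> (\<integral>\<^sup>+y. 2 * (ennreal ((f x - f y)\<^sup>2) * indicator E y) + 2 * (ennreal ((f y)\<^sup>2) * indicator E y) \<partial>lebesgue)"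
    proof (rule nn_integral_mono)
      fix y
      have "(f x)\<^sup>2 \<le> 2 * (f x - f y)\<^sup>2 + 2 * (f y)\<^sup>2"
        using zero_le_power2[of "f x - 2 * f y"] by (simp add: power2_eq_square algebra_simps)
      then have "ennreal ((f x)\<^sup>2) \<le> ennreal (2 * (f x - f y)\<^sup>2 + 2 * (f y)\<^sup>2)" by (rule ennreal_leI)
      also have "\<dots> = 2 * ennreal ((f x - f y)\<^sup>2) + 2 * ennreal ((f y)\<^sup>2)" by (simp add: ennreal_mult)
      finally show "ennreal ((f x)\<^sup>2) * indicator E y \<le> 2 * (ennreal ((f x - f y)\<^sup>2) * indicator E y) + 2 * (ennreal ((f y)\<^sup>2) * indicator E y)"
        by (simp add: indicator_def)
    qed
    also have "\<dots> = 2 * (\<integral>\<^sup>+y. ennreal ((f x - f y)\<^sup>2) * indicator E y \<partial>lebesgue) + 2 * ?J"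
      by (simp add: nn_integral_add nn_integral_cmult)
    also have "\<dots> \<le> 2 * ?D x + 2 * ?J"
      using E(2) by (intro add_right_mono mult_left_mono) (auto simp: nn_integral_completion B_def indicator_def intro!: nn_integral_mono)
    finally show ?thesis .
  qed
  have "ennreal (measure lebesgue E) * (\<integral>\<^sup>+x. ennreal ((f x)\<^sup>2) * indicator B x \<partial>lebesgue) =
     (\<integral>\<^sup>+x. (ennreal (measure lebesgue E) * ennreal ((f x)\<^sup>2)) * indicator B x \<partial>lborel)"
    by (simp add: nn_integral_completion mult.assoc nn_integral_cmult[symmetric])
  also have "\<dots> \<le> (\<integral>\<^sup>+x. 2 * (?D x * indicator B x) + 2 * ?J * indicator B x \<partial>lborel)"
    using pt by (intro nn_integral_mono) (auto simp: indicator_def)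
  also have "\<dots> = 2 * (\<integral>\<^sup>+x. ?D x * indicator B x \<partial>lborel) + 2 * ?J * emeasure lborel B"
    by (simp add: nn_integral_add nn_integral_cmult nn_integral_cmult_indicator)
  also have "\<dots> \<le> 2 * (ennreal (4 * 2 ^ CARD('n) * r\<^sup>2 * measure lebesgue B) * (\<integral>\<^sup>+x. ennreal ((norm (grad f x))\<^sup>2) * indicator B x \<partial>lborel)) + 2 * ?J * emeasure lborel B"
    unfolding B_def by (intro add_right_mono mult_left_mono double_difference_le[OF f r]) simp
  also have "2 * ?J * emeasure lborel B = ennreal (2 * measure lebesgue B) * ?J"
    using Bf by (simp add: ennreal_mult mult_ac)
  also have "2 * (ennreal (4 * 2 ^ CARD('n) * r\<^sup>2 * measure lebesgue B) * (\<integral>\<^sup>+x. ennreal ((norm (grad f x))\<^sup>2) * indicator B x \<partial>lborel)) =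
    ennreal (8 * 2 ^ CARD('n) * r\<^sup>2 * measure lebesgue B) * (\<integral>\<^sup>+x. ennreal ((norm (grad f x))\<^sup>2) * indicator B x \<partial>lebesgue)"
  proof -
    have "2 * ennreal (4 * 2 ^ CARD('n) * r\<^sup>2 * measure lebesgue B) = ennreal (8 * 2 ^ CARD('n) * r\<^sup>2 * measure lebesgue B)"
      using ennreal_mult'[of 2 "4 * 2 ^ CARD('n) * r\<^sup>2 * measure lebesgue B"] by (simp add: mult_ac)
    then show ?thesis by (simp add: nn_integral_completion mult.assoc[symmetric])
  qed
  finally show ?thesis .
qed

lemma nn_integral_square_perturb:
  fixes f g :: "'a \<Rightarrow> 'b::euclidean_space"
  assumes [measurable]: "f \<in> borel_measurable M" "g \<in> borel_measurable M" "S \<in> sets M"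
    and e: "(\<integral>\<^sup>+x. ennreal ((norm (f x - g x))\<^sup>2) \<partial>M) \<le> e"
  shows "(\<integral>\<^sup>+x. ennreal ((norm (f x))\<^sup>2) * indicator S x \<partial>M) \<le> 2 * (\<integral>\<^sup>+x. ennreal ((norm (g x))\<^sup>2) * indicator S x \<partial>M) + 2 * e"
proof -
  have "(\<integral>\<^sup>+x. ennreal ((norm (f x))\<^sup>2) * indicator S x \<partial>M) \<le>
     (\<integral>\<^sup>+x. 2 * (ennreal ((norm (g x))\<^sup>2) * indicator S x) + 2 * ennreal ((norm (f x - g x))\<^sup>2) \<partial>M)"
  proof (rule nn_integral_mono)
    fix x
    have "(norm (f x))\<^sup>2 \<le> (norm (g x) + norm (f x - g x))\<^sup>2"
      by (intro power_mono) (use norm_triangle_sub[of "f x" "g x"] in auto)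
    also have "\<dots> \<le> 2 * (norm (g x))\<^sup>2 + 2 * (norm (f x - g x))\<^sup>2"
      using zero_le_power2[of "norm (g x) - norm (f x - g x)"] by (simp add: power2_eq_square algebra_simps)
    finally have "ennreal ((norm (f x))\<^sup>2) \<le> ennreal (2 * (norm (g x))\<^sup>2 + 2 * (norm (f x - g x))\<^sup>2)" by (rule ennreal_leI)
    also have "\<dots> = 2 * ennreal ((norm (g x))\<^sup>2) + 2 * ennreal ((norm (f x - g x))\<^sup>2)" by (simp add: ennreal_mult)
    finally show "ennreal ((norm (f x))\<^sup>2) * indicator S x \<le> 2 * (ennreal ((norm (g x))\<^sup>2) * indicator S x) + 2 * ennreal ((norm (f x - g x))\<^sup>2)"
      by (simp add: indicator_def)
  qed
  also have "\<dots> = 2 * (\<integral>\<^sup>+x. ennreal ((norm (g x))\<^sup>2) * indicator S x \<partial>M) + 2 * (\<integral>\<^sup>+x. ennreal ((norm (f x - g x))\<^sup>2) \<partial>M)"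
    by (simp add: nn_integral_add nn_integral_cmult)
  also have "\<dots> \<le> 2 * (\<integral>\<^sup>+x. ennreal ((norm (g x))\<^sup>2) * indicator S x \<partial>M) + 2 * e"
    by (intro add_left_mono mult_left_mono e) simp
  finally show ?thesis .
qed

lemma ennreal_le_add_small:
  fixes a b :: ennreal
  assumes c: "0 \<le> c" and le: "\<And>e. 0 < e \<Longrightarrow> a \<le> b + ennreal (c * e)"
  shows "a \<le> b"
proof (rule ennreal_le_epsilon)
  fix e :: real assume e: "0 < e"
  have "a \<le> b + ennreal (c * (e / (c + 1)))" using e c by (intro le) simp
  also have "\<dots> \<le> b + ennreal e" using e c by (intro add_left_mono ennreal_leI) (simp add: field_simps)
  finally show "a \<le> b + ennreal e" .
qed

text \<open>Approximation by test functions perturbs both sides. Each passage between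
  \<open>f\<close> and its approximation costs a factor 2, so both constants of the smooth case are
  multiplied by 4, and the remaining error is linear in \<open>e\<close>.\<close>

lemma poincare_subset:
  fixes f :: "real^'n \<Rightarrow> real" and z :: "real^'n"
  assumes w: "is_weak_grad f G" and f: "L2 f" and G: "L2 G" 
    and fz: "\<And>x. norm x > R \<Longrightarrow> f x = 0" and Gz: "\<And>x. norm x > R \<Longrightarrow> G x = 0"
    and r: "0 < r" and E: "E \<in> sets lebesgue" "E \<subseteq> ball z r"
  defines "B \<equiv> ball z r"
  shows "ennreal (measure lebesgue E) * (\<integral>\<^sup>+x. ennreal ((f x)\<^sup>2) * indicator B x \<partial>lebesgue)
    \<le> ennreal (32 * 2 ^ CARD('n) * r\<^sup>2 * measure lebesgue B) * (\<integral>\<^sup>+x. ennreal ((norm (G x))\<^sup>2) * indicator B x \<partial>lebesgue)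
     + ennreal (8 * measure lebesgue B) * (\<integral>\<^sup>+x. ennreal ((f x)\<^sup>2) * indicator E x \<partial>lebesgue)"
proof (rule ennreal_le_add_small)
  define K where "K = 8 * 2 ^ CARD('n) * r\<^sup>2 * measure lebesgue B"
  define b where "b = measure lebesgue B"
  define m where "m = measure lebesgue E"
  have pos: "K \<ge> 0" "b \<ge> 0" "m \<ge> 0" by (auto simp: K_def b_def m_def)
  show "0 \<le> 2 * m + 4 * K + 8 * b" using pos by simp
  fix e :: real assume e: "0 < e"
  obtain \<phi> where \<phi>: "test_fun \<phi>" and \<phi>1: "(\<integral>\<^sup>+x. ennreal ((f x - \<phi> x)\<^sup>2) \<partial>lebesgue) \<le> ennreal e"
    and \<phi>2: "(\<integral>\<^sup>+x. ennreal ((norm (G x - grad \<phi> x))\<^sup>2) \<partial>lebesgue) \<le> ennreal e"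
    using compact_weak_grad_approx[OF w f G fz Gz e] by blast
  have fm: "f \<in> borel_measurable lebesgue" and Gm: "G \<in> borel_measurable lebesgue" using f G by (auto simp: L2_def)
  have \<phi>m: "\<phi> \<in> borel_measurable lebesgue" "grad \<phi> \<in> borel_measurable lebesgue"
    by (auto intro!: borel_measurable_lebesgueI test_fun_continuous continuous_grad \<phi>)
  have Bm: "B \<in> sets lebesgue" by (simp add: B_def)
  let ?n = "\<lambda>h S. \<integral>\<^sup>+x. ennreal ((h x)\<^sup>2) * indicator S x \<partial>lebesgue"
  let ?v = "\<lambda>h S. \<integral>\<^sup>+x. ennreal ((norm (h x))\<^sup>2) * indicator S x \<partial>lebesgue"
  have alg: "2 * (k * (2 * a + 2 * e) + c * (2 * d + 2 * e)) + 2 * (m * e) = (4 * k) * a + (4 * c) * d + (4 * (k * e) + 4 * (c * e) + 2 * (m * e))"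
    for k a e c d m :: ennreal
    by (simp add: algebra_simps)
  have 1: "?n f B \<le> 2 * ?n \<phi> B + 2 * ennreal e"
    using nn_integral_square_perturb[OF fm \<phi>m(1) Bm] \<phi>1 by simp
  have 2: "?n \<phi> E \<le> 2 * ?n f E + 2 * ennreal e"
    using nn_integral_square_perturb[OF \<phi>m(1) fm E(1)] \<phi>1 by (simp add: power2_commute)
  have 3: "?v (grad \<phi>) B \<le> 2 * ?v G B + 2 * ennreal e"
    using nn_integral_square_perturb[OF \<phi>m(2) Gm Bm] \<phi>2 by (simp add: norm_minus_commute)
  have 4: "ennreal m * ?n \<phi> B \<le> ennreal K * ?v (grad \<phi>) B + ennreal (2 * b) * ?n \<phi> E"
    using poincare_subset_test[OF \<phi> r E] by (simp add: K_def b_def m_def B_def)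
  have "ennreal m * ?n f B \<le> ennreal m * (2 * ?n \<phi> B + 2 * ennreal e)"
    by (intro mult_left_mono 1) simp
  also have "\<dots> = 2 * (ennreal m * ?n \<phi> B) + 2 * (ennreal m * ennreal e)" by (simp add: distrib_left mult_ac)
  also have "\<dots> \<le> 2 * (ennreal K * ?v (grad \<phi>) B + ennreal (2 * b) * ?n \<phi> E) + 2 * (ennreal m * ennreal e)"
    by (intro add_right_mono mult_left_mono 4) simp
  also have "\<dots> \<le> 2 * (ennreal K * (2 * ?v G B + 2 * ennreal e) + ennreal (2 * b) * (2 * ?n f E + 2 * ennreal e)) + 2 * (ennreal m * ennreal e)"
    by (intro add_mono mult_left_mono 2 3 order_refl) simp_all
  also have "\<dots> = (4 * ennreal K) * ?v G B + (4 * ennreal (2 * b)) * ?n f E +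
      (4 * (ennreal K * ennreal e) + 4 * (ennreal (2 * b) * ennreal e) + 2 * (ennreal m * ennreal e))"
    by (rule alg)
  also have "4 * ennreal K = ennreal (32 * 2 ^ CARD('n) * r\<^sup>2 * measure lebesgue B)"
    using ennreal_mult'[of 4 K] by (simp add: K_def mult_ac)
  also have "4 * ennreal (2 * b) = ennreal (8 * measure lebesgue B)"
    using ennreal_mult'[of 4 "2 * b"] by (simp add: b_def)
  also have "4 * (ennreal K * ennreal e) + 4 * (ennreal (2 * b) * ennreal e) + 2 * (ennreal m * ennreal e) = ennreal ((2 * m + 4 * K + 8 * b) * e)"
  proof -
    have "ennreal ((2 * m + 4 * K + 8 * b) * e) = ennreal (4 * (K * e) + 4 * (2 * b * e) + 2 * (m * e))" by (simp add: algebra_simps)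
    also have "\<dots> = ennreal 4 * (ennreal K * ennreal e) + ennreal 4 * (ennreal (2 * b) * ennreal e) + ennreal 2 * (ennreal m * ennreal e)"
      using pos e by (simp only: ennreal_plus ennreal_mult mult_nonneg_nonneg zero_le_numeral add_nonneg_nonneg less_imp_le)
    finally show ?thesis by simp
  qed
  finally show "ennreal (measure lebesgue E) * ?n f B \<le> ennreal (32 * 2 ^ CARD('n) * r\<^sup>2 * measure lebesgue B) * ?v G B
     + ennreal (8 * measure lebesgue B) * ?n f E + ennreal ((2 * m + 4 * K + 8 * b) * e)" by (simp add: m_def)
qed

section \<open>Fefferman-Phong inequality\<close>

text \<open>The gradient is a separate argument so that an explicit product-rule expression can be
  used in place of the chosen \<open>weak_grad\<close>.\<close>

definition compact_H1_pair :: "(real^'n \<Rightarrow> real) \<Rightarrow> (real^'n \<Rightarrow> real^'n) \<Rightarrow> bool" where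
  "compact_H1_pair f G \<longleftrightarrow> is_weak_grad f G \<and> L2 f \<and> L2 G \<and> (\<exists>R. \<forall>x. norm x > R \<longrightarrow> f x = 0 \<and> G x = 0)"

text \<open>On the ball of radius \<open>s = lip_rho V x / 2\<close> the mean of \<open>V\<close> is
  at least \<open>c / s\<^sup>2\<close>, and \<open>V\<close> is at least a quarter of its mean on a
  fixed share of the ball. On that subset the square of \<open>f\<close> is controlled by the
  potential term, and the Poincare inequality relative to the subset does the rest.\<close>

lemma fefferman_phong_local:
  fixes p C :: real assumes p: "1 < p" "real CARD('n) \<le> 2 * p" and C: "1 \<le> C"
  shows "\<exists>K>0. \<forall>(V :: real^'n \<Rightarrow> real) f G x. RH_real p C V \<longrightarrow> compact_H1_pair f G \<longrightarrow>
    (\<integral>\<^sup>+y. ennreal ((f y)\<^sup>2) * indicator (ball x (lip_rho V x / 2)) y \<partial>lebesgue) \<le>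
    ennreal (K * (lip_rho V x / 2)\<^sup>2) * (\<integral>\<^sup>+y. ennreal ((norm (G y))\<^sup>2 + V y * (f y)\<^sup>2) * indicator (ball x (lip_rho V x / 2)) y \<partial>lebesgue)"
proof -
  obtain e where e: "e > 0" "\<And>(V :: real^'n \<Rightarrow> real) x r. RH_real p C V \<Longrightarrow> 0 < r \<Longrightarrow>
   e * measure lebesgue (ball x r) \<le> measure lebesgue {y\<in>ball x r. average (ball x r) V / 4 \<le> V y}"
    using RH_large_set[OF p(1) C, where 'n='n] by blast
  obtain c where c: "c > 0" "\<And>(V :: real^'n \<Rightarrow> real) x. RH_real p C V \<Longrightarrow> c \<le> psi V x (lip_rho V x / 2)"
    using psi_lip_rho[OF p C] by blast
  \<comment> \<open>The first summand comes from the gradient term, the second from the potential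
    term; \<open>e\<close> is the volume share of the large set.\<close>
  define K where "K = 32 * (2 ^ CARD('n) + 1 / c) / e"
  have K: "K > 0" using e(1) c(1) by (simp add: K_def add_pos_pos)
  have "(\<integral>\<^sup>+y. ennreal ((f y)\<^sup>2) * indicator (ball x (lip_rho V x / 2)) y \<partial>lebesgue) \<le>
    ennreal (K * (lip_rho V x / 2)\<^sup>2) * (\<integral>\<^sup>+y. ennreal ((norm (G y))\<^sup>2 + V y * (f y)\<^sup>2) * indicator (ball x (lip_rho V x / 2)) y \<partial>lebesgue)"
    if V: "RH_real p C V" and fG: "compact_H1_pair f G" for V f and G :: "real^'n \<Rightarrow> real^'n" and x
  proof -
    define s where "s = lip_rho V x / 2"
    have s: "s > 0" using lip_rho_pos[OF p C V, of x] by (simp add: s_def)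
    define B where "B = ball x s"
    define a where "a = average B V"
    have a: "a > 0" "c / s\<^sup>2 \<le> a"
      using RH_avg_pos[OF V p(1) C s, of x] c(2)[OF V, of x] s by (simp_all add: a_def B_def psi_def s_def[symmetric] field_simps)
    define E where "E = {y\<in>B. a / 4 \<le> V y}"
    have Vm[measurable]: "V \<in> borel_measurable lebesgue" by (rule RH_meas[OF V p(1) C])
    have V0: "V y \<ge> 0" for y by (rule RH_nonneg[OF V p(1) C])
    have "E = B \<inter> {y \<in> space lebesgue. a / 4 \<le> V y}" by (auto simp: E_def)
    also have "\<dots> \<in> sets lebesgue" by (intro sets.Int borel_measurable_le) (auto simp: B_def)
    finally have Es: "E \<in> sets lebesgue" .
    have EB: "E \<subseteq> ball x s" by (auto simp: E_def B_def)
    define b where "b = measure lebesgue B"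
    have b: "b > 0" using s by (simp add: b_def B_def)
    have mE: "e * b \<le> measure lebesgue E" using e(2)[OF V s, of x] unfolding b_def E_def a_def B_def .
    obtain R where fGR: "is_weak_grad f G" "L2 f" "L2 G" "\<And>x. norm x > R \<Longrightarrow> f x = 0" "\<And>x. norm x > R \<Longrightarrow> G x = 0"
      using fG by (auto simp: compact_H1_pair_def)
    have m[measurable]: "f \<in> borel_measurable lebesgue" "G \<in> borel_measurable lebesgue" using fGR by (auto simp: L2_def)
    have Bs[measurable]: "B \<in> sets lebesgue" by (simp add: B_def)
    let ?N = "\<integral>\<^sup>+y. ennreal ((f y)\<^sup>2) * indicator B y \<partial>lebesgue"
    let ?NE = "\<integral>\<^sup>+y. ennreal ((f y)\<^sup>2) * indicator E y \<partial>lebesgue"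
    let ?P = "\<integral>\<^sup>+y. ennreal ((norm (G y))\<^sup>2) * indicator B y \<partial>lebesgue"
    let ?Q = "\<integral>\<^sup>+y. ennreal (V y * (f y)\<^sup>2) * indicator B y \<partial>lebesgue"
    have "?NE \<le> (\<integral>\<^sup>+y. ennreal (4 * s\<^sup>2 / c) * (ennreal (V y * (f y)\<^sup>2) * indicator B y) \<partial>lebesgue)"
    proof (rule nn_integral_mono)
      fix y
      show "ennreal ((f y)\<^sup>2) * indicator E y \<le> ennreal (4 * s\<^sup>2 / c) * (ennreal (V y * (f y)\<^sup>2) * indicator B y)"
      proof (cases "y \<in> E")
        case True
        have "1 \<le> 4 * s\<^sup>2 / c * V y"
        proof -
          have "c / s\<^sup>2 \<le> 4 * V y" using True a by (simp add: E_def)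
          then show ?thesis using s c(1) by (simp add: field_simps)
        qed
        then have "1 * (f y)\<^sup>2 \<le> (4 * s\<^sup>2 / c * V y) * (f y)\<^sup>2" by (intro mult_right_mono) auto
        then have "ennreal ((f y)\<^sup>2) \<le> ennreal (4 * s\<^sup>2 / c * (V y * (f y)\<^sup>2))" by (intro ennreal_leI) (simp add: mult.assoc)
        also have "\<dots> = ennreal (4 * s\<^sup>2 / c) * ennreal (V y * (f y)\<^sup>2)" using c(1) V0 by (intro ennreal_mult) auto
        finally show ?thesis using True by (simp add: E_def)
      qed simp
    qed
    also have "\<dots> = ennreal (4 * s\<^sup>2 / c) * ?Q" by (rule nn_integral_cmult) measurable
    finally have NE: "?NE \<le> ennreal (4 * s\<^sup>2 / c) * ?Q" .
    have "ennreal (e * b) * ?N \<le> ennreal (measure lebesgue E) * ?N" by (intro mult_right_mono ennreal_leI mE) simp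
    also have "\<dots> \<le> ennreal (32 * 2 ^ CARD('n) * s\<^sup>2 * b) * ?P + ennreal (8 * b) * ?NE"
      using poincare_subset[OF fGR s Es EB] by (simp add: b_def B_def)
    also have "\<dots> \<le> ennreal (32 * 2 ^ CARD('n) * s\<^sup>2 * b) * ?P + ennreal (8 * b) * (ennreal (4 * s\<^sup>2 / c) * ?Q)"
      by (intro add_left_mono mult_left_mono NE) simp
    finally have le: "ennreal (e * b) * ?N \<le> ennreal (32 * 2 ^ CARD('n) * s\<^sup>2 * b) * ?P + ennreal (8 * b) * (ennreal (4 * s\<^sup>2 / c) * ?Q)" .
    have "?N = ennreal (1 / (e * b)) * (ennreal (e * b) * ?N)"
      using e(1) b by (simp add: mult.assoc[symmetric] ennreal_mult[symmetric])
    also have "\<dots> \<le> ennreal (1 / (e * b)) * (ennreal (32 * 2 ^ CARD('n) * s\<^sup>2 * b) * ?P + ennreal (8 * b) * (ennreal (4 * s\<^sup>2 / c) * ?Q))"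
      by (intro mult_left_mono le) simp
    also have "\<dots> = ennreal (32 * 2 ^ CARD('n) * s\<^sup>2 / e) * ?P + ennreal (32 * s\<^sup>2 / (c * e)) * ?Q"
    proof -
      have "ennreal (1 / (e * b)) * ennreal (32 * 2 ^ CARD('n) * s\<^sup>2 * b) = ennreal (32 * 2 ^ CARD('n) * s\<^sup>2 / e)"
        using e(1) b by (subst ennreal_mult[symmetric]) (auto simp: field_simps)
      moreover have "ennreal (1 / (e * b)) * (ennreal (8 * b) * ennreal (4 * s\<^sup>2 / c)) = ennreal (32 * s\<^sup>2 / (c * e))"
        using e(1) b c(1) by (subst ennreal_mult[symmetric], simp, simp, subst ennreal_mult[symmetric]) (auto simp: field_simps)
      ultimately show ?thesis by (simp only: distrib_left mult.assoc[symmetric])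
    qed
    also have "\<dots> \<le> ennreal (K * s\<^sup>2) * ?P + ennreal (K * s\<^sup>2) * ?Q"
    proof (intro add_mono mult_right_mono ennreal_leI)
      have "K * s\<^sup>2 = 32 * 2 ^ CARD('n) * s\<^sup>2 / e + 32 * s\<^sup>2 / (c * e)"
        using e(1) c(1) by (simp add: K_def field_simps)
      moreover have "32 * 2 ^ CARD('n) * s\<^sup>2 / e \<ge> 0" "32 * s\<^sup>2 / (c * e) \<ge> 0" using e(1) c(1) by auto
      ultimately show "32 * 2 ^ CARD('n) * s\<^sup>2 / e \<le> K * s\<^sup>2" "32 * s\<^sup>2 / (c * e) \<le> K * s\<^sup>2" by linarith+
    qed auto
    also have "\<dots> = ennreal (K * s\<^sup>2) * (?P + ?Q)" by (simp add: distrib_left)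
    also have "?P + ?Q = (\<integral>\<^sup>+y. ennreal ((norm (G y))\<^sup>2) * indicator B y + ennreal (V y * (f y)\<^sup>2) * indicator B y \<partial>lebesgue)"
      by (rule nn_integral_add[symmetric]) measurable
    also have "\<dots> = (\<integral>\<^sup>+y. ennreal ((norm (G y))\<^sup>2 + V y * (f y)\<^sup>2) * indicator B y \<partial>lebesgue)"
      using V0 by (intro nn_integral_cong) (simp add: distrib_right)
    finally show ?thesis by (simp add: B_def s_def)
  qed
  with K show ?thesis by blast
qed

text \<open>Averaging the local inequality over the centres of the balls, with weight \<open>s x powr -(n + 2)\<close>, takes
  the place of a covering with bounded overlap.\<close>

lemma fefferman_phong:
  fixes p C :: real assumes p: "1 < p" "real CARD('n) \<le> 2 * p" and C: "1 \<le> C"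
  shows "\<exists>K>0. \<forall>(V :: real^'n \<Rightarrow> real) f G. RH_real p C V \<longrightarrow> compact_H1_pair f G \<longrightarrow>
    (\<integral>\<^sup>+y. ennreal ((f y)\<^sup>2 / (lip_rho V y)\<^sup>2) \<partial>lebesgue) \<le>
    ennreal K * (\<integral>\<^sup>+y. ennreal ((norm (G y))\<^sup>2 + V y * (f y)\<^sup>2) \<partial>lebesgue)"
proof -
  obtain K where K: "K > 0" and local: "\<And>(V :: real^'n \<Rightarrow> real) f G x. RH_real p C V \<Longrightarrow> compact_H1_pair f G \<Longrightarrow>
    (\<integral>\<^sup>+y. ennreal ((f y)\<^sup>2) * indicator (ball x (lip_rho V x / 2)) y \<partial>lebesgue) \<le>
    ennreal (K * (lip_rho V x / 2)\<^sup>2) * (\<integral>\<^sup>+y. ennreal ((norm (G y))\<^sup>2 + V y * (f y)\<^sup>2) * indicator (ball x (lip_rho V x / 2)) y \<partial>lebesgue)"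
    using fefferman_phong_local[OF p C] by blast
  define w where "w = measure lebesgue (ball (0::real^'n) 1)"
  have w: "w > 0" by (simp add: w_def)
  let ?n = "CARD('n)"
  define \<alpha> where "\<alpha> = 4 * w * (4/5) ^ (?n + 2) * (1/2) ^ ?n"
  \<comment> \<open>\<open>\<alpha>\<close> collects the volume of the ball of radius
    \<open>s y / 2\<close>, the bound \<open>s x \<le> 5/4 * s y\<close> on it raised to the power
    \<open>-(n + 2)\<close>, and a factor 4 from \<open>lip_rho V y = 2 * s y\<close>.\<close>
  have \<alpha>: "\<alpha> > 0" using w by (simp add: \<alpha>_def)
  define K' where "K' = K * (w * 3 ^ ?n) / \<alpha>"
  have K': "K' > 0" using K w \<alpha> by (simp add: K'_def)
  have "(\<integral>\<^sup>+y. ennreal ((f y)\<^sup>2 / (lip_rho V y)\<^sup>2) \<partial>lebesgue) \<le>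
    ennreal K' * (\<integral>\<^sup>+y. ennreal ((norm (G y))\<^sup>2 + V y * (f y)\<^sup>2) \<partial>lebesgue)"
    if V: "RH_real p C V" and fG: "compact_H1_pair f G" for V f and G :: "real^'n \<Rightarrow> real^'n"
  proof -
    define s where "s x = lip_rho V x / 2" for x
    have s: "s x > 0" for x using lip_rho_pos[OF p C V, of x] by (simp add: s_def)
    have slip: "s x \<le> s y + dist x y / 2" for x y using lip_rho_lipschitz[OF p C V, of x y] by (simp add: s_def)
    have sc: "continuous_on UNIV s" unfolding s_def by (intro continuous_intros continuous_lip_rho[OF p C V]) simp
    have sm[measurable]: "s \<in> borel_measurable borel" by (rule borel_measurable_continuous_onI[OF sc])
    have Vm[measurable]: "V \<in> borel_measurable lebesgue" by (rule RH_meas[OF V p(1) C])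
    have V0: "V y \<ge> 0" for y by (rule RH_nonneg[OF V p(1) C])
    have m[measurable]: "f \<in> borel_measurable lebesgue" "G \<in> borel_measurable lebesgue"
      using fG by (auto simp: L2_def compact_H1_pair_def)
    define F where "F y = ennreal ((norm (G y))\<^sup>2 + V y * (f y)\<^sup>2)" for y
    have Fm[measurable]: "F \<in> borel_measurable lebesgue" unfolding F_def by measurable
    let ?i = "\<lambda>x y. indicator (ball x (s x)) y :: ennreal"
    have im: "case_prod (\<lambda>x y. ?i x y * ennreal (1 / s x ^ k)) \<in> borel_measurable borel" for k
    proof -
      have "(\<lambda>z :: (real^'n) \<times> (real^'n). indicator {z. dist (fst z) (snd z) < s (fst z)} z * ennreal (1 / s (fst z) ^ k)) \<in> borel_measurable borel"
      proof (rule borel_measurable_times_ennreal)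
        have "open {z :: (real^'n) \<times> (real^'n). dist (fst z) (snd z) < s (fst z)}"
          by (intro open_Collect_less continuous_intros continuous_on_compose2[OF sc]) auto
        then show "(indicator {z. dist (fst z) (snd z) < s (fst z)} :: (real^'n) \<times> (real^'n) \<Rightarrow> ennreal) \<in> borel_measurable borel"
          by (intro borel_measurable_indicator) auto
        have "continuous_on UNIV (\<lambda>z :: (real^'n) \<times> (real^'n). 1 / s (fst z) ^ k)"
          using s by (intro continuous_intros continuous_on_compose2[OF sc]) (auto simp: less_imp_neq[THEN not_sym])
        from borel_measurable_continuous_onI[OF this]
        show "(\<lambda>z :: (real^'n) \<times> (real^'n). ennreal (1 / s (fst z) ^ k)) \<in> borel_measurable borel" by simp
      qed
      moreover have "(\<lambda>z. indicator {z. dist (fst z) (snd z) < s (fst z)} z * ennreal (1 / s (fst z) ^ k)) =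
         case_prod (\<lambda>x y. ?i x y * ennreal (1 / s x ^ k))"
        by (auto simp: fun_eq_iff indicator_def)
      ultimately show ?thesis by simp
    qed
    have loc: "(\<integral>\<^sup>+y. ennreal ((f y)\<^sup>2) * ?i x y \<partial>lborel) \<le> ennreal (K * (s x)\<^sup>2) * (\<integral>\<^sup>+y. F y * ?i x y \<partial>lborel)" for x
      using local[OF V fG, of x] by (simp add: s_def F_def nn_integral_completion)
    note ballm = emeasure_lborel_ball_eq[where 'n='n, folded w_def]
    have cmultL: "(\<integral>\<^sup>+y. g y * (?i x y * c) \<partial>lborel) = c * (\<integral>\<^sup>+y. g y * ?i x y \<partial>lborel)"
      if "g \<in> borel_measurable lebesgue" for g :: "real^'n \<Rightarrow> ennreal" and x c
    proof -
      have "(\<integral>\<^sup>+y. g y * (?i x y * c) \<partial>lebesgue) = (\<integral>\<^sup>+y. c * (g y * ?i x y) \<partial>lebesgue)" by (simp add: mult_ac)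
      also have "\<dots> = c * (\<integral>\<^sup>+y. g y * ?i x y \<partial>lebesgue)"
        by (rule nn_integral_cmult) (use that in \<open>auto intro!: borel_measurable_times_ennreal borel_measurable_indicator\<close>)
      finally show ?thesis by (simp add: nn_integral_completion)
    qed
    have up: "(\<integral>\<^sup>+x. ?i x y * ennreal (1 / s x ^ ?n) \<partial>lborel) \<le> ennreal (w * 3 ^ ?n)" for y
    proof -
      have "(\<integral>\<^sup>+x. ?i x y * ennreal (1 / s x ^ ?n) \<partial>lborel) \<le> (\<integral>\<^sup>+x. ennreal (1 / (2/3 * s y) ^ ?n) * indicator (ball y (2 * s y)) x \<partial>lborel)"
      proof (rule nn_integral_mono)
        fix x
        show "?i x y * ennreal (1 / s x ^ ?n) \<le> ennreal (1 / (2/3 * s y) ^ ?n) * indicator (ball y (2 * s y)) x"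
        proof (cases "dist x y < s x")
          case True
          \<comment> \<open>\<open>s\<close> is Lipschitz with constant 1/2, strictly less than 1;
            this is why half of \<open>lip_rho\<close> was taken as the radius. The quotient of 2
            and 2/3 is the 3 in the constant.\<close>
          then have "s x < 2 * s y" "2/3 * s y \<le> s x"
            using slip[of x y] slip[of y x] by (auto simp: dist_commute)
          moreover have "1 / s x ^ ?n \<le> 1 / (2/3 * s y) ^ ?n"
            using calculation s[of y] by (intro divide_left_mono power_mono) auto
          ultimately show ?thesis using True by (auto simp: dist_commute intro!: ennreal_leI)
        qed simp
      qed
      also have "\<dots> = ennreal (1 / (2/3 * s y) ^ ?n) * ennreal (w * (2 * s y) ^ ?n)"
        using s[of y] ballm[of "2 * s y" y] by (subst nn_integral_cmult_indicator) auto
      also have "\<dots> = ennreal (w * 3 ^ ?n)"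
      proof -
        have "1 / (2/3 * s y) ^ ?n * (w * (2 * s y) ^ ?n) = w * ((2 * s y) / (2/3 * s y)) ^ ?n" by (simp only: power_divide) simp
        also have "(2 * s y) / (2/3 * s y) = 3" using s[of y] by simp
        finally show ?thesis using s[of y] w by (subst ennreal_mult[symmetric]) auto
      qed
      finally show ?thesis .
    qed
    have low: "ennreal (\<alpha> / (lip_rho V y)\<^sup>2) \<le> (\<integral>\<^sup>+x. ?i x y * ennreal (1 / s x ^ (?n + 2)) \<partial>lborel)" for y
    proof -
      have "\<alpha> / (lip_rho V y)\<^sup>2 = 1 / (5/4 * s y) ^ (?n + 2) * (w * (1/2 * s y) ^ ?n)"
        using s[of y] unfolding \<alpha>_def s_def
        by (simp add: field_simps power_add power2_eq_square power_divide) (simp flip: power_mult_distrib)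
      then have "ennreal (\<alpha> / (lip_rho V y)\<^sup>2) = ennreal (1 / (5/4 * s y) ^ (?n + 2)) * ennreal (w * (1/2 * s y) ^ ?n)"
        using s[of y] w by (simp only:) (subst ennreal_mult[symmetric]; simp)
      also have "\<dots> = (\<integral>\<^sup>+x. ennreal (1 / (5/4 * s y) ^ (?n + 2)) * indicator (ball y (1/2 * s y)) x \<partial>lborel)"
        using s[of y] ballm[of "1/2 * s y" y] by (subst nn_integral_cmult_indicator) auto
      also have "\<dots> \<le> (\<integral>\<^sup>+x. ?i x y * ennreal (1 / s x ^ (?n + 2)) \<partial>lborel)"
      proof (rule nn_integral_mono)
        fix x
        show "ennreal (1 / (5/4 * s y) ^ (?n + 2)) * indicator (ball y (1/2 * s y)) x \<le> ?i x y * ennreal (1 / s x ^ (?n + 2))"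
        proof (cases "dist y x < 1/2 * s y")
          case True
          then have "s x \<le> 5/4 * s y" "dist x y < s x"
            using slip[of x y] slip[of y x] s[of y] by (auto simp: dist_commute)
          moreover have "1 / (5/4 * s y) ^ (?n + 2) \<le> 1 / s x ^ (?n + 2)"
            using calculation s[of x] s[of y] by (intro divide_left_mono power_mono mult_pos_pos zero_less_power) auto
          ultimately show ?thesis using True by (auto intro!: ennreal_leI)
        qed simp
      qed
      finally show ?thesis .
    qed
    have "ennreal \<alpha> * (\<integral>\<^sup>+y. ennreal ((f y)\<^sup>2 / (lip_rho V y)\<^sup>2) \<partial>lborel) \<le>
        (\<integral>\<^sup>+y. ennreal ((f y)\<^sup>2) * (\<integral>\<^sup>+x. ?i x y * ennreal (1 / s x ^ (?n + 2)) \<partial>lborel) \<partial>lborel)"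
    proof -
      have "ennreal \<alpha> * (\<integral>\<^sup>+y. ennreal ((f y)\<^sup>2 / (lip_rho V y)\<^sup>2) \<partial>lebesgue) = (\<integral>\<^sup>+y. ennreal \<alpha> * ennreal ((f y)\<^sup>2 / (lip_rho V y)\<^sup>2) \<partial>lebesgue)"
      proof (rule nn_integral_cmult[symmetric])
        have "lip_rho V \<in> borel_measurable lebesgue" by (rule borel_measurable_lebesgueI[OF continuous_lip_rho[OF p C V]])
        then show "(\<lambda>y. ennreal ((f y)\<^sup>2 / (lip_rho V y)\<^sup>2)) \<in> borel_measurable lebesgue" by measurable
      qed
      also have "\<dots> = (\<integral>\<^sup>+y. ennreal ((f y)\<^sup>2) * ennreal (\<alpha> / (lip_rho V y)\<^sup>2) \<partial>lebesgue)"
        using \<alpha> by (intro nn_integral_cong) (simp add: ennreal_mult[symmetric] mult.commute)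
      also have "\<dots> \<le> (\<integral>\<^sup>+y. ennreal ((f y)\<^sup>2) * (\<integral>\<^sup>+x. ?i x y * ennreal (1 / s x ^ (?n + 2)) \<partial>lborel) \<partial>lebesgue)"
        by (intro nn_integral_mono mult_left_mono low) simp
      finally show ?thesis by (simp add: nn_integral_completion)
    qed
    also have "\<dots> = (\<integral>\<^sup>+x. (\<integral>\<^sup>+y. ennreal ((f y)\<^sup>2) * (?i x y * ennreal (1 / s x ^ (?n + 2))) \<partial>lborel) \<partial>lborel)"
      by (rule nn_integral_kernel_swap[symmetric, OF _ im]) measurable
    also have "\<dots> = (\<integral>\<^sup>+x. ennreal (1 / s x ^ (?n + 2)) * (\<integral>\<^sup>+y. ennreal ((f y)\<^sup>2) * ?i x y \<partial>lborel) \<partial>lborel)"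
      by (intro nn_integral_cong cmultL) measurable
    also have "\<dots> \<le> (\<integral>\<^sup>+x. ennreal (1 / s x ^ (?n + 2)) * (ennreal (K * (s x)\<^sup>2) * (\<integral>\<^sup>+y. F y * ?i x y \<partial>lborel)) \<partial>lborel)"
      by (intro nn_integral_mono mult_left_mono loc) simp
    also have "\<dots> = (\<integral>\<^sup>+x. (\<integral>\<^sup>+y. (ennreal K * F y) * (?i x y * ennreal (1 / s x ^ ?n)) \<partial>lborel) \<partial>lborel)"
    proof (rule nn_integral_cong)
      fix x
      \<comment> \<open>The factor \<open>(s x)\<^sup>2\<close> of the local inequality turns the
        weight into \<open>s x powr -n\<close>, whose integral over the balls containing
        \<open>y\<close> is bounded independently of \<open>y\<close>.\<close>
      have "1 / s x ^ (?n + 2) * (K * (s x)\<^sup>2) = K * (1 / s x ^ ?n)"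
        using s[of x] by (simp add: power_add power2_eq_square)
      then have "ennreal (1 / s x ^ (?n + 2)) * ennreal (K * (s x)\<^sup>2) = ennreal K * ennreal (1 / s x ^ ?n)"
        using s[of x] K by (simp add: ennreal_mult[symmetric] less_imp_le)
      then have "ennreal (1 / s x ^ (?n + 2)) * (ennreal (K * (s x)\<^sup>2) * (\<integral>\<^sup>+y. F y * ?i x y \<partial>lborel)) =
         (ennreal K * ennreal (1 / s x ^ ?n)) * (\<integral>\<^sup>+y. F y * ?i x y \<partial>lborel)"
        by (simp only: mult.assoc[symmetric])
      also have "\<dots> = (\<integral>\<^sup>+y. F y * (?i x y * (ennreal K * ennreal (1 / s x ^ ?n))) \<partial>lborel)"
        by (rule cmultL[OF Fm, symmetric])
      finally show "ennreal (1 / s x ^ (?n + 2)) * (ennreal (K * (s x)\<^sup>2) * (\<integral>\<^sup>+y. F y * ?i x y \<partial>lborel)) =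
         (\<integral>\<^sup>+y. (ennreal K * F y) * (?i x y * ennreal (1 / s x ^ ?n)) \<partial>lborel)"
        by (simp only: mult_ac)
    qed
    also have "\<dots> = (\<integral>\<^sup>+y. (ennreal K * F y) * (\<integral>\<^sup>+x. ?i x y * ennreal (1 / s x ^ ?n) \<partial>lborel) \<partial>lborel)"
      by (rule nn_integral_kernel_swap[OF _ im]) measurable
    also have "\<dots> \<le> (\<integral>\<^sup>+y. (ennreal K * F y) * ennreal (w * 3 ^ ?n) \<partial>lborel)"
      by (intro nn_integral_mono mult_left_mono up) simp
    also have "\<dots> = (\<integral>\<^sup>+y. ennreal (K * (w * 3 ^ ?n)) * F y \<partial>lebesgue)"
      using K w by (simp add: nn_integral_completion ennreal_mult mult_ac)
    also have "\<dots> = ennreal (K * (w * 3 ^ ?n)) * (\<integral>\<^sup>+y. F y \<partial>lebesgue)" by (rule nn_integral_cmult) measurable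
    finally have main: "ennreal \<alpha> * (\<integral>\<^sup>+y. ennreal ((f y)\<^sup>2 / (lip_rho V y)\<^sup>2) \<partial>lebesgue) \<le> ennreal (K * (w * 3 ^ ?n)) * (\<integral>\<^sup>+y. F y \<partial>lebesgue)"
      by (simp add: nn_integral_completion)
    have "(\<integral>\<^sup>+y. ennreal ((f y)\<^sup>2 / (lip_rho V y)\<^sup>2) \<partial>lebesgue) = ennreal (1/\<alpha>) * (ennreal \<alpha> * (\<integral>\<^sup>+y. ennreal ((f y)\<^sup>2 / (lip_rho V y)\<^sup>2) \<partial>lebesgue))"
      using \<alpha> by (simp add: mult.assoc[symmetric] ennreal_mult[symmetric])
    also have "\<dots> \<le> ennreal (1/\<alpha>) * (ennreal (K * (w * 3 ^ ?n)) * (\<integral>\<^sup>+y. F y \<partial>lebesgue))"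
      by (intro mult_left_mono main) simp
    also have "\<dots> = ennreal K' * (\<integral>\<^sup>+y. F y \<partial>lebesgue)"
    proof -
      have "ennreal (1/\<alpha>) * ennreal (K * (w * 3 ^ ?n)) = ennreal K'"
        using \<alpha> K w by (subst ennreal_mult[symmetric]) (auto simp: K'_def)
      then show ?thesis by (simp only: mult.assoc[symmetric])
    qed
    finally show ?thesis by (simp add: F_def)
  qed
  with K' show ?thesis by blast
qed

section \<open>Test functions adapted to the Agmon distance\<close>

text \<open>The difference quotient is taken in the direction of the gradient itself, where its
  limit is the squared norm of the gradient.\<close>

lemma norm_grad_le:
  fixes f :: "real^'n \<Rightarrow> real"
  assumes f: "f differentiable at x" and d: "0 < d" and le: "\<And>h. norm h < d \<Longrightarrow> \<bar>f (x + h) - f x\<bar> \<le> L * norm h" and L: "0 \<le> L"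
  shows "norm (grad f x) \<le> L"
proof (cases "grad f x = 0")
  case False
  let ?g = "grad f x"
  have "((\<lambda>t. x + t *\<^sub>R ?g) has_derivative (\<lambda>s. s *\<^sub>R ?g)) (at 0)"
    by (auto intro!: derivative_eq_intros)
  moreover have "(f has_derivative (\<lambda>h. ?g \<bullet> h)) (at (x + 0 *\<^sub>R ?g))" using has_derivative_grad[OF f] by simp
  ultimately have d1: "((\<lambda>t. f (x + t *\<^sub>R ?g)) has_derivative (\<lambda>s. ?g \<bullet> (s *\<^sub>R ?g))) (at 0)"
    by (rule has_derivative_compose)
  then have "((\<lambda>t. f (x + t *\<^sub>R ?g)) has_real_derivative (?g \<bullet> ?g)) (at 0)"
  proof -
    have "(\<lambda>s. ?g \<bullet> (s *\<^sub>R ?g)) = (*) (?g \<bullet> ?g)" by (simp add: fun_eq_iff mult.commute)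
    with d1 show ?thesis by (simp only: has_field_derivative_def)
  qed
  then have lim: "((\<lambda>t. (f (x + t *\<^sub>R ?g) - f x) / t) \<longlongrightarrow> ?g \<bullet> ?g) (at 0)"
    by (simp add: DERIV_def)
  have "?g \<bullet> ?g \<le> L * norm ?g"
  proof (rule tendsto_upperbound[OF lim])
    have "eventually (\<lambda>t. t \<noteq> 0 \<and> norm t < d / norm ?g) (at (0::real))"
      unfolding eventually_at using d False by (intro exI[of _ "d / norm ?g"]) (auto simp: dist_norm)
    then show "eventually (\<lambda>t. (f (x + t *\<^sub>R ?g) - f x) / t \<le> L * norm ?g) (at 0)"
    proof eventually_elim
      case (elim t)
      then have "norm (t *\<^sub>R ?g) < d" using False by (simp add: field_simps)
      from le[OF this] have "\<bar>f (x + t *\<^sub>R ?g) - f x\<bar> / \<bar>t\<bar> \<le> L * norm ?g" using elim by (simp add: field_simps)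
      then have "\<bar>(f (x + t *\<^sub>R ?g) - f x) / t\<bar> \<le> L * norm ?g" by (simp only: abs_divide)
      then show ?case by linarith
    qed
  qed auto
  then have "norm ?g * norm ?g \<le> L * norm ?g" by (simp add: power2_norm_eq_inner[symmetric] power2_eq_square)
  then show ?thesis using False by simp
qed (use L in simp)

lemma integral_translate:
  fixes h :: "real^'n" and g :: "real^'n \<Rightarrow> real"
  assumes [measurable]: "g \<in> borel_measurable borel"
  shows "(LINT y|lebesgue. g (y + h)) = (LINT y|lebesgue. g y)"
proof -
  have "(LINT y|lebesgue. g (h - (0 - y))) = (LINT y|lebesgue. g (h - y))"
    by (rule integral_reflect[of "\<lambda>z. g (h - z)" 0]) measurable
  moreover have "(LINT y|lebesgue. g (h - y)) = (LINT y|lebesgue. g y)"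
    by (rule integral_reflect[of g h]) measurable
  ultimately show ?thesis by (simp add: add.commute)
qed

text \<open>The Lipschitz bound is used only near \<open>x\<close>, so \<open>L\<close> may vary
  with the point. A translation of the convolution is moved onto \<open>f\<close>, and the increment
  of \<open>f\<close> is then averaged by the kernel.\<close>

lemma conv_grad_le:
  fixes f :: "real^'n \<Rightarrow> real"
  assumes f: "continuous_on UNIV f" "\<And>x. norm x > R \<Longrightarrow> f x = 0" and m: "mollifier \<epsilon> \<eta>" and \<epsilon>: "\<epsilon> < \<epsilon>0" and L: "0 \<le> L"
    and le: "\<And>y y'. dist x y < \<epsilon>0 \<Longrightarrow> dist x y' < \<epsilon>0 \<Longrightarrow> \<bar>f y - f y'\<bar> \<le> L * dist y y'"
  shows "norm (grad (conv f \<eta>) x) \<le> L"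
proof (rule norm_grad_le[of _ _ "\<epsilon>0 - \<epsilon>"])
  have fi: "integrable lebesgue f" by (rule continuous_zero_outside_integrable[OF f])
  show "conv f \<eta> differentiable at x"
    by (rule test_fun_differentiable[OF test_fun_conv[OF fi f(2) mollifierD(1)[OF m]]])
  fix h :: "real^'n" assume h: "norm h < \<epsilon>0 - \<epsilon>"
  have fh: "continuous_on UNIV (\<lambda>y. f (y + h))" by (intro continuous_on_compose2[OF f(1)] continuous_intros) auto
  note i1 = mollify_continuous_product[OF m fh, of x] and i2 = mollify_continuous_product[OF m f(1), of x]
  have "continuous_on UNIV (\<lambda>y. f y * \<eta> (x + h - y))"
    by (intro continuous_intros f continuous_on_compose2[OF mollifierD(5)[OF m]]) auto
  from integral_translate[OF borel_measurable_continuous_onI[OF this], of h]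
  have "conv f \<eta> (x + h) = conv (\<lambda>y. f (y + h)) \<eta> x" by (simp add: conv_def)
  then have "conv f \<eta> (x + h) - conv f \<eta> x = conv (\<lambda>y. f (y + h) - f y) \<eta> x"
    using i1 i2 by (simp add: conv_def left_diff_distrib)
  moreover have "\<bar>conv (\<lambda>y. f (y + h) - f y) \<eta> x - 0\<bar> \<le> L * norm h"
  proof (rule mollify_le[OF m])
    show "integrable lebesgue (\<lambda>y. (f (y + h) - f y) * \<eta> (x - y))" using i1 i2 by (simp add: left_diff_distrib)
    fix y assume y: "dist x y < \<epsilon>"
    have "dist x (y + h) \<le> dist x y + norm h"
      using norm_triangle_ineq4[of "x - y" h] by (simp add: dist_norm algebra_simps)
    then show "\<bar>f (y + h) - f y - 0\<bar> \<le> L * norm h"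
      using le[of "y + h" y] y h \<epsilon> by (simp add: dist_norm)
  qed
  ultimately show "\<bar>conv f \<eta> (x + h) - conv f \<eta> x\<bar> \<le> L * norm h" by simp
qed (use \<epsilon> L in auto)

lemma abs_exp_minus_diff_le:
  fixes a b c :: real
  assumes "c \<le> a" "c \<le> b"
  shows "\<bar>exp (- a) - exp (- b)\<bar> \<le> exp (- c) * \<bar>a - b\<bar>"
proof -
  have *: "exp (- a) - exp (- b) \<le> exp (- c) * (b - a)" if "a \<le> b" "c \<le> a" for a b
  proof -
    have "1 - exp (- (b - a)) \<le> b - a" using exp_ge_add_one_self[of "-(b-a)"] by linarith
    then have "exp (- a) * (1 - exp (- (b - a))) \<le> exp (- a) * (b - a)" by (intro mult_left_mono) auto
    also have "\<dots> \<le> exp (- c) * (b - a)" using that by (intro mult_right_mono) auto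
    also have "exp (- a) * (1 - exp (- (b - a))) = exp (- a) - exp (- b)"
      by (simp add: right_diff_distrib flip: exp_add)
    finally show ?thesis .
  qed
  show ?thesis
  proof (cases "a \<le> b")
    case True then show ?thesis using *[of a b] assms by simp
  next
    case False then show ?thesis using *[of b a] assms by (simp add: abs_minus_commute)
  qed
qed

text \<open>The cutoff times the exponential of \<open>- \<gamma> * D\<close> is only locally
  Lipschitz, so it is mollified at a scale so small, relative to the minima of \<rho> and of the
  exponential on the large ball, that the gradient bound survives with slightly larger constants.
  The bound must contain \<open>\<psi> x\<close> itself in its first term, since that term is to be
  absorbed.\<close>

lemma weight_test_fun:
  fixes V :: "real^'n \<Rightarrow> real"
  assumes p: "1 < p" "real CARD('n) \<le> 2 * p" and C: "1 \<le> C" and V: "RH_real p C V"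
    and g: "0 \<le> \<gamma>" "\<gamma> \<le> 1" and R: "1 \<le> R"
  shows "\<exists>\<psi>. test_fun \<psi> \<and> (\<forall>x. norm x > 3 * R \<longrightarrow> \<psi> x = 0) \<and> (\<forall>x. 0 \<le> \<psi> x) \<and>
    (\<forall>x. norm x \<le> R \<longrightarrow> exp (- \<gamma> * agmon_path_inf V x) / 2 \<le> \<psi> x) \<and>
    (\<forall>x. norm (grad \<psi> x) \<le> 4 * \<gamma> * \<psi> x / lip_rho V x + 3 * exp (- \<gamma> * agmon_path_inf V x) / R)"
proof -
  define \<rho> where "\<rho> = lip_rho V"
  define D where "D = agmon_path_inf V"
  define E where "E x = exp (- (\<gamma> * D x))" for x
  have \<rho>: "\<rho> x > 0" for x unfolding \<rho>_def by (rule rho_pos[OF p C V])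
  have \<rho>lip: "\<rho> x \<le> \<rho> y + dist x y" for x y unfolding \<rho>_def by (rule rho_lip[OF p C V])
  have \<rho>c: "continuous_on UNIV \<rho>" unfolding \<rho>_def by (rule continuous_lip_rho[OF p C V])
  have Dlip: "\<bar>D x - D y\<bar> \<le> 2 / \<rho> x * dist x y" if "dist x y \<le> \<rho> x / 2" for x y
    using agmon_path_inf_lipschitz[OF p C V] that by (simp add: D_def \<rho>_def)
  have Dc: "continuous_on UNIV D" unfolding D_def by (rule continuous_agmon_D[OF p C V])
  have Ec: "continuous_on UNIV E" unfolding E_def by (intro continuous_intros Dc)
  have E0: "E x > 0" for x by (simp add: E_def)
  have ne: "cball (0::real^'n) (3*R) \<noteq> {}" using R by simp
  obtain x1 where x1: "\<And>x. x \<in> cball 0 (3*R) \<Longrightarrow> \<rho> x1 \<le> \<rho> x"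
    using continuous_attains_inf[OF compact_cball ne continuous_on_subset[OF \<rho>c]] by blast
  obtain x2 where x2: "\<And>x. x \<in> cball 0 (3*R) \<Longrightarrow> E x2 \<le> E x"
    using continuous_attains_inf[OF compact_cball ne continuous_on_subset[OF Ec]] by blast
  define m where "m = min 1 (min (\<rho> x1) (E x2))"
  have m: "0 < m" "m \<le> 1" "\<And>x. norm x \<le> 3 * R \<Longrightarrow> m \<le> \<rho> x" "\<And>x. norm x \<le> 3 * R \<Longrightarrow> m \<le> E x"
    using \<rho>[of x1] E0[of x2] x1 x2 by (auto simp: m_def min_le_iff_disj)
  define cut where "cut x = max 0 (min 1 (2 - norm x / R))" for x :: "real^'n"
  define \<psi>0 where "\<psi>0 x = cut x * E x" for x
  have cut: "0 \<le> cut x" "cut x \<le> 1" for x by (auto simp: cut_def)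
  have cut_lip: "\<bar>cut x - cut y\<bar> \<le> dist x y / R" for x y
  proof -
    have "\<bar>cut x - cut y\<bar> \<le> \<bar>norm x / R - norm y / R\<bar>" unfolding cut_def by (auto simp: max_def min_def)
    also have "\<dots> = \<bar>norm x - norm y\<bar> / R" using R by (simp add: diff_divide_distrib[symmetric] abs_divide)
    also have "\<dots> \<le> dist x y / R" using R norm_triangle_ineq3[of x y] by (intro divide_right_mono) (auto simp: dist_norm)
    finally show ?thesis .
  qed
  have \<psi>0c: "continuous_on UNIV \<psi>0"
    unfolding \<psi>0_def cut_def using R by (intro continuous_intros Ec) auto
  have \<psi>0z: "\<psi>0 x = 0" if "norm x > 2 * R" for x
    using that R by (simp add: \<psi>0_def cut_def max_def min_def field_simps)
  \<comment> \<open>Points this close to \<open>x\<close> are within \<open>\<rho> x / 8\<close>, so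
    on them \<rho> drops by at most an eighth and \<open>D\<close> by at most 1/4.\<close>
  define \<epsilon>0 where "\<epsilon>0 = m / 8"
  define L where "L x = 4 * \<gamma> * \<psi>0 x / \<rho> x + 2 * E x / R" for x
  have L0: "0 \<le> L x" for x using g \<rho>[of x] E0[of x] R cut[of x] by (simp add: L_def \<psi>0_def less_imp_le)
  have loc: "\<bar>\<psi>0 y - \<psi>0 y'\<bar> \<le> L x * dist y y'"
    if x: "norm x \<le> 3 * R" and y: "dist x y < \<epsilon>0" and y': "dist x y' < \<epsilon>0" for x y y'
  proof -
    define r where "r = \<rho> x"
    have r: "r > 0" "\<epsilon>0 \<le> r / 8" using m(3)[OF x] \<rho>[of x] by (auto simp: r_def \<epsilon>0_def)
    have ry: "7 / 8 * r \<le> \<rho> y" using \<rho>lip[of x y] y r by (simp add: r_def)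
    have yy: "dist y y' \<le> r / 4" using y y' r dist_triangle[of y y' x] by (simp add: dist_commute)
    have "\<bar>D y - D y'\<bar> \<le> 2 / \<rho> y * dist y y'" using yy ry r by (intro Dlip) simp
    also have "\<dots> \<le> 2 / (7 / 8 * r) * dist y y'" using ry r by (intro mult_right_mono divide_left_mono) auto
    also have "\<dots> = 16 / 7 / r * dist y y'" by simp
    finally have DD: "\<bar>D y - D y'\<bar> \<le> 16 / 7 / r * dist y y'" .
    have Dx: "D x - 1 / 4 \<le> D z" if "dist x z < \<epsilon>0" for z
    proof -
      have "\<bar>D x - D z\<bar> \<le> 2 / r * dist x z" using Dlip[of x z] that r by (simp add: r_def)
      also have "\<dots> \<le> 2 / r * (r / 8)" using that r by (intro mult_left_mono) auto
      also have "\<dots> = 1 / 4" using r by simp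
      finally show ?thesis by linarith
    qed
    have gD: "\<gamma> * D x - 1 / 4 \<le> \<gamma> * D z" if "dist x z < \<epsilon>0" for z
    proof -
      have "\<gamma> * (D x - 1 / 4) \<le> \<gamma> * D z" using Dx[OF that] g by (intro mult_left_mono) auto
      then show ?thesis using g by (simp add: right_diff_distrib)
    qed
    have e4: "exp (- (\<gamma> * D x - 1 / 4)) \<le> 4 / 3 * E x"
    proof -
      have "exp (1 / 4) \<le> 1 + 1 / 4 + (1 / 4 :: real)\<^sup>2" by (rule exp_bound) auto
      then have "exp (1 / 4) \<le> (4 / 3 :: real)" by (simp add: power2_eq_square)
      then have "E x * exp (1 / 4) \<le> E x * (4 / 3)" using E0[of x] by (intro mult_left_mono) auto
      moreover have "exp (- (\<gamma> * D x - 1 / 4)) = E x * exp (1 / 4)" by (simp add: E_def flip: exp_add)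
      ultimately show ?thesis by simp
    qed
    have "E y' \<le> exp (- (\<gamma> * D x - 1 / 4))" using gD[OF y'] unfolding E_def by simp
    then have Ey': "E y' \<le> 4 / 3 * E x" using e4 by linarith
    have "\<bar>E y - E y'\<bar> \<le> exp (- (\<gamma> * D x - 1 / 4)) * \<bar>\<gamma> * D y - \<gamma> * D y'\<bar>"
      unfolding E_def by (rule abs_exp_minus_diff_le[OF gD[OF y] gD[OF y']])
    also have "\<dots> \<le> (4 / 3 * E x) * (\<gamma> * (16 / 7 / r * dist y y'))"
    proof (intro mult_mono e4)
      have "\<bar>\<gamma> * D y - \<gamma> * D y'\<bar> = \<gamma> * \<bar>D y - D y'\<bar>" using g by (simp add: abs_mult right_diff_distrib[symmetric])
      also have "\<dots> \<le> \<gamma> * (16 / 7 / r * dist y y')" using DD g by (intro mult_left_mono) auto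
      finally show "\<bar>\<gamma> * D y - \<gamma> * D y'\<bar> \<le> \<gamma> * (16 / 7 / r * dist y y')" .
    qed (use E0[of x] in auto)
    also have "\<dots> = 64 / 21 * (\<gamma> * E x / r * dist y y')" by simp
    \<comment> \<open>64/21 is the product of 16/7, the local Lipschitz factor of \<open>D\<close>,
      and 4/3, the bound for the exponential of 1/4.\<close>
    also have "\<dots> \<le> 4 * (\<gamma> * E x / r * dist y y')"
      using g E0[of x] r by (intro mult_right_mono) auto
    finally have EE: "\<bar>E y - E y'\<bar> \<le> 4 * (\<gamma> * E x / r * dist y y')" .
    \<comment> \<open>The first term must come out with \<open>\<psi>0 x\<close>, so
      \<open>cut y\<close> is traded for \<open>cut x\<close>. The error, multiplied by
      \<open>4 * \<gamma> / r\<close>, is of order \<open>1 / R\<close> and joins the term from the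
      cutoff.\<close>
    have cy: "cut y \<le> cut x + r / (8 * R)"
    proof -
      have "cut y \<le> cut x + dist x y / R" using cut_lip[of x y] by linarith
      also have "dist x y / R \<le> (r / 8) / R" using y r R by (intro divide_right_mono) auto
      finally show ?thesis by simp
    qed
    have "\<psi>0 y - \<psi>0 y' = cut y * (E y - E y') + E y' * (cut y - cut y')" by (simp add: \<psi>0_def algebra_simps)
    then have "\<bar>\<psi>0 y - \<psi>0 y'\<bar> \<le> cut y * \<bar>E y - E y'\<bar> + E y' * \<bar>cut y - cut y'\<bar>"
      using abs_triangle_ineq[of "cut y * (E y - E y')" "E y' * (cut y - cut y')"] cut(1)[of y] E0[of y'] by (simp add: abs_mult)
    also have "\<dots> \<le> (cut x + r / (8 * R)) * (4 * (\<gamma> * E x / r * dist y y')) + (4 / 3 * E x) * (dist y y' / R)"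
      using cut[of x] cut[of y] E0[of x] E0[of y'] r R by (intro add_mono mult_mono EE cy Ey' cut_lip) auto
    also have "\<dots> = (4 * \<gamma> * \<psi>0 x / r + (\<gamma> / 2 + 4 / 3) * E x / R) * dist y y'"
      using r R by (simp add: \<psi>0_def field_simps)
    also have "\<dots> \<le> L x * dist y y'"
    proof (intro mult_right_mono)
      have "(\<gamma> / 2 + 4 / 3) * E x / R \<le> 2 * E x / R"
        using g E0[of x] R by (intro divide_right_mono mult_right_mono) auto
      then show "4 * \<gamma> * \<psi>0 x / r + (\<gamma> / 2 + 4 / 3) * E x / R \<le> L x" by (simp add: L_def r_def)
    qed auto
    finally show ?thesis .
  qed
  \<comment> \<open>This uniform error is below both \<open>E x / 8\<close> and
    \<open>\<rho> x * E x / (8 * R)\<close>: the first keeps the lower bound on the ball of radius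
    \<open>R\<close>, the second lets \<open>\<psi>0\<close> be replaced by \<open>\<psi>\<close> in
    the gradient bound at the cost of one more \<open>E x / R\<close>.\<close>
  define \<tau> where "\<tau> = m * m / (8 * R)"
  have \<tau>: "\<tau> > 0" using m R by (simp add: \<tau>_def)
  obtain d where d: "d > 0" "\<And>\<epsilon> \<eta> x. \<epsilon> \<le> d \<Longrightarrow> mollifier \<epsilon> \<eta> \<Longrightarrow> \<bar>conv \<psi>0 \<eta> x - \<psi>0 x\<bar> \<le> \<tau>"
    using mollify_uniform[OF \<psi>0c \<psi>0z \<tau>] by blast
  define \<epsilon> where "\<epsilon> = min d (\<epsilon>0 / 2)"
  have \<epsilon>: "0 < \<epsilon>" "\<epsilon> \<le> d" "\<epsilon> < \<epsilon>0" "\<epsilon> \<le> 1" using d(1) m by (auto simp: \<epsilon>_def \<epsilon>0_def)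
  obtain \<eta> :: "real^'n \<Rightarrow> real" where mo: "mollifier \<epsilon> \<eta>" using mollifier_ex[OF \<epsilon>(1)] by blast
  define \<psi> where "\<psi> = conv \<psi>0 \<eta>"
  have close: "\<bar>\<psi> x - \<psi>0 x\<bar> \<le> \<tau>" for x unfolding \<psi>_def by (rule d(2)[OF \<epsilon>(2) mo])
  have fi: "integrable lebesgue \<psi>0" by (rule continuous_zero_outside_integrable[OF \<psi>0c \<psi>0z])
  have t: "test_fun \<psi>" unfolding \<psi>_def by (rule test_fun_conv[OF fi \<psi>0z mollifierD(1)[OF mo]])
  have z: "\<psi> x = 0" if "norm x > 3 * R" for x
    unfolding \<psi>_def
    by (rule conv_zero_outside[where R="2*R" and S=1, OF \<psi>0z]) (use that R \<epsilon> mollifierD(3)[OF mo] in auto)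
  have nn: "0 \<le> \<psi> x" for x
    unfolding \<psi>_def conv_def using mollifierD(2)[OF mo] cut E0
    by (intro integral_nonneg_AE AE_I2) (simp add: \<psi>0_def less_imp_le)
  have \<tau>E: "\<tau> \<le> \<rho> x * E x / (8 * R)" "\<tau> \<le> E x / 8" if "norm x \<le> 3 * R" for x
  proof -
    have "m * m \<le> \<rho> x * E x" using m(1) m(3,4)[OF that] by (intro mult_mono) auto
    then show "\<tau> \<le> \<rho> x * E x / (8 * R)" using R by (simp add: \<tau>_def divide_right_mono)
    have "m * m \<le> 1 * E x" using m(1,2) m(4)[OF that] by (intro mult_mono) auto
    then have "\<tau> \<le> E x / (8 * R)" using R by (simp add: \<tau>_def divide_right_mono)
    also have "\<dots> \<le> E x / 8" using R E0[of x] by (intro divide_left_mono) auto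
    finally show "\<tau> \<le> E x / 8" .
  qed
  have low: "E x / 2 \<le> \<psi> x" if "norm x \<le> R" for x
  proof -
    have "cut x = 1" using that R by (simp add: cut_def max_def min_def field_simps)
    then have "\<psi>0 x = E x" by (simp add: \<psi>0_def)
    moreover have "norm x \<le> 3 * R" using that R by simp
    ultimately show ?thesis using close[of x] \<tau>E(2)[of x] E0[of x] by simp
  qed
  have gr: "norm (grad \<psi> x) \<le> 4 * \<gamma> * \<psi> x / \<rho> x + 3 * E x / R" for x
  proof (cases "norm x \<le> 3 * R")
    case False
    have "grad \<psi> x = 0" by (rule grad_zero_outside[OF z]) (use False in auto)
    then show ?thesis using g nn[of x] \<rho>[of x] E0[of x] R by (simp add: less_imp_le)
  next
    case True
    have "norm (grad \<psi> x) \<le> L x"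
      unfolding \<psi>_def using loc[OF True] by (intro conv_grad_le[OF \<psi>0c \<psi>0z mo \<epsilon>(3) L0])
    also have "\<dots> \<le> 4 * \<gamma> * (\<psi> x + \<tau>) / \<rho> x + 2 * E x / R"
    proof -
      have "\<psi>0 x \<le> \<psi> x + \<tau>" using close[of x] by linarith
      then have "4 * \<gamma> * \<psi>0 x / \<rho> x \<le> 4 * \<gamma> * (\<psi> x + \<tau>) / \<rho> x"
        using g \<rho>[of x] by (intro divide_right_mono mult_left_mono) auto
      then show ?thesis by (simp add: L_def)
    qed
    also have "\<dots> = 4 * \<gamma> * \<psi> x / \<rho> x + 4 * \<gamma> * \<tau> / \<rho> x + 2 * E x / R" by (simp add: distrib_left add_divide_distrib)
    also have "4 * \<gamma> * \<tau> / \<rho> x \<le> E x / R"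
    proof -
      have "4 * \<gamma> * \<tau> / \<rho> x \<le> 4 * 1 * (\<rho> x * E x / (8 * R)) / \<rho> x"
        using g \<rho>[of x] \<tau>E(1)[OF True] \<tau> by (intro divide_right_mono mult_mono) auto
      also have "\<dots> = E x / R / 2" using \<rho>[of x] by simp
      also have "\<dots> \<le> E x / R" using E0[of x] R by (simp add: field_simps)
      finally show ?thesis .
    qed
    finally show ?thesis by (simp add: add_divide_distrib[symmetric] add.assoc)
  qed
  show ?thesis
    by (intro exI[of _ \<psi>]) (use t z nn low gr in \<open>simp add: E_def D_def \<rho>_def\<close>)
qed

section \<open>Weighted decay and vanishing\<close>

lemma ennreal_absorb_half:
  fixes X Z :: ennreal
  assumes fin: "X < \<infinity>" and le: "X \<le> ennreal (1/2) * X + Z"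
  shows "X \<le> 2 * Z"
proof (cases "Z = \<infinity>")
  case False
  obtain x where x: "X = ennreal x" "0 \<le> x" using fin by (cases X) auto
  obtain z where z: "Z = ennreal z" "0 \<le> z" using False by (cases Z) auto
  have "ennreal x \<le> ennreal (1/2 * x + z)"
    using le x z by (simp only:) (subst ennreal_plus, simp, simp, subst ennreal_mult, simp_all)
  then have "x \<le> 1/2 * x + z" using x z by (subst (asm) ennreal_le_iff) auto
  then have "ennreal x \<le> ennreal (2 * z)" by (intro ennreal_leI) simp
  then show ?thesis using x z by (simp add: ennreal_mult)
qed (simp add: ennreal_mult_top)

text \<open>The gradient of \<open>\<psi>\<close> has an exponential part
  \<open>4 * \<gamma> * \<psi> / \<rho>\<close> and a cutoff part of order \<open>E / R\<close>. The
  first reproduces the left-hand side of the Fefferman-Phong inequality with a factor of order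
  \<open>\<gamma>\<^sup>2\<close> and is absorbed for small \<gamma>; only the second
  remains.\<close>

lemma weighted_decay:
  fixes p C lam Lam :: real
  assumes p: "1 < p" "real CARD('n) \<le> 2 * p" and C: "1 \<le> C" and lam: "0 < lam" "lam \<le> 1" and Lam: "0 < Lam"
  shows "\<exists>\<gamma>\<^sub>0>0. \<exists>K>0. \<forall>(A :: real^'n \<Rightarrow> real^'n^'n) V V\<^sub>0 u \<gamma> R.
    bounded_elliptic lam Lam A \<longrightarrow> weak_solution A V u \<longrightarrow> V \<in> borel_measurable lebesgue \<longrightarrow>
    (AE x in lebesgue. V x > 0) \<longrightarrow> RH_real p C V\<^sub>0 \<longrightarrow> (AE x in lebesgue. V x = V\<^sub>0 x) \<longrightarrow>
    0 \<le> \<gamma> \<longrightarrow> \<gamma> \<le> \<gamma>\<^sub>0 \<longrightarrow> 1 \<le> R \<longrightarrow>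
    (\<integral>\<^sup>+x. ennreal ((u x * exp (- \<gamma> * agmon_path_inf V\<^sub>0 x) / lip_rho V\<^sub>0 x)\<^sup>2) * indicator (cball 0 R) x \<partial>lebesgue) \<le>
    ennreal (K / R\<^sup>2) * (\<integral>\<^sup>+x. ennreal ((u x * exp (- \<gamma> * agmon_path_inf V\<^sub>0 x))\<^sup>2) * indicator (cball 0 (3 * R)) x \<partial>lebesgue)"
proof -
  obtain Kf where Kf: "Kf > 0" and FP: "\<And>(V :: real^'n \<Rightarrow> real) f G. RH_real p C V \<Longrightarrow> compact_H1_pair f G \<Longrightarrow>
    (\<integral>\<^sup>+y. ennreal ((f y)\<^sup>2 / (lip_rho V y)\<^sup>2) \<partial>lebesgue) \<le>
    ennreal Kf * (\<integral>\<^sup>+y. ennreal ((norm (G y))\<^sup>2 + V y * (f y)\<^sup>2) \<partial>lebesgue)"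
    using fefferman_phong[OF p C] by blast
  \<comment> \<open>Energy of \<open>u * \<psi>\<close> in terms of \<open>u\<^sup>2\<close> times
    the squared gradient of \<open>\<psi>\<close>: the Caccioppoli constant times
    \<open>4 / lam\<close>, plus 2 from the product rule.\<close>
  define c where "c = 8 * Lam\<^sup>2 / lam\<^sup>2 + 2"
  have c: "c > 0" using lam Lam by (simp add: c_def add_pos_pos)
  \<comment> \<open>Chosen so that the absorbed share
    \<open>Kf * c * (32 * \<gamma>\<^sup>2)\<close> is at most 1/2; the bound 1 is required for the
    construction of \<open>\<psi>\<close>.\<close>
  define \<gamma>\<^sub>0 where "\<gamma>\<^sub>0 = min 1 (sqrt (1 / (64 * (Kf * c))))"
  have \<gamma>\<^sub>0: "\<gamma>\<^sub>0 > 0" using Kf c by (simp add: \<gamma>\<^sub>0_def)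
  \<comment> \<open>144 = 4 * 2 * 18: from \<open>\<psi> \<ge> E / 2\<close>, from absorbing one
    half, and from the cutoff part of the squared gradient.\<close>
  define K where "K = 144 * (Kf * c)"
  have K: "K > 0" using Kf c by (simp add: K_def)
  have "(\<integral>\<^sup>+x. ennreal ((u x * exp (- \<gamma> * agmon_path_inf V\<^sub>0 x) / lip_rho V\<^sub>0 x)\<^sup>2) * indicator (cball 0 R) x \<partial>lebesgue) \<le>
    ennreal (K / R\<^sup>2) * (\<integral>\<^sup>+x. ennreal ((u x * exp (- \<gamma> * agmon_path_inf V\<^sub>0 x))\<^sup>2) * indicator (cball 0 (3 * R)) x \<partial>lebesgue)"
    if A: "bounded_elliptic lam Lam A" and u: "weak_solution A V u" and Vm: "V \<in> borel_measurable lebesgue"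
    and Vpos: "AE x in lebesgue. V x > 0" and V0: "RH_real p C V\<^sub>0" and eq: "AE x in lebesgue. V x = V\<^sub>0 x"
    and g: "0 \<le> \<gamma>" "\<gamma> \<le> \<gamma>\<^sub>0" and R: "1 \<le> R"
    for A :: "real^'n \<Rightarrow> real^'n^'n" and V V\<^sub>0 u \<gamma> R
  proof -
    define \<rho> where "\<rho> = lip_rho V\<^sub>0"
    define E where "E x = exp (- \<gamma> * agmon_path_inf V\<^sub>0 x)" for x
    have \<rho>: "\<rho> x > 0" for x unfolding \<rho>_def by (rule lip_rho_pos[OF p C V0])
    have \<rho>c: "continuous_on UNIV \<rho>" unfolding \<rho>_def by (rule continuous_lip_rho[OF p C V0])
    have Ec: "continuous_on UNIV E" unfolding E_def by (intro continuous_intros continuous_agmon_D[OF p C V0])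
    have g1: "\<gamma> \<le> 1" and g2: "Kf * c * (32 * \<gamma>\<^sup>2) \<le> 1/2"
    proof -
      show "\<gamma> \<le> 1" using g by (simp add: \<gamma>\<^sub>0_def)
      have "\<gamma>\<^sup>2 \<le> (sqrt (1 / (64 * (Kf * c))))\<^sup>2" using g by (intro power_mono) (simp_all add: \<gamma>\<^sub>0_def)
      also have "\<dots> = 1 / (64 * (Kf * c))" using Kf c by simp
      finally have "Kf * c * (32 * \<gamma>\<^sup>2) \<le> Kf * c * (32 * (1 / (64 * (Kf * c))))" using Kf c by (intro mult_left_mono) auto
      also have "\<dots> = 1/2" using Kf c by simp
      finally show "Kf * c * (32 * \<gamma>\<^sup>2) \<le> 1/2" .
    qed
    obtain \<psi> where \<psi>: "test_fun \<psi>" and \<psi>z: "\<And>x. norm x > 3 * R \<Longrightarrow> \<psi> x = 0" and \<psi>0: "\<And>x. 0 \<le> \<psi> x"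
      and \<psi>low: "\<And>x. norm x \<le> R \<Longrightarrow> E x / 2 \<le> \<psi> x"
      and \<psi>g: "\<And>x. norm (grad \<psi> x) \<le> 4 * \<gamma> * \<psi> x / \<rho> x + 3 * E x / R"
      using weight_test_fun[OF p C V0 g(1) g1 R] unfolding E_def \<rho>_def by blast
    have H: "H1_loc u" using u by (simp add: weak_solution_def)
    note w = H1_loc_weak_grad[OF H]
    have um[measurable]: "u \<in> borel_measurable lebesgue" "weak_grad u \<in> borel_measurable lebesgue"
      using w by (auto simp: Lp_loc_2_iff)
    have cm[measurable]: "\<psi> \<in> borel_measurable lebesgue" "grad \<psi> \<in> borel_measurable lebesgue" 
      "\<rho> \<in> borel_measurable lebesgue" "E \<in> borel_measurable lebesgue"
      by (auto intro!: borel_measurable_lebesgueI test_fun_continuous continuous_grad \<psi> \<rho>c Ec)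
    note [measurable] = Vm
    define f where "f x = u x * \<psi> x" for x
    define G where "G x = \<psi> x *\<^sub>R weak_grad u x + u x *\<^sub>R grad \<psi> x" for x
    have pair: "compact_H1_pair f G"
    proof -
      have "\<forall>x. norm x > 3 * R \<longrightarrow> u x * \<psi> x = 0 \<and> \<psi> x *\<^sub>R weak_grad u x + u x *\<^sub>R grad \<psi> x = 0"
        using \<psi>z grad_zero_outside[where f=\<psi>, OF \<psi>z] by simp
      with H1_loc_mult_test(1-3)[OF H \<psi>, where R="3*R", OF \<psi>z] show ?thesis
        unfolding compact_H1_pair_def f_def G_def by blast
    qed
    define X where "X = (\<integral>\<^sup>+y. ennreal ((f y)\<^sup>2 / (\<rho> y)\<^sup>2) \<partial>lebesgue)"
    define Y where "Y = (\<integral>\<^sup>+x. ennreal ((u x * E x)\<^sup>2) * indicator (cball 0 (3 * R)) x \<partial>lebesgue)"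
    define W where "W = (\<integral>\<^sup>+x. ennreal ((u x)\<^sup>2 * (norm (grad \<psi> x))\<^sup>2) \<partial>lebesgue)"
    \<comment> \<open>Finiteness makes the absorption legitimate; it holds because
      \<open>\<psi> / \<rho>\<close> is continuous with compact support and \<open>u\<close> is
      locally square integrable.\<close>
    have Xfin: "X < \<infinity>"
    proof -
      have "L2 (\<lambda>x. u x * (\<psi> x / \<rho> x))"
      proof (rule Lp_loc_2_norm_mult_bounded[OF w(1), of _ "\<lambda>x. \<psi> x / \<rho> x" "3*R"])
        show "continuous_on UNIV (\<lambda>x. \<psi> x / \<rho> x)"
          using \<rho> by (intro continuous_on_divide test_fun_continuous \<psi> \<rho>c) (auto simp: less_imp_neq[THEN not_sym])
      qed (use \<psi>z in \<open>auto simp: abs_mult mult.commute\<close>)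
      then have "integrable lebesgue (\<lambda>x. (u x * (\<psi> x / \<rho> x))\<^sup>2)" unfolding L2_def real_norm_def power2_abs by blast
      then have "integrable lebesgue (\<lambda>y. (f y)\<^sup>2 / (\<rho> y)\<^sup>2)"
        by (simp add: f_def power_mult_distrib power_divide)
      then show ?thesis unfolding X_def by (simp add: integrable_iff_bounded)
    qed
    have HW: "(\<integral>\<^sup>+x. ennreal (lam / 2 * ((\<psi> x)\<^sup>2 * (norm (weak_grad u x))\<^sup>2) + V x * (u x)\<^sup>2 * (\<psi> x)\<^sup>2) \<partial>lebesgue)
      \<le> ennreal (2 * Lam\<^sup>2 / lam) * W"
      unfolding W_def by (rule caccioppoli[OF A lam(1) Lam u Vm Vpos \<psi>])
    have "X \<le> ennreal Kf * (\<integral>\<^sup>+y. ennreal ((norm (G y))\<^sup>2 + V\<^sub>0 y * (f y)\<^sup>2) \<partial>lebesgue)"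
      unfolding X_def \<rho>_def by (rule FP[OF V0 pair])
    also have "(\<integral>\<^sup>+y. ennreal ((norm (G y))\<^sup>2 + V\<^sub>0 y * (f y)\<^sup>2) \<partial>lebesgue) \<le>
      (\<integral>\<^sup>+x. ennreal (4 / lam) * ennreal (lam / 2 * ((\<psi> x)\<^sup>2 * (norm (weak_grad u x))\<^sup>2) + V x * (u x)\<^sup>2 * (\<psi> x)\<^sup>2)
         + 2 * ennreal ((u x)\<^sup>2 * (norm (grad \<psi> x))\<^sup>2) \<partial>lebesgue)"
    proof (rule nn_integral_mono_AE)
      show "AE x in lebesgue. ennreal ((norm (G x))\<^sup>2 + V\<^sub>0 x * (f x)\<^sup>2) \<le> ennreal (4 / lam) * ennreal (lam / 2 * ((\<psi> x)\<^sup>2 * (norm (weak_grad u x))\<^sup>2) + V x * (u x)\<^sup>2 * (\<psi> x)\<^sup>2)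
         + 2 * ennreal ((u x)\<^sup>2 * (norm (grad \<psi> x))\<^sup>2)"
        using Vpos eq
      proof eventually_elim
        case (elim x)
        let ?a = "(\<psi> x)\<^sup>2 * (norm (weak_grad u x))\<^sup>2" and ?b = "(u x)\<^sup>2 * (norm (grad \<psi> x))\<^sup>2" and ?v = "V x * (u x)\<^sup>2 * (\<psi> x)\<^sup>2"
        have "norm (G x) \<le> \<bar>\<psi> x\<bar> * norm (weak_grad u x) + \<bar>u x\<bar> * norm (grad \<psi> x)"
          unfolding G_def using norm_triangle_ineq[of "\<psi> x *\<^sub>R weak_grad u x" "u x *\<^sub>R grad \<psi> x"] by simp
        then have "(norm (G x))\<^sup>2 \<le> (\<bar>\<psi> x\<bar> * norm (weak_grad u x) + \<bar>u x\<bar> * norm (grad \<psi> x))\<^sup>2" by (intro power_mono) auto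
        also have "\<dots> \<le> 2 * (\<bar>\<psi> x\<bar> * norm (weak_grad u x))\<^sup>2 + 2 * (\<bar>u x\<bar> * norm (grad \<psi> x))\<^sup>2"
          using zero_le_power2[of "\<bar>\<psi> x\<bar> * norm (weak_grad u x) - \<bar>u x\<bar> * norm (grad \<psi> x)"]
          by (simp add: power2_sum power2_diff)
        finally have G2: "(norm (G x))\<^sup>2 \<le> 2 * ?a + 2 * ?b" by (simp add: power_mult_distrib)
        have v: "0 \<le> ?v" using elim by simp
        have "V\<^sub>0 x * (f x)\<^sup>2 = ?v" using elim by (simp add: f_def power_mult_distrib)
        \<comment> \<open>Here \<open>lam \<le> 1\<close> enters: gradient and potential terms can
          share the one factor \<open>4 / lam\<close>.\<close>
        moreover have "?v \<le> 4 / lam * ?v" using v lam mult_right_mono[of 1 "4/lam" ?v] by simp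
        moreover have "2 * ?a = 4 / lam * (lam / 2 * ?a)" using lam by simp
        ultimately have "(norm (G x))\<^sup>2 + V\<^sub>0 x * (f x)\<^sup>2 \<le> 4 / lam * (lam / 2 * ?a + ?v) + 2 * ?b"
          using G2 unfolding distrib_left by linarith
        then have "ennreal ((norm (G x))\<^sup>2 + V\<^sub>0 x * (f x)\<^sup>2) \<le> ennreal (4 / lam * (lam / 2 * ?a + ?v) + 2 * ?b)" by (rule ennreal_leI)
        also have "\<dots> = ennreal (4 / lam * (lam / 2 * ?a + ?v)) + ennreal (2 * ?b)"
          using v lam by (intro ennreal_plus) auto
        also have "ennreal (4 / lam * (lam / 2 * ?a + ?v)) = ennreal (4 / lam) * ennreal (lam / 2 * ?a + ?v)"
          using v lam by (intro ennreal_mult) auto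
        also have "ennreal (2 * ?b) = 2 * ennreal ?b" by (simp add: ennreal_mult)
        finally show ?case .
      qed
    qed
    also have "\<dots> = ennreal (4 / lam) * (\<integral>\<^sup>+x. ennreal (lam / 2 * ((\<psi> x)\<^sup>2 * (norm (weak_grad u x))\<^sup>2) + V x * (u x)\<^sup>2 * (\<psi> x)\<^sup>2) \<partial>lebesgue) + 2 * W"
      unfolding W_def by (subst nn_integral_add, measurable) (simp add: nn_integral_cmult)
    also have "\<dots> \<le> ennreal (4 / lam) * (ennreal (2 * Lam\<^sup>2 / lam) * W) + 2 * W"
      by (intro add_right_mono mult_left_mono HW) simp
    also have "\<dots> = ennreal c * W"
    proof -
      have "ennreal (4 / lam) * ennreal (2 * Lam\<^sup>2 / lam) = ennreal (8 * Lam\<^sup>2 / lam\<^sup>2)"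
        using lam by (subst ennreal_mult[symmetric]) (auto simp: power2_eq_square)
      then have "ennreal (4 / lam) * (ennreal (2 * Lam\<^sup>2 / lam) * W) = ennreal (8 * Lam\<^sup>2 / lam\<^sup>2) * W" by (simp only: mult.assoc[symmetric])
      moreover have "ennreal c = ennreal (8 * Lam\<^sup>2 / lam\<^sup>2) + 2" unfolding c_def using lam by (subst ennreal_plus) auto
      ultimately show ?thesis by (simp add: distrib_right)
    qed
    finally have XW: "X \<le> ennreal Kf * (ennreal c * W)" by (simp add: mult_left_mono)
    have WX: "W \<le> ennreal (32 * \<gamma>\<^sup>2) * X + ennreal (18 / R\<^sup>2) * Y"
    proof -
      have "W \<le> (\<integral>\<^sup>+x. ennreal (32 * \<gamma>\<^sup>2) * ennreal ((f x)\<^sup>2 / (\<rho> x)\<^sup>2) + ennreal (18 / R\<^sup>2) * (ennreal ((u x * E x)\<^sup>2) * indicator (cball 0 (3 * R)) x) \<partial>lebesgue)"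
        unfolding W_def
      proof (rule nn_integral_mono)
        fix x
        show "ennreal ((u x)\<^sup>2 * (norm (grad \<psi> x))\<^sup>2) \<le> ennreal (32 * \<gamma>\<^sup>2) * ennreal ((f x)\<^sup>2 / (\<rho> x)\<^sup>2) + ennreal (18 / R\<^sup>2) * (ennreal ((u x * E x)\<^sup>2) * indicator (cball 0 (3 * R)) x)"
        proof (cases "norm x > 3 * R")
          case True
          then show ?thesis using grad_zero_outside[where f=\<psi>, OF \<psi>z True] by simp
        next
          case False
          let ?a = "4 * \<gamma> * \<psi> x / \<rho> x" and ?b = "3 * E x / R"
          have "(norm (grad \<psi> x))\<^sup>2 \<le> (?a + ?b)\<^sup>2" using \<psi>g by (intro power_mono) auto
          also have "\<dots> \<le> 2 * ?a\<^sup>2 + 2 * ?b\<^sup>2" using zero_le_power2[of "?a - ?b"] unfolding power2_sum power2_diff by linarith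
          finally have "(u x)\<^sup>2 * (norm (grad \<psi> x))\<^sup>2 \<le> (u x)\<^sup>2 * (2 * ?a\<^sup>2 + 2 * ?b\<^sup>2)" by (intro mult_left_mono) auto
          also have "\<dots> = 32 * \<gamma>\<^sup>2 * ((f x)\<^sup>2 / (\<rho> x)\<^sup>2) + 18 / R\<^sup>2 * (u x * E x)\<^sup>2"
            by (simp add: f_def power_mult_distrib power_divide distrib_left mult_ac)
          finally have "ennreal ((u x)\<^sup>2 * (norm (grad \<psi> x))\<^sup>2) \<le> ennreal (32 * \<gamma>\<^sup>2 * ((f x)\<^sup>2 / (\<rho> x)\<^sup>2) + 18 / R\<^sup>2 * (u x * E x)\<^sup>2)" by (rule ennreal_leI)
          also have "\<dots> = ennreal (32 * \<gamma>\<^sup>2 * ((f x)\<^sup>2 / (\<rho> x)\<^sup>2)) + ennreal (18 / R\<^sup>2 * (u x * E x)\<^sup>2)" by (intro ennreal_plus) auto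
          also have "ennreal (32 * \<gamma>\<^sup>2 * ((f x)\<^sup>2 / (\<rho> x)\<^sup>2)) = ennreal (32 * \<gamma>\<^sup>2) * ennreal ((f x)\<^sup>2 / (\<rho> x)\<^sup>2)" by (intro ennreal_mult) auto
          also have "ennreal (18 / R\<^sup>2 * (u x * E x)\<^sup>2) = ennreal (18 / R\<^sup>2) * ennreal ((u x * E x)\<^sup>2)" by (intro ennreal_mult) auto
          finally show ?thesis using False by simp
        qed
      qed
      also have "\<dots> = ennreal (32 * \<gamma>\<^sup>2) * X + ennreal (18 / R\<^sup>2) * Y"
      proof -
        have m1: "(\<lambda>x. ennreal ((f x)\<^sup>2 / (\<rho> x)\<^sup>2)) \<in> borel_measurable lebesgue" unfolding f_def by measurable
        have "(\<lambda>x. ennreal ((u x * E x)\<^sup>2)) \<in> borel_measurable lebesgue" by measurable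
        then have m2: "(\<lambda>x. ennreal ((u x * E x)\<^sup>2) * indicator (cball 0 (3 * R)) x) \<in> borel_measurable lebesgue"
          by (intro borel_measurable_times_ennreal borel_measurable_indicator) auto
        show ?thesis unfolding X_def Y_def using m1 m2 by (simp add: nn_integral_add nn_integral_cmult)
      qed
      finally show ?thesis .
    qed
    have "X \<le> ennreal (Kf * c) * W" using XW Kf c by (simp add: ennreal_mult mult.assoc)
    also have "\<dots> \<le> ennreal (Kf * c) * (ennreal (32 * \<gamma>\<^sup>2) * X + ennreal (18 / R\<^sup>2) * Y)" by (intro mult_left_mono WX) simp
    also have "\<dots> = ennreal (Kf * c * (32 * \<gamma>\<^sup>2)) * X + ennreal (Kf * c * (18 / R\<^sup>2)) * Y"
      using Kf c by (simp only: distrib_left mult.assoc[symmetric] ennreal_mult[symmetric] mult_nonneg_nonneg less_imp_le zero_le_power2 zero_le_numeral divide_nonneg_nonneg)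
    also have "\<dots> \<le> ennreal (1/2) * X + ennreal (Kf * c * (18 / R\<^sup>2)) * Y"
      by (intro add_right_mono mult_right_mono ennreal_leI g2) simp
    finally have X2: "X \<le> 2 * (ennreal (Kf * c * (18 / R\<^sup>2)) * Y)" by (rule ennreal_absorb_half[OF Xfin])
    have "(\<integral>\<^sup>+x. ennreal ((u x * E x / \<rho> x)\<^sup>2) * indicator (cball 0 R) x \<partial>lebesgue) \<le> (\<integral>\<^sup>+x. 4 * ennreal ((f x)\<^sup>2 / (\<rho> x)\<^sup>2) \<partial>lebesgue)"
    proof (rule nn_integral_mono)
      fix x
      show "ennreal ((u x * E x / \<rho> x)\<^sup>2) * indicator (cball 0 R) x \<le> 4 * ennreal ((f x)\<^sup>2 / (\<rho> x)\<^sup>2)"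
      proof (cases "norm x \<le> R")
        case True
        have "(E x)\<^sup>2 \<le> (2 * \<psi> x)\<^sup>2" using \<psi>low[OF True] by (intro power_mono) (auto simp: E_def)
        then have "(u x)\<^sup>2 * (E x)\<^sup>2 / (\<rho> x)\<^sup>2 \<le> (u x)\<^sup>2 * (2 * \<psi> x)\<^sup>2 / (\<rho> x)\<^sup>2" by (intro divide_right_mono mult_left_mono) auto
        then have "(u x * E x / \<rho> x)\<^sup>2 \<le> 4 * ((f x)\<^sup>2 / (\<rho> x)\<^sup>2)" by (simp add: f_def power_mult_distrib power_divide mult_ac)
        then have "ennreal ((u x * E x / \<rho> x)\<^sup>2) \<le> ennreal (4 * ((f x)\<^sup>2 / (\<rho> x)\<^sup>2))" by (rule ennreal_leI)
        also have "\<dots> = 4 * ennreal ((f x)\<^sup>2 / (\<rho> x)\<^sup>2)" by (subst ennreal_mult) auto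
        finally show ?thesis using True by simp
      qed simp
    qed
    also have "\<dots> = 4 * X" unfolding X_def f_def by (rule nn_integral_cmult) measurable
    also have "\<dots> \<le> 4 * (2 * (ennreal (Kf * c * (18 / R\<^sup>2)) * Y))" by (intro mult_left_mono X2) simp
    also have "\<dots> = ennreal (K / R\<^sup>2) * Y"
    proof -
      have "4 * (2 * (ennreal (Kf * c * (18 / R\<^sup>2)) * Y)) = (ennreal 8 * ennreal (Kf * c * (18 / R\<^sup>2))) * Y" by (simp add: mult.assoc)
      also have "ennreal 8 * ennreal (Kf * c * (18 / R\<^sup>2)) = ennreal (K / R\<^sup>2)"
        using Kf c by (subst ennreal_mult[symmetric]) (auto simp: K_def)
      finally show ?thesis .
    qed
    finally show ?thesis by (simp add: Y_def E_def \<rho>_def)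
  qed
  with \<gamma>\<^sub>0 K show ?thesis by blast
qed

text \<open>Any ball of radius 1/2 lies in the unit ball around the point where \<open>E\<close> is maximal on it, so the
  oscillation of \<open>E\<close> on unit balls does not matter.\<close>

lemma polynomial_growth:
  fixes u E :: "real^'n \<Rightarrow> real"
  assumes u: "u \<in> borel_measurable lebesgue" and E: "continuous_on UNIV E" "\<And>x. 0 < E x" and B: "0 \<le> B"
    and le: "\<And>x. (\<integral>\<^sup>+y. ennreal ((u y)\<^sup>2) * indicator (ball x 1) y \<partial>lebesgue) \<le> ennreal (B / (E x)\<^sup>2)"
    and R: "0 \<le> R"
  shows "(\<integral>\<^sup>+y. ennreal ((u y * E y)\<^sup>2) * indicator (cball 0 R) y \<partial>lebesgue) \<le> ennreal (B * 2 ^ CARD('n) * (1 + R) ^ CARD('n))"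
proof -
  define w where "w = measure lebesgue (ball (0::real^'n) 1)"
  have w: "w > 0" by (simp add: w_def)
  have Em[measurable]: "E \<in> borel_measurable lebesgue" by (rule borel_measurable_lebesgueI[OF E(1)])
  note [measurable] = u
  let ?f = "\<lambda>y. ennreal ((u y * E y)\<^sup>2)"
  have fm: "?f \<in> borel_measurable lebesgue" and um: "(\<lambda>y. ennreal ((u y)\<^sup>2)) \<in> borel_measurable lebesgue"
    by measurable
  note ballm = emeasure_lborel_ball_eq[where 'n='n, folded w_def]
  have F: "(\<integral>\<^sup>+y. ?f y * indicator (ball x (1/2)) y \<partial>lborel) \<le> ennreal B" for x
  proof -
    have ne: "cball x (1/2) \<noteq> {}" by simp
    obtain z where z: "z \<in> cball x (1/2)" "\<And>y. y \<in> cball x (1/2) \<Longrightarrow> E y \<le> E z"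
      using continuous_attains_sup[OF compact_cball ne continuous_on_subset[OF E(1)]] by blast
    have "(\<integral>\<^sup>+y. ?f y * indicator (ball x (1/2)) y \<partial>lebesgue) \<le> (\<integral>\<^sup>+y. ennreal ((E z)\<^sup>2) * (ennreal ((u y)\<^sup>2) * indicator (ball z 1) y) \<partial>lebesgue)"
    proof (rule nn_integral_mono)
      fix y
      show "?f y * indicator (ball x (1/2)) y \<le> ennreal ((E z)\<^sup>2) * (ennreal ((u y)\<^sup>2) * indicator (ball z 1) y)"
      proof (cases "y \<in> ball x (1/2)")
        case True
        have "dist z y < 1" using True z(1) dist_triangle[of z y x] by (simp add: dist_commute)
        have "E y \<le> E z" using True by (intro z(2)) auto
        then have "(E y)\<^sup>2 \<le> (E z)\<^sup>2" using E(2)[of y] by (intro power_mono) auto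
        then have "(u y * E y)\<^sup>2 \<le> (E z)\<^sup>2 * (u y)\<^sup>2" using mult_right_mono[of "(E y)\<^sup>2" "(E z)\<^sup>2" "(u y)\<^sup>2"] by (simp add: power_mult_distrib mult.commute)
        then have "?f y \<le> ennreal ((E z)\<^sup>2 * (u y)\<^sup>2)" by (rule ennreal_leI)
        also have "\<dots> = ennreal ((E z)\<^sup>2) * ennreal ((u y)\<^sup>2)" by (intro ennreal_mult) auto
        finally show ?thesis using True \<open>dist z y < 1\<close> by simp
      qed simp
    qed
    also have "\<dots> = ennreal ((E z)\<^sup>2) * (\<integral>\<^sup>+y. ennreal ((u y)\<^sup>2) * indicator (ball z 1) y \<partial>lebesgue)"
      using um by (intro nn_integral_cmult borel_measurable_times_ennreal borel_measurable_indicator) auto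
    also have "\<dots> \<le> ennreal ((E z)\<^sup>2) * ennreal (B / (E z)\<^sup>2)" by (intro mult_left_mono le) simp
    also have "\<dots> = ennreal B" using E(2)[of z] B by (subst ennreal_mult[symmetric]) auto
    finally show ?thesis by (simp add: nn_integral_completion)
  qed
  \<comment> \<open>Averaging over the centres of half-unit balls replaces a covering: every
    \<open>y\<close> of norm at most \<open>R\<close> lies in the balls of a set of centres of fixed
    volume.\<close>
  let ?k = "\<lambda>x y. indicator (ball (0::real^'n) (R+1)) x * indicator (ball x (1/2)) y :: ennreal"
  have km: "case_prod ?k \<in> borel_measurable borel"
  proof -
    have "open {z :: (real^'n) \<times> (real^'n). norm (fst z) < R + 1 \<and> dist (fst z) (snd z) < 1/2}"
      by (intro open_Collect_conj open_Collect_less continuous_intros)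
    then have "(indicator {z. norm (fst z) < R + 1 \<and> dist (fst z) (snd z) < 1/2} :: (real^'n) \<times> (real^'n) \<Rightarrow> ennreal) \<in> borel_measurable borel"
      by (intro borel_measurable_indicator) auto
    moreover have "indicator {z. norm (fst z) < R + 1 \<and> dist (fst z) (snd z) < 1/2} = case_prod ?k"
      by (auto simp: fun_eq_iff indicator_def)
    ultimately show ?thesis by simp
  qed
  have "ennreal (w * (1/2) ^ CARD('n)) * (\<integral>\<^sup>+y. ?f y * indicator (cball 0 R) y \<partial>lebesgue) =
      (\<integral>\<^sup>+y. ennreal (w * (1/2) ^ CARD('n)) * (?f y * indicator (cball 0 R) y) \<partial>lebesgue)"
    using fm by (intro nn_integral_cmult[symmetric] borel_measurable_times_ennreal borel_measurable_indicator) auto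
  also have "\<dots> \<le> (\<integral>\<^sup>+y. ?f y * (\<integral>\<^sup>+x. ?k x y \<partial>lborel) \<partial>lebesgue)"
  proof (rule nn_integral_mono)
    fix y
    show "ennreal (w * (1/2) ^ CARD('n)) * (?f y * indicator (cball 0 R) y) \<le> ?f y * (\<integral>\<^sup>+x. ?k x y \<partial>lborel)"
    proof (cases "norm y \<le> R")
      case True
      have "ennreal (w * (1/2) ^ CARD('n)) = (\<integral>\<^sup>+x. indicator (ball y (1/2)) x \<partial>lborel)"
        using ballm[of "1/2" y] by simp
      also have "\<dots> \<le> (\<integral>\<^sup>+x. ?k x y \<partial>lborel)"
      proof (rule nn_integral_mono)
        fix x
        have "norm x < R + 1" if "dist y x < 1/2"
          using that True norm_triangle_ineq2[of x y] by (simp add: dist_norm norm_minus_commute)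
        then show "indicator (ball y (1/2)) x \<le> ?k x y" by (auto simp: indicator_def dist_commute)
      qed
      finally show ?thesis using True by (simp add: mult.commute mult_left_mono)
    qed simp
  qed
  also have "\<dots> = (\<integral>\<^sup>+x. (\<integral>\<^sup>+y. ?f y * ?k x y \<partial>lborel) \<partial>lborel)"
    unfolding nn_integral_completion by (rule nn_integral_kernel_swap[OF fm km, symmetric])
  also have "\<dots> \<le> (\<integral>\<^sup>+x. ennreal B * indicator (ball (0::real^'n) (R+1)) x \<partial>lborel)"
  proof (rule nn_integral_mono)
    fix x show "(\<integral>\<^sup>+y. ?f y * ?k x y \<partial>lborel) \<le> ennreal B * indicator (ball (0::real^'n) (R+1)) x"
      using F[of x] by (cases "x \<in> ball 0 (R+1)") simp_all
  qed
  also have "\<dots> = ennreal B * ennreal (w * (R + 1) ^ CARD('n))"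
    using ballm[of "R+1" 0] R by (subst nn_integral_cmult_indicator) auto
  finally have main: "ennreal (w * (1/2) ^ CARD('n)) * (\<integral>\<^sup>+y. ?f y * indicator (cball 0 R) y \<partial>lebesgue) \<le> ennreal B * ennreal (w * (R + 1) ^ CARD('n))" .
  have "(\<integral>\<^sup>+y. ?f y * indicator (cball 0 R) y \<partial>lebesgue) =
     ennreal (2 ^ CARD('n) / w) * (ennreal (w * (1/2) ^ CARD('n)) * (\<integral>\<^sup>+y. ?f y * indicator (cball 0 R) y \<partial>lebesgue))"
  proof -
    have "2 ^ CARD('n) / w * (w * (1/2) ^ CARD('n)) = 1" using w by (simp add: power_divide)
    then have "ennreal (2 ^ CARD('n) / w) * ennreal (w * (1/2) ^ CARD('n)) = 1"
      using w by (subst ennreal_mult[symmetric]) auto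
    then show ?thesis by (simp add: mult.assoc[symmetric])
  qed
  also have "\<dots> \<le> ennreal (2 ^ CARD('n) / w) * (ennreal B * ennreal (w * (R + 1) ^ CARD('n)))"
    by (intro mult_left_mono main) simp
  also have "\<dots> = ennreal (2 ^ CARD('n) / w * (B * (w * (R + 1) ^ CARD('n))))"
    using w B R by (simp only: ennreal_mult[symmetric] mult_nonneg_nonneg less_imp_le zero_le_power divide_nonneg_nonneg add_nonneg_nonneg zero_le_numeral zero_le_one)
  also have "2 ^ CARD('n) / w * (B * (w * (R + 1) ^ CARD('n))) = B * 2 ^ CARD('n) * (1 + R) ^ CARD('n)"
    using w by (simp add: add.commute)
  finally show ?thesis .
qed

text \<open>Tripling the radius multiplies the polynomial bound by about \<open>3 ^ n\<close>, while
  the decay inequality gains a factor \<open>\<kappa>\<close> that can be made as small as desired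
  because \<open>\<rho>\<close> is sublinear. Iterating from a fixed radius therefore drives the
  weighted integral to 0.\<close>

lemma decay_growth_imp_zero:
  fixes u E \<rho> :: "real^'n \<Rightarrow> real"
  assumes u: "u \<in> borel_measurable lebesgue" and E: "continuous_on UNIV E" "\<And>x. 0 < E x"
    and \<rho>: "continuous_on UNIV \<rho>" "\<And>x. 0 < \<rho> x" and K: "0 < K" and B: "0 \<le> B"
    and sub: "\<And>\<delta>. 0 < \<delta> \<Longrightarrow> \<exists>R\<^sub>0>0. \<forall>R\<ge>R\<^sub>0. \<forall>x. norm x \<le> 3 * R \<longrightarrow> \<rho> x \<le> \<delta> * R"
    and decay: "\<And>R. 1 \<le> R \<Longrightarrow> (\<integral>\<^sup>+x. ennreal ((u x * E x / \<rho> x)\<^sup>2) * indicator (cball 0 R) x \<partial>lebesgue) \<le>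
       ennreal (K / R\<^sup>2) * (\<integral>\<^sup>+x. ennreal ((u x * E x)\<^sup>2) * indicator (cball 0 (3 * R)) x \<partial>lebesgue)"
    and growth: "\<And>R. 0 \<le> R \<Longrightarrow> (\<integral>\<^sup>+x. ennreal ((u x * E x)\<^sup>2) * indicator (cball 0 R) x \<partial>lebesgue) \<le> ennreal (B * (1 + R) ^ CARD('n))"
  shows "AE x in lebesgue. u x = 0"
proof -
  let ?n = "CARD('n)"
  define J where "J R = (\<integral>\<^sup>+x. ennreal ((u x * E x / \<rho> x)\<^sup>2) * indicator (cball 0 R) x \<partial>lebesgue)" for R
  define M where "M R = (\<integral>\<^sup>+x. ennreal ((u x * E x)\<^sup>2) * indicator (cball 0 R) x \<partial>lebesgue)" for R
  \<comment> \<open>Half of the reciprocal of \<open>3 ^ n\<close>, so that gain and growth together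
    leave a factor 1/2 per step.\<close>
  define \<kappa> where "\<kappa> = 1 / (2 * 3 ^ ?n :: real)"
  have \<kappa>: "\<kappa> > 0" by (simp add: \<kappa>_def)
  \<comment> \<open>With \<rho> at most \<open>\<delta> * R\<close> on the larger ball, the constant
    \<open>K / R\<^sup>2\<close> of the decay inequality becomes
    \<open>K * \<delta>\<^sup>2\<close>, which is \<open>\<kappa>\<close>.\<close>
  define \<delta> where "\<delta> = sqrt (\<kappa> / K)"
  have \<delta>: "\<delta> > 0" "K * \<delta>\<^sup>2 = \<kappa>" using \<kappa> K by (auto simp: \<delta>_def)
  obtain R0 where R0: "R0 > 0" "\<And>R x. R \<ge> R0 \<Longrightarrow> norm x \<le> 3 * R \<Longrightarrow> \<rho> x \<le> \<delta> * R" using sub[OF \<delta>(1)] by blast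
  have m[measurable]: "u \<in> borel_measurable lebesgue" "E \<in> borel_measurable lebesgue" "\<rho> \<in> borel_measurable lebesgue"
    by (auto intro!: borel_measurable_lebesgueI u E \<rho>)
  have fm: "(\<lambda>x. ennreal ((u x * E x / \<rho> x)\<^sup>2) * indicator (cball 0 R) x) \<in> borel_measurable lebesgue" for R
  proof -
    have "(\<lambda>x. ennreal ((u x * E x / \<rho> x)\<^sup>2)) \<in> borel_measurable lebesgue" by measurable
    then show ?thesis by (intro borel_measurable_times_ennreal borel_measurable_indicator) auto
  qed
  have step: "J R \<le> ennreal \<kappa> * J (3 * R)" if R: "R \<ge> max R0 1" for R
  proof -
    have R1: "R \<ge> 1" "R \<ge> R0" using R by auto
    have "M (3 * R) \<le> (\<integral>\<^sup>+x. ennreal (\<delta>\<^sup>2 * R\<^sup>2) * (ennreal ((u x * E x / \<rho> x)\<^sup>2) * indicator (cball 0 (3 * R)) x) \<partial>lebesgue)"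
      unfolding M_def
    proof (rule nn_integral_mono)
      fix x
      show "ennreal ((u x * E x)\<^sup>2) * indicator (cball 0 (3 * R)) x \<le> ennreal (\<delta>\<^sup>2 * R\<^sup>2) * (ennreal ((u x * E x / \<rho> x)\<^sup>2) * indicator (cball 0 (3 * R)) x)"
      proof (cases "norm x \<le> 3 * R")
        case True
        have "(\<rho> x)\<^sup>2 \<le> (\<delta> * R)\<^sup>2" using R0(2)[OF R1(2) True] \<rho>(2)[of x] by (intro power_mono) auto
        then have "(\<rho> x)\<^sup>2 * (u x * E x / \<rho> x)\<^sup>2 \<le> (\<delta> * R)\<^sup>2 * (u x * E x / \<rho> x)\<^sup>2" by (intro mult_right_mono) auto
        moreover have "(\<rho> x)\<^sup>2 * (u x * E x / \<rho> x)\<^sup>2 = (u x * E x)\<^sup>2" using \<rho>(2)[of x] by (simp add: power_divide)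
        ultimately have "ennreal ((u x * E x)\<^sup>2) \<le> ennreal (\<delta>\<^sup>2 * R\<^sup>2 * (u x * E x / \<rho> x)\<^sup>2)"
          by (intro ennreal_leI) (simp add: power_mult_distrib)
        also have "\<dots> = ennreal (\<delta>\<^sup>2 * R\<^sup>2) * ennreal ((u x * E x / \<rho> x)\<^sup>2)" by (intro ennreal_mult) auto
        finally show ?thesis using True by simp
      qed simp
    qed
    also have "\<dots> = ennreal (\<delta>\<^sup>2 * R\<^sup>2) * J (3 * R)" unfolding J_def by (rule nn_integral_cmult[OF fm])
    finally have MJ: "M (3 * R) \<le> ennreal (\<delta>\<^sup>2 * R\<^sup>2) * J (3 * R)" .
    have "J R \<le> ennreal (K / R\<^sup>2) * M (3 * R)" unfolding J_def M_def by (rule decay[OF R1(1)])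
    also have "\<dots> \<le> ennreal (K / R\<^sup>2) * (ennreal (\<delta>\<^sup>2 * R\<^sup>2) * J (3 * R))" by (intro mult_left_mono MJ) simp
    also have "\<dots> = ennreal (K / R\<^sup>2 * (\<delta>\<^sup>2 * R\<^sup>2)) * J (3 * R)"
    proof -
      have "ennreal (K / R\<^sup>2) * ennreal (\<delta>\<^sup>2 * R\<^sup>2) = ennreal (K / R\<^sup>2 * (\<delta>\<^sup>2 * R\<^sup>2))"
        using K by (intro ennreal_mult[symmetric]) auto
      then show ?thesis by (simp only: mult.assoc[symmetric])
    qed
    also have "K / R\<^sup>2 * (\<delta>\<^sup>2 * R\<^sup>2) = \<kappa>" using R1 \<delta>(2) by simp
    finally show ?thesis .
  qed
  have iter: "J R \<le> ennreal (\<kappa> ^ k) * J (3 ^ k * R)" if R: "R \<ge> max R0 1" for R k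
  proof (induction k)
    case (Suc k)
    have "1 * R \<le> 3 ^ k * R" using R by (intro mult_right_mono) auto
    then have "R \<le> 3 ^ k * R" by (simp only: mult_1)
    from step[OF order_trans[OF R this]] have "J (3 ^ k * R) \<le> ennreal \<kappa> * J (3 * (3 ^ k * R))" .
    then have "ennreal (\<kappa> ^ k) * J (3 ^ k * R) \<le> ennreal (\<kappa> ^ k) * (ennreal \<kappa> * J (3 * (3 ^ k * R)))" by (intro mult_left_mono) auto
    also have "\<dots> = ennreal (\<kappa> ^ Suc k) * J (3 ^ Suc k * R)" using \<kappa> by (simp add: ennreal_mult mult_ac)
    finally show ?case using Suc by (rule order_trans[rotated])
  qed simp
  have J0: "J R = 0" if R: "R \<ge> max R0 1" for R
  proof -
    \<comment> \<open>Independent of \<open>k\<close>; the 4 comes from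
      \<open>1 + 3 * r \<le> 4 * r\<close> for \<open>r \<ge> 1\<close>.\<close>
    define c where "c = K * (B * (4 * R) ^ ?n)"
    have "J R \<le> ennreal ((1/2) ^ k * c)" for k
    proof -
      define r where "r = 3 ^ k * R"
      have "1 * 1 \<le> 3 ^ k * R" using R by (intro mult_mono) auto
      then have r: "r \<ge> 1" by (simp add: r_def)
      have "J r \<le> ennreal (K / r\<^sup>2) * M (3 * r)" unfolding J_def M_def by (rule decay[OF r])
      also have "\<dots> \<le> ennreal K * ennreal (B * (4 * r) ^ ?n)"
      proof (intro mult_mono ennreal_leI)
        show "K / r\<^sup>2 \<le> K" using r K by (simp add: divide_le_eq one_le_power)
        have "M (3 * r) \<le> ennreal (B * (1 + 3 * r) ^ ?n)" unfolding M_def using r by (intro growth) simp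
        also have "\<dots> \<le> ennreal (B * (4 * r) ^ ?n)" using r B by (intro ennreal_leI mult_left_mono power_mono) auto
        finally show "M (3 * r) \<le> ennreal (B * (4 * r) ^ ?n)" .
      qed auto
      also have "\<dots> = ennreal (K * (B * (4 * r) ^ ?n))" using K B r by (intro ennreal_mult[symmetric]) auto
      finally have Jr: "J r \<le> ennreal (K * (B * (4 * r) ^ ?n))" .
      have "J R \<le> ennreal (\<kappa> ^ k) * J r" unfolding r_def by (rule iter[OF R])
      also have "\<dots> \<le> ennreal (\<kappa> ^ k) * ennreal (K * (B * (4 * r) ^ ?n))" by (intro mult_left_mono Jr) simp
      also have "\<dots> = ennreal (\<kappa> ^ k * (K * (B * (4 * r) ^ ?n)))" using \<kappa> K B r by (intro ennreal_mult[symmetric]) auto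
      also have "\<kappa> ^ k * (K * (B * (4 * r) ^ ?n)) = (1/2) ^ k * c"
      proof -
        have "(4 * r) ^ ?n = (3 ^ ?n) ^ k * (4 * R) ^ ?n"
          by (simp add: r_def power_mult_distrib power_mult[symmetric] mult.commute)
        moreover have "\<kappa> ^ k * (3 ^ ?n) ^ k = (1/2) ^ k"
          by (simp add: \<kappa>_def power_mult_distrib[symmetric])
        ultimately show ?thesis by (simp add: c_def mult_ac)
      qed
      finally show ?thesis .
    qed
    moreover have "(\<lambda>k. ennreal ((1/2) ^ k * c)) \<longlonglongrightarrow> ennreal (0 * c)"
      by (intro tendsto_ennrealI tendsto_mult LIMSEQ_power_zero tendsto_const) simp
    ultimately have "J R \<le> ennreal (0 * c)" by (intro LIMSEQ_le_const[where X="\<lambda>k. ennreal ((1/2) ^ k * c)"]) auto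
    then show ?thesis by simp
  qed
  have "AE x in lebesgue. norm x \<le> max R0 1 + real N \<longrightarrow> u x = 0" for N :: nat
  proof -
    have "J (max R0 1 + real N) = 0" by (rule J0) simp
    then have "AE x in lebesgue. ennreal ((u x * E x / \<rho> x)\<^sup>2) * indicator (cball 0 (max R0 1 + real N)) x = 0"
      unfolding J_def by (subst (asm) nn_integral_0_iff_AE[OF fm])
    then show ?thesis
    proof eventually_elim
      case (elim x)
      show ?case
      proof
        assume "norm x \<le> max R0 1 + real N"
        with elim have "(u x * E x / \<rho> x)\<^sup>2 \<le> 0" by (simp add: ennreal_eq_0_iff)
        then show "u x = 0" using E(2)[of x] \<rho>(2)[of x] by simp
      qed
    qed
  qed
  then have "AE x in lebesgue. \<forall>N::nat. norm x \<le> max R0 1 + real N \<longrightarrow> u x = 0" by (subst AE_all_countable) auto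
  then show ?thesis
  proof eventually_elim
    case (elim x)
    obtain N :: nat where "norm x \<le> real N" using real_arch_simple by blast
    moreover have "0 \<le> max R0 1" by simp
    ultimately have "norm x \<le> max R0 1 + real N" by linarith
    then show ?case using elim by blast
  qed
qed

text \<open>The negative part of \<open>V\<close> lives on a null set and is cut off without
  changing any mean. For \<open>p = \<infinity>\<close> the essential bound on a ball gives the
  inequality for every finite exponent, and \<open>q\<close> is taken large enough for both
  \<open>1 < q\<close> and \<open>CARD('n) \<le> 2 * q\<close>.\<close>

lemma RH_imp_RH_real:
  fixes V :: "real^'n \<Rightarrow> real" and p :: ereal
  assumes V: "RH p C V" and p: "1 < p"
  defines "q \<equiv> (if p = \<infinity> then max 2 (real CARD('n)) else real_of_ereal p)"
  shows "RH_real q (max 1 C) (\<lambda>x. max (V x) 0)"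
    and "V \<in> borel_measurable lebesgue" "AE x in lebesgue. V x > 0"
proof -
  let ?W = "\<lambda>x. max (V x) 0"
  show m: "V \<in> borel_measurable lebesgue" and pos: "AE x in lebesgue. V x > 0"
    using V by (auto simp: RH_def Lp_loc_def)
  have mW: "?W \<in> borel_measurable lebesgue" using m by measurable
  have eq: "AE x in lebesgue. ?W x = V x" using pos by eventually_elim simp
  have q1: "1 < q" using p by (cases p) (auto simp: q_def)
  have fin: "set_integrable lebesgue (ball x r) (\<lambda>y. c)" for x :: "real^'n" and r c :: real
    using lmeasurable_ball[of x r] unfolding set_integrable_def fmeasurable_def by (auto simp: less_top)
  have mWp: "(\<lambda>y. ?W y powr q) \<in> borel_measurable lebesgue" using mW by measurable
  have sbm: "set_borel_measurable lebesgue (ball x r) (\<lambda>y. ?W y powr q)" for x r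
    unfolding set_borel_measurable_def using mWp by (intro borel_measurable_scaleR borel_measurable_indicator) auto
  have avg: "average (ball x r) V = average (ball x r) ?W" for x r
    unfolding average_def set_lebesgue_integral_def
    using eq m mW by (intro arg_cong2[where f="(/)"] integral_cong_AE borel_measurable_scaleR borel_measurable_indicator) auto
  have bound: "AE y in lebesgue. y \<in> S \<longrightarrow> \<bar>V y\<bar> \<le> c"
    if "esssup (lebesgue_on S) (\<lambda>y. ereal \<bar>V y\<bar>) \<le> ereal c" "S \<in> sets lebesgue" for S c
  proof -
    have "(\<lambda>y. ereal \<bar>V y\<bar>) \<in> borel_measurable (lebesgue_on S)" using m by (intro measurable_restrict_space1) measurable
    from esssup_AE[of "\<lambda>y. ereal \<bar>V y\<bar>" "lebesgue_on S"]
    have "AE y in lebesgue_on S. ereal \<bar>V y\<bar> \<le> esssup (lebesgue_on S) (\<lambda>y. ereal \<bar>V y\<bar>)" .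
    then have "AE y in lebesgue_on S. \<bar>V y\<bar> \<le> c"
    proof eventually_elim
      case (elim y)
      then show ?case using order_trans[OF elim that(1)] by simp
    qed
    then show ?thesis using that(2) by (subst (asm) AE_restrict_space_iff) auto
  qed
  have int: "set_integrable lebesgue (ball x r) (\<lambda>y. ?W y powr q)" if r: "0 < r" for x r
  proof (cases "p = \<infinity>")
    case True
    have "esssup (lebesgue_on (cball x r)) (\<lambda>y. ereal \<bar>V y\<bar>) < \<infinity>"
      using V True by (simp add: RH_def Lp_loc_def)
    then obtain c where c: "esssup (lebesgue_on (cball x r)) (\<lambda>y. ereal \<bar>V y\<bar>) \<le> ereal c"
      by (cases "esssup (lebesgue_on (cball x r)) (\<lambda>y. ereal \<bar>V y\<bar>)") auto
    have "AE y in lebesgue. y \<in> cball x r \<longrightarrow> \<bar>V y\<bar> \<le> c" by (rule bound[OF c]) simp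
    then have "AE y in lebesgue. y \<in> ball x r \<longrightarrow> norm (?W y powr q) \<le> norm (max c 0 powr q)"
      by eventually_elim (use q1 in \<open>auto intro!: powr_mono2\<close>)
    then show ?thesis by (rule set_integrable_bound[OF fin sbm])
  next
    case False
    then have "set_integrable lebesgue (cball x r) (\<lambda>y. norm (V y) powr q)"
      using V by (simp add: RH_def Lp_loc_def q_def)
    then have "set_integrable lebesgue (ball x r) (\<lambda>y. norm (V y) powr q)"
      by (rule set_integrable_subset) auto
    then show ?thesis
      by (rule set_integrable_bound[OF _ sbm]) (use q1 in \<open>auto intro!: AE_I2 powr_mono2\<close>)
  qed
  have intW: "set_integrable lebesgue (ball x r) ?W" if r: "0 < r" for x r
  proof (rule set_integrable_bound)
    show "set_integrable lebesgue (ball x r) (\<lambda>y. 1 + ?W y powr q)"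
      by (rule set_integral_add[OF fin int[OF r]])
    show "set_borel_measurable lebesgue (ball x r) ?W"
      unfolding set_borel_measurable_def using mW by (intro borel_measurable_scaleR borel_measurable_indicator) auto
    have "?W y \<le> 1 + ?W y powr q" for y using le_add_powr[of "?W y" 1 q] q1 by simp
    then show "AE y in lebesgue. y \<in> ball x r \<longrightarrow> norm (?W y) \<le> norm (1 + ?W y powr q)" by (intro AE_I2) auto
  qed
  have avg_pos: "0 < average (ball x r) ?W" if r: "0 < r" for x r
  proof -
    have i: "integrable lebesgue (\<lambda>y. indicator (ball x r) y *\<^sub>R ?W y)" using intW[OF r, of x] by (simp add: set_integrable_def)
    have "(LINT y:ball x r|lebesgue. ?W y) \<noteq> 0"
    proof
      assume "(LINT y:ball x r|lebesgue. ?W y) = 0"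
      then have "AE y in lebesgue. indicator (ball x r) y *\<^sub>R ?W y = 0"
        unfolding set_lebesgue_integral_def by (subst (asm) integral_nonneg_eq_0_iff_AE[OF i]) auto
      with pos have "AE y in lebesgue. y \<notin> ball x r" by eventually_elim (auto simp: indicator_def split: if_splits)
      then have "ball x r \<in> null_sets lebesgue" by (subst AE_iff_null_sets) auto
      then have "measure lebesgue (ball x r) = 0" by (simp add: null_sets_def measure_def)
      then show False using r by simp
    qed
    moreover have "0 \<le> (LINT y:ball x r|lebesgue. ?W y)"
      unfolding set_lebesgue_integral_def by (intro integral_nonneg_AE AE_I2) auto
    ultimately show ?thesis using r by (simp add: average_def)
  qed
  have le: "average (ball x r) (\<lambda>y. ?W y powr q) \<le> (max 1 C * average (ball x r) ?W) powr q" if r: "0 < r" for x r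
  proof -
    let ?a = "average (ball x r) ?W"
    have RHle: "Lp_mean p (ball x r) V \<le> ereal (C * ?a)" using V r avg by (simp add: RH_def)
    have Ca: "C * ?a \<le> max 1 C * ?a" using avg_pos[OF r, of x] by (intro mult_right_mono) auto
    have Ca0: "0 \<le> max 1 C * ?a" using avg_pos[OF r, of x] by simp
    have b: "measure lebesgue (ball x r) > 0" using r by simp
    show ?thesis
    proof (cases "p = \<infinity>")
      case True
      have "esssup (lebesgue_on (ball x r)) (\<lambda>y. ereal \<bar>V y\<bar>) \<le> ereal (C * ?a)"
        using RHle True by (simp add: Lp_mean_def)
      from bound[OF this] have ae: "AE y in lebesgue. y \<in> ball x r \<longrightarrow> \<bar>V y\<bar> \<le> C * ?a" by simp
      have "(LINT y:ball x r|lebesgue. ?W y powr q) \<le> (LINT y:ball x r|lebesgue. (max 1 C * ?a) powr q)"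
      proof (rule set_integral_mono_AE[OF int[OF r] fin])
        show "AE y \<in> ball x r in lebesgue. ?W y powr q \<le> (max 1 C * ?a) powr q"
          using ae
        proof eventually_elim
          case (elim y)
          show ?case
          proof
            assume "y \<in> ball x r"
            with elim Ca Ca0 have "?W y \<le> max 1 C * ?a" by (auto simp: abs_le_iff)
            then show "?W y powr q \<le> (max 1 C * ?a) powr q" using q1 by (intro powr_mono2) auto
          qed
        qed
      qed
      also have "\<dots> = (max 1 C * ?a) powr q * measure lebesgue (ball x r)" by (simp add: set_lebesgue_integral_def)
      finally show ?thesis using b unfolding average_def[of _ "\<lambda>y. ?W y powr q"] by (simp add: divide_le_eq)
    next
      case False
      let ?I = "average (ball x r) (\<lambda>y. \<bar>V y\<bar> powr q)"
      have "?I powr (1 / q) \<le> C * ?a" using RHle False by (simp add: Lp_mean_def q_def)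
      then have "(?I powr (1 / q)) powr q \<le> (max 1 C * ?a) powr q" using Ca q1 by (intro powr_mono2) auto
      moreover have "?I \<ge> 0"
        unfolding average_def set_lebesgue_integral_def by (intro divide_nonneg_nonneg integral_nonneg_AE AE_I2) auto
      ultimately have "?I \<le> (max 1 C * ?a) powr q" using q1 by (simp add: powr_powr)
      moreover have "?I = average (ball x r) (\<lambda>y. ?W y powr q)"
        unfolding average_def set_lebesgue_integral_def
      proof (intro arg_cong2[where f="(/)"] integral_cong_AE refl)
        show "(\<lambda>y. indicat_real (ball x r) y *\<^sub>R \<bar>V y\<bar> powr q) \<in> borel_measurable lebesgue"
          using m by (intro borel_measurable_scaleR borel_measurable_indicator) (auto, measurable)
        show "(\<lambda>y. indicat_real (ball x r) y *\<^sub>R ?W y powr q) \<in> borel_measurable lebesgue"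
          using mWp by (intro borel_measurable_scaleR borel_measurable_indicator) auto
        show "AE y in lebesgue. indicat_real (ball x r) y *\<^sub>R \<bar>V y\<bar> powr q = indicat_real (ball x r) y *\<^sub>R ?W y powr q"
          using pos by eventually_elim simp
      qed
      ultimately show ?thesis by simp
    qed
  qed
  show "RH_real q (max 1 C) ?W"
    unfolding RH_real_def using mW int avg_pos le by auto
qed

text \<open>The weight \<open>agmon_m\<close> depends on the potential only through means over
  balls, so even its pointwise values are unchanged and paths inside null sets cause no
  difficulty.\<close>

lemma agmon_dist_cong_AE:
  fixes V W :: "real^'n \<Rightarrow> real"
  assumes "AE x in lebesgue. V x = W x" "V \<in> borel_measurable lebesgue" "W \<in> borel_measurable lebesgue"
  shows "agmon_dist V = agmon_dist W"
proof -
  have "average (ball x r) V = average (ball x r) W" for x r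
    unfolding average_def set_lebesgue_integral_def
    using assms by (intro arg_cong2[where f="(/)"] integral_cong_AE borel_measurable_scaleR borel_measurable_indicator) auto
  then have "psi V = psi W" by (simp add: psi_def fun_eq_iff)
  then have "agmon_m V = agmon_m W" by (simp add: agmon_m_def fun_eq_iff)
  then show ?thesis by (simp add: agmon_dist_def agmon_length_def fun_eq_iff)
qed

lemma agmon_dist_nonneg: "0 \<le> agmon_dist V x y"
  by (simp add: agmon_dist_def)

lemma nn_integral_square_ball:
  fixes u :: "real^'n \<Rightarrow> real"
  assumes "Lp_loc 2 u"
  shows "(\<integral>\<^sup>+y. ennreal ((u y)\<^sup>2) * indicator (ball x r) y \<partial>lebesgue) = ennreal ((L2_norm_on (ball x r) u)\<^sup>2)"
proof -
  have i: "integrable lebesgue (\<lambda>y. indicator (ball x r) y *\<^sub>R (u y)\<^sup>2)"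
    using set_integrable_subset[of lebesgue "cball x r" "\<lambda>y. (u y)\<^sup>2" "ball x r"] assms
    by (auto simp: Lp_loc_2_iff set_integrable_def)
  have "(L2_norm_on (ball x r) u)\<^sup>2 = (LINT y|lebesgue. indicator (ball x r) y *\<^sub>R (u y)\<^sup>2)"
    by (simp add: L2_norm_on_def set_lebesgue_integral_def)
  also have "ennreal \<dots> = (\<integral>\<^sup>+y. ennreal (indicator (ball x r) y *\<^sub>R (u y)\<^sup>2) \<partial>lebesgue)"
    by (rule nn_integral_eq_integral[OF i, symmetric]) auto
  also have "\<dots> = (\<integral>\<^sup>+y. ennreal ((u y)\<^sup>2) * indicator (ball x r) y \<partial>lebesgue)"
    by (intro nn_integral_cong) (auto simp: indicator_def)
  finally show ?thesis by simp
qed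

text \<open>If every ball beyond radius \<open>r\<close> violates the lower bound, the weighted norm
  of \<open>u\<close> on unit balls is bounded everywhere, the centres within \<open>r\<close> being
  covered by local square integrability. This is the growth that the decay inequality excludes for a
  nonzero \<open>u\<close>.\<close>

lemma large_balls_far_away:
  fixes p C lam Lam :: real
  assumes p: "1 < p" "real CARD('n) \<le> 2 * p" and C: "1 \<le> C" and lam: "0 < lam" "lam \<le> 1" and Lam: "0 < Lam"
  shows "\<exists>\<gamma>\<^sub>0>0. \<forall>(A :: real^'n \<Rightarrow> real^'n^'n) V V\<^sub>0 u \<gamma> j r.
    bounded_elliptic lam Lam A \<longrightarrow> weak_solution A V u \<longrightarrow> V \<in> borel_measurable lebesgue \<longrightarrow>
    (AE x in lebesgue. V x > 0) \<longrightarrow> RH_real p C V\<^sub>0 \<longrightarrow> (AE x in lebesgue. V x = V\<^sub>0 x) \<longrightarrow>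
    \<not> (AE x in lebesgue. u x = 0) \<longrightarrow> 0 \<le> \<gamma> \<longrightarrow> \<gamma> < \<gamma>\<^sub>0 \<longrightarrow> 0 \<le> j \<longrightarrow>
    (\<exists>x. norm x > r \<and> j * exp (2 * \<gamma> * agmon_dist V\<^sub>0 x 0) \<le> L2_norm_on (ball x 1) u)"
proof -
  obtain \<gamma>\<^sub>0 K where \<gamma>\<^sub>0: "\<gamma>\<^sub>0 > 0" and K: "K > 0" and decay: "\<And>(A :: real^'n \<Rightarrow> real^'n^'n) V V\<^sub>0 u \<gamma> R.
    bounded_elliptic lam Lam A \<Longrightarrow> weak_solution A V u \<Longrightarrow> V \<in> borel_measurable lebesgue \<Longrightarrow>
    (AE x in lebesgue. V x > 0) \<Longrightarrow> RH_real p C V\<^sub>0 \<Longrightarrow> (AE x in lebesgue. V x = V\<^sub>0 x) \<Longrightarrow>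
    0 \<le> \<gamma> \<Longrightarrow> \<gamma> \<le> \<gamma>\<^sub>0 \<Longrightarrow> 1 \<le> R \<Longrightarrow>
    (\<integral>\<^sup>+x. ennreal ((u x * exp (- \<gamma> * agmon_path_inf V\<^sub>0 x) / lip_rho V\<^sub>0 x)\<^sup>2) * indicator (cball 0 R) x \<partial>lebesgue) \<le>
    ennreal (K / R\<^sup>2) * (\<integral>\<^sup>+x. ennreal ((u x * exp (- \<gamma> * agmon_path_inf V\<^sub>0 x))\<^sup>2) * indicator (cball 0 (3 * R)) x \<partial>lebesgue)"
    using weighted_decay[OF p C lam Lam] by blast
  have "\<exists>x. norm x > r \<and> j * exp (2 * \<gamma> * agmon_dist V\<^sub>0 x 0) \<le> L2_norm_on (ball x 1) u"
    if A: "bounded_elliptic lam Lam A" and u: "weak_solution A V u" and Vm: "V \<in> borel_measurable lebesgue"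
    and Vpos: "AE x in lebesgue. V x > 0" and V0: "RH_real p C V\<^sub>0" and eq: "AE x in lebesgue. V x = V\<^sub>0 x"
    and nz: "\<not> (AE x in lebesgue. u x = 0)" and g: "0 \<le> \<gamma>" "\<gamma> < \<gamma>\<^sub>0 / 2" and j: "0 \<le> j"
    for A :: "real^'n \<Rightarrow> real^'n^'n" and V V\<^sub>0 u \<gamma> j r
  proof (rule ccontr)
    assume no: "\<not> (\<exists>x. norm x > r \<and> j * exp (2 * \<gamma> * agmon_dist V\<^sub>0 x 0) \<le> L2_norm_on (ball x 1) u)"
    define E where "E x = exp (- (2 * \<gamma>) * agmon_path_inf V\<^sub>0 x)" for x
    have Ec: "continuous_on UNIV E" unfolding E_def by (intro continuous_intros continuous_agmon_D[OF p C V0])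
    have E0: "E x > 0" and E1: "E x \<le> 1" for x using g agmon_path_inf_nonneg[OF p C V0, of x] by (auto simp: E_def)
    have u2: "Lp_loc 2 u" using u H1_loc_weak_grad(1) by (auto simp: weak_solution_def)
    have um: "u \<in> borel_measurable lebesgue" using u2 unfolding Lp_loc_2_iff by blast
    define N where "N = L2_norm_on (ball 0 (\<bar>r\<bar> + 1)) u"
    \<comment> \<open>\<open>j\<^sup>2\<close> serves the centres far out, where the lower bound
      fails, and \<open>N\<^sup>2\<close> the remaining ones, where \<open>E x \<le> 1\<close> is
      used.\<close>
    define B where "B = j\<^sup>2 + N\<^sup>2"
    have B: "B \<ge> 0" by (simp add: B_def)
    have far: "(\<integral>\<^sup>+y. ennreal ((u y)\<^sup>2) * indicator (ball x 1) y \<partial>lebesgue) \<le> ennreal (B / (E x)\<^sup>2)" for x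
    proof (cases "norm x > r")
      case True
      have "L2_norm_on (ball x 1) u \<le> j * exp (2 * \<gamma> * agmon_dist V\<^sub>0 x 0)" using no True by force
      also have "\<dots> \<le> j * exp (2 * \<gamma> * agmon_path_inf V\<^sub>0 x)"
        using agmon_dist_le_D[OF p C V0, of x] g j by (intro mult_left_mono) (auto intro: mult_left_mono)
      also have "\<dots> = j / E x" by (simp add: E_def exp_minus field_simps)
      finally have "(L2_norm_on (ball x 1) u)\<^sup>2 \<le> (j / E x)\<^sup>2"
        by (intro power_mono) (auto simp: L2_norm_on_def set_lebesgue_integral_def)
      also have "\<dots> \<le> B / (E x)\<^sup>2" by (simp add: power_divide B_def divide_right_mono)
      finally show ?thesis unfolding nn_integral_square_ball[OF u2] by (rule ennreal_leI)
    next
      case False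
      have sub: "ball x 1 \<subseteq> ball 0 (\<bar>r\<bar> + 1)"
      proof
        fix y assume "y \<in> ball x 1"
        then show "y \<in> ball 0 (\<bar>r\<bar> + 1)" using False norm_triangle_ineq2[of y x] by (simp add: dist_norm norm_minus_commute)
      qed
      have "(\<integral>\<^sup>+y. ennreal ((u y)\<^sup>2) * indicator (ball x 1) y \<partial>lebesgue) \<le> (\<integral>\<^sup>+y. ennreal ((u y)\<^sup>2) * indicator (ball 0 (\<bar>r\<bar> + 1)) y \<partial>lebesgue)"
        using sub by (intro nn_integral_mono mult_left_mono) (auto simp: indicator_def)
      also have "\<dots> = ennreal (N\<^sup>2)" unfolding N_def by (rule nn_integral_square_ball[OF u2])
      also have "\<dots> \<le> ennreal (B / (E x)\<^sup>2)"
      proof (rule ennreal_leI)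
        have "N\<^sup>2 \<le> B / 1" by (simp add: B_def)
        also have "\<dots> \<le> B / (E x)\<^sup>2" using E0[of x] E1[of x] B by (intro divide_left_mono) (auto simp: power_le_one)
        finally show "N\<^sup>2 \<le> B / (E x)\<^sup>2" .
      qed
      finally show ?thesis .
    qed
    have "AE x in lebesgue. u x = 0"
    proof (rule decay_growth_imp_zero[OF um Ec E0 _ _ K, where \<rho>="lip_rho V\<^sub>0" and B="B * 2 ^ CARD('n)"])
      show "continuous_on UNIV (lip_rho V\<^sub>0)" by (rule continuous_lip_rho[OF p C V0])
      show "0 < lip_rho V\<^sub>0 x" for x by (rule lip_rho_pos[OF p C V0])
      show "\<exists>R\<^sub>0>0. \<forall>R\<ge>R\<^sub>0. \<forall>x. norm x \<le> 3 * R \<longrightarrow> lip_rho V\<^sub>0 x \<le> \<delta> * R" if "0 < \<delta>" for \<delta>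
        by (rule lip_rho_sublinear[OF p C V0 that])
      show "(\<integral>\<^sup>+x. ennreal ((u x * E x / lip_rho V\<^sub>0 x)\<^sup>2) * indicator (cball 0 R) x \<partial>lebesgue) \<le>
         ennreal (K / R\<^sup>2) * (\<integral>\<^sup>+x. ennreal ((u x * E x)\<^sup>2) * indicator (cball 0 (3 * R)) x \<partial>lebesgue)" if "1 \<le> R" for R
        unfolding E_def by (rule decay[OF A u Vm Vpos V0 eq _ _ that]) (use g in auto)
      show "(\<integral>\<^sup>+x. ennreal ((u x * E x)\<^sup>2) * indicator (cball 0 R) x \<partial>lebesgue) \<le> ennreal (B * 2 ^ CARD('n) * (1 + R) ^ CARD('n))" if "0 \<le> R" for R
        by (rule polynomial_growth[OF um Ec E0 B far that])
    qed (use B in auto)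
    with nz show False by blast
  qed
  \<comment> \<open>The weight \<open>E\<close> decays at the rate \<open>2 * \<gamma>\<close>, so
    only half of the rate of the weighted estimate is available.\<close>
  then show ?thesis using \<gamma>\<^sub>0 by (intro exI[of _ "\<gamma>\<^sub>0 / 2"]) auto
qed

theorem corollary1p3:
  fixes lam Lam C_V :: real and p :: ereal
  assumes "0 < lam" and "lam \<le> 1" and "1 \<le> Lam"
    and "ereal (real CARD('n::finite) / 2) \<le> p" and "1 < p"
  shows "\<exists>\<gamma>\<^sub>0>0. \<forall>(A :: real^'n \<Rightarrow> real^'n^'n) V u.
    bounded_elliptic lam Lam A \<longrightarrow> RH p C_V V \<longrightarrow>
    weak_solution A V u \<longrightarrow> \<not> (AE x in lebesgue. u x = 0) \<longrightarrow>
    (\<forall>\<gamma>\<^sub>1<\<gamma>\<^sub>0. \<exists>x :: nat \<Rightarrow> real^'n.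
      strict_mono_on {1..} (\<lambda>j. norm (x j)) \<and> \<not> bounded (x ` {1..}) \<and>
      (\<forall>j\<ge>1. L2_norm_on (ball (x j) 1) u \<ge> real j * exp (2 * \<gamma>\<^sub>1 * agmon_dist V (x j) 0)))"
proof -
  define q where "q = (if p = \<infinity> then max 2 (real CARD('n)) else real_of_ereal p)"
  define C where "C = max 1 C_V"
  have q: "1 < q" "real CARD('n) \<le> 2 * q" using assms(4,5) by (cases p; simp add: q_def)+
  have C: "1 \<le> C" by (simp add: C_def)
  have Lam: "0 < Lam" using assms(3) by simp
  obtain \<gamma>\<^sub>0 where \<gamma>\<^sub>0: "\<gamma>\<^sub>0 > 0" and far: "\<And>(A :: real^'n \<Rightarrow> real^'n^'n) V V\<^sub>0 u \<gamma> j r.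
    bounded_elliptic lam Lam A \<Longrightarrow> weak_solution A V u \<Longrightarrow> V \<in> borel_measurable lebesgue \<Longrightarrow>
    (AE x in lebesgue. V x > 0) \<Longrightarrow> RH_real q C V\<^sub>0 \<Longrightarrow> (AE x in lebesgue. V x = V\<^sub>0 x) \<Longrightarrow>
    \<not> (AE x in lebesgue. u x = 0) \<Longrightarrow> 0 \<le> \<gamma> \<Longrightarrow> \<gamma> < \<gamma>\<^sub>0 \<Longrightarrow> 0 \<le> j \<Longrightarrow>
    \<exists>x. norm x > r \<and> j * exp (2 * \<gamma> * agmon_dist V\<^sub>0 x 0) \<le> L2_norm_on (ball x 1) u"
    using large_balls_far_away[OF q C assms(1,2) Lam] by blast
  show ?thesis
  proof (intro exI[of _ \<gamma>\<^sub>0] conjI allI impI \<gamma>\<^sub>0)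
    fix A :: "real^'n \<Rightarrow> real^'n^'n" and V u \<gamma>\<^sub>1
    assume A: "bounded_elliptic lam Lam A" and V: "RH p C_V V" and u: "weak_solution A V u"
      and nz: "\<not> (AE x in lebesgue. u x = 0)" and g: "\<gamma>\<^sub>1 < \<gamma>\<^sub>0"
    define W where "W = (\<lambda>x. max (V x) 0)"
    note R = RH_imp_RH_real[OF V assms(5), folded q_def C_def W_def]
    have eq: "AE x in lebesgue. V x = W x" using R(3) by eventually_elim (simp add: W_def)
    have Wm: "W \<in> borel_measurable lebesgue" unfolding W_def using R(2) by measurable
    have d: "agmon_dist V = agmon_dist W" by (rule agmon_dist_cong_AE[OF eq R(2) Wm])
    \<comment> \<open>A negative rate is replaced by 0, which only strengthens the lower bound
      because the distance is nonnegative.\<close>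
    have ex: "\<exists>x. norm x > r \<and> real j * exp (2 * \<gamma>\<^sub>1 * agmon_dist V x 0) \<le> L2_norm_on (ball x 1) u" for j :: nat and r
    proof -
      obtain x where x: "norm x > r" "real j * exp (2 * max \<gamma>\<^sub>1 0 * agmon_dist W x 0) \<le> L2_norm_on (ball x 1) u"
        using far[OF A u R(2) R(3) R(1) eq nz, of "max \<gamma>\<^sub>1 0" "real j" r] g \<gamma>\<^sub>0 by auto
      have "real j * exp (2 * \<gamma>\<^sub>1 * agmon_dist W x 0) \<le> real j * exp (2 * max \<gamma>\<^sub>1 0 * agmon_dist W x 0)"
        using agmon_dist_nonneg[of W x 0] by (intro mult_left_mono) (auto intro!: mult_right_mono)
      with x show ?thesis unfolding d by (intro exI[of _ x]) simp
    qed
    \<comment> \<open>The norm is asked to exceed \<open>n\<close> so that the sequence is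
      unbounded; strict monotonicity is the relation between successive choices. The choice starts
      at index 0, where the factor \<open>n\<close> makes the lower bound trivial.\<close>
    define P where "P n x \<longleftrightarrow> norm x > real n \<and> real n * exp (2 * \<gamma>\<^sub>1 * agmon_dist V x 0) \<le> L2_norm_on (ball x 1) u" for n x
    have "\<exists>x. \<forall>n. P n (x n) \<and> norm (x n) < norm (x (Suc n))"
    proof (rule dependent_nat_choice)
      show "\<exists>x. P 0 x" using ex[of 0 0] by (auto simp: P_def)
      show "\<exists>y. P (Suc n) y \<and> norm x < norm y" if "P n x" for x n
        using ex[of "max (norm x) (real (Suc n))" "Suc n"] by (auto simp: P_def)
    qed
    then obtain x where x: "\<And>n. P n (x n)" "\<And>n. norm (x n) < norm (x (Suc n))" by blast
    have "strict_mono (\<lambda>j. norm (x j))" using x(2) by (simp add: strict_mono_Suc_iff)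
    then have "strict_mono_on {1..} (\<lambda>j. norm (x j))" by (simp add: strict_mono_on_def strict_mono_def)
    moreover have "\<not> bounded (x ` {1..})"
    proof
      assume "bounded (x ` {1..})"
      then obtain b where b: "\<And>j. j \<ge> 1 \<Longrightarrow> norm (x j) \<le> b" by (auto simp: bounded_iff)
      obtain j :: nat where "b \<le> real j" using real_arch_simple by blast
      then have "b < norm (x (Suc j))" using x(1)[of "Suc j"] by (simp add: P_def)
      with b[of "Suc j"] show False by simp
    qed
    moreover have "\<forall>j\<ge>1. L2_norm_on (ball (x j) 1) u \<ge> real j * exp (2 * \<gamma>\<^sub>1 * agmon_dist V (x j) 0)"
      using x(1) by (simp add: P_def)
    ultimately show "\<exists>x :: nat \<Rightarrow> real^'n.
      strict_mono_on {1..} (\<lambda>j. norm (x j)) \<and> \<not> bounded (x ` {1..}) \<and>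
      (\<forall>j\<ge>1. L2_norm_on (ball (x j) 1) u \<ge> real j * exp (2 * \<gamma>\<^sub>1 * agmon_dist V (x j) 0))" by blast
  qed
qed

end
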